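(* Let $\delta\in(0,1)$ and suppose $p=\tfrac12-c_p$ where $c_p\in(0,1/2]$ is an absolute constant. There are constants $C>1$ and $c>0$ depending only on $c_p$ such that, if assumptions (A1), (A2), (A3) hold with this $C$, then with probability at least $1-10\delta$ over the draw of the pre-training data $\{\mu_\tau,(x_{\tau,i},y_{\tau,i})_{i=1}^{N+1}\}_{\tau=1}^B$, the max-margin solution $W_{\mathrm{MM}}$ satisfies, for a freshly sampled test task $\{\mu,(x_i,y_i)_{i=1}^{M+1}\}$ (drawn from the test distribution, independently of the pre-training data), \[ \mathbb P_{(x_i,y_i)_{i=1}^{M+1},\,\mu}\big(\operatorname{sign}(\hat y(E;W_{\mathrm{MM}}))\neq y_{M+1}\big)\le \big(p+2e^{-cM}\big)\mathbf 1(p>0)+2\exp\!\big(-c\rho\sqrt d\big)+4\exp\!\Big(-\frac{c\rho\tilde R}{\|\Lambda^{1/2}\|_2}\Big)+2\exp\!\Big(-\frac{c\rho M^{1/2}\tilde R^2}{\|\Lambda\|_2\sqrt d}\Big), \] where $\rho:=\dfrac{c_B\wedge 1}{\log^2(2B^2/\delta)}$.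
   Context: Pre-training data: let $\Lambda\succ0$ be a symmetric positive-definite $d\times d$ matrix, $B,N\ge1$ integers, $R>0$. For $\tau=1,\dots,B$ and $i=1,\dots,N+1$: $\mu_\tau\sim\mathrm{Unif}(R\cdot\mathbb S^{d-1})$ i.i.d. (uniform on the sphere of radius $R$ in $\mathbb R^d$), $z_{\tau,i}\sim\mathcal N(0,\Lambda)$ i.i.d., $y_{\tau,i}\sim\mathrm{Unif}(\{\pm1\})$ i.i.d., all mutually independent, and $x_{\tau,i}=y_{\tau,i}\mu_\tau+z_{\tau,i}$. Write $\hat\mu_\tau=\frac1N\sum_{i=1}^N y_{\tau,i}x_{\tau,i}$, $x_\tau=x_{\tau,N+1}$, $y_\tau=y_{\tau,N+1}$. The max-margin solution is $W_{\mathrm{MM}}=\arg\min\{\|U\|_F^2:\ U\in\mathbb R^{d\times d},\ \hat\mu_\tau^\top U\,y_\tau x_\tau\ge1\ \forall \tau\in[B]\}$. Assumptions, for a constant $C>1$ and $\delta\in(0,1)$: (A1) $R^2\ge C^2\sqrt{d\,\mathrm{tr}(\Lambda^2)}\ \vee\ C^2\big(\tfrac{\mathrm{tr}(\Lambda)}{d}\vee\sqrt{\tfrac{\mathrm{tr}(\Lambda^2)}{N}}\vee\|\Lambda\|_2\big)\log(2B/\delta)$; (A2) $B\ge c_Bd$ for some $c_B>0$ (not necessarily constant); (A3) $d\ge C\log^4(2B^2/\delta)$. Here $a\vee b=\max(a,b)$, $a\wedge b=\min(a,b)$. Test distribution: for an integer $M\ge1$, $\tilde R>0$ and $p\in[0,1/2)$,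 and $i=1,\dots,M+1$: $\tilde y_i\sim\mathrm{Unif}(\{\pm1\})$; $y_i=\tilde y_i$ with probability $1-p$ and $y_i=-\tilde y_i$ with probability $p$; $\mu\sim\mathrm{Unif}(\tilde R\cdot\mathbb S^{d-1})$; $z_i\sim\mathcal N(0,\Lambda)$; $x_i=\tilde y_i\mu+z_i$; all these random variables mutually independent. The transformer prediction with parameter $W$ is $\hat y(E;W)=\big(\frac1M\sum_{i=1}^M y_ix_i\big)^\top W x_{M+1}$, where $E$ encodes $(x_i,y_i)_{i=1}^M$ and $x_{M+1}$. *)

theory Defs
  imports "HOL-Probability.Probability"
begin

text \<open>Vectors in R^d are functions nat => real (only indices < d matter);
  d x d matrices are functions nat => nat => real (only indices < d matter).
  The dimension d is an explicit natural number so that the constants C, c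
  can be chosen independently of d.\<close>

type_synonym vecd = "nat \<Rightarrow> real"
type_synonym matd = "nat \<Rightarrow> nat \<Rightarrow> real"

definition mat_vec :: "nat \<Rightarrow> matd \<Rightarrow> vecd \<Rightarrow> vecd" where
  "mat_vec d A x = restrict (\<lambda>i. \<Sum>j<d. A i j * x j) {..<d}"

definition sq_norm :: "nat \<Rightarrow> vecd \<Rightarrow> real" where
  "sq_norm d x = (\<Sum>i<d. (x i)\<^sup>2)"

definition inner_d :: "nat \<Rightarrow> vecd \<Rightarrow> vecd \<Rightarrow> real" where
  "inner_d d x y = (\<Sum>i<d. x i * y i)"

definition symmetric_d :: "nat \<Rightarrow> matd \<Rightarrow> bool" where
  "symmetric_d d A \<longleftrightarrow> (\<forall>i<d. \<forall>j<d. A i j = A j i)"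

definition pos_def_d :: "nat \<Rightarrow> matd \<Rightarrow> bool" where
  "pos_def_d d A \<longleftrightarrow> symmetric_d d A \<and>
     (\<forall>x. (\<exists>i<d. x i \<noteq> 0) \<longrightarrow> inner_d d x (mat_vec d A x) > 0)"

definition pos_semidef_d :: "nat \<Rightarrow> matd \<Rightarrow> bool" where
  "pos_semidef_d d A \<longleftrightarrow> symmetric_d d A \<and> (\<forall>x. inner_d d x (mat_vec d A x) \<ge> 0)"

definition mat_mult_d :: "nat \<Rightarrow> matd \<Rightarrow> matd \<Rightarrow> matd" where
  "mat_mult_d d A B = (\<lambda>i j. \<Sum>k<d. A i k * B k j)"

definition trace_d :: "nat \<Rightarrow> matd \<Rightarrow> real" where
  "trace_d d A = (\<Sum>i<d. A i i)"

definition op_norm_d :: "nat \<Rightarrow> matd \<Rightarrow> real" where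
  "op_norm_d d A = (SUP x\<in>{x. sq_norm d x = 1}. sqrt (sq_norm d (mat_vec d A x)))"

definition mat_sqrt_d :: "nat \<Rightarrow> matd \<Rightarrow> matd" where
  "mat_sqrt_d d A = (SOME S. pos_semidef_d d S \<and>
      (\<forall>i<d. \<forall>j<d. mat_mult_d d S S i j = A i j))"

definition frob_sq :: "nat \<Rightarrow> matd \<Rightarrow> real" where
  "frob_sq d U = (\<Sum>i<d. \<Sum>j<d. (U i j)\<^sup>2)"

abbreviation borel_d :: "nat \<Rightarrow> vecd measure" where
  "borel_d d \<equiv> PiM {..<d} (\<lambda>_. borel)"

definition sphere_unif :: "nat \<Rightarrow> real \<Rightarrow> vecd measure" where
  "sphere_unif d r = distr
     (uniform_measure (PiM {..<d} (\<lambda>_. lborel)) {x\<in>PiE {..<d} (\<lambda>_. UNIV). sq_norm d x \<le> 1})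
     (borel_d d)
     (\<lambda>x. restrict (\<lambda>i. r * x i / sqrt (sq_norm d x)) {..<d})"

definition gauss_d :: "nat \<Rightarrow> matd \<Rightarrow> vecd measure" where
  "gauss_d d Lam = distr (PiM {..<d} (\<lambda>_. std_normal_distribution)) (borel_d d)
     (mat_vec d (mat_sqrt_d d Lam))"

definition rademacher :: "real measure" where
  "rademacher = measure_pmf (pmf_of_set {-1, 1})"

text \<open>One pre-training task: (mu, (y_i)_{i=1..N+1}, (z_i)_{i=1..N+1}).\<close>
type_synonym task = "vecd \<times> (nat \<Rightarrow> real) \<times> (nat \<Rightarrow> vecd)"

definition task_measure :: "nat \<Rightarrow> matd \<Rightarrow> real \<Rightarrow> nat \<Rightarrow> task measure" where
  "task_measure d Lam R N =
     sphere_unif d R \<Otimes>\<^sub>M (PiM {1..N+1} (\<lambda>_. rademacher) \<Otimes>\<^sub>M PiM {1..N+1} (\<lambda>_. gauss_d d Lam))"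

definition pretrain_measure :: "nat \<Rightarrow> matd \<Rightarrow> real \<Rightarrow> nat \<Rightarrow> nat \<Rightarrow> (nat \<Rightarrow> task) measure" where
  "pretrain_measure d Lam R N B = PiM {1..B} (\<lambda>_. task_measure d Lam R N)"

definition task_x :: "nat \<Rightarrow> task \<Rightarrow> nat \<Rightarrow> vecd" where
  "task_x d t i = (case t of (mu, ys, zs) \<Rightarrow> restrict (\<lambda>k. ys i * mu k + zs i k) {..<d})"

definition task_y :: "task \<Rightarrow> nat \<Rightarrow> real" where
  "task_y t i = fst (snd t) i"

definition task_muhat :: "nat \<Rightarrow> nat \<Rightarrow> task \<Rightarrow> vecd" where
  "task_muhat d N t = restrict (\<lambda>k. (1 / real N) * (\<Sum>i=1..N. task_y t i * task_x d t i k)) {..<d}"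

definition mm_feasible :: "nat \<Rightarrow> nat \<Rightarrow> nat \<Rightarrow> (nat \<Rightarrow> task) \<Rightarrow> matd \<Rightarrow> bool" where
  "mm_feasible d N B \<omega> U \<longleftrightarrow>
     (\<forall>\<tau>\<in>{1..B}. inner_d d (task_muhat d N (\<omega> \<tau>))
        (mat_vec d U (\<lambda>k. task_y (\<omega> \<tau>) (N+1) * task_x d (\<omega> \<tau>) (N+1) k)) \<ge> 1)"

definition is_max_margin :: "nat \<Rightarrow> nat \<Rightarrow> nat \<Rightarrow> (nat \<Rightarrow> task) \<Rightarrow> matd \<Rightarrow> bool" where
  "is_max_margin d N B \<omega> W \<longleftrightarrow>
     (\<forall>i j. \<not> (i < d \<and> j < d) \<longrightarrow> W i j = 0) \<and>
     mm_feasible d N B \<omega> W \<and>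
     (\<forall>V. mm_feasible d N B \<omega> V \<longrightarrow> frob_sq d W \<le> frob_sq d V)"

text \<open>Test task: (mu, (tilde y_i), (flip_i), (z_i)), i = 1..M+1, with
  y_i = tilde y_i if not flipped, - tilde y_i if flipped (flip ~ Bernoulli p).\<close>
type_synonym test_task = "vecd \<times> (nat \<Rightarrow> real) \<times> (nat \<Rightarrow> bool) \<times> (nat \<Rightarrow> vecd)"

definition test_measure :: "nat \<Rightarrow> matd \<Rightarrow> real \<Rightarrow> real \<Rightarrow> nat \<Rightarrow> test_task measure" where
  "test_measure d Lam Rt p M =
     sphere_unif d Rt \<Otimes>\<^sub>M (PiM {1..M+1} (\<lambda>_. rademacher) \<Otimes>\<^sub>M
       (PiM {1..M+1} (\<lambda>_. measure_pmf (bernoulli_pmf p)) \<Otimes>\<^sub>M PiM {1..M+1} (\<lambda>_. gauss_d d Lam)))"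

definition test_x :: "nat \<Rightarrow> test_task \<Rightarrow> nat \<Rightarrow> vecd" where
  "test_x d s i = (case s of (mu, yt, fl, zs) \<Rightarrow> restrict (\<lambda>k. yt i * mu k + zs i k) {..<d})"

definition test_y :: "test_task \<Rightarrow> nat \<Rightarrow> real" where
  "test_y s i = (case s of (mu, yt, fl, zs) \<Rightarrow> (if fl i then - yt i else yt i))"

definition test_pred :: "nat \<Rightarrow> nat \<Rightarrow> matd \<Rightarrow> test_task \<Rightarrow> real" where
  "test_pred d M W s =
     inner_d d (\<lambda>k. (1 / real M) * (\<Sum>i=1..M. test_y s i * test_x d s i k))
               (mat_vec d W (test_x d s (M+1)))"

definition test_error :: "nat \<Rightarrow> matd \<Rightarrow> real \<Rightarrow> real \<Rightarrow> nat \<Rightarrow> matd \<Rightarrow> real" where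
  "test_error d Lam Rt p M W =
     measure (test_measure d Lam Rt p M)
       {s \<in> space (test_measure d Lam Rt p M). sgn (test_pred d M W s) \<noteq> test_y s (M+1)}"

end

theory Submission
  imports Defs
begin

text \<open>
  Write \<open>W\<close> for the max-margin solution. The test margin is a bilinear form in \<open>W\<close>, whose mean is
  proportional to \<open>tr W\<close> and whose fluctuations are governed by the Frobenius norm of \<open>W\<close>; so the
  test error is small as soon as \<open>tr W / \<parallel>W\<parallel>\<^sub>F\<close> is of order \<open>\<rho> \<surd>d\<close>.

  This ratio is bounded below without duality. On a good event the multiple \<open>2/R\<^sup>2\<close> of the identity is
  feasible, and moving from \<open>W\<close> towards it cannot decrease the norm, so \<open>tr W \<ge> R\<^sup>2/2 \<parallel>W\<parallel>\<^sub>F\<^sup>2\<close>. Summing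
  the \<open>B\<close> constraints gives \<open>B \<le> \<parallel>W\<parallel>\<^sub>F \<parallel>M\<parallel>\<^sub>F\<close> for the sum \<open>M\<close> of the constraint matrices, and \<open>\<parallel>M\<parallel>\<^sub>F\<^sup>2\<close> is a double
  sum of products of inner products of different tasks, which are of order \<open>R\<^sup>2 ln (2B\<^sup>2/\<delta>) / \<surd>d\<close>.

  All tail bounds come from moment generating functions: the uniform law on the sphere is that of a
  normalised Gaussian vector, and bilinear forms of independent sub-Gaussian vectors have
  exponential tails.
\<close>

section \<open>Vectors and matrices\<close>

text \<open>The double sum has \<open>B\<close> diagonal terms of size \<open>h^2\<close> and at
  most \<open>B^2\<close> others of size \<open>h^2 / d\<close>, with \<open>h\<close> of order
  \<open>R^2 ln (2 B^2 / \<delta>)\<close>. With \<open>m = min c_B 1\<close>, both \<open>B\<close>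
  and \<open>d\<close> are at least \<open>m d\<close>, so the total is at most
  \<open>2 B^2 h^2 / (m d)\<close> and the Frobenius norm of \<open>W\<close> is at least of order
  \<open>sqrt (m d) / h\<close>. This costs one logarithm where \<rho> divides by two; the spare one
  is bounded below by 2/3 and only affects constants.

  (A1) enters as \<open>sqrt (d tr (\<Lambda>^2)) \<le> R^2\<close>. It bounds the trace of
  \<Lambda> by \<open>R^2\<close> and its Frobenius norm by \<open>R^2 / sqrt d\<close>, so noise
  inner products are no larger than those of the signals.

  Three definitions shape the work. The matrix square root is a choice, so its existence must be
  constructed. The sphere law is the radial image of a ball, whose coordinates are dependent, so it
  is first transferred to Gaussian vectors. The event of the theorem contains an existential over
  matrices, and \<open>measure\<close> is 0 on nonmeasurable sets, so its measurability is part of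
  the proof.\<close>

lemma sq_norm_nonneg [simp]: "0 \<le> sq_norm d x"
  by (simp add: sq_norm_def sum_nonneg)

lemma frob_sq_nonneg [simp]: "0 \<le> frob_sq d A"
  by (simp add: frob_sq_def sum_nonneg)

lemma inner_d_self: "inner_d d x x = sq_norm d x"
  by (simp add: inner_d_def sq_norm_def power2_eq_square)

lemma inner_d_commute: "inner_d d x y = inner_d d y x"
  by (simp add: inner_d_def mult.commute)

lemma inner_d_cauchy_schwarz: "(inner_d d x y)\<^sup>2 \<le> sq_norm d x * sq_norm d y"
  unfolding inner_d_def sq_norm_def by (rule Cauchy_Schwarz_ineq_sum)

lemma inner_d_add_left: "inner_d d (\<lambda>i. x i + y i) z = inner_d d x z + inner_d d y z"
  by (simp add: inner_d_def sum.distrib algebra_simps)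

lemma inner_d_add_right: "inner_d d z (\<lambda>i. x i + y i) = inner_d d z x + inner_d d z y"
  by (simp add: inner_d_def sum.distrib algebra_simps)

lemma inner_d_scale_left: "inner_d d (\<lambda>i. c * x i) z = c * inner_d d x z"
  by (simp add: inner_d_def sum_distrib_left algebra_simps)

lemma inner_d_scale_right: "inner_d d z (\<lambda>i. c * x i) = c * inner_d d z x"
  by (simp add: inner_d_def sum_distrib_left algebra_simps)

lemma inner_d_sum_left: "inner_d d (\<lambda>k. \<Sum>i\<in>I. f i k) z = (\<Sum>i\<in>I. inner_d d (f i) z)"
  unfolding inner_d_def by (simp add: sum_distrib_right) (rule sum.swap)

lemma inner_d_cong:
  "(\<And>i. i < d \<Longrightarrow> x i = x' i) \<Longrightarrow> (\<And>i. i < d \<Longrightarrow> y i = y' i) \<Longrightarrow> inner_d d x y = inner_d d x' y'"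
  by (simp add: inner_d_def)

lemma sq_norm_cong: "(\<And>i. i < d \<Longrightarrow> x i = x' i) \<Longrightarrow> sq_norm d x = sq_norm d x'"
  by (simp add: sq_norm_def)

lemma mat_vec_nth: "i < d \<Longrightarrow> mat_vec d A x i = (\<Sum>j<d. A i j * x j)"
  by (simp add: mat_vec_def)

lemma mat_vec_cong: "(\<And>i. i < d \<Longrightarrow> x i = x' i) \<Longrightarrow> mat_vec d A x = mat_vec d A x'"
  by (auto simp: mat_vec_def intro!: restrict_ext sum.cong)

lemma mat_vec_add: "i < d \<Longrightarrow> mat_vec d A (\<lambda>j. x j + y j) i = mat_vec d A x i + mat_vec d A y i"
  by (simp add: mat_vec_nth sum.distrib algebra_simps)

lemma mat_vec_scale: "i < d \<Longrightarrow> mat_vec d A (\<lambda>j. c * x j) i = c * mat_vec d A x i"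
  by (simp add: mat_vec_nth sum_distrib_left algebra_simps)

lemma sq_norm_mat_vec: "sq_norm d (mat_vec d A x) = (\<Sum>i<d. (\<Sum>j<d. A i j * x j)\<^sup>2)"
  by (simp add: sq_norm_def mat_vec_nth)

lemma sq_norm_scale: "sq_norm d (\<lambda>i. c * x i) = c\<^sup>2 * sq_norm d x"
  by (simp add: sq_norm_def sum_distrib_left power_mult_distrib)

lemma bilinear_d: "inner_d d x (mat_vec d A y) = (\<Sum>i<d. \<Sum>j<d. x i * A i j * y j)"
  by (simp add: inner_d_def mat_vec_nth sum_distrib_left mult.assoc)

lemma bilinear_transpose: "inner_d d x (mat_vec d A y) = inner_d d y (mat_vec d (\<lambda>i j. A j i) x)"
  unfolding bilinear_d by (subst sum.swap) (simp add: mult_ac)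

lemma bilinear_symmetric:
  assumes "symmetric_d d A"
  shows "inner_d d x (mat_vec d A y) = inner_d d (mat_vec d A x) y"
proof -
  have "mat_vec d (\<lambda>i j. A j i) x = mat_vec d A x"
    using assms by (auto simp: mat_vec_def symmetric_d_def intro!: restrict_ext sum.cong)
  thus ?thesis by (subst bilinear_transpose) (simp add: inner_d_commute)
qed

lemma mat_vec_mult: "mat_vec d (mat_mult_d d A B) x = mat_vec d A (mat_vec d B x)"
  unfolding mat_vec_def mat_mult_d_def
  by (auto intro!: restrict_ext simp: sum_distrib_left sum_distrib_right mult.assoc intro: sum.swap)

lemma sq_norm_mat_vec_le_frob: "sq_norm d (mat_vec d A x) \<le> frob_sq d A * sq_norm d x"
proof -
  have "sq_norm d (mat_vec d A x) \<le> (\<Sum>i<d. (\<Sum>j<d. (A i j)\<^sup>2) * (\<Sum>j<d. (x j)\<^sup>2))"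
    unfolding sq_norm_mat_vec by (intro sum_mono Cauchy_Schwarz_ineq_sum)
  also have "\<dots> = frob_sq d A * sq_norm d x"
    by (simp add: frob_sq_def sq_norm_def sum_distrib_right)
  finally show ?thesis .
qed

text \<open>The supremum in \<open>op_norm_d\<close> is meaningful only over a bounded set; the
  Frobenius norm supplies the bound. Normalising \<open>x\<close> reduces to the unit sphere, and a
  vector of norm zero is covered by the Frobenius bound directly.\<close>

lemma mat_vec_le_op_norm: "sq_norm d (mat_vec d A x) \<le> (op_norm_d d A)\<^sup>2 * sq_norm d x"
proof (cases "sq_norm d x = 0")
  case True
  with sq_norm_mat_vec_le_frob[of d A x] show ?thesis by simp
next
  case False
  define s where "s = sqrt (sq_norm d x)"
  have s: "s > 0" "s\<^sup>2 = sq_norm d x" using False by (auto simp: s_def order_less_le)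
  let ?y = "\<lambda>i. (1/s) * x i"
  have y1: "sq_norm d ?y = 1" unfolding sq_norm_scale s(2)[symmetric] using s(1) by (simp add: power_divide)
  have bdd: "bdd_above ((\<lambda>x. sqrt (sq_norm d (mat_vec d A x))) ` {x. sq_norm d x = 1})"
  proof (rule bdd_aboveI2)
    fix x assume "x \<in> {x. sq_norm d x = 1}"
    thus "sqrt (sq_norm d (mat_vec d A x)) \<le> sqrt (frob_sq d A)"
      using sq_norm_mat_vec_le_frob[of d A x] by simp
  qed
  have "sqrt (sq_norm d (mat_vec d A ?y)) \<le> op_norm_d d A"
    unfolding op_norm_d_def by (rule cSUP_upper[OF _ bdd]) (use y1 in simp)
  hence "sq_norm d (mat_vec d A ?y) \<le> (op_norm_d d A)\<^sup>2"
    by (metis real_sqrt_ge_0_iff sq_norm_nonneg power_mono real_sqrt_pow2)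
  moreover have "sq_norm d (mat_vec d A ?y) = (1/s)\<^sup>2 * sq_norm d (mat_vec d A x)"
    unfolding sq_norm_scale[symmetric] by (rule sq_norm_cong) (simp only: mat_vec_scale)
  ultimately have "(1/s)\<^sup>2 * sq_norm d (mat_vec d A x) \<le> (op_norm_d d A)\<^sup>2" by simp
  from mult_left_mono[OF this, of "s\<^sup>2"] show ?thesis
    using s False by (simp add: power_divide mult_ac)
qed

text \<open>\<open>d \<ge> 1\<close> makes the unit sphere nonempty, without which the supremum
  would be unspecified.\<close>

lemma op_norm_le:
  assumes "d \<ge> 1" "K \<ge> 0" "\<And>x. sq_norm d (mat_vec d A x) \<le> K\<^sup>2 * sq_norm d x"
  shows "op_norm_d d A \<le> K"
  unfolding op_norm_d_def
proof (rule cSUP_least)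
  have "sq_norm d (\<lambda>i. if i = 0 then 1 else 0) = 1"
    using assms(1) by (auto simp: sq_norm_def if_distrib[of "\<lambda>x. x\<^sup>2"] sum.If_cases) 
  thus "{x. sq_norm d x = 1} \<noteq> {}" by blast
next
  fix x assume "x \<in> {x. sq_norm d x = 1}"
  thus "sqrt (sq_norm d (mat_vec d A x)) \<le> K"
    using assms(2) assms(3)[of x] by (auto intro: real_le_lsqrt)
qed

lemma op_norm_nonneg:
  assumes d: "d \<ge> 1"
  shows "0 \<le> op_norm_d d A"
proof -
  let ?e = "\<lambda>i::nat. if i = 0 then 1 else 0 :: real"
  have e: "sq_norm d ?e = 1" using d by (simp add: sq_norm_def if_distrib[of "\<lambda>x. x\<^sup>2"] cong: if_cong)
  have bdd: "bdd_above ((\<lambda>x. sqrt (sq_norm d (mat_vec d A x))) ` {x. sq_norm d x = 1})"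
  proof (rule bdd_aboveI2)
    fix x assume "x \<in> {x. sq_norm d x = 1}"
    thus "sqrt (sq_norm d (mat_vec d A x)) \<le> sqrt (frob_sq d A)"
      using sq_norm_mat_vec_le_frob[of d A x] by simp
  qed
  have "0 \<le> sqrt (sq_norm d (mat_vec d A ?e))" by simp
  also have "\<dots> \<le> op_norm_d d A" unfolding op_norm_d_def
    by (rule cSUP_upper[OF _ bdd]) (use e in simp)
  finally show ?thesis .
qed

text \<open>The squared Frobenius norm is the sum of the squared norms of the columns, and
  \<open>A\<close> acts on each column separately.\<close>

lemma frob_sq_mult_left: "frob_sq d (mat_mult_d d A B) \<le> (op_norm_d d A)\<^sup>2 * frob_sq d B"
proof -
  have "frob_sq d (mat_mult_d d A B) = (\<Sum>j<d. sq_norm d (mat_vec d A (\<lambda>k. B k j)))"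
    unfolding frob_sq_def mat_mult_d_def sq_norm_mat_vec by (rule sum.swap)
  also have "\<dots> \<le> (\<Sum>j<d. (op_norm_d d A)\<^sup>2 * sq_norm d (\<lambda>k. B k j))"
    by (intro sum_mono mat_vec_le_op_norm)
  also have "\<dots> = (op_norm_d d A)\<^sup>2 * frob_sq d B"
    unfolding frob_sq_def sq_norm_def sum_distrib_left by (rule sum.swap)
  finally show ?thesis .
qed

lemma frob_sq_transpose: "frob_sq d (\<lambda>i j. A j i) = frob_sq d A"
  unfolding frob_sq_def by (rule sum.swap)

lemma frob_sq_cong: "(\<And>i j. i < d \<Longrightarrow> j < d \<Longrightarrow> A i j = B i j) \<Longrightarrow> frob_sq d A = frob_sq d B"
  by (simp add: frob_sq_def)

lemma frob_sq_scale: "frob_sq d (\<lambda>i j. c * A i j) = c\<^sup>2 * frob_sq d A"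
  by (simp add: frob_sq_def sum_distrib_left power_mult_distrib)

text \<open>Symmetry of \<open>B\<close> turns the transposed product into a left multiplication by
  \<open>B\<close>, so the operator norm of a transpose never appears.\<close>

lemma frob_sq_mult_right:
  assumes "symmetric_d d B"
  shows "frob_sq d (mat_mult_d d A B) \<le> (op_norm_d d B)\<^sup>2 * frob_sq d A"
proof -
  have "frob_sq d (mat_mult_d d A B) = frob_sq d (\<lambda>i j. mat_mult_d d A B j i)"
    by (rule frob_sq_transpose[symmetric])
  also have "\<dots> = frob_sq d (mat_mult_d d B (\<lambda>i j. A j i))"
    using assms by (intro frob_sq_cong) (auto simp: mat_mult_d_def symmetric_d_def mult.commute intro!: sum.cong)
  also have "\<dots> \<le> (op_norm_d d B)\<^sup>2 * frob_sq d A"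
    using frob_sq_mult_left[of d B "\<lambda>i j. A j i"] by (simp add: frob_sq_transpose[of d A])
  finally show ?thesis .
qed

lemma frob_sq_symmetric:
  assumes "symmetric_d d A"
  shows "frob_sq d A = trace_d d (mat_mult_d d A A)"
  using assms by (auto simp: frob_sq_def trace_d_def mat_mult_d_def symmetric_d_def power2_eq_square intro!: sum.cong)

text \<open>Cauchy-Schwarz on the diagonal. Applied to the covariance it turns (A1) into a bound on
  its trace; it also shows that a matrix with positive trace has positive Frobenius norm.\<close>

lemma trace_sq_le: "(trace_d d A)\<^sup>2 \<le> real d * frob_sq d A"
proof -
  have "(trace_d d A)\<^sup>2 = (\<Sum>i<d. 1 * A i i)\<^sup>2" by (simp add: trace_d_def)
  also have "\<dots> \<le> (\<Sum>i<d. 1\<^sup>2) * (\<Sum>i<d. (A i i)\<^sup>2)" by (rule Cauchy_Schwarz_ineq_sum)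
  also have "\<dots> \<le> real d * frob_sq d A"
    unfolding frob_sq_def by (auto intro!: mult_left_mono sum_mono member_le_sum)
  finally show ?thesis .
qed

lemma frob_cauchy_schwarz:
  "(\<Sum>i<d. \<Sum>j<d. A i j * B i j)\<^sup>2 \<le> frob_sq d A * frob_sq d B"
  unfolding frob_sq_def sum.cartesian_product
  using Cauchy_Schwarz_ineq_sum[of "\<lambda>(i,j). A i j" "\<lambda>(i,j). B i j" "{..<d} \<times> {..<d}"]
  by (simp add: case_prod_unfold)

section \<open>Square roots of positive definite matrices\<close>

definition id_mat :: matd where "id_mat = (\<lambda>i j. if i = j then 1 else 0)"

primrec mat_pow :: "nat \<Rightarrow> matd \<Rightarrow> nat \<Rightarrow> matd" where
  "mat_pow d A 0 = id_mat"
| "mat_pow d A (Suc n) = mat_mult_d d A (mat_pow d A n)"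

lemma mat_vec_id: "i < d \<Longrightarrow> mat_vec d id_mat x i = x i"
  by (simp add: mat_vec_nth id_mat_def if_distrib[of "\<lambda>c. c * _"] sum.delta cong: if_cong)

lemma inner_mat_vec_id: "inner_d d y (mat_vec d id_mat x) = inner_d d y x"
  by (rule inner_d_cong) (auto simp: mat_vec_id)

lemma mat_mult_id: "i < d \<Longrightarrow> mat_mult_d d id_mat A i j = A i j"
  by (simp add: mat_mult_d_def id_mat_def if_distrib[of "\<lambda>c. c * _"] sum.delta cong: if_cong)

lemma mat_mult_id_right: "j < d \<Longrightarrow> mat_mult_d d A id_mat i j = A i j"
  by (simp add: mat_mult_d_def id_mat_def if_distrib[of "\<lambda>c. _ * c"] sum.delta' cong: if_cong)

lemma mat_mult_assoc: "mat_mult_d d A (mat_mult_d d B C) = mat_mult_d d (mat_mult_d d A B) C"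
  unfolding mat_mult_d_def
  by (intro ext) (simp add: sum_distrib_left sum_distrib_right mult.assoc, rule sum.swap)

lemma mat_mult_cong:
  "(\<And>k. k < d \<Longrightarrow> A i k = A' i k) \<Longrightarrow> (\<And>k. k < d \<Longrightarrow> B k j = B' k j) \<Longrightarrow>
    mat_mult_d d A B i j = mat_mult_d d A' B' i j"
  by (simp add: mat_mult_d_def)

lemma mat_pow_add:
  "i < d \<Longrightarrow> mat_mult_d d (mat_pow d A m) (mat_pow d A n) i j = mat_pow d A (m + n) i j"
proof (induction m arbitrary: i)
  case 0 thus ?case by (simp add: mat_mult_id)
next
  case (Suc m)
  have "mat_mult_d d (mat_pow d A (Suc m)) (mat_pow d A n) i j =
      mat_mult_d d A (mat_mult_d d (mat_pow d A m) (mat_pow d A n)) i j"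
    by (simp add: mat_mult_assoc)
  also have "\<dots> = mat_mult_d d A (mat_pow d A (m + n)) i j"
    by (rule mat_mult_cong) (simp_all add: Suc.IH)
  finally show ?case by simp
qed

lemma mat_pow_commute: "i < d \<Longrightarrow> j < d \<Longrightarrow>
    mat_mult_d d (mat_pow d A n) A i j = mat_mult_d d A (mat_pow d A n) i j"
proof -
  assume ij: "i < d" "j < d"
  have "mat_mult_d d (mat_pow d A n) A i j = mat_mult_d d (mat_pow d A n) (mat_pow d A 1) i j"
    using ij by (intro mat_mult_cong) (auto simp: mat_mult_id_right)
  thus ?thesis using ij mat_pow_add[of i d A n 1 j] by simp
qed

lemma mat_pow_symmetric:
  assumes "symmetric_d d A"
  shows "symmetric_d d (mat_pow d A n)"
proof (induction n)
  case 0 show ?case by (auto simp: symmetric_d_def id_mat_def)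
next
  case (Suc n)
  show ?case unfolding symmetric_d_def
  proof (intro allI impI)
    fix i j assume ij: "i < d" "j < d"
    have "mat_pow d A (Suc n) i j = mat_mult_d d (mat_pow d A n) A j i"
      using Suc assms ij by (auto simp: symmetric_d_def mat_mult_d_def mult.commute intro!: sum.cong)
    thus "mat_pow d A (Suc n) i j = mat_pow d A (Suc n) j i"
      using ij by (simp add: mat_pow_commute)
  qed
qed

lemma mat_pow_contraction:
  assumes "\<And>x. sq_norm d (mat_vec d A x) \<le> sq_norm d x"
  shows "sq_norm d (mat_vec d (mat_pow d A n) x) \<le> sq_norm d x"
proof (induction n)
  case 0
  have "sq_norm d (mat_vec d id_mat x) = sq_norm d x" by (rule sq_norm_cong) (simp add: mat_vec_id)
  thus ?case by simp
next
  case (Suc n)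
  show ?case using order_trans[OF assms Suc] by (simp add: mat_vec_mult)
qed

text \<open>Taylor coefficients of \<open>sqrt (1 - x)\<close> at 0: 1, -1/2, -1/8, ...\<close>

definition sqrt_coeff :: "nat \<Rightarrow> real" where
  "sqrt_coeff k = ((1/2) gchoose k) * (-1) ^ k"

lemma sqrt_coeff_0: "sqrt_coeff 0 = 1" by (simp add: sqrt_coeff_def)

lemma gbinomial_Suc_real: "(a::real) gchoose (Suc n) = (a gchoose n) * ((a - real n) / (real n + 1))"
proof -
  have "(a gchoose (Suc n)) * (real n + 1) = (a gchoose n) * (a - real n)"
    using gbinomial_absorb_comp[of a n] gbinomial_absorption[of n a] by (simp add: algebra_simps)
  thus ?thesis by (simp add: field_simps)
qed

lemma sqrt_coeff_Suc: "sqrt_coeff (Suc k) = sqrt_coeff k * ((real k - 1/2) / (real k + 1))"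
  unfolding sqrt_coeff_def gbinomial_Suc_real by (simp add: field_simps)

lemma sqrt_coeff_nonpos: "k \<ge> 1 \<Longrightarrow> sqrt_coeff k \<le> 0"
proof (induction k rule: dec_induct)
  case base show ?case using sqrt_coeff_Suc[of 0] by (simp add: sqrt_coeff_0)
next
  case (step n)
  thus ?case unfolding sqrt_coeff_Suc by (intro mult_nonpos_nonneg divide_nonneg_pos) auto
qed

text \<open>Alternating partial sums of binomial coefficients telescope: the sum up to
  \<open>n\<close> is \<open>(-1) ^ n\<close> times \<open>(-1/2) gchoose n\<close>, whose recursion
  has only positive factors.\<close>

lemma sqrt_coeff_sum_nonneg: "(\<Sum>k\<le>n. sqrt_coeff k) \<ge> 0"
proof -
  have *: "(-1) ^ n * ((-1/2::real) gchoose n) \<ge> 0"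
  proof (induction n)
    case (Suc n)
    have "(-1) ^ Suc n * ((-1/2::real) gchoose (Suc n)) =
        ((-1) ^ n * ((-1/2) gchoose n)) * ((1/2 + real n) / (real n + 1))"
      unfolding gbinomial_Suc_real by (simp add: field_simps)
    moreover have "((-1) ^ n * ((-1/2::real) gchoose n)) * ((1/2 + real n) / (real n + 1)) \<ge> 0"
      by (rule mult_nonneg_nonneg[OF Suc]) simp
    ultimately show ?case by (simp only:)
  qed simp
  thus ?thesis using gbinomial_sum_lower_neg[of "1/2::real" n] by (simp add: sqrt_coeff_def)
qed

text \<open>Adding \<open>sqrt_coeff k\<close> to its absolute value gives 2 for
  \<open>k = 0\<close> and 0 otherwise, so the absolute sum is 2 minus a nonnegative partial
  sum.\<close>

lemma sqrt_coeff_abs_sum: "(\<Sum>k\<le>n. \<bar>sqrt_coeff k\<bar>) \<le> 2"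
proof -
  have "(\<Sum>k\<le>n. \<bar>sqrt_coeff k\<bar>) + (\<Sum>k\<le>n. sqrt_coeff k) = (\<Sum>k\<le>n. if k = 0 then 2 else 0)"
    unfolding sum.distrib[symmetric]
  proof (rule sum.cong[OF refl])
    fix k show "\<bar>sqrt_coeff k\<bar> + sqrt_coeff k = (if k = 0 then 2 else 0)"
      using sqrt_coeff_nonpos[of k] by (cases "k = 0") (auto simp: sqrt_coeff_0)
  qed
  also have "\<dots> = 2" by (simp add: sum.delta)
  finally show ?thesis using sqrt_coeff_sum_nonneg[of n] by simp
qed

lemma summable_sqrt_coeff: "summable (\<lambda>k. \<bar>sqrt_coeff k\<bar>)"
proof (rule summableI_nonneg_bounded)
  show "(\<Sum>i<n. \<bar>sqrt_coeff i\<bar>) \<le> 2" for n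
    by (rule order_trans[OF _ sqrt_coeff_abs_sum[of n]]) (auto intro!: sum_mono2)
qed simp

text \<open>Vandermonde's identity with \<open>1/2 + 1/2 = 1\<close>: squaring the series gives the
  polynomial \<open>1 - x\<close>.\<close>

lemma sqrt_coeff_convolution:
  "(\<Sum>k\<le>n. sqrt_coeff k * sqrt_coeff (n - k)) = (if n = 0 then 1 else if n = 1 then -1 else 0)"
proof -
  have "(\<Sum>k\<le>n. sqrt_coeff k * sqrt_coeff (n - k)) =
      (\<Sum>k\<le>n. ((1/2) gchoose k) * ((1/2) gchoose (n - k))) * (-1) ^ n"
    unfolding sum_distrib_right
    by (rule sum.cong) (auto simp: sqrt_coeff_def power_add[symmetric] mult_ac)
  also have "\<dots> = ((of_nat 1 :: real) gchoose n) * (-1) ^ n"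
    using gbinomial_Vandermonde[of "1/2::real" "1/2" n] by (simp add: atLeast0AtMost)
  also have "\<dots> = (if n = 0 then 1 else if n = 1 then -1 else 0)"
    unfolding binomial_gbinomial[symmetric] by (auto simp: binomial_eq_0)
  finally show ?thesis .
qed

text \<open>The square root is the binomial series of \<open>sqrt (1 - x)\<close> evaluated at \<open>X\<close>. Its coefficients are
  absolutely summable, so that a contraction suffices, and all but the first are nonpositive with
  nonnegative partial sums, which makes the limit positive semidefinite.\<close>

lemma psd_contraction_sqrt:
  assumes sym: "symmetric_d d X" and contr: "\<And>x. sq_norm d (mat_vec d X x) \<le> sq_norm d x"
  shows "\<exists>S. pos_semidef_d d S \<and> (\<forall>i<d. \<forall>j<d. mat_mult_d d S S i j = id_mat i j - X i j)"
proof -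
  let ?P = "mat_pow d X"
  \<comment> \<open>The entry is a coordinate of the image of a unit basis vector, and powers of a
    contraction are contractions. With \<open>summable_sqrt_coeff\<close> this makes every entry of
    the matrix series absolutely convergent.\<close>
  have Pbound: "\<bar>?P k i j\<bar> \<le> 1" if ij: "i < d" "j < d" for k i j
  proof -
    let ?e = "\<lambda>l. if l = j then 1 else 0 :: real"
    have e: "sq_norm d ?e = 1" using ij by (simp add: sq_norm_def if_distrib[of "\<lambda>x. x\<^sup>2"] cong: if_cong)
    have "(?P k i j)\<^sup>2 = (mat_vec d (?P k) ?e i)\<^sup>2"
      using ij by (simp add: mat_vec_nth if_distrib[of "\<lambda>c. _ * c"] cong: if_cong)
    also have "\<dots> \<le> sq_norm d (mat_vec d (?P k) ?e)"
      unfolding sq_norm_def using ij by (intro member_le_sum) auto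
    also have "\<dots> \<le> 1" using mat_pow_contraction[OF contr] e by metis
    finally show ?thesis by (simp add: abs_square_le_1)
  qed
  define S where "S = (\<lambda>i j. \<Sum>k. sqrt_coeff k * ?P k i j)"
  have abs_summ: "summable (\<lambda>k. \<bar>sqrt_coeff k * ?P k i j\<bar>)" if ij: "i < d" "j < d" for i j
    by (rule summable_comparison_test[OF _ summable_sqrt_coeff])
      (use Pbound[OF ij] in \<open>auto simp: abs_mult intro!: exI[of _ 0] mult_left_le\<close>)
  have Ssums: "(\<lambda>k. sqrt_coeff k * ?P k i j) sums S i j" if "i < d" "j < d" for i j
    unfolding S_def by (rule summable_sums, rule summable_rabs_cancel, rule abs_summ[OF that])
  have symS: "symmetric_d d S"
    using mat_pow_symmetric[OF sym] unfolding symmetric_d_def S_def by simp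
  have quad: "inner_d d x (mat_vec d S x) \<ge> 0" for x
  proof -
    have "(\<lambda>k. \<Sum>i<d. \<Sum>j<d. x i * (sqrt_coeff k * ?P k i j) * x j) sums inner_d d x (mat_vec d S x)"
      unfolding bilinear_d by (intro sums_sum sums_mult sums_mult2 Ssums) auto
    also have "(\<lambda>k. \<Sum>i<d. \<Sum>j<d. x i * (sqrt_coeff k * ?P k i j) * x j) =
        (\<lambda>k. sqrt_coeff k * inner_d d x (mat_vec d (?P k) x))"
      unfolding bilinear_d by (simp add: sum_distrib_left mult_ac)
    finally have sm: "(\<lambda>k. sqrt_coeff k * inner_d d x (mat_vec d (?P k) x)) sums inner_d d x (mat_vec d S x)" .
    have le: "inner_d d x (mat_vec d (?P k) x) \<le> sq_norm d x" for k
    proof -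
      have "(inner_d d x (mat_vec d (?P k) x))\<^sup>2 \<le> sq_norm d x * sq_norm d x"
        using inner_d_cauchy_schwarz[of d x "mat_vec d (?P k) x"]
          mult_left_mono[OF mat_pow_contraction[OF contr, where x = x and n = k], of "sq_norm d x"] sq_norm_nonneg
        by (meson order_trans)
      thus ?thesis using abs_le_square_iff[of "inner_d d x (mat_vec d (?P k) x)" "sq_norm d x"]
        by (simp add: power2_eq_square)
    qed
    have "(\<Sum>k\<le>n. sqrt_coeff k * inner_d d x (mat_vec d (?P k) x)) \<ge> 0" for n
    proof -
      \<comment> \<open>For \<open>k \<ge> 1\<close> the coefficient is nonpositive, so the upper
        bound \<open>le\<close> on the quadratic form becomes a lower bound on the term; for
        \<open>k = 0\<close> there is equality.\<close>
      have "sqrt_coeff k * inner_d d x (mat_vec d (?P k) x) \<ge> sqrt_coeff k * sq_norm d x" for k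
      proof (cases "k = 0")
        case True thus ?thesis by (simp add: inner_mat_vec_id inner_d_self)
      next
        case False thus ?thesis using sqrt_coeff_nonpos[of k] le by (intro mult_left_mono_neg) auto
      qed
      hence "(\<Sum>k\<le>n. sqrt_coeff k * inner_d d x (mat_vec d (?P k) x)) \<ge> (\<Sum>k\<le>n. sqrt_coeff k * sq_norm d x)"
        by (intro sum_mono)
      moreover have "(\<Sum>k\<le>n. sqrt_coeff k * sq_norm d x) \<ge> 0"
        unfolding sum_distrib_right[symmetric] using sqrt_coeff_sum_nonneg by simp
      ultimately show ?thesis by linarith
    qed
    moreover have "(\<lambda>n. \<Sum>k\<le>n. sqrt_coeff k * inner_d d x (mat_vec d (?P k) x)) \<longlonglongrightarrow> inner_d d x (mat_vec d S x)"
      using sm by (simp add: sums_def_le)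
    ultimately show ?thesis by (meson LIMSEQ_le_const)
  qed
  have "mat_mult_d d S S i j = id_mat i j - X i j" if ij: "i < d" "j < d" for i j
  proof -
    \<comment> \<open>The product of the two series is taken entry by entry as a Cauchy product;
      after \<open>mat_pow_add\<close> the coefficients are those of
      \<open>sqrt_coeff_convolution\<close>, so only the powers 0 and 1 survive.\<close>
    have "(\<lambda>n. \<Sum>l<d. \<Sum>k\<le>n. (sqrt_coeff k * ?P k i l) * (sqrt_coeff (n - k) * ?P (n - k) l j)) sums
        (\<Sum>l<d. (\<Sum>k. sqrt_coeff k * ?P k i l) * (\<Sum>k. sqrt_coeff k * ?P k l j))"
      using ij abs_summ by (intro sums_sum Cauchy_product_sums) (auto simp del: abs_mult simp: real_norm_def)
    also have "(\<lambda>n. \<Sum>l<d. \<Sum>k\<le>n. (sqrt_coeff k * ?P k i l) * (sqrt_coeff (n - k) * ?P (n - k) l j)) =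
        (\<lambda>n. (\<Sum>k\<le>n. sqrt_coeff k * sqrt_coeff (n - k)) * ?P n i j)"
    proof
      fix n
      have "(\<Sum>l<d. \<Sum>k\<le>n. (sqrt_coeff k * ?P k i l) * (sqrt_coeff (n - k) * ?P (n - k) l j)) =
          (\<Sum>k\<le>n. \<Sum>l<d. (sqrt_coeff k * ?P k i l) * (sqrt_coeff (n - k) * ?P (n - k) l j))"
        by (rule sum.swap)
      also have "\<dots> = (\<Sum>k\<le>n. sqrt_coeff k * sqrt_coeff (n - k) * mat_mult_d d (?P k) (?P (n - k)) i j)"
        by (simp add: mat_mult_d_def sum_distrib_left mult_ac)
      also have "\<dots> = (\<Sum>k\<le>n. sqrt_coeff k * sqrt_coeff (n - k)) * ?P n i j"
        unfolding sum_distrib_right using ij by (intro sum.cong) (auto simp: mat_pow_add)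
      finally show "(\<Sum>l<d. \<Sum>k\<le>n. (sqrt_coeff k * ?P k i l) * (sqrt_coeff (n - k) * ?P (n - k) l j)) =
        (\<Sum>k\<le>n. sqrt_coeff k * sqrt_coeff (n - k)) * ?P n i j" .
    qed
    finally have "(\<lambda>n. (if n = 0 then 1 else if n = 1 then -1 else 0) * ?P n i j) sums mat_mult_d d S S i j"
      unfolding sqrt_coeff_convolution by (simp add: mat_mult_d_def S_def)
    moreover have "(\<lambda>n. (if n = 0 then 1 else if n = 1 then -1 else 0) * ?P n i j) sums
        (\<Sum>n\<in>{0,1}. (if n = 0 then 1 else if n = 1 then -1 else 0) * ?P n i j)"
      by (rule sums_finite) auto
    ultimately have "mat_mult_d d S S i j = ?P 0 i j - ?P 1 i j"
      by (auto dest: sums_unique2)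
    also have "?P 1 i j = X i j" using ij by (simp add: mat_mult_id_right)
    finally show ?thesis by simp
  qed
  with symS quad show ?thesis unfolding pos_semidef_d_def by blast
qed

text \<open>Write \<open>A = K (I - X)\<close>. For \<open>K\<close> above the Frobenius norm,
  \<open>X\<close> is a contraction, because expanding the squared norm of \<open>X x\<close> leaves
  at most \<open>||x||^2 - (1/K) <x, A x>\<close>. The root is \<open>sqrt K\<close> times the root
  of \<open>I - X\<close>. Existence is what gives the choice in \<open>mat_sqrt_d\<close> its
  properties.\<close>

lemma mat_sqrt_exists:
  assumes pd: "pos_def_d d A"
  shows "\<exists>S. pos_semidef_d d S \<and> (\<forall>i<d. \<forall>j<d. mat_mult_d d S S i j = A i j)"
proof -
  have sym: "symmetric_d d A" using pd by (simp add: pos_def_d_def)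
  have nn: "inner_d d x (mat_vec d A x) \<ge> 0" for x
  proof (cases "\<exists>i<d. x i \<noteq> 0")
    case True thus ?thesis using pd by (simp add: pos_def_d_def less_imp_le)
  next
    case False thus ?thesis by (simp add: inner_d_def)
  qed
  \<comment> \<open>The summand 1 makes \<open>K\<close> positive without any lower bound on the
    Frobenius norm.\<close>
  define K where "K = sqrt (frob_sq d A) + 1"
  have K: "K > 0" by (simp add: K_def add_nonneg_pos)
  define X where "X = (\<lambda>i j. id_mat i j - (1/K) * A i j)"
  have symX: "symmetric_d d X" using sym by (auto simp: symmetric_d_def X_def id_mat_def)
  \<comment> \<open>This follows from positivity of the quadratic form at
    \<open>x - A x / K\<close>; the last of the three terms is at most \<open>||A x||^2 / K\<close>
    by the choice of \<open>K\<close>.\<close>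
  have form: "inner_d d x (mat_vec d A x) \<ge> sq_norm d (mat_vec d A x) / K" for x
  proof -
    let ?y = "mat_vec d A x"
    have yAy: "inner_d d ?y (mat_vec d A ?y) \<le> K * sq_norm d ?y"
    proof -
      have "(inner_d d ?y (mat_vec d A ?y))\<^sup>2 \<le> sq_norm d ?y * (frob_sq d A * sq_norm d ?y)"
        by (rule order_trans[OF inner_d_cauchy_schwarz mult_left_mono[OF sq_norm_mat_vec_le_frob]]) simp
      also have "\<dots> = (sqrt (frob_sq d A) * sq_norm d ?y)\<^sup>2"
        by (simp add: power_mult_distrib power2_eq_square[of "sq_norm d ?y"])
      finally have "inner_d d ?y (mat_vec d A ?y) \<le> sqrt (frob_sq d A) * sq_norm d ?y"
        by (rule power2_le_imp_le) simp
      moreover have "0 \<le> sq_norm d ?y" by simp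
      ultimately show ?thesis unfolding K_def distrib_right by linarith
    qed
    have "0 \<le> inner_d d (\<lambda>i. x i + (-1/K) * ?y i) (mat_vec d A (\<lambda>i. x i + (-1/K) * ?y i))" by (rule nn)
    also have "\<dots> = inner_d d (\<lambda>i. x i + (-1/K) * ?y i) (\<lambda>i. ?y i + (-1/K) * mat_vec d A ?y i)"
      by (rule inner_d_cong) (simp_all only: mat_vec_add mat_vec_scale)
    also have "\<dots> = inner_d d x ?y - (2/K) * sq_norm d ?y + (1/K)\<^sup>2 * inner_d d ?y (mat_vec d A ?y)"
      unfolding inner_d_add_left inner_d_add_right inner_d_scale_left inner_d_scale_right inner_d_self
        bilinear_symmetric[OF sym, of x ?y]
      by (simp add: algebra_simps power2_eq_square)
    also have "(1/K)\<^sup>2 * inner_d d ?y (mat_vec d A ?y) \<le> (1/K)\<^sup>2 * (K * sq_norm d ?y)"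
      by (intro mult_left_mono yAy) simp
    also have "(1/K)\<^sup>2 * (K * sq_norm d ?y) = sq_norm d ?y / K" using K by (simp add: power2_eq_square)
    finally show ?thesis by (simp add: field_simps)
  qed
  have contr: "sq_norm d (mat_vec d X x) \<le> sq_norm d x" for x
  proof -
    let ?y = "mat_vec d A x"
    have "mat_vec d X x i = x i + (-1/K) * ?y i" if "i < d" for i
      using that mat_vec_id[OF that, of x]
      by (simp add: X_def mat_vec_nth sum_subtractf left_diff_distrib sum_divide_distrib)
    hence "sq_norm d (mat_vec d X x) = inner_d d (\<lambda>i. x i + (-1/K) * ?y i) (\<lambda>i. x i + (-1/K) * ?y i)"
      unfolding inner_d_self[symmetric] by (intro inner_d_cong)
    also have "\<dots> = sq_norm d x - (2/K) * inner_d d x ?y + (1/K)\<^sup>2 * sq_norm d ?y"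
      unfolding inner_d_add_left inner_d_add_right inner_d_scale_left inner_d_scale_right inner_d_self
        inner_d_commute[of d ?y x]
      by (simp add: algebra_simps power2_eq_square)
    also have "(1/K)\<^sup>2 * sq_norm d ?y = (1/K) * (sq_norm d ?y / K)" by (simp add: power2_eq_square)
    also have "\<dots> \<le> (1/K) * inner_d d x ?y" using K form by (intro mult_left_mono) auto
    finally have "sq_norm d (mat_vec d X x) \<le> sq_norm d x - (1/K) * inner_d d x ?y" by (simp add: field_simps)
    thus ?thesis using nn[of x] K by (smt (verit) divide_nonneg_pos mult_nonneg_nonneg zero_le_divide_1_iff)
  qed
  obtain S where S: "pos_semidef_d d S" "\<forall>i<d. \<forall>j<d. mat_mult_d d S S i j = id_mat i j - X i j"
    using psd_contraction_sqrt[OF symX contr] by blast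
  let ?S = "\<lambda>i j. sqrt K * S i j"
  have "inner_d d x (mat_vec d ?S x) = sqrt K * inner_d d x (mat_vec d S x)" for x
    unfolding bilinear_d by (simp add: sum_distrib_left mult_ac)
  moreover have "mat_mult_d d ?S ?S i j = A i j" if "i < d" "j < d" for i j
  proof -
    have "mat_mult_d d ?S ?S i j = (sqrt K * sqrt K) * mat_mult_d d S S i j"
      by (simp only: mat_mult_d_def sum_distrib_left mult_ac)
    also have "\<dots> = K * ((1/K) * A i j)" using K S(2) that by (simp add: X_def)
    finally show ?thesis using K by simp
  qed
  ultimately show ?thesis
    using S(1) K by (intro exI[of _ ?S]) (auto simp: pos_semidef_d_def symmetric_d_def)
qed

lemma mat_sqrt_d:
  assumes "pos_def_d d A"
  shows "symmetric_d d (mat_sqrt_d d A)"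
    and "\<And>i j. i < d \<Longrightarrow> j < d \<Longrightarrow> mat_mult_d d (mat_sqrt_d d A) (mat_sqrt_d d A) i j = A i j"
  using someI_ex[OF mat_sqrt_exists[OF assms]] unfolding mat_sqrt_d_def[symmetric]
  by (simp_all add: pos_semidef_d_def)

lemma frob_sq_mat_sqrt:
  assumes "pos_def_d d A"
  shows "frob_sq d (mat_sqrt_d d A) = trace_d d A"
  using frob_sq_symmetric[OF mat_sqrt_d(1)[OF assms]] mat_sqrt_d(2)[OF assms] by (simp add: trace_d_def)

text \<open>For the root \<open>S\<close>, \<open>||S x||^2 = <x, A x>\<close>, which is at most the
  operator norm of \<open>A\<close> times \<open>||x||^2\<close>. It is used where noise multiplies
  noise and two factors of the root must become one factor of the covariance.\<close>

lemma op_norm_mat_sqrt_sq: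
  assumes pd: "pos_def_d d A" and d: "d \<ge> 1"
  shows "(op_norm_d d (mat_sqrt_d d A))\<^sup>2 \<le> op_norm_d d A"
proof -
  let ?S = "mat_sqrt_d d A"
  have sqn: "sq_norm d (mat_vec d ?S x) = inner_d d x (mat_vec d A x)" for x
  proof -
    have "sq_norm d (mat_vec d ?S x) = inner_d d x (mat_vec d ?S (mat_vec d ?S x))"
      by (simp add: bilinear_symmetric[OF mat_sqrt_d(1)[OF pd]] inner_d_self)
    also have "\<dots> = inner_d d x (mat_vec d A x)"
      unfolding mat_vec_mult[symmetric]
      by (rule inner_d_cong) (auto simp: mat_vec_nth mat_sqrt_d(2)[OF pd])
    finally show ?thesis .
  qed
  have op0: "op_norm_d d A \<ge> 0" by (rule op_norm_nonneg[OF d])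
  have "op_norm_d d ?S \<le> sqrt (op_norm_d d A)"
  proof (rule op_norm_le[OF d])
    fix x
    have "(inner_d d x (mat_vec d A x))\<^sup>2 \<le> sq_norm d x * ((op_norm_d d A)\<^sup>2 * sq_norm d x)"
      by (rule order_trans[OF inner_d_cauchy_schwarz mult_left_mono[OF mat_vec_le_op_norm]]) simp
    also have "\<dots> = (op_norm_d d A * sq_norm d x)\<^sup>2" by (simp add: power_mult_distrib power2_eq_square)
    finally have "inner_d d x (mat_vec d A x) \<le> op_norm_d d A * sq_norm d x"
      by (rule power2_le_imp_le) (simp add: op0)
    thus "sq_norm d (mat_vec d ?S x) \<le> (sqrt (op_norm_d d A))\<^sup>2 * sq_norm d x"
      using op0 by (simp add: sqn)
  qed (simp add: op0)
  moreover have "0 \<le> op_norm_d d ?S" by (rule op_norm_nonneg[OF d])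
  ultimately show ?thesis using op0 by (metis power_mono real_sqrt_pow2)
qed

lemma trace_pos_def:
  assumes pd: "pos_def_d d Lam" and d: "d \<ge> 1"
  shows "trace_d d Lam > 0"
  unfolding trace_d_def
proof (rule sum_pos)
  fix i assume i: "i \<in> {..<d}"
  let ?e = "\<lambda>k. if k = i then 1 else 0 :: real"
  have "inner_d d ?e (mat_vec d Lam ?e) > 0" using pd i unfolding pos_def_d_def by force
  also have "inner_d d ?e (mat_vec d Lam ?e) = Lam i i"
    using i by (simp add: inner_d_def mat_vec_nth if_distrib[of "\<lambda>c. _ * c"] if_distrib[of "\<lambda>c. c * _"] cong: if_cong)
  finally show "Lam i i > 0" .
qed (use d in \<open>auto simp: lessThan_empty_iff\<close>)

lemma frob_sq_pos_if_trace_pos: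
  assumes "trace_d d A > 0"
  shows "frob_sq d A > 0"
  using trace_sq_le[of d A] assms frob_sq_nonneg[of d A]
  by (cases "frob_sq d A = 0") (auto simp: order_less_le)

text \<open>If the root had operator norm 0, then multiplying it by the identity would give
  Frobenius norm 0, against the positive trace of \<open>Lam\<close>.\<close>

lemma op_norm_pos:
  assumes pd: "pos_def_d d Lam" and d: "d \<ge> 1"
  shows "op_norm_d d (mat_sqrt_d d Lam) > 0" "op_norm_d d Lam > 0"
proof -
  let ?S = "mat_sqrt_d d Lam"
  have "frob_sq d ?S > 0" using trace_pos_def[OF pd d] by (simp add: frob_sq_mat_sqrt[OF pd])
  moreover have "frob_sq d ?S \<le> (op_norm_d d ?S)\<^sup>2 * frob_sq d id_mat"
  proof -
    have "frob_sq d ?S = frob_sq d (mat_mult_d d ?S id_mat)" by (rule frob_sq_cong) (simp add: mat_mult_id_right)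
    thus ?thesis using frob_sq_mult_left[of d ?S id_mat] by simp
  qed
  ultimately have "op_norm_d d ?S \<noteq> 0" by auto
  thus s: "op_norm_d d ?S > 0" using op_norm_nonneg[OF d, of ?S] by linarith
  have "0 < (op_norm_d d ?S)\<^sup>2" using s by simp
  also have "\<dots> \<le> op_norm_d d Lam" by (rule op_norm_mat_sqrt_sq[OF pd d])
  finally show "op_norm_d d Lam > 0" .
qed

section \<open>Coordinatewise measurability and the basic product measures\<close>

abbreviation std_gauss :: "nat \<Rightarrow> vecd measure" where
  "std_gauss d \<equiv> PiM {..<d} (\<lambda>_. std_normal_distribution)"

abbreviation lborel_d :: "nat \<Rightarrow> vecd measure" where
  "lborel_d d \<equiv> PiM {..<d} (\<lambda>_. lborel)"

lemma measurable_inner_d: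
  assumes "\<And>i. i < d \<Longrightarrow> (\<lambda>w. f w i) \<in> borel_measurable M" "\<And>i. i < d \<Longrightarrow> (\<lambda>w. g w i) \<in> borel_measurable M"
  shows "(\<lambda>w. inner_d d (f w) (g w)) \<in> borel_measurable M"
  unfolding inner_d_def using assms by (intro borel_measurable_sum borel_measurable_times) auto

lemma measurable_sq_norm:
  assumes "\<And>i. i < d \<Longrightarrow> (\<lambda>w. f w i) \<in> borel_measurable M"
  shows "(\<lambda>w. sq_norm d (f w)) \<in> borel_measurable M"
  unfolding inner_d_self[symmetric] by (intro measurable_inner_d assms)

lemma measurable_mat_vec:
  assumes "\<And>i. i < d \<Longrightarrow> (\<lambda>w. f w i) \<in> borel_measurable M"
  shows "i < d \<Longrightarrow> (\<lambda>w. mat_vec d A (f w) i) \<in> borel_measurable M"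
  using assms by (auto simp: mat_vec_nth intro!: borel_measurable_sum borel_measurable_times)

lemma measurable_restrict_borel_d:
  assumes "\<And>i. i < d \<Longrightarrow> (\<lambda>w. f w i) \<in> borel_measurable M"
  shows "(\<lambda>w. restrict (f w) {..<d}) \<in> measurable M (borel_d d)"
  using assms by (intro measurable_restrict) auto

lemma measurable_mat_vec_borel_d:
  assumes "\<And>i. i < d \<Longrightarrow> (\<lambda>w. f w i) \<in> borel_measurable M"
  shows "(\<lambda>w. mat_vec d A (f w)) \<in> measurable M (borel_d d)"
  unfolding mat_vec_def using assms
  by (intro measurable_restrict) (auto intro!: borel_measurable_sum borel_measurable_times)

text \<open>The vector laws in use are different measures whose sigma-algebras equal that of
  \<open>borel_d\<close>; the equation on \<open>sets\<close> lets one lemma serve all of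
  them.\<close>

lemma measurable_nth_borel_d:
  assumes "sets M = sets (borel_d d)" "f \<in> measurable N M" "i < d"
  shows "(\<lambda>w. f w i) \<in> borel_measurable N"
proof -
  have "(\<lambda>x. x i) \<in> borel_measurable M"
    unfolding measurable_cong_sets[OF assms(1) refl]
    using assms(3) by (intro measurable_component_singleton) auto
  from measurable_compose[OF assms(2) this] show ?thesis .
qed

lemma measurable_pair_nth:
  assumes "sets P = sets (borel_d d)" "sets Q = sets (borel_d d)" "i < d"
  shows "(\<lambda>z. fst z i) \<in> borel_measurable (P \<Otimes>\<^sub>M Q)"
    and "(\<lambda>z. snd z i) \<in> borel_measurable (P \<Otimes>\<^sub>M Q)"
  by (rule measurable_nth_borel_d[OF assms(1) measurable_fst assms(3)],
      rule measurable_nth_borel_d[OF assms(2) measurable_snd assms(3)])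

lemma sets_std_gauss: "sets (std_gauss d) = sets (borel_d d)"
  by (intro sets_PiM_cong) auto

lemma sets_lborel_d: "sets (lborel_d d) = sets (borel_d d)"
  by (intro sets_PiM_cong) auto

lemma prob_space_std_gauss: "prob_space (std_gauss d)"
  by (intro prob_space_PiM prob_space_normal_density) simp

interpretation lbd: product_sigma_finite "\<lambda>_::nat. lborel :: real measure"
  by standard

interpretation sn: prob_space std_normal_distribution
  by (rule prob_space_normal_density) simp

interpretation sgd: product_sigma_finite "\<lambda>_::nat. std_normal_distribution"
  by standard

section \<open>One-dimensional Gaussian integrals\<close>

text \<open>Completing the square: the exponential tilt moves the mean to \<open>x\<close>. Moment
  generating functions are nonnegative integrals throughout, so a bound needs no prior
  integrability.\<close>

lemma nn_std_normal_exp: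
  "(\<integral>\<^sup>+h. ennreal (exp (h * x)) \<partial>std_normal_distribution) = ennreal (exp (x\<^sup>2 / 2))"
proof -
  have "(\<integral>\<^sup>+h. ennreal (exp (h * x)) \<partial>std_normal_distribution) =
      (\<integral>\<^sup>+h. ennreal (exp (x\<^sup>2/2)) * ennreal (normal_density x 1 h) \<partial>lborel)"
  proof (subst nn_integral_density, (simp; fail), (simp; fail), rule nn_integral_cong)
    fix h :: real
    have "std_normal_density h * exp (h * x) = exp (x\<^sup>2/2) * normal_density x 1 h"
      by (simp add: normal_density_def exp_add[symmetric] power2_eq_square field_simps)
    thus "ennreal (std_normal_density h) * ennreal (exp (h * x)) =
        ennreal (exp (x\<^sup>2/2)) * ennreal (normal_density x 1 h)"
      by (simp add: ennreal_mult''[symmetric])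
  qed
  also have "\<dots> = ennreal (exp (x\<^sup>2/2)) * (\<integral>\<^sup>+h. ennreal (normal_density x 1 h) \<partial>lborel)"
    by (rule nn_integral_cmult) simp
  also have "(\<integral>\<^sup>+h. ennreal (normal_density x 1 h) \<partial>lborel) = 1"
    by (subst nn_integral_eq_integral) auto
  finally show ?thesis by simp
qed

text \<open>The integrand times the density is \<open>sqrt 2\<close> times the normal density of
  variance 2, so the value is \<open>sqrt 2\<close>.\<close>

lemma nn_std_normal_exp_sq:
  "(\<integral>\<^sup>+h. ennreal (exp (h\<^sup>2 / 4)) \<partial>std_normal_distribution) \<le> 2"
proof -
  have "(\<integral>\<^sup>+h. ennreal (exp (h\<^sup>2 / 4)) \<partial>std_normal_distribution) =
      (\<integral>\<^sup>+h. ennreal (sqrt 2) * ennreal (normal_density 0 (sqrt 2) h) \<partial>lborel)"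
  proof (subst nn_integral_density, (simp; fail), (simp; fail), rule nn_integral_cong)
    fix h :: real
    have "std_normal_density h * exp (h\<^sup>2/4) = sqrt 2 * normal_density 0 (sqrt 2) h"
      by (simp add: normal_density_def exp_add[symmetric] real_sqrt_mult field_simps)
    thus "ennreal (std_normal_density h) * ennreal (exp (h\<^sup>2/4)) =
        ennreal (sqrt 2) * ennreal (normal_density 0 (sqrt 2) h)"
      by (simp add: ennreal_mult''[symmetric])
  qed
  also have "\<dots> = ennreal (sqrt 2) * (\<integral>\<^sup>+h. ennreal (normal_density 0 (sqrt 2) h) \<partial>lborel)"
    by (rule nn_integral_cmult) simp
  also have "(\<integral>\<^sup>+h. ennreal (normal_density 0 (sqrt 2) h) \<partial>lborel) = 1"
    by (subst nn_integral_eq_integral) auto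
  also have "ennreal (sqrt 2) * 1 \<le> ennreal 2"
    by (simp add: real_le_lsqrt del: ennreal_numeral)
  finally show ?thesis by simp
qed

section \<open>Sub-Gaussian laws\<close>

text \<open>The right-hand side is the moment generating function of the image of a standard
  Gaussian vector under the transpose of \<open>S\<close>. Only an inequality is asked, so that
  averaged noise, whose covariance is smaller, belongs to the same class.\<close>

definition subgauss :: "nat \<Rightarrow> vecd measure \<Rightarrow> matd \<Rightarrow> bool" where
  "subgauss d P S \<longleftrightarrow> prob_space P \<and> sets P = sets (borel_d d) \<and>
     (\<forall>a. (\<integral>\<^sup>+v. ennreal (exp (inner_d d a v)) \<partial>P) \<le> ennreal (exp (sq_norm d (mat_vec d S a) / 2)))"

lemma subgaussD:
  assumes "subgauss d P S"
  shows "prob_space P" "sets P = sets (borel_d d)"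
    "(\<integral>\<^sup>+v. ennreal (exp (inner_d d a v)) \<partial>P) \<le> ennreal (exp (sq_norm d (mat_vec d S a) / 2))"
  using assms by (auto simp: subgauss_def)

lemma std_gauss_mgf:
  "(\<integral>\<^sup>+g. ennreal (exp (inner_d d a g)) \<partial>std_gauss d) = ennreal (exp (sq_norm d a / 2))"
proof -
  have "(\<integral>\<^sup>+g. ennreal (exp (inner_d d a g)) \<partial>std_gauss d) =
      (\<integral>\<^sup>+g. (\<Prod>i<d. ennreal (exp (g i * a i))) \<partial>std_gauss d)"
    by (simp add: inner_d_def exp_sum prod_ennreal mult.commute)
  also have "\<dots> = (\<Prod>i<d. \<integral>\<^sup>+h. ennreal (exp (h * a i)) \<partial>std_normal_distribution)"
    by (rule sgd.product_nn_integral_prod) auto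
  also have "\<dots> = ennreal (exp (sq_norm d a / 2))"
    by (simp add: nn_std_normal_exp prod_ennreal exp_sum[symmetric] sq_norm_def sum_divide_distrib)
  finally show ?thesis .
qed

lemma subgauss_std_gauss: "subgauss d (std_gauss d) id_mat"
  unfolding subgauss_def
proof (intro conjI allI)
  fix a
  have "sq_norm d (mat_vec d id_mat a) = sq_norm d a" by (rule sq_norm_cong) (simp add: mat_vec_id)
  thus "(\<integral>\<^sup>+v. ennreal (exp (inner_d d a v)) \<partial>std_gauss d) \<le> ennreal (exp (sq_norm d (mat_vec d id_mat a) / 2))"
    by (simp add: std_gauss_mgf)
qed (rule prob_space_std_gauss sets_std_gauss)+

lemma subgauss_law:
  assumes "prob_space Q" "f \<in> measurable Q (borel_d d)"
    and "\<And>a. (\<integral>\<^sup>+q. ennreal (exp (inner_d d a (f q))) \<partial>Q) \<le> ennreal (exp (sq_norm d (mat_vec d S a) / 2))"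
  shows "subgauss d (distr Q (borel_d d) f) S"
  unfolding subgauss_def
proof (intro conjI allI)
  show "prob_space (distr Q (borel_d d) f)" by (rule prob_space.prob_space_distr[OF assms(1,2)])
  fix a
  have "(\<lambda>v. ennreal (exp (inner_d d a v))) \<in> borel_measurable (borel_d d)"
    by (intro measurable_compose[OF _ measurable_ennreal] measurable_compose[OF _ borel_measurable_exp]
        measurable_inner_d borel_measurable_const measurable_component_singleton) auto
  thus "(\<integral>\<^sup>+v. ennreal (exp (inner_d d a v)) \<partial>distr Q (borel_d d) f) \<le> ennreal (exp (sq_norm d (mat_vec d S a) / 2))"
    using assms(3)[of a] by (subst nn_integral_distr[OF assms(2)]) simp_all
qed simp

text \<open>Linearisation of the square: \<open>exp (x^2 / (2 p))\<close> is the Gaussian average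
  over \<open>h\<close> of \<open>exp (h x / sqrt p)\<close>. After exchanging the integrals the
  sub-Gaussian bound applies for fixed \<open>h\<close>, and the condition on \<open>p\<close> turns
  its exponent into at most \<open>h^2 / 4\<close>.\<close>

lemma subgauss_scaled_exp_sq:
  assumes P: "subgauss d P S" and p: "p > 0" "2 * sq_norm d (mat_vec d S a) \<le> p"
  shows "(\<integral>\<^sup>+v. ennreal (exp ((inner_d d a v)\<^sup>2 / (2 * p))) \<partial>P) \<le> 2"
proof -
  interpret P: prob_space P by (rule subgaussD[OF P])
  interpret pair_sigma_finite P std_normal_distribution ..
  note [measurable] = measurable_inner_d[where d = d] measurable_nth_borel_d[OF subgaussD(2)[OF P]]
  have "(\<integral>\<^sup>+v. ennreal (exp ((inner_d d a v)\<^sup>2 / (2 * p))) \<partial>P) =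
      (\<integral>\<^sup>+v. \<integral>\<^sup>+h. ennreal (exp (h * (inner_d d a v / sqrt p))) \<partial>std_normal_distribution \<partial>P)"
    unfolding nn_std_normal_exp using p by (simp add: power_divide mult.commute)
  also have "\<dots> = (\<integral>\<^sup>+h. \<integral>\<^sup>+v. ennreal (exp (h * (inner_d d a v / sqrt p))) \<partial>P \<partial>std_normal_distribution)"
    by (rule Fubini'[symmetric]) measurable
  also have "\<dots> \<le> (\<integral>\<^sup>+h. ennreal (exp (h\<^sup>2 / 4)) \<partial>std_normal_distribution)"
  proof (rule nn_integral_mono)
    fix h :: real
    have "(\<integral>\<^sup>+v. ennreal (exp (h * (inner_d d a v / sqrt p))) \<partial>P) =
        (\<integral>\<^sup>+v. ennreal (exp (inner_d d (\<lambda>i. (h / sqrt p) * a i) v)) \<partial>P)"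
      by (simp only: inner_d_scale_left) simp
    also have "\<dots> \<le> ennreal (exp (sq_norm d (mat_vec d S (\<lambda>i. (h / sqrt p) * a i)) / 2))"
      by (rule subgaussD[OF P])
    also have "sq_norm d (mat_vec d S (\<lambda>i. (h / sqrt p) * a i)) = (h / sqrt p)\<^sup>2 * sq_norm d (mat_vec d S a)"
      unfolding sq_norm_scale[symmetric] by (rule sq_norm_cong) (simp only: mat_vec_scale)
    also have "\<dots> / 2 \<le> h\<^sup>2 / 4"
    proof -
      have "h\<^sup>2 * (2 * sq_norm d (mat_vec d S a)) \<le> h\<^sup>2 * p" by (intro mult_left_mono p) simp
      thus ?thesis using p by (simp add: power_divide field_simps)
    qed
    finally show "(\<integral>\<^sup>+v. ennreal (exp (h * (inner_d d a v / sqrt p))) \<partial>P) \<le> ennreal (exp (h\<^sup>2 / 4))"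
      by simp
  qed
  also have "\<dots> \<le> 2" by (rule nn_std_normal_exp_sq)
  finally show ?thesis .
qed

text \<open>Jensen's inequality with the weights \<open>p i\<close> reduces the quadratic form to
  one-dimensional marginals, so that no diagonalisation is needed.\<close>

lemma subgauss_exp_sq_norm:
  assumes P: "subgauss d P S" and sym: "symmetric_d d S"
    and fr: "frob_sq d (mat_mult_d d A S) \<le> 1/4"
  shows "(\<integral>\<^sup>+v. ennreal (exp (sq_norm d (mat_vec d A v) / 2)) \<partial>P) \<le> 2"
proof (cases "d = 0")
  case True
  interpret P: prob_space P by (rule subgaussD[OF P])
  show ?thesis using True by (simp add: sq_norm_def P.emeasure_space_1)
next
  case False
  interpret P: prob_space P by (rule subgaussD[OF P])
  note [measurable] = measurable_inner_d[where d = d] measurable_nth_borel_d[OF subgaussD(2)[OF P]]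
  define w where "w = (\<lambda>i. sq_norm d (mat_vec d S (A i)))"
  have w: "(\<Sum>i<d. w i) \<le> 1/4"
  proof -
    have "(\<Sum>i<d. w i) = frob_sq d (mat_mult_d d A S)"
      unfolding w_def frob_sq_def sq_norm_mat_vec mat_mult_d_def
      using sym by (intro sum.cong refl arg_cong[where f = "\<lambda>x. x\<^sup>2"]) (auto simp: symmetric_d_def mult.commute)
    thus ?thesis using fr by simp
  qed
  have w0: "w i \<ge> 0" for i by (simp add: w_def)
  \<comment> \<open>Each weight must be at least \<open>2 * w i\<close> for the one-dimensional
    bound. The \<open>w i\<close> sum to at most 1/4, so the mass left over is positive; spreading
    it evenly makes all weights positive with sum 1.\<close>
  define p where "p = (\<lambda>i. 2 * w i + (1 - 2 * (\<Sum>i<d. w i)) / real d)"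
  have p0: "p i > 0" for i
    using w0[of i] w False unfolding p_def by (intro add_nonneg_pos divide_pos_pos) auto
  have p1: "(\<Sum>i<d. p i) = 1"
    using False unfolding p_def by (simp add: sum.distrib sum_distrib_left[symmetric])
  have pw: "2 * w i \<le> p i" for i
    using w False unfolding p_def by (simp add: divide_nonneg_pos)
  let ?X = "\<lambda>i v. inner_d d (A i) v"
  have "(\<integral>\<^sup>+v. ennreal (exp (sq_norm d (mat_vec d A v) / 2)) \<partial>P) \<le>
      (\<integral>\<^sup>+v. (\<Sum>i<d. ennreal (p i) * ennreal (exp ((?X i v)\<^sup>2 / (2 * p i)))) \<partial>P)"
  proof (rule nn_integral_mono)
    fix v
    have "sq_norm d (mat_vec d A v) / 2 = (\<Sum>i<d. p i *\<^sub>R ((?X i v)\<^sup>2 / (2 * p i)))"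
      unfolding sq_norm_mat_vec inner_d_def sum_divide_distrib
      by (rule sum.cong) (use p0 in \<open>auto simp: less_imp_neq[symmetric]\<close>)
    also have "exp \<dots> \<le> (\<Sum>i<d. p i * exp ((?X i v)\<^sup>2 / (2 * p i)))"
      by (rule convex_on_sum[OF _ _ convex_on_exp[of 1, simplified]])
        (use p0 p1 False in \<open>auto intro: less_imp_le\<close>)
    finally show "ennreal (exp (sq_norm d (mat_vec d A v) / 2)) \<le>
        (\<Sum>i<d. ennreal (p i) * ennreal (exp ((?X i v)\<^sup>2 / (2 * p i))))"
      using p0 by (simp add: ennreal_mult''[symmetric] sum_ennreal less_imp_le ennreal_leI)
  qed
  also have "\<dots> = (\<Sum>i<d. ennreal (p i) * (\<integral>\<^sup>+v. ennreal (exp ((?X i v)\<^sup>2 / (2 * p i))) \<partial>P))"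
    by (subst nn_integral_sum, measurable, intro sum.cong refl nn_integral_cmult) measurable
  also have "\<dots> \<le> (\<Sum>i<d. ennreal (p i) * 2)"
    using p0 pw unfolding w_def by (intro sum_mono mult_left_mono subgauss_scaled_exp_sq[OF P]) auto
  also have "\<dots> = ennreal (\<Sum>i<d. p i) * 2"
    using p0 by (simp add: sum_distrib_right[symmetric] sum_ennreal less_imp_le)
  finally show ?thesis by (simp add: p1)
qed

section \<open>Tails of decoupled bilinear forms\<close>

lemma markov_exp_tail:
  assumes [measurable]: "X \<in> borel_measurable M"
    and "(\<integral>\<^sup>+x. ennreal (exp (X x)) \<partial>M) \<le> 2"
  shows "emeasure M {x\<in>space M. X x > t} \<le> ennreal (2 * exp (- t))"
proof -
  have "emeasure M {x\<in>space M. X x > t} \<le> (\<integral>\<^sup>+x. ennreal (exp (- t)) * ennreal (exp (X x)) \<partial>M)"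
    by (subst nn_integral_indicator[symmetric], measurable, intro nn_integral_mono)
      (auto simp: indicator_def ennreal_mult''[symmetric] exp_add[symmetric])
  also have "\<dots> = ennreal (exp (- t)) * (\<integral>\<^sup>+x. ennreal (exp (X x)) \<partial>M)"
    by (rule nn_integral_cmult) measurable
  also have "\<dots> \<le> ennreal (exp (- t)) * 2" by (intro mult_left_mono assms) simp
  also have "\<dots> = ennreal (2 * exp (- t))" by (simp add: ennreal_mult'' mult.commute)
  finally show ?thesis .
qed

lemma markov_exp_tail_abs:
  assumes [measurable]: "X \<in> borel_measurable M"
    and 1: "(\<integral>\<^sup>+x. ennreal (exp (X x)) \<partial>M) \<le> 2" and 2: "(\<integral>\<^sup>+x. ennreal (exp (- X x)) \<partial>M) \<le> 2"
  shows "emeasure M {x\<in>space M. \<bar>X x\<bar> > t} \<le> ennreal (4 * exp (- t))"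
proof -
  have "{x\<in>space M. \<bar>X x\<bar> > t} = {x\<in>space M. X x > t} \<union> {x\<in>space M. - X x > t}" by auto
  hence "emeasure M {x\<in>space M. \<bar>X x\<bar> > t} \<le> emeasure M {x\<in>space M. X x > t} + emeasure M {x\<in>space M. - X x > t}"
    by (simp only:) (rule emeasure_subadditive; measurable)
  also have "\<dots> \<le> ennreal (2 * exp (- t)) + ennreal (2 * exp (- t))"
    by (intro add_mono markov_exp_tail assms) measurable
  also have "\<dots> = ennreal (4 * exp (- t))" by (simp add: ennreal_plus[symmetric] del: ennreal_plus)
  finally show ?thesis .
qed

text \<open>For fixed \<open>w\<close> the exponent is linear in the first vector, so
  sub-Gaussianity of \<open>P\<close> leaves the exponential of a quadratic form in
  \<open>w\<close>. \<open>Q\<close> enters only through \<open>sq\<close>, so it may be a noise law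
  or the uniform law on a sphere.\<close>

lemma decoupled_mgf:
  assumes P: "subgauss d P S" and Q: "prob_space Q" "sets Q = sets (borel_d d)"
    and sq: "(\<integral>\<^sup>+w. ennreal (exp (sq_norm d (mat_vec d (mat_mult_d d S A) w) / 2)) \<partial>Q) \<le> 2"
  shows "(\<integral>\<^sup>+z. ennreal (exp (inner_d d (fst z) (mat_vec d A (snd z)))) \<partial>(P \<Otimes>\<^sub>M Q)) \<le> 2"
proof -
  interpret P: prob_space P by (rule subgaussD[OF P])
  interpret Q: prob_space Q by fact
  interpret pair_sigma_finite P Q ..
  note [measurable] = measurable_inner_d[where d = d] measurable_mat_vec[where d = d]
    measurable_pair_nth[OF subgaussD(2)[OF P] Q(2)]
  have "(\<integral>\<^sup>+z. ennreal (exp (inner_d d (fst z) (mat_vec d A (snd z)))) \<partial>(P \<Otimes>\<^sub>M Q)) =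
      (\<integral>\<^sup>+w. \<integral>\<^sup>+v. ennreal (exp (inner_d d v (mat_vec d A w))) \<partial>P \<partial>Q)"
    by (subst nn_integral_snd[symmetric]) (measurable, (simp; fail)?)
  also have "\<dots> \<le> (\<integral>\<^sup>+w. ennreal (exp (sq_norm d (mat_vec d S (mat_vec d A w)) / 2)) \<partial>Q)"
    by (intro nn_integral_mono) (subst inner_d_commute, rule subgaussD[OF P])
  also have "\<dots> \<le> 2" using sq by (simp add: mat_vec_mult)
  finally show ?thesis .
qed

lemma decoupled_tail:
  assumes P: "subgauss d P S" and Q: "prob_space Q" "sets Q = sets (borel_d d)"
    and sq: "(\<integral>\<^sup>+w. ennreal (exp (sq_norm d (mat_vec d (mat_mult_d d S A) w) / 2)) \<partial>Q) \<le> 2"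
  shows "emeasure (P \<Otimes>\<^sub>M Q) {z\<in>space (P \<Otimes>\<^sub>M Q). \<bar>inner_d d (fst z) (mat_vec d A (snd z))\<bar> > t} \<le> ennreal (4 * exp (- t))"
proof (rule markov_exp_tail_abs)
  note [measurable] = measurable_inner_d[where d = d] measurable_mat_vec[where d = d]
    measurable_pair_nth[OF subgaussD(2)[OF P] Q(2)]
  show "(\<lambda>z. inner_d d (fst z) (mat_vec d A (snd z))) \<in> borel_measurable (P \<Otimes>\<^sub>M Q)" by measurable
  show "(\<integral>\<^sup>+z. ennreal (exp (inner_d d (fst z) (mat_vec d A (snd z)))) \<partial>(P \<Otimes>\<^sub>M Q)) \<le> 2"
    by (rule decoupled_mgf) fact+
  \<comment> \<open>The lower tail is the upper tail for the matrix \<open>- A\<close>, which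
    satisfies the same bound \<open>sq\<close>.\<close>
  let ?A = "\<lambda>i j. - A i j"
  have "- inner_d d v (mat_vec d A w) = inner_d d v (mat_vec d ?A w)" for v w
    by (simp add: bilinear_d sum_negf)
  moreover have "sq_norm d (mat_vec d (mat_mult_d d S ?A) w) = sq_norm d (mat_vec d (mat_mult_d d S A) w)" for w
    by (simp add: sq_norm_mat_vec mat_mult_d_def sum_negf)
  ultimately show "(\<integral>\<^sup>+z. ennreal (exp (- inner_d d (fst z) (mat_vec d A (snd z)))) \<partial>(P \<Otimes>\<^sub>M Q)) \<le> 2"
    using decoupled_mgf[OF P Q, of ?A] sq by simp
qed

section \<open>Change of variables in finite products of Lebesgue measure\<close>

text \<open>Induction on the coordinates, each of which contributes one factor \<open>|c|\<close>. A
  common scale with a coordinatewise shift covers both uses: dilations of balls and the shears that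
  compose a rotation.\<close>

lemma nn_integral_PiM_lborel_affine:
  fixes a :: "nat \<Rightarrow> real"
  assumes "finite I" "c \<noteq> 0" "F \<in> borel_measurable (PiM I (\<lambda>_. lborel))"
  shows "(\<integral>\<^sup>+x. F x \<partial>PiM I (\<lambda>_. lborel)) =
    ennreal (\<bar>c\<bar> ^ card I) * (\<integral>\<^sup>+x. F (restrict (\<lambda>i. a i + c * x i) I) \<partial>PiM I (\<lambda>_. lborel))"
  using assms
proof (induction I arbitrary: F rule: finite_induct)
  case empty
  show ?case by (simp add: PiM_empty nn_integral_count_space_finite)
next
  case (insert i I)
  note [measurable] = insert.prems(2)
  let ?M = "\<lambda>J. PiM J (\<lambda>_. lborel :: real measure)"
  have upd [measurable]: "(\<lambda>p. (fst p)(i := snd p)) \<in> measurable (?M I \<Otimes>\<^sub>M lborel) (?M (insert i I))"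
    using measurable_add_dim[of i I "\<lambda>_. lborel :: real measure"] by (simp add: case_prod_unfold)
  define G where "G = (\<lambda>x. \<integral>\<^sup>+y. F (x(i := a i + c * y)) \<partial>lborel)"
  have "(\<lambda>p. (fst p)(i := a i + c * snd p)) \<in> measurable (?M I \<Otimes>\<^sub>M lborel) (?M (insert i I))"
    using measurable_compose[OF _ upd, of "\<lambda>p. (fst p, a i + c * snd p)" "?M I \<Otimes>\<^sub>M lborel"] by simp
  from measurable_compose[OF this insert.prems(2)]
  have G [measurable]: "G \<in> borel_measurable (?M I)"
    unfolding G_def by (intro lborel.borel_measurable_nn_integral) (simp add: case_prod_unfold)
  have "(\<integral>\<^sup>+x. F x \<partial>?M (insert i I)) = (\<integral>\<^sup>+x. \<integral>\<^sup>+y. F (x(i := y)) \<partial>lborel \<partial>?M I)"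
    by (rule lbd.product_nn_integral_insert) (use insert in auto)
  also have "\<dots> = (\<integral>\<^sup>+x. ennreal \<bar>c\<bar> * G x \<partial>?M I)"
  proof (rule nn_integral_cong)
    fix x assume x: "x \<in> space (?M I)"
    have [measurable]: "(\<lambda>y. F (x(i := y))) \<in> borel_measurable borel"
      using measurable_compose[OF measurable_Pair1'[OF x, of lborel] measurable_compose[OF upd insert.prems(2)]]
      by (simp only: fst_conv snd_conv measurable_lborel2)
    show "(\<integral>\<^sup>+y. F (x(i := y)) \<partial>lborel) = ennreal \<bar>c\<bar> * G x"
      unfolding G_def by (rule nn_integral_real_affine) (use insert.prems in auto)
  qed
  also have "\<dots> = ennreal \<bar>c\<bar> * (\<integral>\<^sup>+x. G x \<partial>?M I)" by (rule nn_integral_cmult) (rule G)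
  also have "(\<integral>\<^sup>+x. G x \<partial>?M I) = ennreal (\<bar>c\<bar> ^ card I) * (\<integral>\<^sup>+x. G (restrict (\<lambda>j. a j + c * x j) I) \<partial>?M I)"
    by (rule insert.IH[OF insert.prems(1) G])
  also have "(\<integral>\<^sup>+x. G (restrict (\<lambda>j. a j + c * x j) I) \<partial>?M I) =
      (\<integral>\<^sup>+x. \<integral>\<^sup>+y. F (restrict (\<lambda>j. a j + c * (x(i := y)) j) (insert i I)) \<partial>lborel \<partial>?M I)"
    unfolding G_def using insert.hyps
    by (intro nn_integral_cong arg_cong[of _ _ F]) (auto simp: fun_eq_iff restrict_def)
  also have "\<dots> = (\<integral>\<^sup>+x. F (restrict (\<lambda>j. a j + c * x j) (insert i I)) \<partial>?M (insert i I))"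
    by (rule lbd.product_nn_integral_insert[symmetric]) (use insert in auto)
  finally have "(\<integral>\<^sup>+x. F x \<partial>?M (insert i I)) = (ennreal \<bar>c\<bar> * ennreal (\<bar>c\<bar> ^ card I)) *
      (\<integral>\<^sup>+x. F (restrict (\<lambda>j. a j + c * x j) (insert i I)) \<partial>?M (insert i I))"
    by (simp only: mult.assoc)
  also have "ennreal \<bar>c\<bar> * ennreal (\<bar>c\<bar> ^ card I) = ennreal (\<bar>c\<bar> ^ card (insert i I))"
    using insert.hyps by (simp add: ennreal_mult'')
  finally show ?case .
qed

text \<open>A product of densities is a density for the product measure. The induction peels off one
  coordinate, and the partial integral \<open>G\<close> is the function to which the induction
  hypothesis is applied.\<close>

lemma nn_integral_PiM_std_normal:
  assumes "finite I" "F \<in> borel_measurable (PiM I (\<lambda>_. lborel))"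
  shows "(\<integral>\<^sup>+x. F x \<partial>PiM I (\<lambda>_. std_normal_distribution)) =
    (\<integral>\<^sup>+x. (\<Prod>i\<in>I. ennreal (std_normal_density (x i))) * F x \<partial>PiM I (\<lambda>_::nat. lborel))"
  using assms
proof (induction I arbitrary: F rule: finite_induct)
  case empty
  show ?case by (simp add: PiM_empty nn_integral_count_space_finite)
next
  case (insert i I)
  note [measurable] = insert.prems
  let ?M = "\<lambda>J. PiM J (\<lambda>_. lborel :: real measure)"
  let ?N = "\<lambda>J. PiM J (\<lambda>_::nat. std_normal_distribution)"
  have setsN: "sets (?N J) = sets (?M J)" for J by (intro sets_PiM_cong) auto
  have upd [measurable]: "(\<lambda>p. (fst p)(i := snd p)) \<in> measurable (?M I \<Otimes>\<^sub>M lborel) (?M (insert i I))"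
    using measurable_add_dim[of i I "\<lambda>_. lborel :: real measure"] by (simp add: case_prod_unfold)
  define G where "G = (\<lambda>x. \<integral>\<^sup>+y. ennreal (std_normal_density y) * F (x(i := y)) \<partial>lborel)"
  have G [measurable]: "G \<in> borel_measurable (?M I)"
    unfolding G_def
  proof (intro lborel.borel_measurable_nn_integral)
    show "(\<lambda>(x, y). ennreal (std_normal_density y) * F (x(i := y))) \<in> borel_measurable (?M I \<Otimes>\<^sub>M lborel)"
      unfolding case_prod_unfold using measurable_compose[OF upd insert.prems] by measurable
  qed
  have "(\<integral>\<^sup>+x. F x \<partial>?N (insert i I)) = (\<integral>\<^sup>+x. \<integral>\<^sup>+y. F (x(i := y)) \<partial>std_normal_distribution \<partial>?N I)"
    by (rule sgd.product_nn_integral_insert) (use insert in \<open>auto simp: measurable_cong_sets[OF setsN refl]\<close>)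
  also have "\<dots> = (\<integral>\<^sup>+x. G x \<partial>?N I)"
  proof (rule nn_integral_cong)
    fix x assume x: "x \<in> space (?N I)"
    hence x: "x \<in> space (?M I)" by (simp add: space_PiM)
    have "(\<lambda>y. F (x(i := y))) \<in> borel_measurable lborel"
      using measurable_compose[OF measurable_Pair1'[OF x, of lborel] measurable_compose[OF upd insert.prems]]
      by (simp only: fst_conv snd_conv)
    thus "(\<integral>\<^sup>+y. F (x(i := y)) \<partial>std_normal_distribution) = G x"
      unfolding G_def by (subst nn_integral_density) auto
  qed
  also have "\<dots> = (\<integral>\<^sup>+x. (\<Prod>i\<in>I. ennreal (std_normal_density (x i))) * G x \<partial>?M I)"
    by (rule insert.IH[OF G])
  also have "\<dots> = (\<integral>\<^sup>+x. \<integral>\<^sup>+y. (\<Prod>j\<in>insert i I. ennreal (std_normal_density ((x(i := y)) j))) * F (x(i := y)) \<partial>lborel \<partial>?M I)"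
  proof (rule nn_integral_cong)
    fix x assume x: "x \<in> space (?M I)"
    have [measurable]: "(\<lambda>y. F (x(i := y))) \<in> borel_measurable lborel"
      using measurable_compose[OF measurable_Pair1'[OF x, of lborel] measurable_compose[OF upd insert.prems]]
      by (simp only: fst_conv snd_conv)
    have "(\<Prod>j\<in>insert i I. ennreal (std_normal_density ((x(i := y)) j))) * F (x(i := y)) =
        (\<Prod>j\<in>I. ennreal (std_normal_density (x j))) * (ennreal (std_normal_density y) * F (x(i := y)))" for y
    proof -
      have "(\<Prod>j\<in>I. ennreal (std_normal_density ((x(i := y)) j))) = (\<Prod>j\<in>I. ennreal (std_normal_density (x j)))"
        using insert.hyps by (intro prod.cong) auto
      thus ?thesis using insert.hyps by (simp add: mult_ac)
    qed
    thus "(\<Prod>i\<in>I. ennreal (std_normal_density (x i))) * G x =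
      (\<integral>\<^sup>+y. (\<Prod>j\<in>insert i I. ennreal (std_normal_density ((x(i := y)) j))) * F (x(i := y)) \<partial>lborel)"
      unfolding G_def by (simp add: nn_integral_cmult)
  qed
  also have "\<dots> = (\<integral>\<^sup>+x. (\<Prod>i\<in>insert i I. ennreal (std_normal_density (x i))) * F x \<partial>?M (insert i I))"
    by (rule lbd.product_nn_integral_insert[symmetric]) (use insert in auto)
  finally show ?case .
qed

definition gauss_const :: "nat \<Rightarrow> real" where "gauss_const d = (1 / sqrt (2 * pi)) ^ d"

lemma gauss_const_pos: "gauss_const d > 0"
  by (simp add: gauss_const_def)

lemma nn_integral_std_gauss:
  assumes "F \<in> borel_measurable (borel_d d)"
  shows "(\<integral>\<^sup>+x. F x \<partial>std_gauss d) =
    (\<integral>\<^sup>+x. ennreal (gauss_const d * exp (- sq_norm d x / 2)) * F x \<partial>lborel_d d)"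
proof -
  have "(\<Prod>i<d. ennreal (std_normal_density (x i))) = ennreal (gauss_const d * exp (- sq_norm d x / 2))" for x :: vecd
  proof -
    have "(\<Prod>i<d. ennreal (std_normal_density (x i))) = ennreal (\<Prod>i<d. std_normal_density (x i))"
      by (rule prod_ennreal) simp
    also have "(\<Prod>i<d. std_normal_density (x i)) = (\<Prod>i<d. 1 / sqrt (2 * pi)) * (\<Prod>i<d. exp (- (x i)\<^sup>2 / 2))"
      unfolding prod.distrib[symmetric] by (rule prod.cong) (auto simp: normal_density_def)
    also have "\<dots> = gauss_const d * exp (- sq_norm d x / 2)"
      by (simp add: gauss_const_def sq_norm_def exp_sum[symmetric] sum_negf sum_divide_distrib)
    finally show ?thesis .
  qed
  thus ?thesis using assms
    by (subst nn_integral_PiM_std_normal) (auto simp: measurable_cong_sets[OF sets_lborel_d refl])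
qed

lemma lborel_d_affine:
  assumes "c \<noteq> 0" "F \<in> borel_measurable (borel_d d)"
  shows "(\<integral>\<^sup>+x. F x \<partial>lborel_d d) =
    ennreal (\<bar>c\<bar> ^ d) * (\<integral>\<^sup>+x. F (restrict (\<lambda>i. a i + c * x i) {..<d}) \<partial>lborel_d d)"
  using assms nn_integral_PiM_lborel_affine[of "{..<d}" c F a]
  by (auto simp: measurable_cong_sets[OF sets_lborel_d refl])

section \<open>The uniform law on the sphere is the law of a normalised Gaussian vector\<close>

text \<open>Division by zero is 0, so a vector of norm zero is sent to the zero vector; this is the
  reason for the case distinction in \<open>sq_norm_sphere_proj\<close>.\<close>

definition sphere_proj :: "nat \<Rightarrow> real \<Rightarrow> vecd \<Rightarrow> vecd" where
  "sphere_proj d r x = restrict (\<lambda>i. r * x i / sqrt (sq_norm d x)) {..<d}"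

lemma nn_integral_exp_Ici:
  "(\<integral>\<^sup>+s. ennreal (exp (- s)) * indicator {t..} s \<partial>lborel) = ennreal (exp (- t :: real))"
proof -
  have "(\<integral>\<^sup>+s. ennreal (exp (- s)) * indicator {t..} s \<partial>lborel) = ennreal (0 - (- exp (- t)))"
  proof (rule nn_integral_FTC_atLeast)
    show "((\<lambda>s::real. - exp (- s)) \<longlongrightarrow> 0) at_top"
      using tendsto_minus[OF filterlim_compose[OF exp_at_bot filterlim_uminus_at_bot_at_top]] by simp
  qed (auto intro!: derivative_eq_intros)
  thus ?thesis by simp
qed

text \<open>For a function that is homogeneous of degree 0, writing \<open>exp (- t)\<close> as the integral of
  \<open>exp (- s)\<close> over \<open>s \<ge> t\<close> decomposes the Gaussian integral into integrals over balls, which are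
  all multiples of the one over the unit ball.\<close>

lemma gaussian_to_ball:
  fixes f :: "vecd \<Rightarrow> ennreal"
  assumes f [measurable]: "f \<in> borel_measurable (borel_d d)"
    and hom: "\<And>c x. c > 0 \<Longrightarrow> f (restrict (\<lambda>i. c * x i) {..<d}) = f x"
  shows "(\<integral>\<^sup>+x. ennreal (exp (- sq_norm d x / 2)) * f x \<partial>lborel_d d) =
    (\<integral>\<^sup>+s. ennreal (exp (- s)) * indicator {0<..} s * ennreal (sqrt (2 * s) ^ d) \<partial>lborel) *
    (\<integral>\<^sup>+x. f x * indicator {x. sq_norm d x \<le> 1} x \<partial>lborel_d d)"
proof -
  interpret L: sigma_finite_measure "lborel_d d" by (rule lbd.sigma_finite) simp
  interpret pair_sigma_finite "lborel_d d" "lborel :: real measure" ..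
  have f' [measurable]: "f \<in> borel_measurable (lborel_d d)"
    using f by (simp add: measurable_cong_sets[OF sets_lborel_d refl])
  have sqn [measurable]: "sq_norm d \<in> borel_measurable (lborel_d d)"
    by (rule measurable_sq_norm) (rule measurable_component_singleton[THEN measurable_compose], auto)
  have sqn' [measurable]: "sq_norm d \<in> borel_measurable (borel_d d)"
    using sqn by (simp add: measurable_cong_sets[OF sets_lborel_d refl])
  define I where "I = (\<integral>\<^sup>+x. f x * indicator {x. sq_norm d x \<le> 1} x \<partial>lborel_d d)"
  have "(\<integral>\<^sup>+x. ennreal (exp (- sq_norm d x / 2)) * f x \<partial>lborel_d d) =
      (\<integral>\<^sup>+x. \<integral>\<^sup>+s. ennreal (exp (- s)) * indicator {sq_norm d x / 2..} s * f x \<partial>lborel \<partial>lborel_d d)"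
    using nn_integral_exp_Ici by (intro nn_integral_cong) (simp add: nn_integral_multc)
  also have "\<dots> = (\<integral>\<^sup>+x. \<integral>\<^sup>+s. ennreal (exp (- s)) * (if sq_norm d x \<le> 2 * s then f x else 0) \<partial>lborel \<partial>lborel_d d)"
    by (intro nn_integral_cong) (auto simp: indicator_def)
  also have "\<dots> = (\<integral>\<^sup>+s. \<integral>\<^sup>+x. ennreal (exp (- s)) * (if sq_norm d x \<le> 2 * s then f x else 0) \<partial>lborel_d d \<partial>lborel)"
    by (rule Fubini'[symmetric]) measurable
  also have "\<dots> = (\<integral>\<^sup>+s. ennreal (exp (- s)) * indicator {0<..} s * ennreal (sqrt (2 * s) ^ d) * I \<partial>lborel)"
  \<comment> \<open>The single point \<open>s = 0\<close> is discarded as a null set, since the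
    dilation by \<open>sqrt (2 * s)\<close> needs a nonzero factor. Negative \<open>s\<close>
    contribute 0 on both sides.\<close>
  proof (rule nn_integral_cong_AE, rule AE_mp[OF AE_lborel_singleton[of 0]], rule AE_I2, rule impI)
    fix s :: real assume s0: "s \<noteq> 0"
    show "(\<integral>\<^sup>+x. ennreal (exp (- s)) * (if sq_norm d x \<le> 2 * s then f x else 0) \<partial>lborel_d d) =
      ennreal (exp (- s)) * indicator {0<..} s * ennreal (sqrt (2 * s) ^ d) * I"
    proof (cases "s > 0")
      case False
      hence "\<not> sq_norm d x \<le> 2 * s" for x using s0 sq_norm_nonneg[of d x] by linarith
      thus ?thesis using False by simp
    next
      case True
      \<comment> \<open>The dilation maps the unit ball onto the ball
        \<open>sq_norm d x \<le> 2 * s\<close>; homogeneity leaves \<open>f\<close> unchanged, so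
        only the Jacobian depends on \<open>s\<close>.\<close>
      have "(\<integral>\<^sup>+x. (if sq_norm d x \<le> 2 * s then f x else 0) \<partial>lborel_d d) =
          ennreal (\<bar>sqrt (2 * s)\<bar> ^ d) * (\<integral>\<^sup>+x. (if sq_norm d (restrict (\<lambda>i. 0 + sqrt (2 * s) * x i) {..<d}) \<le> 2 * s
            then f (restrict (\<lambda>i. 0 + sqrt (2 * s) * x i) {..<d}) else 0) \<partial>lborel_d d)"
        by (rule lborel_d_affine) (use True in \<open>auto, measurable\<close>)
      also have "(\<integral>\<^sup>+x. (if sq_norm d (restrict (\<lambda>i. 0 + sqrt (2 * s) * x i) {..<d}) \<le> 2 * s
            then f (restrict (\<lambda>i. 0 + sqrt (2 * s) * x i) {..<d}) else 0) \<partial>lborel_d d) = I"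
        unfolding I_def
      proof (rule nn_integral_cong)
        fix x
        have "sq_norm d (restrict (\<lambda>i. sqrt (2 * s) * x i) {..<d}) = 2 * s * sq_norm d x"
          using True sq_norm_scale[of d "sqrt (2 * s)" x] by (subst sq_norm_cong[of d _ "\<lambda>i. sqrt (2 * s) * x i"]) auto
        moreover have "2 * s * sq_norm d x \<le> 2 * s \<longleftrightarrow> sq_norm d x \<le> 1" using True by simp
        moreover have "f (restrict (\<lambda>i. sqrt (2 * s) * x i) {..<d}) = f x" using True by (intro hom) simp
        ultimately show "(if sq_norm d (restrict (\<lambda>i. 0 + sqrt (2 * s) * x i) {..<d}) \<le> 2 * s
            then f (restrict (\<lambda>i. 0 + sqrt (2 * s) * x i) {..<d}) else 0) = f x * indicator {x. sq_norm d x \<le> 1} x"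
          by simp
      qed
      finally show ?thesis using True by (simp add: nn_integral_cmult mult.assoc)
    qed
  qed
  also have "\<dots> = (\<integral>\<^sup>+s. ennreal (exp (- s)) * indicator {0<..} s * ennreal (sqrt (2 * s) ^ d) \<partial>lborel) * I"
    by (rule nn_integral_multc) measurable
  finally show ?thesis unfolding I_def .
qed

lemma sphere_proj_scale:
  assumes "c > 0"
  shows "sphere_proj d r (restrict (\<lambda>i. c * x i) {..<d}) = sphere_proj d r x"
proof -
  have "sq_norm d (restrict (\<lambda>i. c * x i) {..<d}) = c\<^sup>2 * sq_norm d x"
    unfolding sq_norm_scale[symmetric] by (rule sq_norm_cong) simp
  thus ?thesis using assms by (auto simp: sphere_proj_def real_sqrt_mult fun_eq_iff restrict_def)
qed

lemma measurable_sphere_proj [measurable]: "sphere_proj d r \<in> measurable (borel_d d) (borel_d d)"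
  unfolding sphere_proj_def
  by (intro measurable_restrict_borel_d borel_measurable_divide borel_measurable_times
      borel_measurable_const measurable_compose[OF _ borel_measurable_sqrt] measurable_sq_norm
      measurable_component_singleton) auto

text \<open>The indicator of a preimage under \<open>sphere_proj\<close> is homogeneous of degree 0,
  so its Gaussian integral is \<kappa> times its integral over the unit ball, with the same \<kappa>
  for every set. The constant function 1 gives \<open>\<kappa> * V = 1\<close>, hence neither the
  volume of the ball nor the radial integral has to be evaluated.\<close>

lemma sphere_unif_eq: "sphere_unif d r = distr (std_gauss d) (borel_d d) (sphere_proj d r)"
proof (rule measure_eqI)
  show "sets (sphere_unif d r) = sets (distr (std_gauss d) (borel_d d) (sphere_proj d r))"
    by (simp add: sphere_unif_def)
next
  fix A assume "A \<in> sets (sphere_unif d r)"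
  hence A [measurable]: "A \<in> sets (borel_d d)" by (simp add: sphere_unif_def)
  have mproj: "sphere_proj d r \<in> measurable (lborel_d d) (borel_d d)"
    by (simp add: measurable_cong_sets[OF sets_lborel_d refl])
  have mproj': "sphere_proj d r \<in> measurable (std_gauss d) (borel_d d)"
    by (simp add: measurable_cong_sets[OF sets_std_gauss refl])
  have sp: "(\<lambda>x. restrict (\<lambda>i. r * x i / sqrt (sq_norm d x)) {..<d}) = sphere_proj d r"
    by (simp add: fun_eq_iff sphere_proj_def)
  define ball where "ball = {x\<in>PiE {..<d} (\<lambda>_. UNIV). sq_norm d x \<le> (1::real)}"
  have sqn [measurable]: "sq_norm d \<in> borel_measurable (lborel_d d)"
    by (rule measurable_sq_norm) (rule measurable_component_singleton[THEN measurable_compose], auto)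
  have ball: "ball = {x\<in>space (lborel_d d). sq_norm d x \<le> 1}" by (simp add: ball_def space_PiM)
  have ballm [measurable]: "ball \<in> sets (lborel_d d)" unfolding ball by measurable
  define f where "f = (\<lambda>x. indicator A (sphere_proj d r x) :: ennreal)"
  have f: "f \<in> borel_measurable (borel_d d)" unfolding f_def by measurable
  define J where "J = (\<integral>\<^sup>+x. f x * indicator {x. sq_norm d x \<le> 1} x \<partial>lborel_d d)"
  define \<kappa> where "\<kappa> = ennreal (gauss_const d) * (\<integral>\<^sup>+s. ennreal (exp (- s)) * indicator {0<..} s * ennreal (sqrt (2 * s) ^ d) \<partial>lborel)"
  define V where "V = (\<integral>\<^sup>+x. indicator {x. sq_norm d x \<le> 1} x \<partial>lborel_d d)"
  have gauss: "(\<integral>\<^sup>+x. g x \<partial>std_gauss d) = \<kappa> * (\<integral>\<^sup>+x. g x * indicator {x. sq_norm d x \<le> 1} x \<partial>lborel_d d)"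
    if g: "g \<in> borel_measurable (borel_d d)" and hom: "\<And>c x. c > 0 \<Longrightarrow> g (restrict (\<lambda>i. c * x i) {..<d}) = g x"
    for g :: "vecd \<Rightarrow> ennreal"
  proof -
    have [measurable]: "g \<in> borel_measurable (lborel_d d)"
      using g by (simp add: measurable_cong_sets[OF sets_lborel_d refl])
    have "(\<integral>\<^sup>+x. g x \<partial>std_gauss d) = (\<integral>\<^sup>+x. ennreal (gauss_const d) * (ennreal (exp (- sq_norm d x / 2)) * g x) \<partial>lborel_d d)"
      using gauss_const_pos[of d] by (simp add: nn_integral_std_gauss[OF g] ennreal_mult mult.assoc)
    also have "\<dots> = ennreal (gauss_const d) * (\<integral>\<^sup>+x. ennreal (exp (- sq_norm d x / 2)) * g x \<partial>lborel_d d)"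
      by (rule nn_integral_cmult) measurable
    also have "\<dots> = \<kappa> * (\<integral>\<^sup>+x. g x * indicator {x. sq_norm d x \<le> 1} x \<partial>lborel_d d)"
      by (subst gaussian_to_ball[OF g], erule hom, simp only: \<kappa>_def mult.assoc)
    finally show ?thesis .
  qed
  have \<kappa>V: "\<kappa> * V = 1"
    using gauss[of "\<lambda>_. 1"] prob_space.emeasure_space_1[OF prob_space_std_gauss[of d]] by (simp add: V_def)
  have Vball: "emeasure (lborel_d d) ball = V"
    unfolding V_def by (subst nn_integral_indicator[OF ballm, symmetric], rule nn_integral_cong)
      (auto simp: ball indicator_def)
  have "emeasure (sphere_unif d r) A =
      emeasure (uniform_measure (lborel_d d) ball) (sphere_proj d r -` A \<inter> space (lborel_d d))"
    unfolding sphere_unif_def ball_def[symmetric] sp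
    by (subst emeasure_distr) (use mproj A in \<open>auto simp: measurable_cong_sets[OF sets_uniform_measure refl]\<close>)
  also have "\<dots> = emeasure (lborel_d d) (ball \<inter> (sphere_proj d r -` A \<inter> space (lborel_d d))) / V"
    by (subst emeasure_uniform_measure) (use measurable_sets[OF mproj A] in \<open>auto simp: Vball\<close>)
  also have "emeasure (lborel_d d) (ball \<inter> (sphere_proj d r -` A \<inter> space (lborel_d d))) = J"
    unfolding J_def f_def
    by (subst nn_integral_indicator[symmetric], (use measurable_sets[OF mproj A] in auto)[1], rule nn_integral_cong)
      (auto simp: ball indicator_def)
  also have "J / V = \<kappa> * J"
  proof -
    \<comment> \<open>Cancelling in the extended reals requires a finite nonzero volume; both follow
      from the product being 1.\<close>
    have "V \<noteq> 0" "V \<noteq> \<top>" using \<kappa>V by (auto simp: ennreal_mult_top split: if_splits) 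
    have "J / V = (\<kappa> * V) * J / V" by (simp add: \<kappa>V)
    also have "\<dots> = \<kappa> * J * (V / V)" by (simp add: divide_ennreal_def mult_ac)
    also have "\<dots> = \<kappa> * J" using \<open>V \<noteq> 0\<close> \<open>V \<noteq> \<top>\<close> by (subst ennreal_divide_self) (auto simp: less_top)
    finally show ?thesis .
  qed
  also have "\<dots> = (\<integral>\<^sup>+x. f x \<partial>std_gauss d)"
    unfolding J_def by (rule gauss[OF f, symmetric]) (simp add: f_def sphere_proj_scale)
  also have "\<dots> = emeasure (distr (std_gauss d) (borel_d d) (sphere_proj d r)) A"
    unfolding f_def by (subst nn_integral_distr[OF mproj', of "indicator A", symmetric]) auto
  finally show "emeasure (sphere_unif d r) A = emeasure (distr (std_gauss d) (borel_d d) (sphere_proj d r)) A" .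
qed

lemma prob_space_sphere_unif: "prob_space (sphere_unif d r)"
  unfolding sphere_unif_eq
  by (rule prob_space.prob_space_distr[OF prob_space_std_gauss])
    (simp add: measurable_cong_sets[OF sets_std_gauss refl])

lemma sets_sphere_unif: "sets (sphere_unif d r) = sets (borel_d d)"
  by (simp add: sphere_unif_def)

section \<open>Quadratic forms of a Gaussian vector\<close>

lemma std_gauss_second_moment:
  assumes "i < d" "j < d"
  shows "integrable (std_gauss d) (\<lambda>g. g i * g j)"
    and "(\<integral>g. g i * g j \<partial>std_gauss d) = (if i = j then 1 else 0)"
proof -
  \<comment> \<open>Factor \<open>k\<close> is \<open>x\<close>, \<open>x * x\<close> or 1, so
    \<open>g i * g j\<close> becomes a product over all coordinates and its expectation factorises,
    whether or not \<open>i = j\<close>.\<close>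
  define f where "f = (\<lambda>k x::real. (if k = i then x else 1) * (if k = j then x else 1))"
  have prod: "(\<Prod>k<d. f k (g k)) = g i * g j" for g :: vecd
    unfolding f_def prod.distrib using assms by simp
  have m1: "integrable std_normal_distribution (\<lambda>x. x)" "(\<integral>x. x \<partial>std_normal_distribution) = 0"
    using integrable_std_normal_moment[of 1] integral_std_normal_moment_odd[of 0]
    by (simp_all add: integrable_density integral_density)
  have m2: "integrable std_normal_distribution (\<lambda>x. x * x)" "(\<integral>x. x * x \<partial>std_normal_distribution) = 1"
    using integrable_std_normal_moment[of 2] integral_std_normal_moment_even[of 1]
    by (simp_all add: integrable_density integral_density power2_eq_square fact_numeral)
  have fk: "f k = (if k = i then if k = j then (\<lambda>x. x * x) else (\<lambda>x. x) else if k = j then (\<lambda>x. x) else (\<lambda>x. 1))" for k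
    by (simp add: f_def fun_eq_iff)
  have one: "integrable std_normal_distribution (\<lambda>x. 1::real)" by (rule sn.integrable_const)
  have int: "integrable std_normal_distribution (f k)" for k
    unfolding fk using m1(1) m2(1) one by (cases "k = i"; cases "k = j") (simp_all only: if_True if_False refl)
  have val: "(\<integral>x. f k x \<partial>std_normal_distribution) = (if k = i \<and> k = j then 1 else if k = i \<or> k = j then 0 else 1)" for k
    unfolding fk using m1(2) m2(2) sn.prob_space
    by (cases "k = i"; cases "k = j") (simp_all only: if_True if_False refl, simp_all)
  show "integrable (std_gauss d) (\<lambda>g. g i * g j)"
    using sgd.product_integrable_prod[of "{..<d}" f] int by (simp add: prod)
  have "(\<integral>g. g i * g j \<partial>std_gauss d) = (\<Prod>k<d. \<integral>x. f k x \<partial>std_normal_distribution)"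
    using sgd.product_integral_prod[of "{..<d}" f] int by (simp add: prod)
  also have "\<dots> = (if i = j then 1 else 0)"
  proof (cases "i = j")
    case True thus ?thesis by (auto simp: val intro!: prod.neutral)
  next
    case False
    hence "(\<integral>x. f i x \<partial>std_normal_distribution) = 0" by (simp add: val)
    hence "(\<Prod>k<d. \<integral>x. f k x \<partial>std_normal_distribution) = 0" using assms by (intro prod_zero) auto
    thus ?thesis using False by simp
  qed
  finally show "(\<integral>g. g i * g j \<partial>std_gauss d) = (if i = j then 1 else 0)" .
qed

text \<open>The tangent line of \<open>exp\<close> at the mean lies below \<open>exp\<close>. Taking
  its positive part permits comparison with a nonnegative integral, so \<open>exp (Y x)\<close> need
  not be integrable.\<close>

lemma jensen_exp_nn:
  assumes "prob_space M" and Y: "integrable M Y"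
  shows "ennreal (exp (\<integral>x. Y x \<partial>M)) \<le> (\<integral>\<^sup>+x. ennreal (exp (Y x)) \<partial>M)"
proof -
  interpret prob_space M by fact
  define m where "m = (\<integral>x. Y x \<partial>M)"
  define l where "l = (\<lambda>x. exp m * (1 + (Y x - m)))"
  have l: "integrable M l" unfolding l_def using Y by auto
  have "(\<integral>x. l x \<partial>M) = exp m" unfolding l_def using Y by (simp add: prob_space m_def)
  hence "ennreal (exp m) = ennreal (\<integral>x. l x \<partial>M)" by simp
  also have "\<dots> \<le> ennreal (\<integral>x. max 0 (l x) \<partial>M)"
    by (intro ennreal_leI integral_mono l integrable_max) auto
  also have "\<dots> = (\<integral>\<^sup>+x. ennreal (max 0 (l x)) \<partial>M)"
    by (rule nn_integral_eq_integral[symmetric]) (use l in auto)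
  also have "\<dots> \<le> (\<integral>\<^sup>+x. ennreal (exp (Y x)) \<partial>M)"
  proof (intro nn_integral_mono ennreal_leI)
    fix x
    have "l x \<le> exp m * exp (Y x - m)" unfolding l_def by (intro mult_left_mono) (auto simp: add.commute)
    thus "max 0 (l x) \<le> exp (Y x)" by (simp add: exp_add[symmetric])
  qed
  finally show ?thesis by (simp add: m_def)
qed

text \<open>Rotation by 45 degrees in each of the planes spanned by the coordinates \<open>g i\<close>, \<open>h i\<close>,
  performed as two successive affine substitutions.\<close>

lemma lborel_d_rotation:
  fixes H :: "vecd \<times> vecd \<Rightarrow> ennreal"
  assumes H: "H \<in> borel_measurable (borel_d d \<Otimes>\<^sub>M borel_d d)"
  shows "(\<integral>\<^sup>+g. \<integral>\<^sup>+h. H (restrict (\<lambda>i. (h i - g i) / sqrt 2) {..<d}, restrict (\<lambda>i. (h i + g i) / sqrt 2) {..<d}) \<partial>lborel_d d \<partial>lborel_d d) =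
    (\<integral>\<^sup>+v. \<integral>\<^sup>+u. H (u, v) \<partial>lborel_d d \<partial>lborel_d d)"
proof -
  interpret L: sigma_finite_measure "lborel_d d" by (rule lbd.sigma_finite) simp
  interpret pair_sigma_finite "lborel_d d" "lborel_d d" ..
  let ?r = "\<lambda>x::vecd. restrict x {..<d}"
  have abs2: "\<bar>sqrt 2 :: real\<bar> = sqrt 2" by simp
  have s2: "sets (lborel_d d \<Otimes>\<^sub>M lborel_d d) = sets (borel_d d \<Otimes>\<^sub>M borel_d d)"
    by (intro sets_pair_measure_cong sets_lborel_d)
  have nth: "i < d \<Longrightarrow> (\<lambda>x. x i) \<in> borel_measurable (borel_d d)" for i
    by (rule measurable_component_singleton) auto
  have cH: "(\<lambda>w. H (?r (f w), ?r (g w))) \<in> borel_measurable M"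
    if "\<And>i. i < d \<Longrightarrow> (\<lambda>w. f w i) \<in> borel_measurable M" "\<And>i. i < d \<Longrightarrow> (\<lambda>w. g w i) \<in> borel_measurable M"
    for f g :: "'z \<Rightarrow> vecd" and M
    by (rule measurable_compose[OF measurable_Pair H]) (intro measurable_restrict_borel_d that; assumption)+
  have cH': "(\<lambda>w. H (?r (f w), g w)) \<in> borel_measurable M"
    if "\<And>i. i < d \<Longrightarrow> (\<lambda>w. f w i) \<in> borel_measurable M" "g \<in> measurable M (borel_d d)"
    for f g :: "'z \<Rightarrow> vecd" and M
    by (rule measurable_compose[OF measurable_Pair H], intro measurable_restrict_borel_d that, assumption, rule that)
  \<comment> \<open>First shear, for fixed \<open>g\<close>: \<open>h = - g + sqrt 2 v\<close>. The
    second argument becomes \<open>v\<close>, the first one \<open>v - sqrt 2 g\<close>.\<close>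
  have "(\<integral>\<^sup>+g. \<integral>\<^sup>+h. H (?r (\<lambda>i. (h i - g i) / sqrt 2), ?r (\<lambda>i. (h i + g i) / sqrt 2)) \<partial>lborel_d d \<partial>lborel_d d) =
      (\<integral>\<^sup>+g. ennreal (sqrt 2 ^ d) * (\<integral>\<^sup>+v. H (?r (\<lambda>i. v i - sqrt 2 * g i), v) \<partial>lborel_d d) \<partial>lborel_d d)"
  proof (rule nn_integral_cong)
    fix g
    have "(\<integral>\<^sup>+h. H (?r (\<lambda>i. (h i - g i) / sqrt 2), ?r (\<lambda>i. (h i + g i) / sqrt 2)) \<partial>lborel_d d) =
      ennreal (\<bar>sqrt 2\<bar> ^ d) * (\<integral>\<^sup>+v. H (?r (\<lambda>i. (?r (\<lambda>i. - g i + sqrt 2 * v i) i - g i) / sqrt 2),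
          ?r (\<lambda>i. (?r (\<lambda>i. - g i + sqrt 2 * v i) i + g i) / sqrt 2)) \<partial>lborel_d d)"
      by (rule lborel_d_affine)
        (auto intro!: cH borel_measurable_divide borel_measurable_diff borel_measurable_add nth)
    also have "(\<integral>\<^sup>+v. H (?r (\<lambda>i. (?r (\<lambda>i. - g i + sqrt 2 * v i) i - g i) / sqrt 2),
          ?r (\<lambda>i. (?r (\<lambda>i. - g i + sqrt 2 * v i) i + g i) / sqrt 2)) \<partial>lborel_d d) =
        (\<integral>\<^sup>+v. H (?r (\<lambda>i. v i - sqrt 2 * g i), v) \<partial>lborel_d d)"
    proof (rule nn_integral_cong)
      fix v assume v: "v \<in> space (lborel_d d)"
      have "?r (\<lambda>i. (?r (\<lambda>i. - g i + sqrt 2 * v i) i - g i) / sqrt 2) = ?r (\<lambda>i. v i - sqrt 2 * g i)"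
        by (rule restrict_ext) (simp add: field_simps)
      moreover have "?r (\<lambda>i. (?r (\<lambda>i. - g i + sqrt 2 * v i) i + g i) / sqrt 2) = v"
        using v by (auto simp: fun_eq_iff space_PiM PiE_def extensional_def)
      ultimately show "H (?r (\<lambda>i. (?r (\<lambda>i. - g i + sqrt 2 * v i) i - g i) / sqrt 2),
          ?r (\<lambda>i. (?r (\<lambda>i. - g i + sqrt 2 * v i) i + g i) / sqrt 2)) = H (?r (\<lambda>i. v i - sqrt 2 * g i), v)" by simp
    qed
    finally show "(\<integral>\<^sup>+h. H (?r (\<lambda>i. (h i - g i) / sqrt 2), ?r (\<lambda>i. (h i + g i) / sqrt 2)) \<partial>lborel_d d) =
       ennreal (sqrt 2 ^ d) * (\<integral>\<^sup>+v. H (?r (\<lambda>i. v i - sqrt 2 * g i), v) \<partial>lborel_d d)" unfolding abs2 .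
  qed
  also have "\<dots> = (\<integral>\<^sup>+g. \<integral>\<^sup>+v. ennreal (sqrt 2 ^ d) * H (?r (\<lambda>i. v i - sqrt 2 * g i), v) \<partial>lborel_d d \<partial>lborel_d d)"
  proof (intro nn_integral_cong nn_integral_cmult[symmetric])
    fix g
    show "(\<lambda>v. H (?r (\<lambda>i. v i - sqrt 2 * g i), v)) \<in> borel_measurable (lborel_d d)"
      unfolding measurable_cong_sets[OF sets_lborel_d refl]
      by (intro cH' borel_measurable_diff nth) auto
  qed
  also have "\<dots> = (\<integral>\<^sup>+v. \<integral>\<^sup>+g. ennreal (sqrt 2 ^ d) * H (?r (\<lambda>i. v i - sqrt 2 * g i), v) \<partial>lborel_d d \<partial>lborel_d d)"
  proof (rule Fubini'[symmetric])
    show "(\<lambda>(g, v). ennreal (sqrt 2 ^ d) * H (?r (\<lambda>i. v i - sqrt 2 * g i), v)) \<in> borel_measurable (lborel_d d \<Otimes>\<^sub>M lborel_d d)"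
      unfolding measurable_cong_sets[OF s2 refl] case_prod_unfold
      by (intro borel_measurable_times_ennreal borel_measurable_const cH' borel_measurable_diff borel_measurable_times
          measurable_pair_nth measurable_snd) auto
  qed
  \<comment> \<open>Second shear, for fixed \<open>v\<close>: \<open>u = v - sqrt 2 g\<close>. Its
    Jacobian is the factor left by the first one, so nothing remains.\<close>
  also have "\<dots> = (\<integral>\<^sup>+v. \<integral>\<^sup>+u. H (u, v) \<partial>lborel_d d \<partial>lborel_d d)"
  proof (rule nn_integral_cong)
    fix v assume "v \<in> space (lborel_d d)"
    hence v: "v \<in> space (borel_d d)" by (simp add: space_PiM)
    have Hv: "(\<lambda>u. H (u, v)) \<in> borel_measurable (borel_d d)"
      by (rule measurable_compose[OF measurable_Pair2'[OF v] H])
    have "(\<integral>\<^sup>+u. H (u, v) \<partial>lborel_d d) =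
        ennreal (\<bar>- sqrt 2\<bar> ^ d) * (\<integral>\<^sup>+g. H (?r (\<lambda>i. v i + (- sqrt 2) * g i), v) \<partial>lborel_d d)"
      by (rule lborel_d_affine[OF _ Hv]) simp
    also have "\<dots> = (\<integral>\<^sup>+g. ennreal (sqrt 2 ^ d) * H (?r (\<lambda>i. v i - sqrt 2 * g i), v) \<partial>lborel_d d)"
    proof -
      have "(\<lambda>g. H (?r (\<lambda>i. v i - sqrt 2 * g i), v)) \<in> borel_measurable (lborel_d d)"
        unfolding measurable_cong_sets[OF sets_lborel_d refl] using v
        by (intro cH' borel_measurable_diff borel_measurable_times nth) auto
      thus ?thesis by (simp add: nn_integral_cmult)
    qed
    finally show "(\<integral>\<^sup>+g. ennreal (sqrt 2 ^ d) * H (?r (\<lambda>i. v i - sqrt 2 * g i), v) \<partial>lborel_d d) = (\<integral>\<^sup>+u. H (u, v) \<partial>lborel_d d)" ..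
  qed
  finally show ?thesis .
qed

text \<open>Symmetrising keeps the trace and the quadratic form of a matrix and does not increase
  its Frobenius norm. Symmetry is needed below so that the cross terms of the rotated form
  cancel.\<close>

lemma frob_sq_symmetrize: "frob_sq d (\<lambda>i j. (A i j + A j i) / 2) \<le> frob_sq d A"
proof -
  have "frob_sq d (\<lambda>i j. (A i j + A j i) / 2) \<le> (\<Sum>i<d. \<Sum>j<d. (A i j)\<^sup>2 / 2 + (A j i)\<^sup>2 / 2)"
    unfolding frob_sq_def
  proof (intro sum_mono)
    fix i j
    have "0 \<le> (A i j - A j i)\<^sup>2" by simp
    thus "((A i j + A j i) / 2)\<^sup>2 \<le> (A i j)\<^sup>2 / 2 + (A j i)\<^sup>2 / 2"
      by (simp add: power2_eq_square field_simps)
  qed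
  also have "\<dots> = frob_sq d A / 2 + frob_sq d (\<lambda>i j. A j i) / 2"
    by (simp add: frob_sq_def sum.distrib sum_divide_distrib)
  finally show ?thesis using frob_sq_transpose[of d A] by simp
qed

text \<open>Jensen's inequality replaces the trace by the quadratic form of an independent copy \<open>h\<close>, and
  the rotation turns the difference of the two quadratic forms into a decoupled bilinear form.\<close>

lemma std_gauss_quadratic_mgf:
  assumes fr: "frob_sq d W \<le> 1/4"
  shows "(\<integral>\<^sup>+g. ennreal (exp ((trace_d d W - inner_d d g (mat_vec d W g)) / 2)) \<partial>std_gauss d) \<le> 2"
proof -
  interpret G: prob_space "std_gauss d" by (rule prob_space_std_gauss)
  interpret GG: pair_sigma_finite "std_gauss d" "std_gauss d" ..
  define W' where "W' = (\<lambda>i j. (W i j + W j i) / 2)"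
  have sym: "symmetric_d d W'" by (simp add: symmetric_d_def W'_def)
  have fr': "frob_sq d W' \<le> 1/4" using frob_sq_symmetrize[of d W] fr by (simp add: W'_def)
  have tr: "trace_d d W' = trace_d d W" by (simp add: W'_def trace_d_def)
  define q where "q = (\<lambda>x y. inner_d d x (mat_vec d W' y))"
  have quad: "inner_d d g (mat_vec d W g) = q g g" for g
  proof -
    have "q g g = (inner_d d g (mat_vec d W g) + inner_d d g (mat_vec d (\<lambda>i j. W j i) g)) / 2"
      unfolding q_def bilinear_d W'_def
      by (simp add: sum.distrib sum_divide_distrib add_divide_distrib algebra_simps)
    thus ?thesis using bilinear_transpose[of d g W g] by simp
  qed
  have qsym: "q x y = q y x" for x y
    using bilinear_symmetric[OF sym, of x y] by (simp add: q_def inner_d_commute)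
  have nth: "i < d \<Longrightarrow> (\<lambda>x. x i) \<in> borel_measurable (borel_d d)" for i
    by (rule measurable_component_singleton) auto
  have qm [measurable]: "(\<lambda>x. q x x) \<in> borel_measurable (borel_d d)"
    unfolding q_def by (intro measurable_inner_d measurable_mat_vec nth)
  have qm' [measurable]: "(\<lambda>x. q x x) \<in> borel_measurable (std_gauss d)"
    using qm by (simp only: measurable_cong_sets[OF sets_std_gauss refl])
  have qm2 [measurable]: "(\<lambda>z. q (fst z) (snd z)) \<in> borel_measurable (borel_d d \<Otimes>\<^sub>M borel_d d)"
    unfolding q_def by (intro measurable_inner_d measurable_mat_vec measurable_pair_nth) auto
  have sq1 [measurable]: "sq_norm d \<in> borel_measurable (borel_d d)"
    by (intro measurable_sq_norm nth)
  have jensen: "ennreal (exp (trace_d d W / 2)) \<le> (\<integral>\<^sup>+h. ennreal (exp (q h h / 2)) \<partial>std_gauss d)"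
  proof -
    have qeq: "(\<lambda>h. q h h / 2) = (\<lambda>h. \<Sum>i<d. \<Sum>j<d. (W' i j / 2) * (h i * h j))"
      by (rule ext) (simp add: q_def bilinear_d sum_divide_distrib mult_ac)
    have int: "integrable (std_gauss d) (\<lambda>h. q h h / 2)"
      unfolding qeq by (intro Bochner_Integration.integrable_sum integrable_mult_right std_gauss_second_moment) auto
    have "(\<integral>h. q h h / 2 \<partial>std_gauss d) = (\<Sum>i<d. \<Sum>j<d. (W' i j / 2) * (if i = j then 1 else 0))"
      unfolding qeq
      by (subst Bochner_Integration.integral_sum, fastforce intro!: Bochner_Integration.integrable_sum integrable_mult_right std_gauss_second_moment,
          rule sum.cong, rule refl,
          subst Bochner_Integration.integral_sum, fastforce intro!: integrable_mult_right std_gauss_second_moment,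
          rule sum.cong, rule refl) (simp add: std_gauss_second_moment)
    also have "\<dots> = trace_d d W / 2"
      unfolding tr[symmetric]
      by (simp add: trace_d_def sum_divide_distrib if_distrib[of "\<lambda>c. _ * c"] cong: if_cong)
    finally have "(\<integral>h. q h h / 2 \<partial>std_gauss d) = trace_d d W / 2" .
    thus ?thesis using jensen_exp_nn[OF prob_space_std_gauss int] by simp
  qed
  define E where "E = (\<lambda>x. gauss_const d * exp (- sq_norm d x / 2))"
  have Em [measurable]: "E \<in> borel_measurable (borel_d d)" unfolding E_def by measurable
  define H where "H = (\<lambda>z. ennreal (E (snd z)) * (ennreal (E (fst z)) * ennreal (exp (q (fst z) (snd z)))))"
  have H: "H \<in> borel_measurable (borel_d d \<Otimes>\<^sub>M borel_d d)" unfolding H_def by measurable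
  have "(\<integral>\<^sup>+g. ennreal (exp ((trace_d d W - inner_d d g (mat_vec d W g)) / 2)) \<partial>std_gauss d) =
      (\<integral>\<^sup>+g. ennreal (exp (trace_d d W / 2)) * ennreal (exp (- q g g / 2)) \<partial>std_gauss d)"
    unfolding quad by (simp add: ennreal_mult''[symmetric] exp_add[symmetric] diff_divide_distrib)
  also have "\<dots> \<le> (\<integral>\<^sup>+g. (\<integral>\<^sup>+h. ennreal (exp (q h h / 2)) \<partial>std_gauss d) * ennreal (exp (- q g g / 2)) \<partial>std_gauss d)"
    by (intro nn_integral_mono mult_right_mono jensen) simp
  also have "\<dots> = (\<integral>\<^sup>+g. (\<integral>\<^sup>+h. ennreal (exp (q h h / 2)) * ennreal (exp (- q g g / 2)) \<partial>std_gauss d) \<partial>std_gauss d)"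
    by (simp add: nn_integral_multc)
  also have "\<dots> = (\<integral>\<^sup>+g. (\<integral>\<^sup>+h. ennreal (E g) * (ennreal (E h) * (ennreal (exp (q h h / 2)) * ennreal (exp (- q g g / 2)))) \<partial>lborel_d d) \<partial>lborel_d d)"
  proof -
    have "(\<integral>\<^sup>+h. ennreal (exp (q h h / 2)) * ennreal (exp (- q g g / 2)) \<partial>std_gauss d) =
        (\<integral>\<^sup>+h. ennreal (E h) * (ennreal (exp (q h h / 2)) * ennreal (exp (- q g g / 2))) \<partial>lborel_d d)" for g
      unfolding E_def by (rule nn_integral_std_gauss) measurable
    moreover have "(\<integral>\<^sup>+g. (\<integral>\<^sup>+h. ennreal (E h) * (ennreal (exp (q h h / 2)) * ennreal (exp (- q g g / 2))) \<partial>lborel_d d) \<partial>std_gauss d) =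
        (\<integral>\<^sup>+g. ennreal (E g) * (\<integral>\<^sup>+h. ennreal (E h) * (ennreal (exp (q h h / 2)) * ennreal (exp (- q g g / 2))) \<partial>lborel_d d) \<partial>lborel_d d)"
    proof -
      interpret L: sigma_finite_measure "lborel_d d" by (rule lbd.sigma_finite) simp
      have a: "sets (borel_d d \<Otimes>\<^sub>M lborel_d d) = sets (borel_d d \<Otimes>\<^sub>M borel_d d)"
        by (intro sets_pair_measure_cong sets_lborel_d refl)
      have "(\<lambda>(g, h). ennreal (E h) * (ennreal (exp (q h h / 2)) * ennreal (exp (- q g g / 2))))
          \<in> borel_measurable (borel_d d \<Otimes>\<^sub>M lborel_d d)"
        unfolding measurable_cong_sets[OF a refl] by measurable
      thus ?thesis unfolding E_def by (intro nn_integral_std_gauss L.borel_measurable_nn_integral)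
    qed
    moreover have "ennreal (E g) * (\<integral>\<^sup>+h. ennreal (E h) * (ennreal (exp (q h h / 2)) * ennreal (exp (- q g g / 2))) \<partial>lborel_d d) =
        (\<integral>\<^sup>+h. ennreal (E g) * (ennreal (E h) * (ennreal (exp (q h h / 2)) * ennreal (exp (- q g g / 2)))) \<partial>lborel_d d)" for g
      by (rule nn_integral_cmult[symmetric]) (simp only: measurable_cong_sets[OF sets_lborel_d refl], measurable)
    ultimately show ?thesis by simp
  qed
  \<comment> \<open>With \<open>u = (h - g) / sqrt 2\<close> and \<open>v = (h + g) / sqrt 2\<close>
    the product of the Gaussian densities is unchanged, and
    \<open>q u v = (q h h - q g g) / 2\<close> because \<open>q h g = q g h\<close>.\<close>
  also have "\<dots> = (\<integral>\<^sup>+g. (\<integral>\<^sup>+h. H (restrict (\<lambda>i. (h i - g i) / sqrt 2) {..<d}, restrict (\<lambda>i. (h i + g i) / sqrt 2) {..<d}) \<partial>lborel_d d) \<partial>lborel_d d)"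
  proof (intro nn_integral_cong)
    fix g h :: vecd
    let ?u = "restrict (\<lambda>i. (h i - g i) / sqrt 2) {..<d}" and ?v = "restrict (\<lambda>i. (h i + g i) / sqrt 2) {..<d}"
    have "sq_norm d ?u + sq_norm d ?v = sq_norm d g + sq_norm d h"
      unfolding sq_norm_def sum.distrib[symmetric]
      by (rule sum.cong) (auto simp: power2_eq_square field_simps)
    hence EE: "E ?v * E ?u = E g * E h"
      unfolding E_def by (simp add: mult_ac exp_add[symmetric] add_divide_distrib[symmetric] minus_add_distrib[symmetric] del: minus_add_distrib)
    have "q ?u ?v = (\<Sum>i<d. \<Sum>j<d. (h i * W' i j * h j + h i * W' i j * g j - g i * W' i j * h j - g i * W' i j * g j) / 2)"
      unfolding q_def bilinear_d by (intro sum.cong refl) (simp add: field_simps)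
    also have "\<dots> = (q h h + q h g - q g h - q g g) / 2"
      unfolding q_def bilinear_d by (simp add: sum.distrib sum_subtractf sum_divide_distrib[symmetric])
    also have "\<dots> = q h h / 2 + (- q g g / 2)" using qsym[of h g] by (simp add: field_simps)
    finally have "exp (q ?u ?v) = exp (q h h / 2) * exp (- q g g / 2)" by (simp only: exp_add)
    moreover have "E x \<ge> 0" for x using gauss_const_pos[of d] by (simp add: E_def)
    ultimately show "ennreal (E g) * (ennreal (E h) * (ennreal (exp (q h h / 2)) * ennreal (exp (- q g g / 2)))) = H (?u, ?v)"
      unfolding H_def fst_conv snd_conv using EE
      by (simp add: ennreal_mult''[symmetric] mult.assoc[symmetric])
  qed
  also have "\<dots> = (\<integral>\<^sup>+v. \<integral>\<^sup>+u. H (u, v) \<partial>lborel_d d \<partial>lborel_d d)" by (rule lborel_d_rotation[OF H])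
  also have "\<dots> = (\<integral>\<^sup>+v. \<integral>\<^sup>+u. ennreal (exp (q u v)) \<partial>std_gauss d \<partial>std_gauss d)"
  proof -
    have inner: "(\<integral>\<^sup>+u. ennreal (exp (q u v)) \<partial>std_gauss d) = (\<integral>\<^sup>+u. ennreal (E u) * ennreal (exp (q u v)) \<partial>lborel_d d)"
      if "v \<in> space (borel_d d)" for v
      unfolding E_def by (rule nn_integral_std_gauss)
        (use measurable_compose[OF measurable_Pair2'[OF that] qm2] in simp)
    have "(\<integral>\<^sup>+v. \<integral>\<^sup>+u. ennreal (exp (q u v)) \<partial>std_gauss d \<partial>std_gauss d) =
        (\<integral>\<^sup>+v. ennreal (E v) * (\<integral>\<^sup>+u. ennreal (exp (q u v)) \<partial>std_gauss d) \<partial>lborel_d d)"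
    proof -
      have a: "sets (borel_d d \<Otimes>\<^sub>M std_gauss d) = sets (borel_d d \<Otimes>\<^sub>M borel_d d)"
        by (intro sets_pair_measure_cong sets_std_gauss refl)
      have "(\<lambda>(v, u). ennreal (exp (q u v))) \<in> borel_measurable (borel_d d \<Otimes>\<^sub>M std_gauss d)"
        unfolding measurable_cong_sets[OF a refl] q_def case_prod_unfold
        by (intro measurable_compose[OF _ measurable_ennreal] borel_measurable_exp[THEN measurable_compose[rotated]]
            measurable_inner_d measurable_mat_vec measurable_pair_nth) auto
      thus ?thesis unfolding E_def by (intro nn_integral_std_gauss G.borel_measurable_nn_integral)
    qed
    also have "\<dots> = (\<integral>\<^sup>+v. \<integral>\<^sup>+u. H (u, v) \<partial>lborel_d d \<partial>lborel_d d)"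
    proof (rule nn_integral_cong)
      fix v assume "v \<in> space (lborel_d d)"
      hence v: "v \<in> space (borel_d d)" by (simp add: space_PiM)
      have m: "(\<lambda>u. ennreal (E u) * ennreal (exp (q u v))) \<in> borel_measurable (lborel_d d)"
        unfolding measurable_cong_sets[OF sets_lborel_d refl]
        using measurable_compose[OF measurable_Pair2'[OF v] qm2] by simp
      show "ennreal (E v) * (\<integral>\<^sup>+u. ennreal (exp (q u v)) \<partial>std_gauss d) = (\<integral>\<^sup>+u. H (u, v) \<partial>lborel_d d)"
        unfolding inner[OF v] H_def fst_conv snd_conv by (rule nn_integral_cmult[OF m, symmetric])
    qed
    finally show ?thesis ..
  qed
  also have "\<dots> = (\<integral>\<^sup>+z. ennreal (exp (inner_d d (fst z) (mat_vec d W' (snd z)))) \<partial>(std_gauss d \<Otimes>\<^sub>M std_gauss d))"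
  proof -
    have "(\<lambda>z. ennreal (exp (inner_d d (fst z) (mat_vec d W' (snd z))))) \<in> borel_measurable (std_gauss d \<Otimes>\<^sub>M std_gauss d)"
      using qm2 unfolding measurable_cong_sets[OF sets_pair_measure_cong[OF sets_std_gauss sets_std_gauss] refl] q_def
      by simp
    thus ?thesis by (subst GG.nn_integral_snd[symmetric]) (auto simp: q_def)
  qed
  also have "\<dots> \<le> 2"
  proof (rule decoupled_mgf[OF subgauss_std_gauss prob_space_std_gauss sets_std_gauss])
    have "symmetric_d d id_mat" by (simp add: symmetric_d_def id_mat_def)
    moreover have "frob_sq d (mat_mult_d d (mat_mult_d d id_mat W') id_mat) = frob_sq d W'"
      by (rule frob_sq_cong) (simp add: mat_mult_id_right mat_mult_id)
    ultimately show "(\<integral>\<^sup>+w. ennreal (exp (sq_norm d (mat_vec d (mat_mult_d d id_mat W') w) / 2)) \<partial>std_gauss d) \<le> 2"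
      using fr' by (intro subgauss_exp_sq_norm[OF subgauss_std_gauss]) auto
  qed
  finally show ?thesis .
qed

lemma std_gauss_quadratic_tail:
  assumes "frob_sq d W \<le> 1/4"
  shows "emeasure (std_gauss d) {g\<in>space (std_gauss d). trace_d d W - inner_d d g (mat_vec d W g) > 2 * t} \<le> ennreal (2 * exp (- t))"
proof -
  have "(\<lambda>g. (trace_d d W - inner_d d g (mat_vec d W g)) / 2) \<in> borel_measurable (borel_d d)"
    by (intro borel_measurable_divide borel_measurable_diff borel_measurable_const measurable_inner_d
        measurable_mat_vec measurable_component_singleton) auto
  hence m: "(\<lambda>g. (trace_d d W - inner_d d g (mat_vec d W g)) / 2) \<in> borel_measurable (std_gauss d)"
    by (simp only: measurable_cong_sets[OF sets_std_gauss refl])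
  have "{g\<in>space (std_gauss d). trace_d d W - inner_d d g (mat_vec d W g) > 2 * t} =
      {g\<in>space (std_gauss d). (trace_d d W - inner_d d g (mat_vec d W g)) / 2 > t}" by auto
  thus ?thesis using markov_exp_tail[OF m std_gauss_quadratic_mgf[OF assms], of t] by simp
qed

text \<open>Quadratic tails for plus and minus \<open>l\<close> times the identity, where
  \<open>l = 1 / (2 sqrt d)\<close> makes the squared Frobenius norm exactly 1/4. The rate
  \<open>sqrt d\<close> instead of \<open>d\<close> comes from normalising by the Frobenius norm,
  and suffices because the theorem itself contains a term of that rate.\<close>

lemma std_gauss_norm_tails:
  shows "emeasure (std_gauss d) {g\<in>space (std_gauss d). sq_norm d g < real d / 2} \<le> ennreal (2 * exp (- sqrt (real d) / 8))"
    and "emeasure (std_gauss d) {g\<in>space (std_gauss d). sq_norm d g > 2 * real d} \<le> ennreal (2 * exp (- sqrt (real d) / 8))"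
proof -
  define l where "l = 1 / (2 * sqrt (real d))"
  have quad: "inner_d d g (mat_vec d (\<lambda>i j. c * id_mat i j) g) = c * sq_norm d g" for g c
  proof -
    have "inner_d d g (mat_vec d (\<lambda>i j. c * id_mat i j) g) = c * inner_d d g (mat_vec d id_mat g)"
      by (simp add: bilinear_d sum_distrib_left mult_ac)
    thus ?thesis by (simp add: inner_mat_vec_id inner_d_self)
  qed
  have fr: "frob_sq d (\<lambda>i j. c * id_mat i j) = c\<^sup>2 * real d" for c
    unfolding frob_sq_scale by (simp add: frob_sq_def id_mat_def if_distrib[of "\<lambda>x. x\<^sup>2"] cong: if_cong)
  have tr: "trace_d d (\<lambda>i j. c * id_mat i j) = c * real d" for c
    by (simp add: trace_d_def id_mat_def)
  show "emeasure (std_gauss d) {g\<in>space (std_gauss d). sq_norm d g < real d / 2} \<le> ennreal (2 * exp (- sqrt (real d) / 8))"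
  proof (cases "d = 0")
    case False
    have l2: "l\<^sup>2 * real d = 1/4" "l * real d = sqrt (real d) / 2" and l0: "l > 0"
      using False by (auto simp: l_def power_divide power_mult_distrib real_div_sqrt field_simps)
    have "{g\<in>space (std_gauss d). sq_norm d g < real d / 2} =
        {g\<in>space (std_gauss d). l * real d - l * sq_norm d g > 2 * (sqrt (real d) / 8)}"
    proof -
      have "sq_norm d g < real d / 2 \<longleftrightarrow> l * real d - l * sq_norm d g > 2 * (sqrt (real d) / 8)" for g
      proof -
        have "sq_norm d g < real d / 2 \<longleftrightarrow> l * sq_norm d g < l * (real d / 2)" using l0 by simp
        thus ?thesis using l2(2) by (auto simp: algebra_simps)
      qed
      thus ?thesis by simp
    qed
    thus ?thesis using std_gauss_quadratic_tail[of d "\<lambda>i j. l * id_mat i j" "sqrt (real d) / 8"]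
      by (simp add: quad fr tr l2)
  qed (simp add: sq_norm_def)
  show "emeasure (std_gauss d) {g\<in>space (std_gauss d). sq_norm d g > 2 * real d} \<le> ennreal (2 * exp (- sqrt (real d) / 8))"
  proof (cases "d = 0")
    case False
    have l2: "l\<^sup>2 * real d = 1/4" "l * real d = sqrt (real d) / 2" and l0: "l > 0"
      using False by (auto simp: l_def power_divide power_mult_distrib real_div_sqrt field_simps)
    have "{g\<in>space (std_gauss d). sq_norm d g > 2 * real d} =
        {g\<in>space (std_gauss d). (-l) * real d - (-l) * sq_norm d g > 2 * (sqrt (real d) / 4)}"
    proof -
      have "sq_norm d g > 2 * real d \<longleftrightarrow> (-l) * real d - (-l) * sq_norm d g > 2 * (sqrt (real d) / 4)" for g
      proof -
        have "sq_norm d g > 2 * real d \<longleftrightarrow> l * sq_norm d g > l * (2 * real d)" using l0 by simp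
        thus ?thesis using l2(2) by (auto simp: algebra_simps)
      qed
      thus ?thesis by simp
    qed
    hence "emeasure (std_gauss d) {g\<in>space (std_gauss d). sq_norm d g > 2 * real d} \<le> ennreal (2 * exp (- (sqrt (real d) / 4)))"
      using std_gauss_quadratic_tail[of d "\<lambda>i j. (-l) * id_mat i j" "sqrt (real d) / 4"]
      by (simp only: quad fr tr power2_minus l2(1))
    also have "\<dots> \<le> ennreal (2 * exp (- sqrt (real d) / 8))" by (intro ennreal_leI) simp
    finally show ?thesis .
  qed (simp add: sq_norm_def)
qed

text \<open>On the sphere the vector is \<open>r g / |g|\<close>. Where
  \<open>|g|^2 \<ge> d / 2\<close>, the normalisation costs at most the factor
  \<open>sqrt 2 * r / sqrt d\<close>, and the Gaussian bilinear tail applies; the remaining event is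
  the lower norm tail.\<close>

lemma sphere_linear_tail:
  assumes d: "d \<ge> 1" and r: "r > 0" and Q: "prob_space Q" "sets Q = sets (borel_d d)"
    and sq: "(\<integral>\<^sup>+w. ennreal (exp (sq_norm d (mat_vec d A w) / 2)) \<partial>Q) \<le> 2"
  shows "emeasure (sphere_unif d r \<Otimes>\<^sub>M Q) {z\<in>space (sphere_unif d r \<Otimes>\<^sub>M Q).
      \<bar>inner_d d (fst z) (mat_vec d A (snd z))\<bar> > t * (sqrt 2 * r / sqrt (real d))}
    \<le> ennreal (4 * exp (- t) + 2 * exp (- sqrt (real d) / 8))"
proof -
  interpret G: prob_space "std_gauss d" by (rule prob_space_std_gauss)
  interpret Q: prob_space Q by (rule Q)
  interpret GQ: pair_prob_space "std_gauss d" Q ..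
  note Q2 = Q(2)
  have mp: "sphere_proj d r \<in> measurable (std_gauss d) (borel_d d)"
    by (simp add: measurable_cong_sets[OF sets_std_gauss refl])
  have pair: "sphere_unif d r \<Otimes>\<^sub>M Q = distr (std_gauss d \<Otimes>\<^sub>M Q) (borel_d d \<Otimes>\<^sub>M Q) (\<lambda>(g, w). (sphere_proj d r g, w))"
    using pair_measure_distr[OF mp, of "\<lambda>w. w" Q Q] Q.sigma_finite_measure_axioms
    unfolding sphere_unif_eq by (simp add: distr_id2)
  define X where "X = (\<lambda>z. \<bar>inner_d d (fst z) (mat_vec d A (snd z))\<bar>)"
  have X [measurable]: "X \<in> borel_measurable (borel_d d \<Otimes>\<^sub>M Q)"
    unfolding X_def by (intro borel_measurable_abs measurable_inner_d measurable_mat_vec measurable_pair_nth[OF refl Q2])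
  have X' [measurable]: "X \<in> borel_measurable (std_gauss d \<Otimes>\<^sub>M Q)"
    using X by (simp only: measurable_cong_sets[OF sets_pair_measure_cong[OF sets_std_gauss refl] refl])
  have sqn [measurable]: "sq_norm d \<in> borel_measurable (std_gauss d)"
    unfolding measurable_cong_sets[OF sets_std_gauss refl]
    by (intro measurable_sq_norm measurable_component_singleton) auto
  have mpair: "(\<lambda>(g, w). (sphere_proj d r g, w)) \<in> measurable (std_gauss d \<Otimes>\<^sub>M Q) (borel_d d \<Otimes>\<^sub>M Q)"
    using mp by measurable
  let ?\<theta> = "t * (sqrt 2 * r / sqrt (real d))"
  have "emeasure (sphere_unif d r \<Otimes>\<^sub>M Q) {z\<in>space (sphere_unif d r \<Otimes>\<^sub>M Q). X z > ?\<theta>} =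
      emeasure (std_gauss d \<Otimes>\<^sub>M Q) ((\<lambda>(g, w). (sphere_proj d r g, w)) -` {z\<in>space (borel_d d \<Otimes>\<^sub>M Q). X z > ?\<theta>} \<inter> space (std_gauss d \<Otimes>\<^sub>M Q))"
    unfolding pair space_distr by (rule emeasure_distr[OF mpair]) measurable
  also have "\<dots> \<le> emeasure (std_gauss d \<Otimes>\<^sub>M Q)
      ({z\<in>space (std_gauss d \<Otimes>\<^sub>M Q). X z > t} \<union> {g\<in>space (std_gauss d). sq_norm d g < real d / 2} \<times> space Q)"
  proof (rule emeasure_mono)
    show "(\<lambda>(g, w). (sphere_proj d r g, w)) -` {z\<in>space (borel_d d \<Otimes>\<^sub>M Q). X z > ?\<theta>} \<inter> space (std_gauss d \<Otimes>\<^sub>M Q)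
      \<subseteq> {z\<in>space (std_gauss d \<Otimes>\<^sub>M Q). X z > t} \<union> {g\<in>space (std_gauss d). sq_norm d g < real d / 2} \<times> space Q"
    proof (rule subsetI, rule UnCI)
      fix z assume z: "z \<in> (\<lambda>(g, w). (sphere_proj d r g, w)) -` {z\<in>space (borel_d d \<Otimes>\<^sub>M Q). X z > ?\<theta>} \<inter> space (std_gauss d \<Otimes>\<^sub>M Q)"
        and no: "z \<notin> {g\<in>space (std_gauss d). sq_norm d g < real d / 2} \<times> space Q"
      obtain g w where zgw: "z = (g, w)" by (cases z)
      from z have gw: "(g, w) \<in> space (std_gauss d \<Otimes>\<^sub>M Q)" and big: "X (sphere_proj d r g, w) > ?\<theta>"
        by (auto simp: zgw)
      from gw no have n: "sq_norm d g \<ge> real d / 2" by (auto simp: space_pair_measure zgw)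
      define s where "s = sqrt (sq_norm d g)"
      have s: "s \<ge> sqrt (real d / 2)" unfolding s_def by (rule real_sqrt_le_mono[OF n])
      have sd: "sqrt (real d / 2) > 0" using d by simp
      hence s0: "s > 0" using s by linarith
      have "X (sphere_proj d r g, w) = \<bar>inner_d d (\<lambda>i. (r / s) * g i) (mat_vec d A w)\<bar>"
        unfolding X_def fst_conv snd_conv
        by (intro arg_cong[of _ _ abs] inner_d_cong) (auto simp: sphere_proj_def s_def)
      also have "\<dots> = (r / s) * X (g, w)"
        unfolding inner_d_scale_left X_def using r s0 by (simp add: abs_mult)
      also have "\<dots> \<le> (r / sqrt (real d / 2)) * X (g, w)"
        using r s sd s0 by (intro mult_right_mono divide_left_mono mult_pos_pos) (auto simp: X_def)
      also have "r / sqrt (real d / 2) = sqrt 2 * r / sqrt (real d)" by (simp add: real_sqrt_divide)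
      finally have "t * (sqrt 2 * r / sqrt (real d)) < X (g, w) * (sqrt 2 * r / sqrt (real d))"
        using big by (simp add: mult.commute)
      hence "X (g, w) > t" using r d by (subst (asm) mult_less_cancel_right_pos) auto
      thus "z \<in> {z\<in>space (std_gauss d \<Otimes>\<^sub>M Q). X z > t}" using gw by (simp add: zgw)
    qed
  qed measurable
  also have "\<dots> \<le> emeasure (std_gauss d \<Otimes>\<^sub>M Q) {z\<in>space (std_gauss d \<Otimes>\<^sub>M Q). X z > t} +
      emeasure (std_gauss d \<Otimes>\<^sub>M Q) ({g\<in>space (std_gauss d). sq_norm d g < real d / 2} \<times> space Q)"
    by (rule emeasure_subadditive) measurable
  also have "emeasure (std_gauss d \<Otimes>\<^sub>M Q) ({g\<in>space (std_gauss d). sq_norm d g < real d / 2} \<times> space Q) =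
      emeasure (std_gauss d) {g\<in>space (std_gauss d). sq_norm d g < real d / 2}"
    by (subst Q.emeasure_pair_measure_Times) (auto simp: Q.emeasure_space_1)
  also have "emeasure (std_gauss d \<Otimes>\<^sub>M Q) {z\<in>space (std_gauss d \<Otimes>\<^sub>M Q). X z > t} +
      emeasure (std_gauss d) {g\<in>space (std_gauss d). sq_norm d g < real d / 2} \<le>
      ennreal (4 * exp (- t)) + ennreal (2 * exp (- sqrt (real d) / 8))"
  proof (rule add_mono)
    have "sq_norm d (mat_vec d (mat_mult_d d id_mat A) w) = sq_norm d (mat_vec d A w)" for w
      unfolding mat_vec_mult by (rule sq_norm_cong) (simp add: mat_vec_id)
    thus "emeasure (std_gauss d \<Otimes>\<^sub>M Q) {z\<in>space (std_gauss d \<Otimes>\<^sub>M Q). X z > t} \<le> ennreal (4 * exp (- t))"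
      unfolding X_def using sq by (intro decoupled_tail[OF subgauss_std_gauss Q]) simp
  qed (rule std_gauss_norm_tails)
  also have "\<dots> = ennreal (4 * exp (- t) + 2 * exp (- sqrt (real d) / 8))" by simp
  finally show ?thesis unfolding X_def .
qed

text \<open>The Gaussian form falls below half its mean, the trace, only with small probability, and
  \<open>|g|^2 \<le> 2 d\<close> outside the upper norm tail; the quotient of 1/2 and
  \<open>2 d\<close> gives the factor \<open>1 / (4 d)\<close>. Scaling \<open>W\<close> by
  \<open>1 / (2 F)\<close> brings it to squared Frobenius norm 1/4.\<close>

lemma sphere_quadratic_tail:
  assumes d: "d \<ge> 1" and r: "r > 0" and tr: "trace_d d W > 0"
  shows "emeasure (sphere_unif d r) {\<mu>\<in>space (sphere_unif d r).
      inner_d d \<mu> (mat_vec d W \<mu>) < r\<^sup>2 * trace_d d W / (4 * real d)}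
    \<le> ennreal (2 * exp (- trace_d d W / (8 * sqrt (frob_sq d W))) + 2 * exp (- sqrt (real d) / 8))"
proof -
  define F where "F = sqrt (frob_sq d W)"
  have "frob_sq d W > 0" by (rule frob_sq_pos_if_trace_pos[OF tr])
  hence F: "F > 0" "F\<^sup>2 = frob_sq d W" by (simp_all add: F_def)
  define T where "T = trace_d d W"
  have T: "T > 0" using tr by (simp add: T_def)
  define q where "q = (\<lambda>x. inner_d d x (mat_vec d W x))"
  have qm [measurable]: "q \<in> borel_measurable (borel_d d)"
    unfolding q_def by (intro measurable_inner_d measurable_mat_vec measurable_component_singleton) auto
  have qm' [measurable]: "q \<in> borel_measurable (std_gauss d)"
    using qm by (simp only: measurable_cong_sets[OF sets_std_gauss refl])
  have sqn [measurable]: "sq_norm d \<in> borel_measurable (std_gauss d)"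
    unfolding measurable_cong_sets[OF sets_std_gauss refl]
    by (intro measurable_sq_norm measurable_component_singleton) auto
  have mp: "sphere_proj d r \<in> measurable (std_gauss d) (borel_d d)"
    by (simp add: measurable_cong_sets[OF sets_std_gauss refl])
  define A where "A = {g\<in>space (std_gauss d). trace_d d (\<lambda>i j. (1/(2*F)) * W i j) -
      inner_d d g (mat_vec d (\<lambda>i j. (1/(2*F)) * W i j) g) > 2 * (T / (8 * F))}"
  have Aeq: "A = {g\<in>space (std_gauss d). q g < T / 2}"
  proof -
    have "trace_d d (\<lambda>i j. (1/(2*F)) * W i j) - inner_d d g (mat_vec d (\<lambda>i j. (1/(2*F)) * W i j) g) = (T - q g) / (2 * F)" for g
      by (simp add: trace_d_def bilinear_d q_def T_def sum_divide_distrib[symmetric] diff_divide_distrib)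
    moreover have "(T - q g) / (2 * F) > 2 * (T / (8 * F)) \<longleftrightarrow> q g < T / 2" for g
      using F(1) by (simp add: field_simps)
    ultimately show ?thesis unfolding A_def by simp
  qed
  have Am [measurable]: "A \<in> sets (std_gauss d)" unfolding Aeq by measurable
  have "emeasure (sphere_unif d r) {\<mu>\<in>space (sphere_unif d r). q \<mu> < r\<^sup>2 * T / (4 * real d)} =
      emeasure (std_gauss d) (sphere_proj d r -` {\<mu>\<in>space (borel_d d). q \<mu> < r\<^sup>2 * T / (4 * real d)} \<inter> space (std_gauss d))"
    unfolding sphere_unif_eq space_distr by (rule emeasure_distr[OF mp]) measurable
  also have "\<dots> \<le> emeasure (std_gauss d) (A \<union> {g\<in>space (std_gauss d). sq_norm d g > 2 * real d})"
  proof (rule emeasure_mono)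
    show "sphere_proj d r -` {\<mu>\<in>space (borel_d d). q \<mu> < r\<^sup>2 * T / (4 * real d)} \<inter> space (std_gauss d)
      \<subseteq> A \<union> {g\<in>space (std_gauss d). sq_norm d g > 2 * real d}"
    proof (rule subsetI, rule ccontr)
      fix g assume g: "g \<in> sphere_proj d r -` {\<mu>\<in>space (borel_d d). q \<mu> < r\<^sup>2 * T / (4 * real d)} \<inter> space (std_gauss d)"
        and no: "g \<notin> A \<union> {g\<in>space (std_gauss d). sq_norm d g > 2 * real d}"
      have g1: "q g \<ge> T / 2" "sq_norm d g \<le> 2 * real d" "q (sphere_proj d r g) < r\<^sup>2 * T / (4 * real d)"
        using g no by (auto simp: Aeq)
      have n0: "sq_norm d g > 0"
      proof (rule ccontr)
        assume "\<not> sq_norm d g > 0"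
        hence "sq_norm d g = 0" using sq_norm_nonneg[of d g] by linarith
        hence "(q g)\<^sup>2 \<le> 0" using inner_d_cauchy_schwarz[of d g "mat_vec d W g"] by (simp add: q_def)
        thus False using g1(1) T by simp
      qed
      define s where "s = sqrt (sq_norm d g)"
      have s: "s > 0" "s\<^sup>2 = sq_norm d g" using n0 by (auto simp: s_def)
      have "q (sphere_proj d r g) = inner_d d (\<lambda>i. (r/s) * g i) (\<lambda>i. (r/s) * mat_vec d W g i)"
        unfolding q_def
      proof (rule inner_d_cong)
        fix i assume i: "i < d"
        show "sphere_proj d r g i = (r/s) * g i" using i by (simp add: sphere_proj_def s_def)
        have "mat_vec d W (sphere_proj d r g) = mat_vec d W (\<lambda>i. (r/s) * g i)"
          by (rule mat_vec_cong) (simp add: sphere_proj_def s_def)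
        thus "mat_vec d W (sphere_proj d r g) i = (r/s) * mat_vec d W g i" using i by (simp only: mat_vec_scale)
      qed
      also have "\<dots> = (r/s)\<^sup>2 * q g" unfolding inner_d_scale_left inner_d_scale_right q_def by (simp add: power2_eq_square)
      also have "\<dots> = r\<^sup>2 * (q g / sq_norm d g)" by (simp add: power_divide s)
      finally have "q (sphere_proj d r g) = r\<^sup>2 * (q g / sq_norm d g)" .
      moreover have "(T / 2) / (2 * real d) \<le> q g / sq_norm d g"
        using g1 n0 T by (intro frac_le) auto
      hence "r\<^sup>2 * ((T / 2) / (2 * real d)) \<le> r\<^sup>2 * (q g / sq_norm d g)" by (intro mult_left_mono) auto
      ultimately have "r\<^sup>2 * ((T / 2) / (2 * real d)) \<le> q (sphere_proj d r g)" by simp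
      thus False using g1(3) by simp
    qed
  qed measurable
  also have "\<dots> \<le> emeasure (std_gauss d) A + emeasure (std_gauss d) {g\<in>space (std_gauss d). sq_norm d g > 2 * real d}"
    by (rule emeasure_subadditive) measurable
  also have "\<dots> \<le> ennreal (2 * exp (- (T / (8 * F)))) + ennreal (2 * exp (- sqrt (real d) / 8))"
  proof (intro add_mono std_gauss_norm_tails)
    have "frob_sq d (\<lambda>i j. (1/(2*F)) * W i j) = 1/4"
      using F(1) unfolding frob_sq_scale F(2)[symmetric] by (simp add: power_divide)
    thus "emeasure (std_gauss d) A \<le> ennreal (2 * exp (- (T / (8 * F))))"
      unfolding A_def by (intro std_gauss_quadratic_tail) simp
  qed
  finally show ?thesis by (simp add: q_def T_def F_def)
qed

lemma sphere_bilinear_tail: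
  assumes pd: "pos_def_d d Lam" and d: "d \<ge> 1" and r: "r > 0"
    and Q: "subgauss d Q (mat_sqrt_d d Lam)" and W: "frob_sq d W > 0"
  shows "emeasure (sphere_unif d r \<Otimes>\<^sub>M Q) {z\<in>space (sphere_unif d r \<Otimes>\<^sub>M Q).
      \<bar>inner_d d (fst z) (mat_vec d W (snd z))\<bar> > \<theta>}
    \<le> ennreal (4 * exp (- (\<theta> * sqrt (real d) / (2 * sqrt 2 * r * sqrt (frob_sq d W) * op_norm_d d (mat_sqrt_d d Lam))))
        + 2 * exp (- sqrt (real d) / 8))"
proof -
  let ?S = "mat_sqrt_d d Lam"
  define \<sigma> where "\<sigma> = op_norm_d d ?S"
  define F where "F = sqrt (frob_sq d W)"
  have \<sigma>: "\<sigma> > 0" unfolding \<sigma>_def by (rule op_norm_pos[OF pd d])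
  have F: "F > 0" "F\<^sup>2 = frob_sq d W" using W by (auto simp: F_def)
  \<comment> \<open>Normalises the matrix so that its product with the covariance root has squared
    Frobenius norm at most 1/4, as \<open>subgauss_exp_sq_norm\<close> requires.\<close>
  define l where "l = 1 / (2 * F * \<sigma>)"
  have l: "l > 0" using \<sigma> F by (simp add: l_def)
  let ?A = "\<lambda>i j. l * W i j"
  define t where "t = \<theta> * sqrt (real d) / (2 * sqrt 2 * r * F * \<sigma>)"
  have sc: "inner_d d x (mat_vec d ?A y) = l * inner_d d x (mat_vec d W y)" for x y
    by (simp add: bilinear_d sum_distrib_left mult_ac)
  have "frob_sq d (mat_mult_d d ?A ?S) = l\<^sup>2 * frob_sq d (mat_mult_d d W ?S)"
    unfolding frob_sq_scale[symmetric] by (simp add: mat_mult_d_def sum_distrib_left mult.assoc)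
  also have "\<dots> \<le> l\<^sup>2 * (\<sigma>\<^sup>2 * frob_sq d W)"
    unfolding \<sigma>_def by (intro mult_left_mono frob_sq_mult_right mat_sqrt_d(1)[OF pd]) simp
  also have "\<dots> = 1/4" using F \<sigma> unfolding F(2)[symmetric] l_def by (simp add: power_mult_distrib power_divide)
  finally have "(\<integral>\<^sup>+w. ennreal (exp (sq_norm d (mat_vec d ?A w) / 2)) \<partial>Q) \<le> 2"
    by (rule subgauss_exp_sq_norm[OF Q mat_sqrt_d(1)[OF pd]])
  from sphere_linear_tail[OF d r subgaussD(1,2)[OF Q] this, of t]
  have "emeasure (sphere_unif d r \<Otimes>\<^sub>M Q) {z\<in>space (sphere_unif d r \<Otimes>\<^sub>M Q).
      \<bar>inner_d d (fst z) (mat_vec d ?A (snd z))\<bar> > t * (sqrt 2 * r / sqrt (real d))}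
    \<le> ennreal (4 * exp (- t) + 2 * exp (- sqrt (real d) / 8))" .
  moreover have "t * (sqrt 2 * r / sqrt (real d)) = l * \<theta>"
    using d r F \<sigma> by (simp add: t_def l_def field_simps)
  moreover have "\<bar>inner_d d x (mat_vec d ?A y)\<bar> > l * \<theta> \<longleftrightarrow> \<bar>inner_d d x (mat_vec d W y)\<bar> > \<theta>" for x y
    unfolding sc using l by (simp add: abs_mult)
  ultimately show ?thesis by (simp add: t_def F_def \<sigma>_def)
qed

section \<open>Measurable selection of the max-margin solution\<close>

definition margin_ok :: "nat \<Rightarrow> 'k set \<Rightarrow> ('k \<Rightarrow> vecd) \<Rightarrow> ('k \<Rightarrow> vecd) \<Rightarrow> matd \<Rightarrow> bool" where
  "margin_ok d T a b V \<longleftrightarrow> (\<forall>t\<in>T. 1 \<le> inner_d d (a t) (mat_vec d V (b t)))"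

definition min_norm :: "nat \<Rightarrow> (matd \<Rightarrow> bool) \<Rightarrow> matd \<Rightarrow> bool" where
  "min_norm d F W \<longleftrightarrow> (\<forall>i j. \<not> (i < d \<and> j < d) \<longrightarrow> W i j = 0) \<and> F W \<and> (\<forall>V. F V \<longrightarrow> frob_sq d W \<le> frob_sq d V)"

text \<open>Countability is the point: quantifying over rational competitors keeps events
  measurable. Entries outside the \<open>d\<close> by \<open>d\<close> block are fixed to 0, without
  which the set would be uncountable.\<close>

definition rat_mats :: "nat \<Rightarrow> matd set" where
  "rat_mats d = {V. \<forall>i j. if i < d \<and> j < d then V i j \<in> \<rat> else V i j = 0}"

abbreviation rat_mat :: "nat \<Rightarrow> nat \<Rightarrow> matd" where
  "rat_mat d \<equiv> from_nat_into (rat_mats d)"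

text \<open>A tolerance is needed because the infimum over rational matrices need not be
  attained.\<close>

definition near_opt :: "nat \<Rightarrow> (matd \<Rightarrow> bool) \<Rightarrow> nat \<Rightarrow> nat \<Rightarrow> bool" where
  "near_opt d F n k \<longleftrightarrow> F (rat_mat d k) \<and>
     (\<forall>l. F (rat_mat d l) \<longrightarrow> frob_sq d (rat_mat d k) \<le> frob_sq d (rat_mat d l) + 1 / real (Suc n))"

text \<open>The least index makes the choice measurable in the data. \<open>lim\<close> is total, so
  measurability holds for all data, whereas convergence is needed only for feasible ones.\<close>

definition opt_limit :: "nat \<Rightarrow> (matd \<Rightarrow> bool) \<Rightarrow> matd" where
  "opt_limit d F i j = lim (\<lambda>n. rat_mat d (LEAST k. near_opt d F n k) i j)"

lemma countable_rat_mats: "countable (rat_mats d)"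
proof -
  let ?P = "PiE ({..<d} \<times> {..<d}) (\<lambda>_. \<rat> :: real set)"
  have "rat_mats d \<subseteq> (\<lambda>f i j. if i < d \<and> j < d then f (i, j) else 0) ` ?P"
  proof
    fix V assume V: "V \<in> rat_mats d"
    have "V = (\<lambda>i j. if i < d \<and> j < d then (restrict (\<lambda>(i, j). V i j) ({..<d} \<times> {..<d})) (i, j) else 0)"
    proof (intro ext)
      fix i j
      show "V i j = (if i < d \<and> j < d then (restrict (\<lambda>(i, j). V i j) ({..<d} \<times> {..<d})) (i, j) else 0)"
        using V[unfolded rat_mats_def mem_Collect_eq, rule_format, of i j] by (auto split: if_splits)
    qed
    moreover have "restrict (\<lambda>(i, j). V i j) ({..<d} \<times> {..<d}) \<in> ?P"
      using V by (auto simp: rat_mats_def)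
    ultimately show "V \<in> (\<lambda>f i j. if i < d \<and> j < d then f (i, j) else 0) ` ?P" by blast
  qed
  moreover have "countable ?P" by (intro countable_PiE countable_rat) auto
  ultimately show ?thesis by (meson countable_image countable_subset)
qed

lemma zero_in_rat_mats: "(\<lambda>i j. 0) \<in> rat_mats d" by (simp add: rat_mats_def)

lemma rat_matsI:
  "(\<And>i j. if i < d \<and> j < d then V i j \<in> \<rat> else V i j = 0) \<Longrightarrow> V \<in> rat_mats d"
  by (simp add: rat_mats_def)

lemma rat_mat_in: "rat_mat d k \<in> rat_mats d"
  using from_nat_into zero_in_rat_mats by blast

lemma rat_mat_entry:
  "i < d \<Longrightarrow> j < d \<Longrightarrow> rat_mat d k i j \<in> \<rat>"
  "\<not> (i < d \<and> j < d) \<Longrightarrow> rat_mat d k i j = 0"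
proof -
  have "V \<in> rat_mats d \<Longrightarrow> if i < d \<and> j < d then V i j \<in> \<rat> else V i j = 0" for V
    unfolding rat_mats_def by blast
  from this[OF rat_mat_in] show "i < d \<Longrightarrow> j < d \<Longrightarrow> rat_mat d k i j \<in> \<rat>"
    "\<not> (i < d \<and> j < d) \<Longrightarrow> rat_mat d k i j = 0" by (simp_all split: if_splits)
qed

lemma rat_mat_surj: "V \<in> rat_mats d \<Longrightarrow> \<exists>k. rat_mat d k = V"
  by (metis countable_rat_mats from_nat_into_surj)

lemma frob_parallelogram:
  "frob_sq d (\<lambda>i j. (V i j + U i j) / 2) = frob_sq d V / 2 + frob_sq d U / 2 - frob_sq d (\<lambda>i j. V i j - U i j) / 4"
proof -
  have "frob_sq d (\<lambda>i j. (V i j + U i j) / 2) =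
      (\<Sum>i<d. \<Sum>j<d. (V i j)\<^sup>2 / 2 + (U i j)\<^sup>2 / 2 - (V i j - U i j)\<^sup>2 / 4)"
    unfolding frob_sq_def by (intro sum.cong refl) (simp add: power2_eq_square field_simps)
  thus ?thesis by (simp add: frob_sq_def sum.distrib sum_subtractf sum_divide_distrib)
qed

lemma entry_le_frob: "i < d \<Longrightarrow> j < d \<Longrightarrow> (V i j)\<^sup>2 \<le> frob_sq d V"
proof -
  assume ij: "i < d" "j < d"
  have "(V i j)\<^sup>2 \<le> (\<Sum>j<d. (V i j)\<^sup>2)" using ij by (intro member_le_sum) auto
  also have "\<dots> \<le> frob_sq d V" unfolding frob_sq_def
    using ij member_le_sum[of i "{..<d}" "\<lambda>i. \<Sum>j<d. (V i j)\<^sup>2"] by (simp add: sum_nonneg)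
  finally show ?thesis .
qed

lemma margin_ok_midpoint:
  assumes "margin_ok d T a b V" "margin_ok d T a b U" "0 \<le> s" "s \<le> 1"
  shows "margin_ok d T a b (\<lambda>i j. (1 - s) * V i j + s * U i j)"
  unfolding margin_ok_def
proof
  fix t assume t: "t \<in> T"
  have "inner_d d (a t) (mat_vec d (\<lambda>i j. (1 - s) * V i j + s * U i j) (b t)) =
      (1 - s) * inner_d d (a t) (mat_vec d V (b t)) + s * inner_d d (a t) (mat_vec d U (b t))"
    unfolding bilinear_d sum_distrib_left sum.distrib[symmetric]
    by (intro sum.cong refl) (simp add: algebra_simps)
  moreover have "(1 - s) * 1 + s * 1 \<le> (1 - s) * inner_d d (a t) (mat_vec d V (b t)) + s * inner_d d (a t) (mat_vec d U (b t))"
    using assms t by (intro add_mono mult_left_mono) (auto simp: margin_ok_def)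
  ultimately show "1 \<le> inner_d d (a t) (mat_vec d (\<lambda>i j. (1 - s) * V i j + s * U i j) (b t))" by simp
qed

lemma margin_ok_half:
  assumes "margin_ok d T a b V" "margin_ok d T a b U"
  shows "margin_ok d T a b (\<lambda>i j. (V i j + U i j) / 2)"
  using margin_ok_midpoint[OF assms, of "1/2"] by (simp add: add_divide_distrib)

text \<open>Strict convexity: by the parallelogram law the feasible midpoint of two distinct
  minimisers would be shorter. Hence every statement about some max-margin solution is one about the
  measurably selected solution.\<close>

lemma min_norm_unique:
  assumes W: "min_norm d (margin_ok d T a b) W" and W': "min_norm d (margin_ok d T a b) W'"
  shows "W = W'"
proof (intro ext)
  fix i j
  have "frob_sq d W \<le> frob_sq d (\<lambda>i j. (W i j + W' i j) / 2)" "frob_sq d W' \<le> frob_sq d (\<lambda>i j. (W i j + W' i j) / 2)"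
    using W W' margin_ok_half unfolding min_norm_def by blast+
  hence *: "frob_sq d (\<lambda>i j. W i j - W' i j) \<le> 0"
    using frob_parallelogram[of d W W'] by linarith
  show "W i j = W' i j"
  proof (cases "i < d \<and> j < d")
    case True
    hence "(W i j - W' i j)\<^sup>2 \<le> 0" using entry_le_frob[of i d j "\<lambda>i j. W i j - W' i j"] * by linarith
    thus ?thesis by simp
  next
    case False thus ?thesis using W W' by (simp add: min_norm_def)
  qed
qed

lemma rational_sequence: "\<exists>q. (\<forall>n. q n \<in> \<rat>) \<and> q \<longlonglongrightarrow> (x::real)"
proof -
  have "\<exists>q\<in>\<rat>. x < q \<and> q < x + 1 / real (Suc n)" for n by (rule Rats_dense_in_real) simp
  then obtain q where q: "\<And>n. q n \<in> \<rat>" "\<And>n. x < q n" "\<And>n. q n < x + 1 / real (Suc n)" by metis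
  have "q \<longlonglongrightarrow> x"
  proof (rule tendsto_sandwich[of "\<lambda>_. x" _ _ "\<lambda>n. x + 1 / real (Suc n)"])
    show "(\<lambda>n. x + 1 / real (Suc n)) \<longlonglongrightarrow> x" using LIMSEQ_inverse_real_of_nat_add[of x] by (simp add: inverse_eq_divide)
  qed (auto intro!: always_eventually less_imp_le q(2) q(3)[unfolded of_nat_Suc] simp: q(3))
  with q(1) show ?thesis by blast
qed

lemma frob_sq_tendsto:
  assumes "\<And>i j. i < d \<Longrightarrow> j < d \<Longrightarrow> (\<lambda>n. X n i j) \<longlonglongrightarrow> V i j"
  shows "(\<lambda>n. frob_sq d (X n)) \<longlonglongrightarrow> frob_sq d V"
  unfolding frob_sq_def by (intro tendsto_sum tendsto_power assms) auto

lemma bilinear_tendsto: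
  assumes "\<And>i j. i < d \<Longrightarrow> j < d \<Longrightarrow> (\<lambda>n. X n i j) \<longlonglongrightarrow> V i j"
  shows "(\<lambda>n. inner_d d x (mat_vec d (X n) y)) \<longlonglongrightarrow> inner_d d x (mat_vec d V y)"
  unfolding bilinear_d by (intro tendsto_sum tendsto_mult tendsto_const assms) auto

text \<open>A feasible matrix may satisfy constraints with equality, so a nearby rational one may be
  infeasible. Scaling by some \<open>s > 1\<close> first makes all constraints strict; finitely many
  strict constraints survive a small perturbation, and \<open>s\<close> close to 1 keeps the norm
  below the allowance.\<close>

lemma rational_feasible_approx:
  assumes T: "finite T" and V: "margin_ok d T a b V" and e: "e > 0"
  shows "\<exists>k. margin_ok d T a b (rat_mat d k) \<and> frob_sq d (rat_mat d k) < frob_sq d V + e"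
proof -
  have "((\<lambda>s. s\<^sup>2 * frob_sq d V) \<longlongrightarrow> 1\<^sup>2 * frob_sq d V) (at_right (1::real))" by (intro tendsto_intros)
  hence "eventually (\<lambda>s. s\<^sup>2 * frob_sq d V < frob_sq d V + e) (at_right (1::real))"
    by (rule order_tendstoD) (use e in simp)
  then obtain s :: real where s: "s > 1" "s\<^sup>2 * frob_sq d V < frob_sq d V + e"
    unfolding eventually_at_right_field by (metis dense)
  have "\<forall>i j. \<exists>q. (\<forall>n. q n \<in> \<rat>) \<and> q \<longlonglongrightarrow> s * V i j" using rational_sequence by blast
  then obtain q where q: "\<And>i j n. q i j n \<in> \<rat>" "\<And>i j. q i j \<longlonglongrightarrow> s * V i j" by metis
  define X where "X = (\<lambda>n i j. if i < d \<and> j < d then q i j n else 0)"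
  have Xlim: "(\<lambda>n. X n i j) \<longlonglongrightarrow> s * V i j" if "i < d" "j < d" for i j
    using that q(2) by (simp add: X_def)
  have "eventually (\<lambda>n. frob_sq d (X n) < frob_sq d V + e) sequentially"
    using order_tendstoD(2)[OF frob_sq_tendsto[OF Xlim]] s(2) by (simp add: frob_sq_scale)
  moreover have "eventually (\<lambda>n. \<forall>t\<in>T. 1 < inner_d d (a t) (mat_vec d (X n) (b t))) sequentially"
  proof (intro eventually_ball_finite T ballI order_tendstoD(1)[OF bilinear_tendsto[OF Xlim]])
    fix t assume "t \<in> T"
    hence "1 \<le> inner_d d (a t) (mat_vec d V (b t))" using V by (simp add: margin_ok_def)
    hence "s * 1 \<le> s * inner_d d (a t) (mat_vec d V (b t))" using s(1) by (intro mult_left_mono) auto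
    also have "\<dots> = inner_d d (a t) (mat_vec d (\<lambda>i j. s * V i j) (b t))"
      by (simp add: bilinear_d sum_distrib_left mult_ac)
    finally show "1 < inner_d d (a t) (mat_vec d (\<lambda>i j. s * V i j) (b t))" using s(1) by simp
  qed
  ultimately have "eventually (\<lambda>n. frob_sq d (X n) < frob_sq d V + e \<and> (\<forall>t\<in>T. 1 < inner_d d (a t) (mat_vec d (X n) (b t)))) sequentially"
    by (rule eventually_conj)
  then obtain n where n: "frob_sq d (X n) < frob_sq d V + e" "\<forall>t\<in>T. 1 < inner_d d (a t) (mat_vec d (X n) (b t))"
    by (auto dest: eventually_happens'[rotated])
  have "X n \<in> rat_mats d" using q(1) by (auto simp: rat_mats_def X_def)
  then obtain k where "rat_mat d k = X n" using rat_mat_surj by blast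
  thus ?thesis using n by (intro exI[of _ k]) (auto simp: margin_ok_def less_imp_le)
qed

lemma near_opt_exists:
  assumes "F (rat_mat d k0)"
  shows "\<exists>k. near_opt d F n k"
proof -
  let ?S = "(\<lambda>k. frob_sq d (rat_mat d k)) ` {k. F (rat_mat d k)}"
  have ne: "?S \<noteq> {}" using assms by auto
  have bdd: "bdd_below ?S" by (rule bdd_belowI2[of _ 0]) simp
  have "Inf ?S < Inf ?S + 1 / real (Suc n)" by simp
  then obtain y where "y \<in> ?S" "y < Inf ?S + 1 / real (Suc n)"
    unfolding cInf_less_iff[OF ne bdd] by blast
  then obtain k where k: "F (rat_mat d k)" "frob_sq d (rat_mat d k) < Inf ?S + 1 / real (Suc n)"
    by blast
  have "near_opt d F n k" unfolding near_opt_def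
  proof (intro conjI allI impI k(1))
    fix l assume "F (rat_mat d l)"
    hence "Inf ?S \<le> frob_sq d (rat_mat d l)" by (intro cInf_lower[OF _ bdd]) auto
    thus "frob_sq d (rat_mat d k) \<le> frob_sq d (rat_mat d l) + 1 / real (Suc n)" using k(2) by linarith
  qed
  thus ?thesis ..
qed

text \<open>The parallelogram law, applied to the midpoint, which is again rational and feasible.\<close>

lemma near_opt_close:
  assumes "near_opt d (margin_ok d T a b) n k" "near_opt d (margin_ok d T a b) m l" "n \<le> m"
  shows "frob_sq d (\<lambda>i j. rat_mat d k i j - rat_mat d l i j) \<le> 4 / real (Suc n)"
proof -
  let ?V = "rat_mat d k" and ?U = "rat_mat d l"
  let ?Z = "\<lambda>i j. (?V i j + ?U i j) / 2"
  have "?Z \<in> rat_mats d"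
  proof (rule rat_matsI)
    fix i j show "if i < d \<and> j < d then (?V i j + ?U i j) / 2 \<in> \<rat> else (?V i j + ?U i j) / 2 = 0"
      using rat_mat_entry[of i d j] by (cases "i < d \<and> j < d") auto
  qed
  then obtain z where z: "rat_mat d z = ?Z" using rat_mat_surj by blast
  have "margin_ok d T a b (rat_mat d z)"
    unfolding z using assms by (intro margin_ok_half) (auto simp: near_opt_def)
  hence "frob_sq d ?V \<le> frob_sq d ?Z + 1 / real (Suc n)" "frob_sq d ?U \<le> frob_sq d ?Z + 1 / real (Suc m)"
    using assms unfolding near_opt_def z[symmetric] by blast+
  moreover have "1 / real (Suc m) \<le> 1 / real (Suc n)" using assms(3) by (intro divide_left_mono) auto
  ultimately have "frob_sq d (\<lambda>i j. ?V i j - ?U i j) \<le> 4 * (1 / real (Suc n))"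
    using frob_parallelogram[of d ?V ?U] by linarith
  thus ?thesis by simp
qed

text \<open>Near-optimal matrices are Cauchy by \<open>near_opt_close\<close>. The constraints are
  closed and the norm continuous, so both pass to the limit; an arbitrary competitor is compared
  through rational ones of almost the same norm.\<close>

lemma opt_limit_min_norm:
  assumes T: "finite T" and ex: "margin_ok d T a b V0"
  shows "min_norm d (margin_ok d T a b) (opt_limit d (margin_ok d T a b))"
proof -
  let ?F = "margin_ok d T a b"
  define W where "W = opt_limit d ?F"
  define X where "X = (\<lambda>n. rat_mat d (LEAST k. near_opt d ?F n k))"
  obtain k0 where k0: "?F (rat_mat d k0)" using rational_feasible_approx[OF T ex, of 1] by auto
  have opt: "near_opt d ?F n (LEAST k. near_opt d ?F n k)" for n
    using near_opt_exists[of ?F d k0 n] k0 by (auto intro: LeastI_ex)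
  have lim: "(\<lambda>n. X n i j) \<longlonglongrightarrow> W i j" for i j
  proof (cases "i < d \<and> j < d")
    case False
    hence "rat_mat d k i j = 0" for k by (rule rat_mat_entry(2))
    thus ?thesis unfolding W_def opt_limit_def X_def by simp
  next
    case True
    have "Cauchy (\<lambda>n. X n i j)"
    proof (rule metric_CauchyI)
      fix e :: real assume e: "e > 0"
      obtain n0 :: nat where n0: "4 / e\<^sup>2 < real n0" using reals_Archimedean2 by blast
      have n0': "4 / real (Suc n0) < e\<^sup>2"
      proof -
        have "4 < real n0 * e\<^sup>2" using n0 e by (simp add: field_simps)
        also have "\<dots> \<le> real (Suc n0) * e\<^sup>2" by (intro mult_right_mono) auto
        finally show ?thesis by (simp add: field_simps)
      qed
      have close: "\<bar>X m i j - X n i j\<bar> < e" if "n0 \<le> m" "m \<le> n" for m n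
      proof -
        have "(X m i j - X n i j)\<^sup>2 \<le> frob_sq d (\<lambda>i j. X m i j - X n i j)"
          using True by (intro entry_le_frob[of i d j "\<lambda>i j. X m i j - X n i j"]) auto
        also have "\<dots> \<le> 4 / real (Suc m)" unfolding X_def by (rule near_opt_close[OF opt opt that(2)])
        also have "\<dots> \<le> 4 / real (Suc n0)" using that by (intro divide_left_mono) auto
        finally have "(X m i j - X n i j)\<^sup>2 < e\<^sup>2" using n0' by linarith
        thus ?thesis using e abs_le_square_iff[of e "X m i j - X n i j"] by (auto simp: not_le[symmetric])
      qed
      show "\<exists>M. \<forall>m\<ge>M. \<forall>n\<ge>M. dist (X m i j) (X n i j) < e"
      proof (intro exI[of _ n0] allI impI)
        fix m n assume "n0 \<le> m" "n0 \<le> n"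
        thus "dist (X m i j) (X n i j) < e"
          using close[of m n] close[of n m] by (cases "m \<le> n") (auto simp: dist_real_def abs_minus_commute)
      qed
    qed
    hence "convergent (\<lambda>n. X n i j)" by (simp add: Cauchy_convergent_iff)
    thus ?thesis unfolding W_def opt_limit_def X_def[symmetric] by (simp add: convergent_LIMSEQ_iff X_def)
  qed
  have "?F W" unfolding margin_ok_def
  proof
    fix t assume t: "t \<in> T"
    show "1 \<le> inner_d d (a t) (mat_vec d W (b t))"
    proof (rule LIMSEQ_le_const[OF bilinear_tendsto[OF lim]])
      show "\<exists>N. \<forall>n\<ge>N. 1 \<le> inner_d d (a t) (mat_vec d (X n) (b t))"
        using opt t unfolding near_opt_def margin_ok_def X_def by blast
    qed
  qed
  moreover have "frob_sq d W \<le> frob_sq d V" if V: "?F V" for V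
  proof (rule field_le_epsilon)
    fix e :: real assume e: "e > 0"
    obtain l where l: "?F (rat_mat d l)" "frob_sq d (rat_mat d l) < frob_sq d V + e"
      using rational_feasible_approx[OF T V e] by blast
    have 1: "frob_sq d (X n) \<le> frob_sq d (rat_mat d l) + 1 / real (Suc n)" for n
      using opt[of n] l(1) unfolding near_opt_def X_def by blast
    have 2: "(\<lambda>n. frob_sq d (rat_mat d l) + 1 / real (Suc n)) \<longlonglongrightarrow> frob_sq d (rat_mat d l)"
      using LIMSEQ_inverse_real_of_nat_add[of "frob_sq d (rat_mat d l)"] by (simp add: inverse_eq_divide)
    have "frob_sq d W \<le> frob_sq d (rat_mat d l)"
      by (rule LIMSEQ_le[OF frob_sq_tendsto[OF lim] 2]) (use 1 in auto)
    thus "frob_sq d W \<le> frob_sq d V + e" using l(2) by simp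
  qed
  moreover have "W i j = 0" if "\<not> (i < d \<and> j < d)" for i j
  proof -
    have "X n i j = 0" for n
      using that rat_mat_entry(2) unfolding X_def by blast
    thus ?thesis using lim[of i j] by (simp add: LIMSEQ_const_iff)
  qed
  ultimately show ?thesis unfolding min_norm_def W_def by blast
qed

lemma measurable_opt_limit:
  assumes [measurable]: "\<And>V. Measurable.pred M (\<lambda>\<omega>. F \<omega> V)"
  shows "(\<lambda>\<omega>. opt_limit d (F \<omega>) i j) \<in> borel_measurable M"
proof -
  have [measurable]: "Measurable.pred M (\<lambda>\<omega>. near_opt d (F \<omega>) n k)" for n k
    unfolding near_opt_def by measurable
  have "(\<lambda>\<omega>. LEAST k. near_opt d (F \<omega>) n k) \<in> measurable M (count_space UNIV)" for n
    by measurable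
  hence "(\<lambda>\<omega>. rat_mat d (LEAST k. near_opt d (F \<omega>) n k) i j) \<in> borel_measurable M" for n
    by (rule measurable_compose[of _ _ _ "\<lambda>k. rat_mat d k i j"]) simp
  thus ?thesis unfolding opt_limit_def by (rule borel_measurable_lim_metric)
qed

section \<open>The max-margin solution has a large trace\<close>

text \<open>Optimality is only used in the direction of a feasible multiple of the identity, and
  feasibility only through the sum of all constraints.\<close>

lemma min_norm_trace_ge:
  assumes W: "min_norm d (margin_ok d T a b) W" and K: "K > 0"
    and id: "margin_ok d T a b (\<lambda>i j. K * id_mat i j)"
  shows "frob_sq d W \<le> K * trace_d d W"
proof (rule ccontr)
  assume neg: "\<not> frob_sq d W \<le> K * trace_d d W"
  define e where "e = frob_sq d W - K * trace_d d W"
  have e: "e > 0" using neg by (simp add: e_def)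
  define D where "D = frob_sq d (\<lambda>i j. K * id_mat i j - W i j)"
  have D0: "D \<ge> 0" by (simp add: D_def)
  \<comment> \<open>Moving by \<open>s\<close> changes the squared norm by
    \<open>s * (s * D - 2 * e)\<close>, which is negative once \<open>s * D < 2 * e\<close>. The
    denominator \<open>D + 1\<close> avoids dividing by zero.\<close>
  define s where "s = min 1 (e / (D + 1))"
  have s: "0 < s" "s \<le> 1" using e D0 by (auto simp: s_def)
  have sD: "s * D < 2 * e"
  proof -
    have "s * D \<le> e / (D + 1) * D" using D0 by (intro mult_right_mono) (auto simp: s_def)
    also have "\<dots> = e * (D / (D + 1))" by simp
    also have "\<dots> \<le> e * 1" using e D0 by (intro mult_left_mono) auto
    finally show ?thesis using e by linarith
  qed
  have ip: "(\<Sum>i<d. \<Sum>j<d. W i j * (K * id_mat i j - W i j)) = - e"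
  proof -
    have "(\<Sum>i<d. \<Sum>j<d. W i j * (K * id_mat i j - W i j)) =
        (\<Sum>i<d. \<Sum>j<d. K * (W i j * id_mat i j) - (W i j)\<^sup>2)"
      by (intro sum.cong refl) (simp add: algebra_simps power2_eq_square)
    also have "\<dots> = K * (\<Sum>i<d. \<Sum>j<d. W i j * id_mat i j) - frob_sq d W"
      by (simp add: sum_subtractf sum_distrib_left frob_sq_def)
    also have "(\<Sum>i<d. \<Sum>j<d. W i j * id_mat i j) = trace_d d W"
      by (simp add: trace_d_def id_mat_def if_distrib[of "\<lambda>c. _ * c"] cong: if_cong)
    finally show ?thesis by (simp add: e_def)
  qed
  have "frob_sq d W \<le> frob_sq d (\<lambda>i j. (1 - s) * W i j + s * (K * id_mat i j))"
    using W margin_ok_midpoint[OF _ id, of W s] s unfolding min_norm_def by auto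
  also have "\<dots> = (\<Sum>i<d. \<Sum>j<d. (W i j)\<^sup>2 + 2 * s * (W i j * (K * id_mat i j - W i j)) + s\<^sup>2 * (K * id_mat i j - W i j)\<^sup>2)"
    unfolding frob_sq_def by (intro sum.cong refl) (simp add: power2_eq_square algebra_simps)
  also have "\<dots> = frob_sq d W + 2 * s * (\<Sum>i<d. \<Sum>j<d. W i j * (K * id_mat i j - W i j)) + s\<^sup>2 * D"
    by (simp add: sum.distrib sum_distrib_left frob_sq_def D_def)
  also have "\<dots> = frob_sq d W + s * (s * D - 2 * e)" unfolding ip by (simp add: power2_eq_square algebra_simps)
  finally have "0 \<le> s * (s * D - 2 * e)" by simp
  moreover have "s * (s * D - 2 * e) < 0" using s sD by (intro mult_pos_neg) auto
  ultimately show False by simp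
qed

lemma margin_sum_bound:
  assumes T: "finite T" and W: "margin_ok d T a b W"
  shows "(real (card T))\<^sup>2 \<le> frob_sq d W * (\<Sum>s\<in>T. \<Sum>t\<in>T. inner_d d (a s) (a t) * inner_d d (b s) (b t))"
proof -
  define A where "A = (\<lambda>i j. \<Sum>t\<in>T. a t i * b t j)"
  have "real (card T) = (\<Sum>t\<in>T. 1)" by simp
  also have "\<dots> \<le> (\<Sum>t\<in>T. inner_d d (a t) (mat_vec d W (b t)))"
    using W by (intro sum_mono) (auto simp: margin_ok_def)
  also have "\<dots> = (\<Sum>i<d. \<Sum>j<d. W i j * A i j)"
  proof -
    have "(\<Sum>t\<in>T. inner_d d (a t) (mat_vec d W (b t))) = (\<Sum>i<d. \<Sum>t\<in>T. \<Sum>j<d. a t i * W i j * b t j)"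
      unfolding bilinear_d by (rule sum.swap)
    also have "\<dots> = (\<Sum>i<d. \<Sum>j<d. \<Sum>t\<in>T. a t i * W i j * b t j)" by (intro sum.cong refl sum.swap)
    finally show ?thesis by (simp add: A_def sum_distrib_left mult_ac)
  qed
  finally have "real (card T) \<le> (\<Sum>i<d. \<Sum>j<d. W i j * A i j)" .
  hence "(real (card T))\<^sup>2 \<le> (\<Sum>i<d. \<Sum>j<d. W i j * A i j)\<^sup>2" by (intro power_mono) auto
  also have "\<dots> \<le> frob_sq d W * frob_sq d A" by (rule frob_cauchy_schwarz)
  \<comment> \<open>The Frobenius product of two rank-one matrices is the product of the inner
    products of their left and of their right factors.\<close>
  also have "frob_sq d A = (\<Sum>s\<in>T. \<Sum>t\<in>T. inner_d d (a s) (a t) * inner_d d (b s) (b t))"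
  proof -
    have "frob_sq d A = (\<Sum>i<d. \<Sum>j<d. \<Sum>s\<in>T. \<Sum>t\<in>T. (a s i * a t i) * (b s j * b t j))"
      unfolding frob_sq_def A_def power2_eq_square sum_product by (simp add: mult_ac)
    also have "\<dots> = (\<Sum>s\<in>T. \<Sum>t\<in>T. \<Sum>i<d. \<Sum>j<d. (a s i * a t i) * (b s j * b t j))"
    proof -
      have "(\<Sum>i<d. \<Sum>j<d. \<Sum>s\<in>T. \<Sum>t\<in>T. f i j s t) = (\<Sum>s\<in>T. \<Sum>t\<in>T. \<Sum>i<d. \<Sum>j<d. f i j s t)"
        for f :: "nat \<Rightarrow> nat \<Rightarrow> 'a \<Rightarrow> 'a \<Rightarrow> real"
      proof -
        have "(\<Sum>i<d. \<Sum>j<d. \<Sum>s\<in>T. \<Sum>t\<in>T. f i j s t) = (\<Sum>i<d. \<Sum>s\<in>T. \<Sum>j<d. \<Sum>t\<in>T. f i j s t)"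
          by (intro sum.cong refl sum.swap)
        also have "\<dots> = (\<Sum>s\<in>T. \<Sum>i<d. \<Sum>t\<in>T. \<Sum>j<d. f i j s t)"
          by (subst sum.swap) (intro sum.cong refl sum.swap)
        also have "\<dots> = (\<Sum>s\<in>T. \<Sum>t\<in>T. \<Sum>i<d. \<Sum>j<d. f i j s t)"
          by (intro sum.cong refl sum.swap)
        finally show ?thesis .
      qed
      thus ?thesis .
    qed
    also have "\<dots> = (\<Sum>s\<in>T. \<Sum>t\<in>T. inner_d d (a s) (a t) * inner_d d (b s) (b t))"
      unfolding inner_d_def sum_product ..
    finally show ?thesis .
  qed
  finally show ?thesis .
qed

section \<open>Products of probability spaces\<close>

text \<open>The inner bound is asked only almost everywhere because the sign measures live on all
  real sequences and are concentrated on -1 and 1 only up to a null set.\<close>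

lemma nn_integral_pair_bound:
  assumes "prob_space P" "prob_space Q" "h \<in> borel_measurable (P \<Otimes>\<^sub>M Q)"
    and "AE x in P. (\<integral>\<^sup>+y. h (x, y) \<partial>Q) \<le> B"
  shows "(\<integral>\<^sup>+z. h z \<partial>(P \<Otimes>\<^sub>M Q)) \<le> B"
proof -
  interpret P: prob_space P by fact
  interpret Q: prob_space Q by fact
  have "(\<integral>\<^sup>+z. h z \<partial>(P \<Otimes>\<^sub>M Q)) = (\<integral>\<^sup>+x. \<integral>\<^sup>+y. h (x, y) \<partial>Q \<partial>P)"
    by (rule Q.nn_integral_fst[OF assms(3), symmetric])
  also have "\<dots> \<le> (\<integral>\<^sup>+x. B \<partial>P)" by (rule nn_integral_mono_AE[OF assms(4)])
  also have "\<dots> = B" by (simp add: P.emeasure_space_1)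
  finally show ?thesis .
qed

text \<open>Replaces labels and noise by the law of the one vector built from them, the form in
  which the sphere tails are stated.\<close>

lemma emeasure_pair_law:
  assumes "prob_space P" "prob_space Q" and f: "f \<in> measurable Q (borel_d d)"
    and g: "g \<in> borel_measurable (P \<Otimes>\<^sub>M borel_d d)"
  shows "emeasure (P \<Otimes>\<^sub>M Q) {s\<in>space (P \<Otimes>\<^sub>M Q). g (fst s, f (snd s)) > (t::real)} =
    emeasure (P \<Otimes>\<^sub>M distr Q (borel_d d) f) {z\<in>space (P \<Otimes>\<^sub>M distr Q (borel_d d) f). g z > t}"
proof -
  interpret P: prob_space P by fact
  interpret Q: prob_space Q by fact
  interpret D: prob_space "distr Q (borel_d d) f" by (rule Q.prob_space_distr[OF f])
  have pair: "P \<Otimes>\<^sub>M distr Q (borel_d d) f = distr (P \<Otimes>\<^sub>M Q) (P \<Otimes>\<^sub>M borel_d d) (\<lambda>(x, y). (x, f y))"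
    using pair_measure_distr[OF measurable_ident f, of P] D.sigma_finite_measure_axioms
    by (simp add: distr_id2 id_def)
  have m: "(\<lambda>(x, y). (x, f y)) \<in> measurable (P \<Otimes>\<^sub>M Q) (P \<Otimes>\<^sub>M borel_d d)" using f by measurable
  note [measurable] = g
  have "emeasure (P \<Otimes>\<^sub>M distr Q (borel_d d) f) {z\<in>space (P \<Otimes>\<^sub>M distr Q (borel_d d) f). g z > t} =
      emeasure (P \<Otimes>\<^sub>M Q) ((\<lambda>(x, y). (x, f y)) -` {z\<in>space (P \<Otimes>\<^sub>M borel_d d). g z > t} \<inter> space (P \<Otimes>\<^sub>M Q))"
    unfolding pair space_distr by (rule emeasure_distr[OF m]) measurable
  also have "(\<lambda>(x, y). (x, f y)) -` {z\<in>space (P \<Otimes>\<^sub>M borel_d d). g z > t} \<inter> space (P \<Otimes>\<^sub>M Q) =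
      {s\<in>space (P \<Otimes>\<^sub>M Q). g (fst s, f (snd s)) > t}"
    using measurable_space[OF m] by (auto simp: case_prod_unfold)
  finally show ?thesis by simp
qed

lemma emeasure_pair_fst_snd:
  assumes "prob_space P" "prob_space Q"
  shows "A \<in> sets P \<Longrightarrow> emeasure (P \<Otimes>\<^sub>M Q) {s\<in>space (P \<Otimes>\<^sub>M Q). fst s \<in> A} = emeasure P A"
    and "B \<in> sets Q \<Longrightarrow> emeasure (P \<Otimes>\<^sub>M Q) {s\<in>space (P \<Otimes>\<^sub>M Q). snd s \<in> B} = emeasure Q B"
proof -
  interpret P: prob_space P by fact
  interpret Q: prob_space Q by fact
  show "emeasure (P \<Otimes>\<^sub>M Q) {s\<in>space (P \<Otimes>\<^sub>M Q). fst s \<in> A} = emeasure P A" if A: "A \<in> sets P"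
  proof -
    have "{s\<in>space (P \<Otimes>\<^sub>M Q). fst s \<in> A} = A \<times> space Q"
      using sets.sets_into_space[OF A] by (auto simp: space_pair_measure)
    thus ?thesis using A by (simp add: Q.emeasure_pair_measure_Times Q.emeasure_space_1)
  qed
  show "emeasure (P \<Otimes>\<^sub>M Q) {s\<in>space (P \<Otimes>\<^sub>M Q). snd s \<in> B} = emeasure Q B" if B: "B \<in> sets Q"
  proof -
    have "{s\<in>space (P \<Otimes>\<^sub>M Q). snd s \<in> B} = space P \<times> B"
      using sets.sets_into_space[OF B] by (auto simp: space_pair_measure)
    thus ?thesis using B by (simp add: Q.emeasure_pair_measure_Times P.emeasure_space_1)
  qed
qed

lemma AE_pair_fst_snd:
  assumes "prob_space P" "prob_space Q"
  shows "AE x in P. \<phi> x \<Longrightarrow> AE s in P \<Otimes>\<^sub>M Q. \<phi> (fst s)"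
    and "AE y in Q. \<psi> y \<Longrightarrow> AE s in P \<Otimes>\<^sub>M Q. \<psi> (snd s)"
proof -
  interpret P: prob_space P by fact
  interpret Q: prob_space Q by fact
  show "AE s in P \<Otimes>\<^sub>M Q. \<phi> (fst s)" if "AE x in P. \<phi> x"
  proof -
    from that obtain A where A: "{x\<in>space P. \<not> \<phi> x} \<subseteq> A" "emeasure P A = 0" "A \<in> sets P" by (rule AE_E)
    show ?thesis
      by (rule AE_I[of _ _ "{s\<in>space (P \<Otimes>\<^sub>M Q). fst s \<in> A}"])
        (use A emeasure_pair_fst_snd(1)[OF assms A(3)] in \<open>auto simp: space_pair_measure\<close>)
  qed
  show "AE s in P \<Otimes>\<^sub>M Q. \<psi> (snd s)" if "AE y in Q. \<psi> y"
  proof -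
    from that obtain A where A: "{x\<in>space Q. \<not> \<psi> x} \<subseteq> A" "emeasure Q A = 0" "A \<in> sets Q" by (rule AE_E)
    show ?thesis
      by (rule AE_I[of _ _ "{s\<in>space (P \<Otimes>\<^sub>M Q). snd s \<in> A}"])
        (use A emeasure_pair_fst_snd(2)[OF assms A(3)] in \<open>auto simp: space_pair_measure\<close>)
  qed
qed

lemma prob_space_pair: "prob_space P \<Longrightarrow> prob_space Q \<Longrightarrow> prob_space (P \<Otimes>\<^sub>M Q)"
proof -
  assume "prob_space P" "prob_space Q"
  then interpret pair_prob_space P Q by (simp add: pair_prob_space_def pair_sigma_finite_def prob_space_imp_sigma_finite)
  show ?thesis by (rule prob_space_axioms)
qed

lemma emeasure_Un_le:
  assumes "A \<in> sets M" "B \<in> sets M" "emeasure M A \<le> ennreal a" "emeasure M B \<le> ennreal b" "0 \<le> a" "0 \<le> b"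
  shows "emeasure M (A \<union> B) \<le> ennreal (a + b)"
proof -
  have "emeasure M (A \<union> B) \<le> emeasure M A + emeasure M B" by (rule emeasure_subadditive[OF assms(1,2)])
  also have "\<dots> \<le> ennreal a + ennreal b" by (intro add_mono assms)
  finally show ?thesis using assms by simp
qed

section \<open>Noise vectors\<close>

lemma sets_gauss_d: "sets (gauss_d d Lam) = sets (borel_d d)"
  by (simp add: gauss_d_def)

lemma measurable_mat_vec_std: "mat_vec d A \<in> measurable (std_gauss d) (borel_d d)"
  unfolding measurable_cong_sets[OF sets_std_gauss refl]
  by (rule measurable_mat_vec_borel_d) (rule measurable_component_singleton, auto)

lemma prob_space_gauss_d: "prob_space (gauss_d d Lam)"
  unfolding gauss_d_def
  by (rule prob_space.prob_space_distr[OF prob_space_std_gauss measurable_mat_vec_std])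

lemma subgauss_gauss_d:
  assumes pd: "pos_def_d d Lam"
  shows "subgauss d (gauss_d d Lam) (mat_sqrt_d d Lam)"
  unfolding subgauss_def
proof (intro conjI allI prob_space_gauss_d sets_gauss_d)
  fix a
  have "(\<lambda>v. ennreal (exp (inner_d d a v))) \<in> borel_measurable (borel_d d)"
    by (intro measurable_compose[OF _ measurable_ennreal] measurable_compose[OF _ borel_measurable_exp]
        measurable_inner_d borel_measurable_const measurable_component_singleton) auto
  hence "(\<integral>\<^sup>+v. ennreal (exp (inner_d d a v)) \<partial>gauss_d d Lam) =
      (\<integral>\<^sup>+g. ennreal (exp (inner_d d a (mat_vec d (mat_sqrt_d d Lam) g))) \<partial>std_gauss d)"
    unfolding gauss_d_def by (subst nn_integral_distr[OF measurable_mat_vec_std]) simp_all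
  also have "\<dots> = (\<integral>\<^sup>+g. ennreal (exp (inner_d d (mat_vec d (mat_sqrt_d d Lam) a) g)) \<partial>std_gauss d)"
    by (simp add: bilinear_symmetric[OF mat_sqrt_d(1)[OF pd]])
  also have "\<dots> = ennreal (exp (sq_norm d (mat_vec d (mat_sqrt_d d Lam) a) / 2))" by (rule std_gauss_mgf)
  finally show "(\<integral>\<^sup>+v. ennreal (exp (inner_d d a v)) \<partial>gauss_d d Lam) \<le>
      ennreal (exp (sq_norm d (mat_vec d (mat_sqrt_d d Lam) a) / 2))" by simp
qed

abbreviation noise :: "nat \<Rightarrow> matd \<Rightarrow> nat set \<Rightarrow> (nat \<Rightarrow> vecd) measure" where
  "noise d Lam I \<equiv> PiM I (\<lambda>_. gauss_d d Lam)"

lemma prob_space_noise: "prob_space (noise d Lam I)"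
  by (intro prob_space_PiM prob_space_gauss_d)

lemma product_sigma_finite_gauss: "product_sigma_finite (\<lambda>_::nat. gauss_d d Lam)"
  using prob_space_gauss_d by (simp add: product_sigma_finite_def prob_space_imp_sigma_finite)

lemma measurable_noise_nth:
  "i \<in> I \<Longrightarrow> k < d \<Longrightarrow> (\<lambda>z. z i k) \<in> borel_measurable (noise d Lam I)"
  by (rule measurable_nth_borel_d[OF sets_gauss_d]) (rule measurable_component_singleton, auto)

text \<open>The restriction places the value in the space of \<open>borel_d\<close>, so that its law
  can be formed.\<close>

definition comb :: "nat \<Rightarrow> nat set \<Rightarrow> (nat \<Rightarrow> real) \<Rightarrow> (nat \<Rightarrow> vecd) \<Rightarrow> vecd" where
  "comb d I c z = restrict (\<lambda>k. \<Sum>i\<in>I. c i * z i k) {..<d}"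

lemma inner_comb: "inner_d d a (comb d I c z) = (\<Sum>i\<in>I. c i * inner_d d a (z i))"
proof -
  have "inner_d d a (comb d I c z) = inner_d d (\<lambda>k. \<Sum>i\<in>I. c i * z i k) a"
    by (subst inner_d_commute) (rule inner_d_cong, simp_all add: comb_def)
  also have "\<dots> = (\<Sum>i\<in>I. c i * inner_d d (z i) a)"
    unfolding inner_d_sum_left by (intro sum.cong refl inner_d_scale_left)
  finally show ?thesis by (simp add: inner_d_commute)
qed

lemma noise_comb_mgf:
  assumes pd: "pos_def_d d Lam" and I: "finite I"
  shows "(\<integral>\<^sup>+z. ennreal (exp (inner_d d a (comb d I c z))) \<partial>noise d Lam I) \<le>
    ennreal (exp ((\<Sum>i\<in>I. (c i)\<^sup>2) * sq_norm d (mat_vec d (mat_sqrt_d d Lam) a) / 2))"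
proof -
  interpret product_sigma_finite "\<lambda>_::nat. gauss_d d Lam" by (rule product_sigma_finite_gauss)
  let ?S = "mat_sqrt_d d Lam"
  have m: "(\<lambda>v. ennreal (exp (c i * inner_d d a v))) \<in> borel_measurable (gauss_d d Lam)" for i
    unfolding measurable_cong_sets[OF sets_gauss_d refl]
    by (intro measurable_compose[OF _ measurable_ennreal] measurable_compose[OF _ borel_measurable_exp]
        borel_measurable_times measurable_inner_d borel_measurable_const measurable_component_singleton) auto
  have "(\<integral>\<^sup>+z. ennreal (exp (inner_d d a (comb d I c z))) \<partial>noise d Lam I) =
      (\<integral>\<^sup>+z. (\<Prod>i\<in>I. ennreal (exp (c i * inner_d d a (z i)))) \<partial>noise d Lam I)"
    using I by (simp add: inner_comb exp_sum prod_ennreal)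
  also have "\<dots> = (\<Prod>i\<in>I. \<integral>\<^sup>+v. ennreal (exp (c i * inner_d d a v)) \<partial>gauss_d d Lam)"
    by (rule product_nn_integral_prod[OF I m])
  also have "\<dots> \<le> (\<Prod>i\<in>I. ennreal (exp ((c i)\<^sup>2 * sq_norm d (mat_vec d ?S a) / 2)))"
  proof (rule prod_mono_ennreal)
    fix i
    have "(\<integral>\<^sup>+v. ennreal (exp (c i * inner_d d a v)) \<partial>gauss_d d Lam) \<le>
        ennreal (exp (sq_norm d (mat_vec d ?S (\<lambda>k. c i * a k)) / 2))"
      using subgaussD(3)[OF subgauss_gauss_d[OF pd], of "\<lambda>k. c i * a k"] by (simp only: inner_d_scale_left)
    also have "sq_norm d (mat_vec d ?S (\<lambda>k. c i * a k)) = (c i)\<^sup>2 * sq_norm d (mat_vec d ?S a)"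
      unfolding sq_norm_scale[symmetric] by (rule sq_norm_cong) (simp only: mat_vec_scale)
    finally show "(\<integral>\<^sup>+v. ennreal (exp (c i * inner_d d a v)) \<partial>gauss_d d Lam) \<le>
        ennreal (exp ((c i)\<^sup>2 * sq_norm d (mat_vec d ?S a) / 2))" .
  qed
  also have "\<dots> = ennreal (exp ((\<Sum>i\<in>I. (c i)\<^sup>2) * sq_norm d (mat_vec d ?S a) / 2))"
    using I by (simp add: prod_ennreal exp_sum[symmetric] sum_distrib_right sum_divide_distrib)
  finally show ?thesis .
qed

text \<open>Both vectors come from one noise family, but \<open>j \<notin> I\<close> makes them
  independent. The coordinate \<open>j\<close> is held fixed while the others are integrated.
  Keeping the sum of the \<open>(c i)^2\<close> explicit preserves the gain from averaging, the
  source of \<open>M^{1/2}\<close> in the final bound.\<close>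

lemma noise_bilinear_mgf:
  assumes pd: "pos_def_d d Lam" and I: "finite I" "j \<notin> I"
    and fr: "(\<Sum>i\<in>I. (c i)\<^sup>2) * b\<^sup>2 * frob_sq d (mat_mult_d d (mat_mult_d d (mat_sqrt_d d Lam) A) (mat_sqrt_d d Lam)) \<le> 1/4"
  shows "(\<integral>\<^sup>+z. ennreal (exp (inner_d d (comb d I c z) (mat_vec d A (comb d {j} (\<lambda>_. b) z)))) \<partial>noise d Lam (insert j I)) \<le> 2"
proof -
  interpret product_sigma_finite "\<lambda>_::nat. gauss_d d Lam" by (rule product_sigma_finite_gauss)
  let ?S = "mat_sqrt_d d Lam"
  define s where "s = sqrt (\<Sum>i\<in>I. (c i)\<^sup>2)"
  have s2: "s\<^sup>2 = (\<Sum>i\<in>I. (c i)\<^sup>2)" by (simp add: s_def sum_nonneg)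
  define A' where "A' = (\<lambda>i k. (s * b) * mat_mult_d d ?S A i k)"
  have cj: "mat_vec d A (comb d {j} (\<lambda>_. b) z) k = b * mat_vec d A (z j) k" if "k < d" for z k
  proof -
    have "mat_vec d A (comb d {j} (\<lambda>_. b) z) = mat_vec d A (\<lambda>l. b * z j l)"
      by (rule mat_vec_cong) (simp add: comb_def)
    thus ?thesis using that by (simp only: mat_vec_scale)
  qed
  have eqn: "inner_d d (comb d I c z) (mat_vec d A (comb d {j} (\<lambda>_. b) z)) =
      inner_d d (\<lambda>k. b * mat_vec d A (z j) k) (comb d I c z)" for z
    unfolding inner_d_commute[of d "comb d I c z"] by (rule inner_d_cong) (simp_all only: cj)
  have "(\<lambda>z. ennreal (exp (inner_d d (\<lambda>k. b * mat_vec d A (z j) k) (comb d I c z)))) \<in> borel_measurable (noise d Lam (insert j I))"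
    by (intro measurable_compose[OF _ measurable_ennreal] measurable_compose[OF _ borel_measurable_exp]
        measurable_inner_d borel_measurable_times borel_measurable_const measurable_mat_vec measurable_noise_nth)
      (auto simp: comb_def intro!: borel_measurable_sum borel_measurable_times measurable_noise_nth)
  hence "(\<integral>\<^sup>+z. ennreal (exp (inner_d d (\<lambda>k. b * mat_vec d A (z j) k) (comb d I c z))) \<partial>noise d Lam (insert j I)) =
      (\<integral>\<^sup>+y. \<integral>\<^sup>+x. ennreal (exp (inner_d d (\<lambda>k. b * mat_vec d A ((x(j := y)) j) k) (comb d I c (x(j := y))))) \<partial>noise d Lam I \<partial>gauss_d d Lam)"
    by (rule product_nn_integral_insert_rev[OF I])
  also have "\<dots> = (\<integral>\<^sup>+y. \<integral>\<^sup>+x. ennreal (exp (inner_d d (\<lambda>k. b * mat_vec d A y k) (comb d I c x))) \<partial>noise d Lam I \<partial>gauss_d d Lam)"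
  proof -
    have "comb d I c (x(j := y)) = comb d I c x" for x y
      unfolding comb_def using I(2) by (intro restrict_ext sum.cong) auto
    thus ?thesis by simp
  qed
  also have "\<dots> \<le> (\<integral>\<^sup>+y. ennreal (exp (sq_norm d (mat_vec d A' y) / 2)) \<partial>gauss_d d Lam)"
  proof (rule nn_integral_mono)
    fix y
    have "s\<^sup>2 * sq_norm d (mat_vec d ?S (\<lambda>k. b * mat_vec d A y k)) = sq_norm d (mat_vec d A' y)"
    proof -
      have "mat_vec d A' y k = (s * b) * mat_vec d (mat_mult_d d ?S A) y k" if "k < d" for k
        using that by (simp add: A'_def mat_vec_nth sum_distrib_left mult_ac)
      hence "sq_norm d (mat_vec d A' y) = (s * b)\<^sup>2 * sq_norm d (mat_vec d (mat_mult_d d ?S A) y)"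
        unfolding sq_norm_scale[symmetric] by (rule sq_norm_cong)
      moreover have "sq_norm d (mat_vec d ?S (\<lambda>k. b * mat_vec d A y k)) = b\<^sup>2 * sq_norm d (mat_vec d ?S (mat_vec d A y))"
        unfolding sq_norm_scale[symmetric] by (rule sq_norm_cong) (simp only: mat_vec_scale)
      ultimately show ?thesis by (simp add: mat_vec_mult power_mult_distrib)
    qed
    thus "(\<integral>\<^sup>+x. ennreal (exp (inner_d d (\<lambda>k. b * mat_vec d A y k) (comb d I c x))) \<partial>noise d Lam I) \<le>
        ennreal (exp (sq_norm d (mat_vec d A' y) / 2))"
      using noise_comb_mgf[OF pd I(1), of "\<lambda>k. b * mat_vec d A y k" c] by (simp add: s2)
  qed
  also have "\<dots> \<le> 2"
  proof (rule subgauss_exp_sq_norm[OF subgauss_gauss_d[OF pd] mat_sqrt_d(1)[OF pd]])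
    have "mat_mult_d d A' ?S = (\<lambda>i k. (s * b) * mat_mult_d d (mat_mult_d d ?S A) ?S i k)"
      unfolding mat_mult_d_def[of d A'] mat_mult_d_def[of d "mat_mult_d d ?S A"]
      unfolding A'_def sum_distrib_left by (simp add: mult.assoc)
    thus "frob_sq d (mat_mult_d d A' ?S) \<le> 1 / 4"
      using fr by (simp add: frob_sq_scale power_mult_distrib s2)
  qed
  finally show ?thesis unfolding eqn .
qed

lemma noise_bilinear_tail:
  assumes pd: "pos_def_d d Lam" and I: "finite I" "j \<notin> I"
    and fr: "(\<Sum>i\<in>I. (c i)\<^sup>2) * b\<^sup>2 * frob_sq d (mat_mult_d d (mat_mult_d d (mat_sqrt_d d Lam) A) (mat_sqrt_d d Lam)) \<le> 1/4"
  shows "emeasure (noise d Lam (insert j I)) {z\<in>space (noise d Lam (insert j I)).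
      \<bar>inner_d d (comb d I c z) (mat_vec d A (comb d {j} (\<lambda>_. b) z))\<bar> > t} \<le> ennreal (4 * exp (- t))"
proof (rule markov_exp_tail_abs)
  show "(\<lambda>z. inner_d d (comb d I c z) (mat_vec d A (comb d {j} (\<lambda>_. b) z))) \<in> borel_measurable (noise d Lam (insert j I))"
    by (intro measurable_inner_d measurable_mat_vec)
      (auto simp: comb_def intro!: borel_measurable_sum borel_measurable_times measurable_noise_nth)
  show "(\<integral>\<^sup>+z. ennreal (exp (inner_d d (comb d I c z) (mat_vec d A (comb d {j} (\<lambda>_. b) z)))) \<partial>noise d Lam (insert j I)) \<le> 2"
    by (rule noise_bilinear_mgf[OF pd I fr])
  have "comb d {j} (\<lambda>_. - b) z k = - comb d {j} (\<lambda>_. b) z k" if "k < d" for z k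
    using that by (simp add: comb_def)
  hence "- inner_d d (comb d I c z) (mat_vec d A (comb d {j} (\<lambda>_. b) z)) =
      inner_d d (comb d I c z) (mat_vec d A (comb d {j} (\<lambda>_. - b) z))" for z
    by (simp add: bilinear_d sum_negf)
  thus "(\<integral>\<^sup>+z. ennreal (exp (- inner_d d (comb d I c z) (mat_vec d A (comb d {j} (\<lambda>_. b) z)))) \<partial>noise d Lam (insert j I)) \<le> 2"
    using noise_bilinear_mgf[OF pd I, of c "- b" A] fr by simp
qed

text \<open>Coefficients are padded by zeros so that context and query vectors, which use different
  indices of the same family, share one covariance bound.\<close>

lemma noise_comb_mgf_subset:
  assumes pd: "pos_def_d d Lam" and I: "finite I" "J \<subseteq> I" and c: "(\<Sum>i\<in>J. (c i)\<^sup>2) \<le> 1"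
  shows "(\<integral>\<^sup>+z. ennreal (exp (inner_d d a (comb d J c z))) \<partial>noise d Lam I) \<le>
    ennreal (exp (sq_norm d (mat_vec d (mat_sqrt_d d Lam) a) / 2))"
proof -
  let ?c = "\<lambda>i. if i \<in> J then c i else 0"
  have "comb d J c z = comb d I ?c z" for z
    unfolding comb_def
    by (intro restrict_ext) (rule sum.mono_neutral_cong_left[OF I], auto)
  hence "(\<integral>\<^sup>+z. ennreal (exp (inner_d d a (comb d J c z))) \<partial>noise d Lam I) \<le>
      ennreal (exp ((\<Sum>i\<in>I. (?c i)\<^sup>2) * sq_norm d (mat_vec d (mat_sqrt_d d Lam) a) / 2))"
    using noise_comb_mgf[OF pd I(1), of a ?c] by simp
  also have "(\<Sum>i\<in>I. (?c i)\<^sup>2) = (\<Sum>i\<in>J. (c i)\<^sup>2)"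
    by (rule sum.mono_neutral_cong_right[OF I]) auto
  also have "ennreal (exp ((\<Sum>i\<in>J. (c i)\<^sup>2) * sq_norm d (mat_vec d (mat_sqrt_d d Lam) a) / 2)) \<le>
      ennreal (exp (sq_norm d (mat_vec d (mat_sqrt_d d Lam) a) / 2))"
    using mult_right_mono[OF c, of "sq_norm d (mat_vec d (mat_sqrt_d d Lam) a)"] by (intro ennreal_leI) simp
  finally show ?thesis .
qed

section \<open>Random signs\<close>

lemma prob_space_rademacher: "prob_space rademacher"
  unfolding rademacher_def by (rule prob_space_measure_pmf)

lemma AE_rademacher: "AE y in rademacher. y \<in> {-1, 1}"
  unfolding rademacher_def by (simp add: AE_measure_pmf_iff set_pmf_of_set)

abbreviation signs :: "nat set \<Rightarrow> (nat \<Rightarrow> real) measure" where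
  "signs I \<equiv> PiM I (\<lambda>_. rademacher)"

lemma prob_space_signs: "prob_space (signs I)"
  by (intro prob_space_PiM prob_space_rademacher)

lemma AE_signs:
  assumes "finite I"
  shows "AE y in signs I. \<forall>i\<in>I. y i \<in> {-1, 1}"
  using assms by (intro AE_finite_allI AE_PiM_component prob_space_rademacher AE_rademacher)

lemma measurable_signs_nth: "i \<in> I \<Longrightarrow> (\<lambda>y. y i) \<in> borel_measurable (signs I)"
proof -
  assume i: "i \<in> I"
  have "(\<lambda>y. y i) \<in> measurable (signs I) rademacher" by (rule measurable_component_singleton[OF i])
  from measurable_compose[OF this, of "\<lambda>x. x"] show ?thesis by (simp add: rademacher_def)
qed

section \<open>Label flips\<close>

abbreviation flips :: "nat set \<Rightarrow> real \<Rightarrow> (nat \<Rightarrow> bool) measure" where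
  "flips I p \<equiv> PiM I (\<lambda>_. measure_pmf (bernoulli_pmf p))"

definition flip_sign :: "bool \<Rightarrow> real" where "flip_sign b = (if b then -1 else 1)"

lemma prob_space_flips: "prob_space (flips I p)"
  by (intro prob_space_PiM prob_space_measure_pmf)

lemma measurable_flips_nth:
  "i \<in> I \<Longrightarrow> (\<lambda>f. f i) \<in> measurable (flips I p) (count_space UNIV)"
proof -
  assume i: "i \<in> I"
  have "(\<lambda>f. f i) \<in> measurable (flips I p) (measure_pmf (bernoulli_pmf p))" by (rule measurable_component_singleton[OF i])
  thus ?thesis by (simp add: measurable_cong_sets)
qed

text \<open>For \<open>x = - y\<close> negative, it suffices that
  \<open>(1 - y + y^2) exp y \<ge> 1\<close>; with the quadratic Taylor minorant of
  \<open>exp y\<close> the product is 1 plus nonnegative terms.\<close>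

lemma exp_le_quadratic:
  assumes "\<bar>x::real\<bar> \<le> 1"
  shows "exp x \<le> 1 + x + x\<^sup>2"
proof (cases "x \<ge> 0")
  case True thus ?thesis using assms by (intro exp_bound) auto
next
  case False
  define y where "y = - x"
  have y: "0 \<le> y" "y \<le> 1" using False assms by (auto simp: y_def)
  have pos: "1 + y + y\<^sup>2 / 2 > 0" using y by (simp add: add_pos_nonneg)
  have "1 \<le> (1 - y + y\<^sup>2) * (1 + y + y\<^sup>2 / 2)"
  proof -
    have "(1 - y + y\<^sup>2) * (1 + y + y\<^sup>2 / 2) = 1 + (y\<^sup>2 + y^3 + y^4) / 2"
      by (simp add: power2_eq_square power3_eq_cube power4_eq_xxxx field_simps)
    thus ?thesis using y by simp
  qed
  also have "\<dots> \<le> (1 - y + y\<^sup>2) * exp y"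
    using y exp_lower_Taylor_quadratic[OF y(1)] by (intro mult_left_mono) (auto simp: add_nonneg_nonneg)
  finally have "exp (- y) * 1 \<le> exp (- y) * ((1 - y + y\<^sup>2) * exp y)" by (intro mult_left_mono) auto
  also have "\<dots> = 1 - y + y\<^sup>2" by (simp add: exp_minus)
  finally show ?thesis by (simp add: y_def)
qed

text \<open>Chernoff bound. The flip sign has mean \<open>2 c_p\<close>, so the threshold
  \<open>c_p\<close> is half the mean. With parameter \<open>c_p / 2\<close> one factor is at most
  \<open>1 - c_p^2 + c_p^2 / 4\<close>, and the threshold adds \<open>c_p^2 / 2\<close> to the
  exponent, leaving \<open>- c_p^2 / 4\<close> per index.\<close>

lemma flips_mean_tail:
  assumes cp: "0 < c_p" "c_p \<le> 1/2" and J: "finite I" "J \<subseteq> I"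
  shows "emeasure (flips I (1/2 - c_p)) {f\<in>space (flips I (1/2 - c_p)). (\<Sum>i\<in>J. flip_sign (f i)) < real (card J) * c_p}
    \<le> ennreal (exp (- (c_p\<^sup>2 / 4) * real (card J)))"
proof -
  let ?p = "1/2 - c_p" and ?l = "c_p / 2"
  interpret product_sigma_finite "\<lambda>_::nat. measure_pmf (bernoulli_pmf ?p)"
    by (simp add: product_sigma_finite_def measure_pmf.sigma_finite_measure_axioms)
  have fJ: "finite J" using J by (rule finite_subset[rotated])
  have m [measurable]: "(\<lambda>f. flip_sign (f i)) \<in> borel_measurable (flips I ?p)" if "i \<in> J" for i
    by (rule measurable_compose[OF measurable_flips_nth]) (use that J in auto)
  have sm [measurable]: "(\<lambda>f. \<Sum>i\<in>J. flip_sign (f i)) \<in> borel_measurable (flips I ?p)"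
    by (intro borel_measurable_sum m)
  let ?h = "\<lambda>i b. if i \<in> J then ennreal (exp (- ?l * flip_sign b)) else 1"
  have one: "(\<integral>\<^sup>+b. ?h i b \<partial>measure_pmf (bernoulli_pmf ?p)) \<le> (if i \<in> J then ennreal (exp (- (3/4) * c_p\<^sup>2)) else 1)" for i
  proof (cases "i \<in> J")
    case True
    have "(\<integral>\<^sup>+b. ?h i b \<partial>measure_pmf (bernoulli_pmf ?p)) = ennreal (exp ?l * ?p + exp (- ?l) * (1 - ?p))"
      using True cp by (subst nn_integral_bernoulli_pmf)
        (auto simp: flip_sign_def ennreal_mult''[symmetric] ennreal_plus[symmetric] simp del: ennreal_plus)
    also have "exp ?l * ?p + exp (- ?l) * (1 - ?p) \<le> (1 + ?l + ?l\<^sup>2) * ?p + (1 + (- ?l) + (- ?l)\<^sup>2) * (1 - ?p)"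
      using cp by (intro add_mono mult_right_mono exp_le_quadratic) auto
    also have "\<dots> = 1 + (- (3/4) * c_p\<^sup>2)" by (simp add: power2_eq_square field_simps)
    also have "\<dots> \<le> exp (- (3/4) * c_p\<^sup>2)" by (rule exp_ge_add_one_self)
    finally show ?thesis using True by (simp add: ennreal_leI)
  qed (simp add: measure_pmf.emeasure_space_1[simplified])
  have "emeasure (flips I ?p) {f\<in>space (flips I ?p). (\<Sum>i\<in>J. flip_sign (f i)) < real (card J) * c_p} \<le>
      (\<integral>\<^sup>+f. ennreal (exp (?l * (real (card J) * c_p))) * ennreal (exp (- ?l * (\<Sum>i\<in>J. flip_sign (f i)))) \<partial>flips I ?p)"
  proof (subst nn_integral_indicator[symmetric], measurable, intro nn_integral_mono)
    fix f
    have "ennreal (exp (?l * (real (card J) * c_p))) * ennreal (exp (- ?l * (\<Sum>i\<in>J. flip_sign (f i)))) =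
        ennreal (exp (?l * (real (card J) * c_p - (\<Sum>i\<in>J. flip_sign (f i)))))"
      by (simp add: ennreal_mult''[symmetric] exp_add[symmetric] algebra_simps diff_divide_distrib)
    moreover have "exp (?l * (real (card J) * c_p - (\<Sum>i\<in>J. flip_sign (f i)))) \<ge> 1"
      if "(\<Sum>i\<in>J. flip_sign (f i)) < real (card J) * c_p"
      using that cp by simp
    ultimately show "indicator {f\<in>space (flips I ?p). (\<Sum>i\<in>J. flip_sign (f i)) < real (card J) * c_p} f \<le>
        ennreal (exp (?l * (real (card J) * c_p))) * ennreal (exp (- ?l * (\<Sum>i\<in>J. flip_sign (f i))))"
      by (auto simp: indicator_def)
  qed
  also have "\<dots> = ennreal (exp (?l * (real (card J) * c_p))) * (\<integral>\<^sup>+f. ennreal (exp (- ?l * (\<Sum>i\<in>J. flip_sign (f i)))) \<partial>flips I ?p)"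
    by (rule nn_integral_cmult) measurable
  also have "(\<integral>\<^sup>+f. ennreal (exp (- ?l * (\<Sum>i\<in>J. flip_sign (f i)))) \<partial>flips I ?p) = (\<integral>\<^sup>+f. (\<Prod>i\<in>I. ?h i (f i)) \<partial>flips I ?p)"
  proof (intro nn_integral_cong)
    fix f :: "nat \<Rightarrow> bool"
    have "(\<Prod>i\<in>I. ?h i (f i)) = (\<Prod>i\<in>J. ennreal (exp (- ?l * flip_sign (f i))))"
      using J by (simp add: prod.inter_restrict[symmetric] Int_absorb1)
    also have "\<dots> = ennreal (exp (- ?l * (\<Sum>i\<in>J. flip_sign (f i))))"
      using fJ by (simp add: prod_ennreal exp_sum[symmetric] sum_distrib_left)
    finally show "ennreal (exp (- ?l * (\<Sum>i\<in>J. flip_sign (f i)))) = (\<Prod>i\<in>I. ?h i (f i))" ..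
  qed
  also have "\<dots> = (\<Prod>i\<in>I. \<integral>\<^sup>+b. ?h i b \<partial>measure_pmf (bernoulli_pmf ?p))"
    by (rule product_nn_integral_prod[OF J(1)]) simp
  also have "\<dots> \<le> (\<Prod>i\<in>I. if i \<in> J then ennreal (exp (- (3/4) * c_p\<^sup>2)) else 1)"
    by (intro prod_mono_ennreal one)
  also have "\<dots> = ennreal (exp (- (3/4) * c_p\<^sup>2)) ^ card J"
    using J by (simp add: prod.inter_restrict[symmetric] Int_absorb1)
  also have "ennreal (exp (?l * (real (card J) * c_p))) * ennreal (exp (- (3/4) * c_p\<^sup>2)) ^ card J =
      ennreal (exp (- (c_p\<^sup>2 / 4) * real (card J)))"
    by (simp add: ennreal_power ennreal_mult''[symmetric] exp_of_nat_mult[symmetric] exp_add[symmetric])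
      (simp add: power2_eq_square field_simps)
  finally show ?thesis by (simp add: mult_left_mono)
qed

text \<open>For \<open>p > 0\<close> this is a union bound over the query flip and the context
  average. For \<open>p = 0\<close> almost surely no label flips, the average is 1, and the event is
  null; this is the origin of the indicator in the theorem.\<close>

lemma bad_flips_bound:
  assumes cp: "0 < c_p" "c_p \<le> 1/2" and M: "M \<ge> 1"
  defines "p \<equiv> 1/2 - c_p"
  defines "Fl \<equiv> flips {1..M+1} p"
  defines "Bad \<equiv> {f\<in>space Fl. f (M+1)} \<union> {f\<in>space Fl. (\<Sum>i\<in>{1..M}. flip_sign (f i)) < real (card {1..M}) * c_p}"
  shows "Bad \<in> sets Fl" "emeasure Fl Bad \<le> ennreal ((p + exp (- (c_p\<^sup>2 / 4) * real M)) * (if p > 0 then 1 else 0))"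
proof -
  have nth [measurable]: "(\<lambda>f. f i) \<in> measurable Fl (count_space UNIV)" if "i \<in> {1..M+1}" for i
    unfolding Fl_def by (rule measurable_flips_nth[OF that])
  have [measurable]: "(\<lambda>f. \<Sum>i\<in>{1..M}. flip_sign (f i)) \<in> borel_measurable Fl"
    by (intro borel_measurable_sum measurable_compose[OF nth]) auto
  have [measurable]: "(\<lambda>f. f (M+1)) \<in> measurable Fl (count_space UNIV)" by (rule nth) simp
  have s1: "{f\<in>space Fl. f (M+1)} \<in> sets Fl" by measurable
  have s2: "{f\<in>space Fl. (\<Sum>i\<in>{1..M}. flip_sign (f i)) < real (card {1..M}) * c_p} \<in> sets Fl" by measurable
  show "Bad \<in> sets Fl" unfolding Bad_def by (intro sets.Un s1 s2)
  have p01: "0 \<le> p" "p \<le> 1" using cp by (auto simp: p_def)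
  show "emeasure Fl Bad \<le> ennreal ((p + exp (- (c_p\<^sup>2 / 4) * real M)) * (if p > 0 then 1 else 0))"
  proof (cases "p > 0")
    case True
    have "emeasure Fl {f\<in>space Fl. f (M+1)} = emeasure (distr Fl (measure_pmf (bernoulli_pmf p)) (\<lambda>f. f (M+1))) {True}"
      by (subst emeasure_distr) (auto simp: measurable_cong_sets intro!: arg_cong[of _ _ "emeasure Fl"])
    also have "distr Fl (measure_pmf (bernoulli_pmf p)) (\<lambda>f. f (M+1)) = measure_pmf (bernoulli_pmf p)"
      unfolding Fl_def by (rule distr_PiM_component) (auto intro: prob_space_measure_pmf)
    also have "emeasure (measure_pmf (bernoulli_pmf p)) {True} = ennreal p"
      using p01 by (simp add: emeasure_pmf_single)
    finally have 1: "emeasure Fl {f\<in>space Fl. f (M+1)} \<le> ennreal p" by simp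
    have 2: "emeasure Fl {f\<in>space Fl. (\<Sum>i\<in>{1..M}. flip_sign (f i)) < real (card {1..M}) * c_p}
        \<le> ennreal (exp (- (c_p\<^sup>2 / 4) * real M))"
      using flips_mean_tail[OF cp, of "{1..M+1}" "{1..M}"] unfolding Fl_def p_def by (simp del: sum.cl_ivl_Suc)
    show ?thesis unfolding Bad_def using emeasure_Un_le[OF s1 s2 1 2] p01 True by simp
  next
    case False
    hence p0: "p = 0" using p01 by simp
    have "AE f in Fl. \<forall>i\<in>{1..M+1}. \<not> f i"
      unfolding Fl_def p0
      by (intro AE_finite_allI AE_PiM_component prob_space_measure_pmf) (auto simp: AE_measure_pmf_iff set_pmf_iff)
    hence "AE f in Fl. f \<notin> Bad"
    proof (rule AE_mp, intro AE_I2 impI)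
      fix f assume f: "\<forall>i\<in>{1..M+1}. \<not> f i"
      hence "(\<Sum>i\<in>{1..M}. flip_sign (f i)) = (\<Sum>i\<in>{1..M}. 1)" by (intro sum.cong) (auto simp: flip_sign_def)
      hence "real (card {1..M}) * c_p \<le> (\<Sum>i\<in>{1..M}. flip_sign (f i))"
        using mult_left_mono[OF cp(2), of "real M"] by simp
      thus "f \<notin> Bad" using f unfolding Bad_def by auto
    qed
    hence "emeasure Fl Bad = 0" using \<open>Bad \<in> sets Fl\<close> by (subst (asm) AE_iff_null_sets[symmetric]) auto
    thus ?thesis by simp
  qed
qed

section \<open>Test error of a fixed parameter matrix\<close>

type_synonym test_noise = "(nat \<Rightarrow> real) \<times> (nat \<Rightarrow> bool) \<times> (nat \<Rightarrow> vecd)"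

definition test_noise_measure :: "nat \<Rightarrow> matd \<Rightarrow> real \<Rightarrow> nat \<Rightarrow> test_noise measure" where
  "test_noise_measure d Lam p M =
     signs {1..M+1} \<Otimes>\<^sub>M (flips {1..M+1} p \<Otimes>\<^sub>M noise d Lam {1..M+1})"

text \<open>Since squared labels are 1, the context mean is \<open>mean_flip\<close> times the class
  mean plus this vector. Likewise \<open>query_noise\<close> is the noise of the query after
  multiplication by its clean label.\<close>

definition ctx_noise :: "nat \<Rightarrow> nat \<Rightarrow> test_noise \<Rightarrow> vecd" where
  "ctx_noise d M q = (case q of (yt, fl, z) \<Rightarrow> comb d {1..M} (\<lambda>i. flip_sign (fl i) * yt i / real M) z)"

definition query_noise :: "nat \<Rightarrow> nat \<Rightarrow> test_noise \<Rightarrow> vecd" where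
  "query_noise d M q = (case q of (yt, fl, z) \<Rightarrow> comb d {M+1} (\<lambda>_. yt (M+1)) z)"

definition mean_flip :: "nat \<Rightarrow> test_noise \<Rightarrow> real" where
  "mean_flip M q = (\<Sum>i=1..M. flip_sign (fst (snd q) i)) / real M"

lemma test_measure_eq: "test_measure d Lam Rt p M = sphere_unif d Rt \<Otimes>\<^sub>M test_noise_measure d Lam p M"
  by (simp add: test_measure_def test_noise_measure_def)

lemma prob_space_test_noise: "prob_space (test_noise_measure d Lam p M)"
  unfolding test_noise_measure_def
  by (intro prob_space_pair prob_space_signs prob_space_flips prob_space_noise)

lemma prob_space_test: "prob_space (test_measure d Lam Rt p M)"
  unfolding test_measure_eq by (intro prob_space_pair prob_space_sphere_unif prob_space_test_noise)

lemma measurable_test_noise_components: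
  "i \<in> {1..M+1} \<Longrightarrow> (\<lambda>q. fst q i) \<in> borel_measurable (test_noise_measure d Lam p M)"
  "i \<in> {1..M+1} \<Longrightarrow> (\<lambda>q. fst (snd q) i) \<in> measurable (test_noise_measure d Lam p M) (count_space UNIV)"
  "i \<in> {1..M+1} \<Longrightarrow> k < d \<Longrightarrow> (\<lambda>q. snd (snd q) i k) \<in> borel_measurable (test_noise_measure d Lam p M)"
  unfolding test_noise_measure_def
  by (rule measurable_compose[OF measurable_fst measurable_signs_nth], assumption)
    (rule measurable_compose[OF measurable_compose[OF measurable_snd measurable_fst] measurable_flips_nth], assumption,
     rule measurable_compose[OF measurable_compose[OF measurable_snd measurable_snd] measurable_noise_nth])

lemma measurable_flip_sign:
  "i \<in> {1..M+1} \<Longrightarrow> (\<lambda>q. flip_sign (fst (snd q) i)) \<in> borel_measurable (test_noise_measure d Lam p M)"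
  by (rule measurable_compose[OF measurable_test_noise_components(2)]) auto

lemma measurable_ctx_noise: "ctx_noise d M \<in> measurable (test_noise_measure d Lam p M) (borel_d d)"
  unfolding ctx_noise_def case_prod_unfold comb_def
  by (intro measurable_restrict_borel_d borel_measurable_sum borel_measurable_times borel_measurable_divide
      borel_measurable_const measurable_flip_sign measurable_test_noise_components) auto

lemma measurable_query_noise: "query_noise d M \<in> measurable (test_noise_measure d Lam p M) (borel_d d)"
  unfolding query_noise_def case_prod_unfold comb_def
  by (intro measurable_restrict_borel_d borel_measurable_sum borel_measurable_times
      measurable_test_noise_components) auto

text \<open>Conditioning on labels and flips: any bound that is uniform over all sign patterns
  survives integration.\<close>

lemma test_noise_integral_bound:
  assumes h: "h \<in> borel_measurable (test_noise_measure d Lam p M)"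
    and bnd: "\<And>yt fl. (\<forall>i\<in>{1..M+1}. yt i \<in> {-1, 1}) \<Longrightarrow> (\<integral>\<^sup>+z. h (yt, fl, z) \<partial>noise d Lam {1..M+1}) \<le> B"
  shows "(\<integral>\<^sup>+q. h q \<partial>test_noise_measure d Lam p M) \<le> B"
  unfolding test_noise_measure_def
proof (rule nn_integral_pair_bound)
  note h' = h[unfolded test_noise_measure_def]
  show "prob_space (signs {1..M+1})" "prob_space (flips {1..M+1} p \<Otimes>\<^sub>M noise d Lam {1..M+1})"
    by (intro prob_space_pair prob_space_signs prob_space_flips prob_space_noise)+
  show "h \<in> borel_measurable (signs {1..M+1} \<Otimes>\<^sub>M (flips {1..M+1} p \<Otimes>\<^sub>M noise d Lam {1..M+1}))" by (rule h')
  have "AE yt in signs {1..M+1}. yt \<in> space (signs {1..M+1}) \<and> (\<forall>i\<in>{1..M+1}. yt i \<in> {-1, 1})"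
    using AE_signs[of "{1..M+1}"] by (auto intro: AE_conjI AE_space)
  thus "AE yt in signs {1..M+1}. (\<integral>\<^sup>+y. h (yt, y) \<partial>(flips {1..M+1} p \<Otimes>\<^sub>M noise d Lam {1..M+1})) \<le> B"
  proof (rule AE_mp, intro AE_I2 impI)
    fix yt assume yt: "yt \<in> space (signs {1..M+1}) \<and> (\<forall>i\<in>{1..M+1}. yt i \<in> {-1, 1})"
    show "(\<integral>\<^sup>+y. h (yt, y) \<partial>(flips {1..M+1} p \<Otimes>\<^sub>M noise d Lam {1..M+1})) \<le> B"
    proof (rule nn_integral_pair_bound[OF prob_space_flips prob_space_noise])
      show "(\<lambda>y. h (yt, y)) \<in> borel_measurable (flips {1..M+1} p \<Otimes>\<^sub>M noise d Lam {1..M+1})"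
        by (rule measurable_compose[OF measurable_Pair1' h']) (use yt in auto)
      show "AE fl in flips {1..M+1} p. (\<integral>\<^sup>+z. h (yt, fl, z) \<partial>noise d Lam {1..M+1}) \<le> B"
        by (rule AE_I2) (use bnd yt in blast)
    qed
  qed
qed

lemma sign_sq:
  assumes "\<forall>i\<in>I. y i \<in> {-1, 1::real}" "i \<in> I"
  shows "(y i)\<^sup>2 = 1"
proof -
  have "y i \<in> {-1, 1}" using assms by blast
  thus ?thesis by auto
qed

lemma flip_sign_cases: "flip_sign b \<in> {-1, 1}" "(flip_sign b)\<^sup>2 = 1" "\<bar>flip_sign b\<bar> = 1"
  by (auto simp: flip_sign_def)

lemma ctx_coeff_sq_sum:
  assumes "\<forall>i\<in>{1..M+1}. yt i \<in> {-1, 1}" "M \<ge> 1"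
  shows "(\<Sum>i\<in>{1..M}. (flip_sign (fl i) * yt i / real M)\<^sup>2) = 1 / real M"
proof -
  have "(\<Sum>i\<in>{1..M}. (flip_sign (fl i) * yt i / real M)\<^sup>2) = (\<Sum>i\<in>{1..M}. (1 / real M)\<^sup>2)"
  proof (intro sum.cong refl)
    fix i assume "i \<in> {1..M}"
    hence "(yt i)\<^sup>2 = 1" by (intro sign_sq[OF assms(1)]) auto
    thus "(flip_sign (fl i) * yt i / real M)\<^sup>2 = (1 / real M)\<^sup>2"
      by (simp add: power_mult_distrib power_divide flip_sign_cases)
  qed
  also have "\<dots> = 1 / real M" using assms(2) by (simp add: power2_eq_square)
  finally show ?thesis .
qed

lemma subgauss_ctx_query_noise:
  assumes pd: "pos_def_d d Lam" and M: "M \<ge> 1"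
  shows "subgauss d (distr (test_noise_measure d Lam p M) (borel_d d) (ctx_noise d M)) (mat_sqrt_d d Lam)"
    and "subgauss d (distr (test_noise_measure d Lam p M) (borel_d d) (query_noise d M)) (mat_sqrt_d d Lam)"
proof -
  have me: "(\<lambda>q. ennreal (exp (inner_d d a (f q)))) \<in> borel_measurable (test_noise_measure d Lam p M)"
    if f: "f \<in> measurable (test_noise_measure d Lam p M) (borel_d d)" for f a
    by (intro measurable_compose[OF _ measurable_ennreal] measurable_compose[OF _ borel_measurable_exp]
        measurable_inner_d borel_measurable_const measurable_nth_borel_d[OF refl f])
  show "subgauss d (distr (test_noise_measure d Lam p M) (borel_d d) (ctx_noise d M)) (mat_sqrt_d d Lam)"
  proof (rule subgauss_law[OF prob_space_test_noise measurable_ctx_noise],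
      rule test_noise_integral_bound[OF me[OF measurable_ctx_noise]])
    fix a yt fl assume yt: "\<forall>i\<in>{1..M+1}. yt i \<in> {-1, 1::real}"
    have "(\<Sum>i\<in>{1..M}. (flip_sign (fl i) * yt i / real M)\<^sup>2) \<le> 1"
      unfolding ctx_coeff_sq_sum[OF yt M] using M by simp
    thus "(\<integral>\<^sup>+z. ennreal (exp (inner_d d a (ctx_noise d M (yt, fl, z)))) \<partial>noise d Lam {1..M+1}) \<le>
        ennreal (exp (sq_norm d (mat_vec d (mat_sqrt_d d Lam) a) / 2))"
      unfolding ctx_noise_def prod.case by (intro noise_comb_mgf_subset[OF pd]) auto
  qed
  show "subgauss d (distr (test_noise_measure d Lam p M) (borel_d d) (query_noise d M)) (mat_sqrt_d d Lam)"
  proof (rule subgauss_law[OF prob_space_test_noise measurable_query_noise],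
      rule test_noise_integral_bound[OF me[OF measurable_query_noise]])
    fix a yt fl assume yt: "\<forall>i\<in>{1..M+1}. yt i \<in> {-1, 1::real}"
    hence "(\<Sum>i\<in>{M+1}. (yt (M+1))\<^sup>2) \<le> 1" using sign_sq[OF yt, of "M+1"] by simp
    thus "(\<integral>\<^sup>+z. ennreal (exp (inner_d d a (query_noise d M (yt, fl, z)))) \<partial>noise d Lam {1..M+1}) \<le>
        ennreal (exp (sq_norm d (mat_vec d (mat_sqrt_d d Lam) a) / 2))"
      unfolding query_noise_def prod.case by (intro noise_comb_mgf_subset[OF pd]) auto
  qed
qed

text \<open>Multiplying by the clean query label leaves a signal form in \<mu>, two cross terms and
  one noise term. The flip of the query label is thereby kept out of the prediction and appears only
  as a separate event.\<close>

lemma test_pred_decomposition: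
  fixes yt :: "nat \<Rightarrow> real" and fl :: "nat \<Rightarrow> bool" and z :: "nat \<Rightarrow> vecd"
  assumes yt: "\<forall>i\<in>{1..M+1}. yt i \<in> {-1, 1}" and M: "M \<ge> 1"
  defines "q \<equiv> (yt, fl, z)"
  shows "test_pred d M W (\<mu>, q) * yt (M+1) =
    mean_flip M q * inner_d d \<mu> (mat_vec d W \<mu>) + mean_flip M q * inner_d d \<mu> (mat_vec d W (query_noise d M q))
    + inner_d d (ctx_noise d M q) (mat_vec d W \<mu>) + inner_d d (ctx_noise d M q) (mat_vec d W (query_noise d M q))"
proof -
  let ?v = "ctx_noise d M q" and ?w = "query_noise d M q" and ?a = "mean_flip M q"
  have ysq: "yt i * yt i = 1" if "i \<in> {1..M+1}" for i using sign_sq[OF yt that] by (simp add: power2_eq_square)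
  have y1: "yt (M+1) * yt (M+1) = 1" by (rule ysq) auto
  have ty: "test_y (\<mu>, q) i = flip_sign (fl i) * yt i" for i
    by (simp add: test_y_def q_def flip_sign_def)
  have left: "(1 / real M) * (\<Sum>i=1..M. test_y (\<mu>, q) i * test_x d (\<mu>, q) i k) = ?a * \<mu> k + ?v k" if k: "k < d" for k
  proof -
    have "(\<Sum>i=1..M. test_y (\<mu>, q) i * test_x d (\<mu>, q) i k) =
        (\<Sum>i=1..M. flip_sign (fl i) * \<mu> k + flip_sign (fl i) * yt i * z i k)"
    proof (intro sum.cong refl)
      fix i assume i: "i \<in> {1..M}"
      have "test_y (\<mu>, q) i * test_x d (\<mu>, q) i k = flip_sign (fl i) * (yt i * yt i) * \<mu> k + flip_sign (fl i) * yt i * z i k"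
        unfolding ty using k by (simp add: test_x_def q_def algebra_simps)
      thus "test_y (\<mu>, q) i * test_x d (\<mu>, q) i k = flip_sign (fl i) * \<mu> k + flip_sign (fl i) * yt i * z i k"
        using ysq[of i] i by simp
    qed
    thus ?thesis using k
      by (simp add: mean_flip_def q_def ctx_noise_def comb_def sum.distrib sum_distrib_left sum_distrib_right
          sum_divide_distrib distrib_left mult_ac)
  qed
  have right: "yt (M+1) * test_x d (\<mu>, q) (M+1) k = \<mu> k + ?w k" if k: "k < d" for k
  proof -
    have "yt (M+1) * test_x d (\<mu>, q) (M+1) k = (yt (M+1) * yt (M+1)) * \<mu> k + yt (M+1) * z (M+1) k"
      using k by (simp add: test_x_def q_def algebra_simps)
    thus ?thesis using k y1 by (simp add: query_noise_def q_def comb_def)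
  qed
  have "test_pred d M W (\<mu>, q) = inner_d d (\<lambda>k. ?a * \<mu> k + ?v k) (mat_vec d W (test_x d (\<mu>, q) (M+1)))"
    unfolding test_pred_def by (rule inner_d_cong[OF left]) auto
  hence "test_pred d M W (\<mu>, q) * yt (M+1) =
      inner_d d (\<lambda>k. ?a * \<mu> k + ?v k) (\<lambda>k. yt (M+1) * mat_vec d W (test_x d (\<mu>, q) (M+1)) k)"
    by (simp only: inner_d_scale_right mult.commute)
  also have "\<dots> = inner_d d (\<lambda>k. ?a * \<mu> k + ?v k) (mat_vec d W (\<lambda>k. \<mu> k + ?w k))"
  proof (rule inner_d_cong[OF refl])
    fix i assume i: "i < d"
    have "mat_vec d W (\<lambda>k. \<mu> k + ?w k) = mat_vec d W (\<lambda>k. yt (M+1) * test_x d (\<mu>, q) (M+1) k)"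
      by (rule mat_vec_cong) (simp only: right)
    thus "yt (M+1) * mat_vec d W (test_x d (\<mu>, q) (M+1)) i = mat_vec d W (\<lambda>k. \<mu> k + ?w k) i"
      using i by (simp only: mat_vec_scale)
  qed
  also have "\<dots> = inner_d d (\<lambda>k. ?a * \<mu> k + ?v k) (\<lambda>k. mat_vec d W \<mu> k + mat_vec d W ?w k)"
    by (rule inner_d_cong[OF refl]) (simp only: mat_vec_add)
  finally show ?thesis
    unfolding inner_d_add_left inner_d_add_right inner_d_scale_left by (simp add: algebra_simps)
qed

lemma mean_flip_le_one: "M \<ge> 1 \<Longrightarrow> \<bar>mean_flip M q\<bar> \<le> 1"
proof -
  assume M: "M \<ge> 1"
  have "\<bar>\<Sum>i=1..M. flip_sign (fst (snd q) i)\<bar> \<le> (\<Sum>i=1..M. \<bar>flip_sign (fst (snd q) i)\<bar>)" by (rule sum_abs)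
  also have "\<dots> = real M" by (simp add: flip_sign_cases)
  finally show ?thesis using M by (simp add: mean_flip_def)
qed

lemma measurable_test_pred:
  assumes W: "\<And>i j. i < d \<Longrightarrow> j < d \<Longrightarrow> (\<lambda>\<omega>. W \<omega> i j) \<in> borel_measurable N"
  shows "(\<lambda>\<omega>s. test_pred d M (W (fst \<omega>s)) (snd \<omega>s)) \<in> borel_measurable (N \<Otimes>\<^sub>M test_measure d Lam Rt p M)"
    and "i \<in> {1..M+1} \<Longrightarrow> (\<lambda>s. test_y s i) \<in> borel_measurable (test_measure d Lam Rt p M)"
proof -
  let ?T = "test_measure d Lam Rt p M"
  have mu: "(\<lambda>s. fst s k) \<in> borel_measurable ?T" if "k < d" for k
    unfolding test_measure_eq by (rule measurable_nth_borel_d[OF sets_sphere_unif measurable_fst that])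
  have sndm: "snd \<in> measurable ?T (test_noise_measure d Lam p M)" unfolding test_measure_eq by (rule measurable_snd)
  note comp = measurable_test_noise_components[of _ M, THEN measurable_compose[OF sndm]]
  have y: "(\<lambda>s. test_y s i) \<in> borel_measurable ?T" if i: "i \<in> {1..M+1}" for i
  proof -
    have "(\<lambda>s. test_y s i) = (\<lambda>s. flip_sign (fst (snd (snd s)) i) * fst (snd s) i)"
      by (auto simp: test_y_def flip_sign_def fun_eq_iff)
    thus ?thesis
      using measurable_compose[OF sndm measurable_flip_sign[OF i]] measurable_compose[OF sndm measurable_test_noise_components(1)[OF i]]
      by simp
  qed
  show "i \<in> {1..M+1} \<Longrightarrow> (\<lambda>s. test_y s i) \<in> borel_measurable ?T" by (rule y)
  have x: "(\<lambda>s. test_x d s i k) \<in> borel_measurable ?T" if i: "i \<in> {1..M+1}" and k: "k < d" for i k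
  proof -
    have "(\<lambda>s. test_x d s i k) = (\<lambda>s. fst (snd s) i * fst s k + snd (snd (snd s)) i k)"
      using k by (auto simp: test_x_def fun_eq_iff)
    thus ?thesis
      using measurable_compose[OF sndm measurable_test_noise_components(1)[OF i]] mu[OF k]
        measurable_compose[OF sndm measurable_test_noise_components(3)[OF i k]]
      by simp
  qed
  have W': "(\<lambda>\<omega>s. W (fst \<omega>s) i j) \<in> borel_measurable (N \<Otimes>\<^sub>M ?T)" if "i < d" "j < d" for i j
    by (rule measurable_compose[OF measurable_fst W[OF that]])
  have y': "(\<lambda>\<omega>s. test_y (snd \<omega>s) i) \<in> borel_measurable (N \<Otimes>\<^sub>M ?T)" if "i \<in> {1..M+1}" for i
    by (rule measurable_compose[OF measurable_snd y[OF that]])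
  have x': "(\<lambda>\<omega>s. test_x d (snd \<omega>s) i k) \<in> borel_measurable (N \<Otimes>\<^sub>M ?T)" if "i \<in> {1..M+1}" "k < d" for i k
    by (rule measurable_compose[OF measurable_snd x[OF that]])
  show "(\<lambda>\<omega>s. test_pred d M (W (fst \<omega>s)) (snd \<omega>s)) \<in> borel_measurable (N \<Otimes>\<^sub>M ?T)"
    unfolding test_pred_def bilinear_d
    by (intro borel_measurable_sum borel_measurable_times borel_measurable_const W' x' y') auto
qed

text \<open>The error is the measure of a section of a set in the product of data and test spaces,
  so joint measurability of the prediction suffices.\<close>

lemma measurable_test_error:
  assumes W: "\<And>i j. i < d \<Longrightarrow> j < d \<Longrightarrow> (\<lambda>\<omega>. W \<omega> i j) \<in> borel_measurable N"
  shows "(\<lambda>\<omega>. test_error d Lam Rt p M (W \<omega>)) \<in> borel_measurable N"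
proof -
  let ?T = "test_measure d Lam Rt p M"
  interpret T: prob_space ?T by (rule prob_space_test)
  have [measurable]: "(\<lambda>\<omega>s. test_pred d M (W (fst \<omega>s)) (snd \<omega>s)) \<in> borel_measurable (N \<Otimes>\<^sub>M ?T)"
    "(\<lambda>s. test_y s (M+1)) \<in> borel_measurable ?T"
    by (intro measurable_test_pred W, assumption, assumption) (rule measurable_test_pred(2)[where N = N and W = W], auto intro: W)
  define E where "E = {\<omega>s\<in>space (N \<Otimes>\<^sub>M ?T). sgn (test_pred d M (W (fst \<omega>s)) (snd \<omega>s)) \<noteq> test_y (snd \<omega>s) (M+1)}"
  have "E \<in> sets (N \<Otimes>\<^sub>M ?T)" unfolding E_def by measurable
  from T.measurable_emeasure_Pair[OF this]
  have "(\<lambda>\<omega>. enn2real (emeasure ?T (Pair \<omega> -` E))) \<in> borel_measurable N" by measurable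
  moreover have "enn2real (emeasure ?T (Pair \<omega> -` E)) = test_error d Lam Rt p M (W \<omega>)" if "\<omega> \<in> space N" for \<omega>
    unfolding test_error_def measure_def E_def
    by (rule arg_cong[of _ _ "\<lambda>A. enn2real (emeasure ?T A)"]) (use that in \<open>auto simp: space_pair_measure\<close>)
  ultimately show ?thesis by (simp cong: measurable_cong)
qed

text \<open>The context coefficients have square sum \<open>1 / M\<close>, so the matrix may be
  scaled up until its squared Frobenius norm, between two covariance roots, reaches
  \<open>M / 4\<close>; this yields \<open>sqrt M\<close> in the exponent.\<close>

lemma ctx_query_tail:
  assumes pd: "pos_def_d d Lam" and d: "d \<ge> 1" and M: "M \<ge> 1" and W: "frob_sq d W > 0"
  shows "emeasure (test_noise_measure d Lam p M) {q\<in>space (test_noise_measure d Lam p M).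
      \<bar>inner_d d (ctx_noise d M q) (mat_vec d W (query_noise d M q))\<bar> > \<theta>}
    \<le> ennreal (4 * exp (- (\<theta> * sqrt (real M) / (2 * sqrt (frob_sq d W) * op_norm_d d Lam))))"
proof -
  let ?S = "mat_sqrt_d d Lam"
  let ?Q = "test_noise_measure d Lam p M"
  define \<Lambda> where "\<Lambda> = op_norm_d d Lam"
  define F where "F = sqrt (frob_sq d W)"
  have \<Lambda>: "\<Lambda> > 0" unfolding \<Lambda>_def by (rule op_norm_pos[OF pd d])
  have F: "F > 0" "F\<^sup>2 = frob_sq d W" using W by (auto simp: F_def)
  define l where "l = sqrt (real M) / (2 * F * \<Lambda>)"
  have l: "l > 0" using \<Lambda> F M by (simp add: l_def)
  let ?A = "\<lambda>i j. l * W i j"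
  have sc: "inner_d d x (mat_vec d ?A y) = l * inner_d d x (mat_vec d W y)" for x y
    by (simp add: bilinear_d sum_distrib_left mult_ac)
  have "frob_sq d (mat_mult_d d (mat_mult_d d ?S ?A) ?S) = l\<^sup>2 * frob_sq d (mat_mult_d d (mat_mult_d d ?S W) ?S)"
  proof -
    have "mat_mult_d d ?S ?A = (\<lambda>i j. l * mat_mult_d d ?S W i j)"
      by (intro ext) (simp add: mat_mult_d_def sum_distrib_left mult_ac)
    hence "mat_mult_d d (mat_mult_d d ?S ?A) ?S = (\<lambda>i j. l * mat_mult_d d (mat_mult_d d ?S W) ?S i j)"
      by (simp only: mat_mult_d_def[of d "\<lambda>i j. l * mat_mult_d d ?S W i j"] mat_mult_d_def[of d "mat_mult_d d ?S W"]
          sum_distrib_left mult.assoc)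
    thus ?thesis by (simp only: frob_sq_scale)
  qed
  also have "\<dots> \<le> l\<^sup>2 * ((op_norm_d d ?S)\<^sup>2 * ((op_norm_d d ?S)\<^sup>2 * frob_sq d W))"
    by (intro mult_left_mono order_trans[OF frob_sq_mult_right[OF mat_sqrt_d(1)[OF pd]]] frob_sq_mult_left) auto
  also have "\<dots> \<le> l\<^sup>2 * (\<Lambda> * (\<Lambda> * frob_sq d W))"
    using op_norm_mat_sqrt_sq[OF pd d] \<Lambda> unfolding \<Lambda>_def[symmetric]
    by (intro mult_left_mono mult_mono mult_right_mono) auto
  also have "\<dots> = real M / 4"
    using F \<Lambda> unfolding F(2)[symmetric] l_def by (simp add: power_mult_distrib power_divide power2_eq_square)
  finally have fr: "frob_sq d (mat_mult_d d (mat_mult_d d ?S ?A) ?S) \<le> real M / 4" .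
  let ?E = "{q\<in>space ?Q. \<bar>inner_d d (ctx_noise d M q) (mat_vec d ?A (query_noise d M q))\<bar> > l * \<theta>}"
  have Em [measurable]: "?E \<in> sets ?Q"
  proof -
    have [measurable]: "(\<lambda>q. \<bar>inner_d d (ctx_noise d M q) (mat_vec d ?A (query_noise d M q))\<bar>) \<in> borel_measurable ?Q"
      by (intro borel_measurable_abs measurable_inner_d measurable_mat_vec
          measurable_nth_borel_d[OF refl measurable_ctx_noise] measurable_nth_borel_d[OF refl measurable_query_noise])
    show ?thesis by measurable
  qed
  have "emeasure ?Q ?E = (\<integral>\<^sup>+q. indicator ?E q \<partial>?Q)" by simp
  also have "\<dots> \<le> ennreal (4 * exp (- (l * \<theta>)))"
  proof (rule test_noise_integral_bound)
    fix yt :: "nat \<Rightarrow> real" and fl :: "nat \<Rightarrow> bool"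
    assume yt: "\<forall>i\<in>{1..M+1}. yt i \<in> {-1, 1}"
    let ?N = "noise d Lam {1..M+1}"
    let ?c = "\<lambda>i. flip_sign (fl i) * yt i / real M"
    have ins: "insert (M+1) {1..M} = {1..M+1}" by auto
    have y1: "(yt (M+1))\<^sup>2 = 1" by (rule sign_sq[OF yt]) auto
    have "(\<integral>\<^sup>+z. indicator ?E (yt, fl, z) \<partial>?N) \<le>
        (\<integral>\<^sup>+z. indicator {z\<in>space ?N. \<bar>inner_d d (comb d {1..M} ?c z) (mat_vec d ?A (comb d {M+1} (\<lambda>_. yt (M+1)) z))\<bar> > l * \<theta>} z \<partial>?N)"
      by (intro nn_integral_mono) (auto simp: indicator_def ctx_noise_def query_noise_def)
    also have "\<dots> = emeasure ?N {z\<in>space ?N. \<bar>inner_d d (comb d {1..M} ?c z) (mat_vec d ?A (comb d {M+1} (\<lambda>_. yt (M+1)) z))\<bar> > l * \<theta>}"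
    proof (rule nn_integral_indicator)
      have [measurable]: "(\<lambda>z. \<bar>inner_d d (comb d {1..M} ?c z) (mat_vec d ?A (comb d {M+1} (\<lambda>_. yt (M+1)) z))\<bar>) \<in> borel_measurable ?N"
        by (intro borel_measurable_abs measurable_inner_d measurable_mat_vec)
          (auto simp: comb_def intro!: borel_measurable_sum borel_measurable_divide borel_measurable_times measurable_noise_nth)
      show "{z\<in>space ?N. \<bar>inner_d d (comb d {1..M} ?c z) (mat_vec d ?A (comb d {M+1} (\<lambda>_. yt (M+1)) z))\<bar> > l * \<theta>} \<in> sets ?N"
        by measurable
    qed
    also have "\<dots> \<le> ennreal (4 * exp (- (l * \<theta>)))"
      unfolding ins[symmetric]
    proof (rule noise_bilinear_tail[OF pd])
      have "(\<Sum>i\<in>{1..M}. (?c i)\<^sup>2) * (yt (M+1))\<^sup>2 * frob_sq d (mat_mult_d d (mat_mult_d d ?S ?A) ?S) \<le> 1 / real M * 1 * (real M / 4)"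
        unfolding ctx_coeff_sq_sum[OF yt M] y1 using fr by (intro mult_left_mono) auto
      also have "\<dots> = 1/4" using M by simp
      finally show "(\<Sum>i\<in>{1..M}. (?c i)\<^sup>2) * (yt (M+1))\<^sup>2 * frob_sq d (mat_mult_d d (mat_mult_d d ?S ?A) ?S) \<le> 1/4" .
    qed auto
    finally show "(\<integral>\<^sup>+z. indicator ?E (yt, fl, z) \<partial>?N) \<le> ennreal (4 * exp (- (l * \<theta>)))" .
  qed simp
  also have "?E = {q\<in>space ?Q. \<bar>inner_d d (ctx_noise d M q) (mat_vec d W (query_noise d M q))\<bar> > \<theta>}"
    unfolding sc using l by (simp add: abs_mult)
  also have "l * \<theta> = \<theta> * sqrt (real M) / (2 * F * \<Lambda>)" by (simp add: l_def)
  finally show ?thesis by (simp add: F_def \<Lambda>_def)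
qed

text \<open>Union bound over five events. The three that involve the sphere each add 2 to the
  coefficient of \<open>exp (- sqrt d / 8)\<close>; the two cross terms of mean and noise add 4 each
  to the coefficient 8.\<close>

lemma test_error_bound:
  assumes pd: "pos_def_d d Lam" and d: "d \<ge> 1" and M: "M \<ge> 1" and Rt: "Rt > 0"
    and cp: "0 < c_p" "c_p \<le> 1/2"
    and q: "q > 0" and W: "frob_sq d W > 0" "q * sqrt (frob_sq d W) \<le> trace_d d W"
  defines "p \<equiv> 1/2 - c_p"
  shows "test_error d Lam Rt p M W \<le> (p + exp (- (c_p\<^sup>2 / 4) * real M)) * (if p > 0 then 1 else 0)
    + (2 * exp (- q / 8) + 6 * exp (- sqrt (real d) / 8))
    + 8 * exp (- (c_p * Rt * q / (64 * op_norm_d d (mat_sqrt_d d Lam) * sqrt (real d))))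
    + 4 * exp (- (c_p * sqrt (real M) * Rt\<^sup>2 * q / (32 * op_norm_d d Lam * real d)))"
proof -
  let ?P = "sphere_unif d Rt" and ?Q = "test_noise_measure d Lam p M" and ?T = "test_measure d Lam Rt p M"
  have T: "?T = ?P \<Otimes>\<^sub>M ?Q" by (rule test_measure_eq)
  note prP = prob_space_sphere_unif[of d Rt] and prQ = prob_space_test_noise[of d Lam p M]
  define F where "F = sqrt (frob_sq d W)"
  define \<sigma> where "\<sigma> = op_norm_d d (mat_sqrt_d d Lam)"
  define \<Lambda> where "\<Lambda> = op_norm_d d Lam"
  define tr where "tr = trace_d d W"
  \<comment> \<open>A quarter of the guaranteed signal \<open>c_p * (Rt^2 * tr / (4 * d))\<close>:
    three disturbances of size at most \<theta> leave a positive margin.\<close>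
  define \<theta> where "\<theta> = c_p * Rt\<^sup>2 * tr / (16 * real d)"
  have F: "F > 0" using W by (simp add: F_def)
  have \<sigma>: "\<sigma> > 0" and \<Lambda>: "\<Lambda> > 0" unfolding \<sigma>_def \<Lambda>_def by (intro op_norm_pos[OF pd d])+
  have tr: "q * F \<le> tr" "tr > 0" using W(2) mult_pos_pos[OF q F] unfolding F_def tr_def by linarith+
  have qF: "q \<le> tr / F" using tr F by (simp add: field_simps)
  have \<theta>: "\<theta> > 0" using cp Rt tr d by (simp add: \<theta>_def)
  define flb where "flb = (p + exp (- (c_p\<^sup>2 / 4) * real M)) * (if p > 0 then 1 else 0)"
  define Bad where "Bad = {f\<in>space (flips {1..M+1} p). f (M+1)} \<union>
      {f\<in>space (flips {1..M+1} p). (\<Sum>i\<in>{1..M}. flip_sign (f i)) < real (card {1..M}) * c_p}"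
  have Bad: "Bad \<in> sets (flips {1..M+1} p)" "emeasure (flips {1..M+1} p) Bad \<le> ennreal flb"
    unfolding Bad_def flb_def p_def by (rule bad_flips_bound[OF cp M])+
  define U0 where "U0 = {s\<in>space ?T. fst (snd (snd s)) \<in> Bad}"
  define U1 where "U1 = {s\<in>space ?T. fst s \<in> {\<mu>\<in>space ?P. inner_d d \<mu> (mat_vec d W \<mu>) < Rt\<^sup>2 * tr / (4 * real d)}}"
  define U2 where "U2 = {s\<in>space ?T. \<bar>inner_d d (fst s) (mat_vec d W (query_noise d M (snd s)))\<bar> > \<theta>}"
  \<comment> \<open>The transpose moves the context noise to the second argument, where
    \<open>sphere_bilinear_tail\<close> expects noise; the Frobenius norm does not change.\<close>
  define U3 where "U3 = {s\<in>space ?T. \<bar>inner_d d (fst s) (mat_vec d (\<lambda>i j. W j i) (ctx_noise d M (snd s)))\<bar> > \<theta>}"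
  define U4 where "U4 = {s\<in>space ?T. snd s \<in> {q\<in>space ?Q. \<bar>inner_d d (ctx_noise d M q) (mat_vec d W (query_noise d M q))\<bar> > \<theta>}}"
  have nu: "k < d \<Longrightarrow> (\<lambda>s. fst s k) \<in> borel_measurable ?T" for k
    unfolding T by (rule measurable_nth_borel_d[OF sets_sphere_unif measurable_fst])
  have nq: "k < d \<Longrightarrow> (\<lambda>s. query_noise d M (snd s) k) \<in> borel_measurable ?T" for k
    unfolding T by (rule measurable_nth_borel_d[OF refl measurable_compose[OF measurable_snd measurable_query_noise]])
  have nc: "k < d \<Longrightarrow> (\<lambda>s. ctx_noise d M (snd s) k) \<in> borel_measurable ?T" for k
    unfolding T by (rule measurable_nth_borel_d[OF refl measurable_compose[OF measurable_snd measurable_ctx_noise]])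
  have A1: "{\<mu>\<in>space ?P. inner_d d \<mu> (mat_vec d W \<mu>) < Rt\<^sup>2 * tr / (4 * real d)} \<in> sets ?P"
  proof -
    have [measurable]: "(\<lambda>\<mu>. inner_d d \<mu> (mat_vec d W \<mu>)) \<in> borel_measurable ?P"
      unfolding measurable_cong_sets[OF sets_sphere_unif refl]
      by (intro measurable_inner_d measurable_mat_vec measurable_component_singleton) auto
    show ?thesis by measurable
  qed
  have A4: "{q\<in>space ?Q. \<bar>inner_d d (ctx_noise d M q) (mat_vec d W (query_noise d M q))\<bar> > \<theta>} \<in> sets ?Q"
  proof -
    have [measurable]: "(\<lambda>q. \<bar>inner_d d (ctx_noise d M q) (mat_vec d W (query_noise d M q))\<bar>) \<in> borel_measurable ?Q"
      by (intro borel_measurable_abs measurable_inner_d measurable_mat_vec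
          measurable_nth_borel_d[OF refl measurable_ctx_noise] measurable_nth_borel_d[OF refl measurable_query_noise])
    show ?thesis by measurable
  qed
  have flm: "(\<lambda>s. fst (snd (snd s))) \<in> measurable ?T (flips {1..M+1} p)"
    unfolding T test_noise_measure_def by measurable
  have S0: "U0 \<in> sets ?T" using measurable_sets[OF flm Bad(1)] unfolding U0_def by (simp add: vimage_def Int_def conj_commute)
  have S1: "U1 \<in> sets ?T" unfolding U1_def T using measurable_sets[OF measurable_fst A1] by (simp add: vimage_def Int_def conj_commute)
  have S4: "U4 \<in> sets ?T" unfolding U4_def T using measurable_sets[OF measurable_snd A4] by (simp add: vimage_def Int_def conj_commute)
  have S2: "U2 \<in> sets ?T"
  proof -
    have [measurable]: "(\<lambda>s. \<bar>inner_d d (fst s) (mat_vec d W (query_noise d M (snd s)))\<bar>) \<in> borel_measurable ?T"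
      by (intro borel_measurable_abs measurable_inner_d measurable_mat_vec nu nq)
    show ?thesis unfolding U2_def by measurable
  qed
  have S3: "U3 \<in> sets ?T"
  proof -
    have [measurable]: "(\<lambda>s. \<bar>inner_d d (fst s) (mat_vec d (\<lambda>i j. W j i) (ctx_noise d M (snd s)))\<bar>) \<in> borel_measurable ?T"
      by (intro borel_measurable_abs measurable_inner_d measurable_mat_vec nu nc)
    show ?thesis unfolding U3_def by measurable
  qed
  have b0: "emeasure ?T U0 \<le> ennreal flb"
  proof -
    let ?B1 = "{x\<in>space (flips {1..M+1} p \<Otimes>\<^sub>M noise d Lam {1..M+1}). fst x \<in> Bad}"
    have m1: "?B1 \<in> sets (flips {1..M+1} p \<Otimes>\<^sub>M noise d Lam {1..M+1})"
      using measurable_sets[OF measurable_fst Bad(1)] by (simp add: vimage_def Int_def conj_commute)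
    let ?B2 = "{x\<in>space ?Q. snd x \<in> ?B1}"
    note [measurable] = m1
    have m2: "?B2 \<in> sets ?Q" unfolding test_noise_measure_def by measurable
    have "U0 = {s\<in>space (?P \<Otimes>\<^sub>M ?Q). snd s \<in> ?B2}"
      unfolding U0_def T by (auto simp: space_pair_measure test_noise_measure_def)
    hence "emeasure ?T U0 = emeasure ?Q ?B2"
      unfolding T by (simp only: emeasure_pair_fst_snd(2)[OF prP prQ m2])
    also have "\<dots> = emeasure (flips {1..M+1} p \<Otimes>\<^sub>M noise d Lam {1..M+1}) ?B1"
      unfolding test_noise_measure_def
      by (rule emeasure_pair_fst_snd(2)[OF prob_space_signs prob_space_pair[OF prob_space_flips prob_space_noise] m1])
    also have "\<dots> = emeasure (flips {1..M+1} p) Bad"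
      by (rule emeasure_pair_fst_snd(1)[OF prob_space_flips prob_space_noise Bad(1)])
    finally show ?thesis using Bad(2) by simp
  qed
  have b1: "emeasure ?T U1 \<le> ennreal (2 * exp (- q / 8) + 2 * exp (- sqrt (real d) / 8))"
  proof -
    have "emeasure ?T U1 = emeasure ?P {\<mu>\<in>space ?P. inner_d d \<mu> (mat_vec d W \<mu>) < Rt\<^sup>2 * tr / (4 * real d)}"
      unfolding U1_def T by (rule emeasure_pair_fst_snd(1)[OF prP prQ A1])
    also have "\<dots> \<le> ennreal (2 * exp (- tr / (8 * F)) + 2 * exp (- sqrt (real d) / 8))"
      using sphere_quadratic_tail[OF d Rt, of W] tr unfolding tr_def F_def by simp
    also have "\<dots> \<le> ennreal (2 * exp (- q / 8) + 2 * exp (- sqrt (real d) / 8))"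
      using qF by (intro ennreal_leI) (simp add: field_simps)
    finally show ?thesis .
  qed
  \<comment> \<open>Inserting \<theta> cancels one power of \<open>Rt\<close> and of
    \<open>sqrt d\<close>. The rest is \<open>sqrt 2 \<le> 2\<close> and the lower bound
    \<open>q\<close> on the ratio of trace to Frobenius norm.\<close>
  have t2: "c_p * Rt * q / (64 * \<sigma> * sqrt (real d)) \<le> \<theta> * sqrt (real d) / (2 * sqrt 2 * Rt * F * \<sigma>)"
  proof -
    have sd: "sqrt (real d) * sqrt (real d) = real d" "sqrt (real d) > 0" using d by auto
    have eq: "\<theta> * sqrt (real d) / (2 * sqrt 2 * Rt * F * \<sigma>) = c_p * Rt * (tr / F) / (32 * sqrt 2 * \<sigma> * sqrt (real d))"
    proof -
      have "\<theta> = c_p * Rt\<^sup>2 * tr / (16 * (sqrt (real d) * sqrt (real d)))" using sd by (simp add: \<theta>_def)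
      thus ?thesis using sd(2) Rt F \<sigma> by (simp add: power2_eq_square field_simps)
    qed
    have "sqrt 2 \<le> (2::real)" by (rule real_le_lsqrt) auto
    hence "32 * sqrt 2 * \<sigma> * sqrt (real d) \<le> 64 * \<sigma> * sqrt (real d)" using \<sigma> sd by simp
    hence "c_p * Rt * q / (64 * \<sigma> * sqrt (real d)) \<le> c_p * Rt * (tr / F) / (32 * sqrt 2 * \<sigma> * sqrt (real d))"
      using cp Rt q qF \<sigma> sd by (intro frac_le mult_left_mono mult_nonneg_nonneg mult_pos_pos) auto
    thus ?thesis using eq by simp
  qed
  let ?b23 = "4 * exp (- (c_p * Rt * q / (64 * \<sigma> * sqrt (real d)))) + 2 * exp (- sqrt (real d) / 8)"
  have b2: "emeasure ?T U2 \<le> ennreal ?b23"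
  proof -
    let ?D = "distr ?Q (borel_d d) (query_noise d M)"
    have "emeasure ?T U2 = emeasure (?P \<Otimes>\<^sub>M ?D) {z\<in>space (?P \<Otimes>\<^sub>M ?D). \<bar>inner_d d (fst z) (mat_vec d W (snd z))\<bar> > \<theta>}"
      unfolding U2_def T
      using emeasure_pair_law[OF prP prQ measurable_query_noise, of "\<lambda>z. \<bar>inner_d d (fst z) (mat_vec d W (snd z))\<bar>" \<theta>]
        borel_measurable_abs[OF measurable_inner_d[OF measurable_pair_nth(1) measurable_mat_vec[OF measurable_pair_nth(2)]], OF sets_sphere_unif refl _ sets_sphere_unif refl]
      by simp
    also have "\<dots> \<le> ennreal (4 * exp (- (\<theta> * sqrt (real d) / (2 * sqrt 2 * Rt * F * \<sigma>))) + 2 * exp (- sqrt (real d) / 8))"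
      unfolding F_def \<sigma>_def by (rule sphere_bilinear_tail[OF pd d Rt subgauss_ctx_query_noise(2)[OF pd M] W(1)])
    also have "\<dots> \<le> ennreal ?b23" using t2 by (intro ennreal_leI) simp
    finally show ?thesis .
  qed
  have b3: "emeasure ?T U3 \<le> ennreal ?b23"
  proof -
    let ?D = "distr ?Q (borel_d d) (ctx_noise d M)"
    let ?W = "\<lambda>i j. W j i"
    have WT: "frob_sq d ?W = frob_sq d W" by (rule frob_sq_transpose)
    have "emeasure ?T U3 = emeasure (?P \<Otimes>\<^sub>M ?D) {z\<in>space (?P \<Otimes>\<^sub>M ?D). \<bar>inner_d d (fst z) (mat_vec d ?W (snd z))\<bar> > \<theta>}"
      unfolding U3_def T
      using emeasure_pair_law[OF prP prQ measurable_ctx_noise, of "\<lambda>z. \<bar>inner_d d (fst z) (mat_vec d ?W (snd z))\<bar>" \<theta>]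
        borel_measurable_abs[OF measurable_inner_d[OF measurable_pair_nth(1) measurable_mat_vec[OF measurable_pair_nth(2)]], OF sets_sphere_unif refl _ sets_sphere_unif refl]
      by simp
    also have "\<dots> \<le> ennreal (4 * exp (- (\<theta> * sqrt (real d) / (2 * sqrt 2 * Rt * F * \<sigma>))) + 2 * exp (- sqrt (real d) / 8))"
      using sphere_bilinear_tail[OF pd d Rt subgauss_ctx_query_noise(1)[OF pd M], where W = ?W] W(1) unfolding F_def \<sigma>_def WT by simp
    also have "\<dots> \<le> ennreal ?b23" using t2 by (intro ennreal_leI) simp
    finally show ?thesis .
  qed
  have b4: "emeasure ?T U4 \<le> ennreal (4 * exp (- (c_p * sqrt (real M) * Rt\<^sup>2 * q / (32 * \<Lambda> * real d))))"
  proof -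
    have "emeasure ?T U4 = emeasure ?Q {q\<in>space ?Q. \<bar>inner_d d (ctx_noise d M q) (mat_vec d W (query_noise d M q))\<bar> > \<theta>}"
      unfolding U4_def T by (rule emeasure_pair_fst_snd(2)[OF prP prQ A4])
    also have "\<dots> \<le> ennreal (4 * exp (- (\<theta> * sqrt (real M) / (2 * F * \<Lambda>))))"
      unfolding F_def \<Lambda>_def by (rule ctx_query_tail[OF pd d M W(1)])
    also have "\<theta> * sqrt (real M) / (2 * F * \<Lambda>) = c_p * sqrt (real M) * Rt\<^sup>2 * (tr / F) / (32 * \<Lambda> * real d)"
      using F \<Lambda> d by (simp add: \<theta>_def field_simps)
    also have "ennreal (4 * exp (- (c_p * sqrt (real M) * Rt\<^sup>2 * (tr / F) / (32 * \<Lambda> * real d)))) \<le>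
        ennreal (4 * exp (- (c_p * sqrt (real M) * Rt\<^sup>2 * q / (32 * \<Lambda> * real d))))"
    proof -
      have "c_p * sqrt (real M) * Rt\<^sup>2 * q / (32 * \<Lambda> * real d) \<le> c_p * sqrt (real M) * Rt\<^sup>2 * (tr / F) / (32 * \<Lambda> * real d)"
        using cp qF \<Lambda> by (intro divide_right_mono mult_left_mono mult_nonneg_nonneg) auto
      thus ?thesis by (intro ennreal_leI) simp
    qed
    finally show ?thesis .
  qed
  define E where "E = {s\<in>space ?T. sgn (test_pred d M W s) \<noteq> test_y s (M+1)}"
  have incl: "s \<in> U0 \<union> U1 \<union> U2 \<union> U3 \<union> U4"
    if sE: "s \<in> E" and sy: "\<forall>i\<in>{1..M+1}. fst (snd s) i \<in> {-1, 1}" for s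
  proof (rule ccontr)
    assume no: "s \<notin> U0 \<union> U1 \<union> U2 \<union> U3 \<union> U4"
    obtain \<mu> yt fl z where s: "s = (\<mu>, yt, fl, z)" by (metis prod_cases4)
    let ?q = "(yt, fl, z)"
    have sp: "s \<in> space ?T" using sE by (simp add: E_def)
    hence sp': "\<mu> \<in> space ?P" "?q \<in> space ?Q" "fl \<in> space (flips {1..M+1} p)"
      unfolding s T test_noise_measure_def by (auto simp: space_pair_measure)
    have y: "\<forall>i\<in>{1..M+1}. yt i \<in> {-1, 1}" using sy by (simp add: s)
    have nf: "\<not> fl (M+1)" and mf: "mean_flip M ?q \<ge> c_p"
      using no sp sp' M unfolding U0_def Bad_def s by (auto simp: mean_flip_def field_simps not_less)
    have g1: "inner_d d \<mu> (mat_vec d W \<mu>) \<ge> Rt\<^sup>2 * tr / (4 * real d)"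
      using no sp sp' unfolding U1_def s by auto
    have g2: "\<bar>inner_d d \<mu> (mat_vec d W (query_noise d M ?q))\<bar> \<le> \<theta>"
      using no sp unfolding U2_def s by auto
    have g3: "\<bar>inner_d d (ctx_noise d M ?q) (mat_vec d W \<mu>)\<bar> \<le> \<theta>"
      unfolding bilinear_transpose[of d "ctx_noise d M ?q"] using no sp unfolding U3_def s by auto
    have g4: "\<bar>inner_d d (ctx_noise d M ?q) (mat_vec d W (query_noise d M ?q))\<bar> \<le> \<theta>"
      using no sp sp' unfolding U4_def s by auto
    have "c_p * (Rt\<^sup>2 * tr / (4 * real d)) \<le> mean_flip M ?q * inner_d d \<mu> (mat_vec d W \<mu>)"
      using mf g1 cp tr Rt by (intro mult_mono) auto
    moreover have "c_p * (Rt\<^sup>2 * tr / (4 * real d)) = 4 * \<theta>" by (simp add: \<theta>_def)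
    moreover have "\<bar>mean_flip M ?q * inner_d d \<mu> (mat_vec d W (query_noise d M ?q))\<bar> \<le> 1 * \<theta>"
      unfolding abs_mult using mean_flip_le_one[OF M, of ?q] g2 by (intro mult_mono) auto
    ultimately have "test_pred d M W (\<mu>, ?q) * yt (M+1) > 0"
      unfolding test_pred_decomposition[OF y M] using g3 g4 \<theta> by linarith
    moreover have "yt (M+1) \<in> {-1, 1}" using y by (rule bspec) simp
    ultimately have "sgn (test_pred d M W (\<mu>, ?q)) = yt (M+1)" by (auto simp: sgn_real_def)
    moreover have "test_y (\<mu>, ?q) (M+1) = yt (M+1)" using nf by (simp add: test_y_def)
    ultimately show False using sE by (simp add: E_def s)
  qed
  have AEy: "AE s in ?T. \<forall>i\<in>{1..M+1}. fst (snd s) i \<in> {-1, 1}"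
    unfolding T
    by (rule AE_pair_fst_snd(2)[OF prP prQ], unfold test_noise_measure_def,
        rule AE_pair_fst_snd(1)[OF prob_space_signs prob_space_pair[OF prob_space_flips prob_space_noise]], rule AE_signs) simp
  have flb0: "flb \<ge> 0" using cp by (auto simp: flb_def p_def)
  \<comment> \<open>The inclusion needs labels in -1 and 1, hence monotonicity up to a null
    set.\<close>
  have "emeasure ?T E \<le> emeasure ?T (U0 \<union> U1 \<union> U2 \<union> U3 \<union> U4)"
    by (rule emeasure_mono_AE, rule AE_mp[OF AEy], intro AE_I2 impI incl) (auto intro!: sets.Un S0 S1 S2 S3 S4)
  also have "\<dots> \<le> ennreal ((((flb + (2 * exp (- q / 8) + 2 * exp (- sqrt (real d) / 8))) + ?b23) + ?b23)
      + 4 * exp (- (c_p * sqrt (real M) * Rt\<^sup>2 * q / (32 * \<Lambda> * real d))))"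
    by (intro emeasure_Un_le sets.Un S0 S1 S2 S3 S4 b0 b1 b2 b3 b4 add_nonneg_nonneg flb0) auto
  finally have "measure ?T E \<le> (((flb + (2 * exp (- q / 8) + 2 * exp (- sqrt (real d) / 8))) + ?b23) + ?b23)
      + 4 * exp (- (c_p * sqrt (real M) * Rt\<^sup>2 * q / (32 * \<Lambda> * real d)))"
    unfolding measure_def using flb0 by (intro enn2real_leI add_nonneg_nonneg) auto
  thus ?thesis unfolding test_error_def E_def[symmetric] flb_def[symmetric] \<sigma>_def[symmetric] \<Lambda>_def[symmetric] by simp
qed

section \<open>Concentration of the pre-training data\<close>

lemma inner_scaled_id: "inner_d d x (mat_vec d (\<lambda>i j. c * id_mat i j) y) = c * inner_d d x y"
proof -
  have "inner_d d x (mat_vec d (\<lambda>i j. c * id_mat i j) y) = c * inner_d d x (mat_vec d id_mat y)"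
    by (simp add: bilinear_d sum_distrib_left mult_ac)
  thus ?thesis by (simp add: inner_mat_vec_id)
qed

lemma sq_norm_scaled_id: "sq_norm d (mat_vec d (\<lambda>i j. c * id_mat i j) y) = c\<^sup>2 * sq_norm d y"
proof -
  have "mat_vec d (\<lambda>i j. c * id_mat i j) y i = c * y i" if "i < d" for i
    using mat_vec_id[OF that, of y] that by (simp add: mat_vec_nth sum_distrib_left mult.assoc flip: sum_distrib_left)
  thus ?thesis unfolding sq_norm_scale[symmetric] by (rule sq_norm_cong)
qed

lemma frob_scaled_id_mult:
  "frob_sq d (mat_mult_d d (\<lambda>i j. c * id_mat i j) S) = c\<^sup>2 * frob_sq d S"
proof -
  have "mat_mult_d d (\<lambda>i j. c * id_mat i j) S i j = c * S i j" if "i < d" for i j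
    using mat_mult_id[OF that, of S j] by (simp add: mat_mult_d_def mult.assoc flip: sum_distrib_left)
  thus ?thesis unfolding frob_sq_scale[symmetric] by (intro frob_sq_cong)
qed

text \<open>The case of a multiple of the identity: the squared Frobenius norm of the covariance
  root is the trace, so \<open>l = 1 / (2 sqrt tr)\<close> normalises to 1/4.\<close>

lemma sphere_noise_inner_tail:
  assumes pd: "pos_def_d d Lam" and d: "d \<ge> 1" and r: "r > 0" and Q: "subgauss d Q (mat_sqrt_d d Lam)"
    and T0: "trace_d d Lam > 0"
  shows "emeasure (sphere_unif d r \<Otimes>\<^sub>M Q) {z\<in>space (sphere_unif d r \<Otimes>\<^sub>M Q).
      \<bar>inner_d d (fst z) (snd z)\<bar> > 2 * sqrt (trace_d d Lam) * (t * (sqrt 2 * r / sqrt (real d)))}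
    \<le> ennreal (4 * exp (- t) + 2 * exp (- sqrt (real d) / 8))"
proof -
  define l where "l = 1 / (2 * sqrt (trace_d d Lam))"
  have l: "l > 0" using T0 by (simp add: l_def)
  have l2: "l\<^sup>2 * trace_d d Lam = 1/4" using T0 by (simp add: l_def power_divide power_mult_distrib)
  have "(\<integral>\<^sup>+w. ennreal (exp (sq_norm d (mat_vec d (\<lambda>i j. l * id_mat i j) w) / 2)) \<partial>Q) \<le> 2"
    by (rule subgauss_exp_sq_norm[OF Q mat_sqrt_d(1)[OF pd]]) (simp add: frob_scaled_id_mult frob_sq_mat_sqrt[OF pd] l2)
  from sphere_linear_tail[OF d r subgaussD(1,2)[OF Q] this, of t]
  have "emeasure (sphere_unif d r \<Otimes>\<^sub>M Q) {z\<in>space (sphere_unif d r \<Otimes>\<^sub>M Q).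
      \<bar>l * inner_d d (fst z) (snd z)\<bar> > t * (sqrt 2 * r / sqrt (real d))}
    \<le> ennreal (4 * exp (- t) + 2 * exp (- sqrt (real d) / 8))"
    unfolding inner_scaled_id .
  moreover have "\<bar>l * x\<bar> > y \<longleftrightarrow> \<bar>x\<bar> > 2 * sqrt (trace_d d Lam) * y" for x y
  proof -
    have "\<bar>l * x\<bar> > y \<longleftrightarrow> \<bar>x\<bar> / (2 * sqrt (trace_d d Lam)) > y" using l by (simp add: abs_mult l_def)
    thus ?thesis using T0 by (simp add: pos_less_divide_eq mult.commute)
  qed
  ultimately show ?thesis by simp
qed

lemma sq_norm_sphere_proj: "sq_norm d (sphere_proj d r g) = (if sq_norm d g = 0 then 0 else r\<^sup>2)"
proof -
  define s where "s = sqrt (sq_norm d g)"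
  have "sq_norm d (sphere_proj d r g) = (r/s)\<^sup>2 * sq_norm d g"
    unfolding sq_norm_scale[symmetric] by (rule sq_norm_cong) (simp add: sphere_proj_def s_def)
  thus ?thesis by (simp add: s_def power_divide)
qed

text \<open>Only one of the two vectors is replaced by a Gaussian one. The other, divided by
  \<open>r\<close>, has norm at most 1, and \<open>exp (1/2) \<le> 2\<close> is the required
  exponential moment.\<close>

lemma sphere_sphere_inner_tail:
  assumes d: "d \<ge> 1" and r: "r > 0"
  shows "emeasure (sphere_unif d r \<Otimes>\<^sub>M sphere_unif d r) {z\<in>space (sphere_unif d r \<Otimes>\<^sub>M sphere_unif d r).
      \<bar>inner_d d (fst z) (snd z)\<bar> > r * (t * (sqrt 2 * r / sqrt (real d)))}
    \<le> ennreal (4 * exp (- t) + 2 * exp (- sqrt (real d) / 8))"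
proof -
  let ?A = "\<lambda>i j. (1/r) * id_mat i j"
  have mp: "sphere_proj d r \<in> measurable (std_gauss d) (borel_d d)"
    by (simp add: measurable_cong_sets[OF sets_std_gauss refl])
  interpret G: prob_space "std_gauss d" by (rule prob_space_std_gauss)
  have "(\<integral>\<^sup>+w. ennreal (exp (sq_norm d (mat_vec d ?A w) / 2)) \<partial>sphere_unif d r) =
      (\<integral>\<^sup>+g. ennreal (exp (sq_norm d (mat_vec d ?A (sphere_proj d r g)) / 2)) \<partial>std_gauss d)"
    unfolding sphere_unif_eq
    by (subst nn_integral_distr[OF mp])
      (auto intro!: measurable_compose[OF _ measurable_ennreal] measurable_compose[OF _ borel_measurable_exp]
        borel_measurable_divide measurable_sq_norm measurable_mat_vec)
  also have "\<dots> \<le> (\<integral>\<^sup>+g. 2 \<partial>std_gauss d)"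
  proof (rule nn_integral_mono)
    fix g
    have "exp (1/2) \<le> (1 + 1/2 + (1/2)\<^sup>2 :: real)" by (rule exp_bound) auto
    hence "exp (1/2) \<le> (2::real)" by (simp add: power2_eq_square)
    moreover have "sq_norm d (mat_vec d ?A (sphere_proj d r g)) / 2 \<le> 1/2"
      unfolding sq_norm_scaled_id sq_norm_sphere_proj using r by (simp add: power_divide)
    ultimately have "exp (sq_norm d (mat_vec d ?A (sphere_proj d r g)) / 2) \<le> 2"
      by (meson exp_le_cancel_iff order_trans)
    hence "ennreal (exp (sq_norm d (mat_vec d ?A (sphere_proj d r g)) / 2)) \<le> ennreal 2" by (rule ennreal_leI)
    thus "ennreal (exp (sq_norm d (mat_vec d ?A (sphere_proj d r g)) / 2)) \<le> 2" by simp
  qed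
  also have "\<dots> = 2" by (simp add: G.emeasure_space_1)
  finally have "(\<integral>\<^sup>+w. ennreal (exp (sq_norm d (mat_vec d ?A w) / 2)) \<partial>sphere_unif d r) \<le> 2" .
  from sphere_linear_tail[OF d r prob_space_sphere_unif sets_sphere_unif this, of t]
  have "emeasure (sphere_unif d r \<Otimes>\<^sub>M sphere_unif d r) {z\<in>space (sphere_unif d r \<Otimes>\<^sub>M sphere_unif d r).
      \<bar>(1/r) * inner_d d (fst z) (snd z)\<bar> > t * (sqrt 2 * r / sqrt (real d))}
    \<le> ennreal (4 * exp (- t) + 2 * exp (- sqrt (real d) / 8))"
    unfolding inner_scaled_id .
  moreover have "\<bar>(1/r) * x\<bar> > y \<longleftrightarrow> \<bar>x\<bar> > r * y" for x y
    using r by (simp add: abs_mult pos_less_divide_eq mult.commute)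
  ultimately show ?thesis by simp
qed

lemma frob_sqrt_id_sqrt:
  assumes pd: "pos_def_d d Lam"
  shows "frob_sq d (mat_mult_d d (mat_mult_d d (mat_sqrt_d d Lam) (\<lambda>i j. l * id_mat i j)) (mat_sqrt_d d Lam)) = l\<^sup>2 * frob_sq d Lam"
  unfolding frob_sq_scale[symmetric]
proof (rule frob_sq_cong)
  fix i j assume ij: "i < d" "j < d"
  let ?S = "mat_sqrt_d d Lam"
  have "mat_mult_d d ?S (\<lambda>i j. l * id_mat i j) i k = l * ?S i k" if "k < d" for k
    using mat_mult_id_right[OF that, of ?S i] by (simp add: mat_mult_d_def mult.left_commute flip: sum_distrib_left)
  hence "mat_mult_d d (mat_mult_d d ?S (\<lambda>i j. l * id_mat i j)) ?S i j = mat_mult_d d (\<lambda>i k. l * ?S i k) ?S i j"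
    by (intro mat_mult_cong) auto
  also have "\<dots> = l * mat_mult_d d ?S ?S i j" by (simp add: mat_mult_d_def sum_distrib_left mult.assoc)
  finally show "mat_mult_d d (mat_mult_d d ?S (\<lambda>i j. l * id_mat i j)) ?S i j = l * Lam i j"
    using mat_sqrt_d(2)[OF pd ij] by simp
qed

lemma noise_noise_inner_tail:
  assumes pd: "pos_def_d d Lam" and F2: "frob_sq d Lam > 0"
    and P: "subgauss d P (mat_sqrt_d d Lam)" and Q: "subgauss d Q (mat_sqrt_d d Lam)"
  shows "emeasure (P \<Otimes>\<^sub>M Q) {z\<in>space (P \<Otimes>\<^sub>M Q). \<bar>inner_d d (fst z) (snd z)\<bar> > 2 * sqrt (frob_sq d Lam) * t}
    \<le> ennreal (4 * exp (- t))"
proof -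
  define l where "l = 1 / (2 * sqrt (frob_sq d Lam))"
  have l: "l > 0" using F2 by (simp add: l_def)
  have l2: "l\<^sup>2 * frob_sq d Lam = 1/4" using F2 by (simp add: l_def power_divide power_mult_distrib)
  have "(\<integral>\<^sup>+w. ennreal (exp (sq_norm d (mat_vec d (mat_mult_d d (mat_sqrt_d d Lam) (\<lambda>i j. l * id_mat i j)) w) / 2)) \<partial>Q) \<le> 2"
    by (rule subgauss_exp_sq_norm[OF Q mat_sqrt_d(1)[OF pd]]) (simp add: frob_sqrt_id_sqrt[OF pd] l2)
  from decoupled_tail[OF P subgaussD(1,2)[OF Q] this, of t]
  have "emeasure (P \<Otimes>\<^sub>M Q) {z\<in>space (P \<Otimes>\<^sub>M Q). \<bar>l * inner_d d (fst z) (snd z)\<bar> > t} \<le> ennreal (4 * exp (- t))"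
    unfolding inner_scaled_id .
  moreover have "\<bar>l * x\<bar> > t \<longleftrightarrow> \<bar>x\<bar> > 2 * sqrt (frob_sq d Lam) * t" for x
  proof -
    have "\<bar>l * x\<bar> > t \<longleftrightarrow> \<bar>x\<bar> / (2 * sqrt (frob_sq d Lam)) > t" using l by (simp add: abs_mult l_def)
    thus ?thesis using F2 by (simp add: pos_less_divide_eq mult.commute)
  qed
  ultimately show ?thesis by simp
qed

text \<open>The exponential moment of the squared norm, scaled by \<open>1 / (8 tr)\<close>, is at
  most 2; Markov's inequality gives the threshold \<open>8 tr t\<close>.\<close>

lemma noise_norm_tail:
  assumes pd: "pos_def_d d Lam" and T0: "trace_d d Lam > 0" and P: "subgauss d P (mat_sqrt_d d Lam)"
  shows "emeasure P {v\<in>space P. sq_norm d v > 8 * trace_d d Lam * t} \<le> ennreal (2 * exp (- t))"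
proof -
  define l where "l = 1 / (2 * sqrt (trace_d d Lam))"
  have l2: "l\<^sup>2 = 1 / (4 * trace_d d Lam)" using T0 by (simp add: l_def power_divide power_mult_distrib)
  have "(\<integral>\<^sup>+w. ennreal (exp (sq_norm d (mat_vec d (\<lambda>i j. l * id_mat i j) w) / 2)) \<partial>P) \<le> 2"
    by (rule subgauss_exp_sq_norm[OF P mat_sqrt_d(1)[OF pd]])
      (use T0 in \<open>simp add: frob_scaled_id_mult frob_sq_mat_sqrt[OF pd] l2\<close>)
  hence "(\<integral>\<^sup>+w. ennreal (exp (l\<^sup>2 * sq_norm d w / 2)) \<partial>P) \<le> 2" unfolding sq_norm_scaled_id .
  moreover have "(\<lambda>w. l\<^sup>2 * sq_norm d w / 2) \<in> borel_measurable P"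
    unfolding measurable_cong_sets[OF subgaussD(2)[OF P] refl]
    by (intro borel_measurable_divide borel_measurable_times borel_measurable_const measurable_sq_norm
        measurable_component_singleton) auto
  ultimately have "emeasure P {v\<in>space P. l\<^sup>2 * sq_norm d v / 2 > t} \<le> ennreal (2 * exp (- t))"
    by (intro markov_exp_tail)
  moreover have "l\<^sup>2 * x / 2 > t \<longleftrightarrow> x > 8 * trace_d d Lam * t" for x
    unfolding l2 using T0 by (simp add: pos_less_divide_eq mult_ac)
  ultimately show ?thesis by simp
qed

text \<open>The norm can differ from \<open>r\<close> only at a Gaussian vector of norm zero.
  Placing this event inside the lower norm tail gives a bound already available.\<close>

lemma sphere_norm_tail:
  "emeasure (sphere_unif d r) {\<mu>\<in>space (sphere_unif d r). sq_norm d \<mu> \<noteq> r\<^sup>2} \<le> ennreal (2 * exp (- sqrt (real d) / 8))"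
  if "d \<ge> 1"
proof -
  have mp: "sphere_proj d r \<in> measurable (std_gauss d) (borel_d d)"
    by (simp add: measurable_cong_sets[OF sets_std_gauss refl])
  have [measurable]: "sq_norm d \<in> borel_measurable (borel_d d)"
    by (intro measurable_sq_norm measurable_component_singleton) auto
  hence [measurable]: "sq_norm d \<in> borel_measurable (std_gauss d)"
    by (simp only: measurable_cong_sets[OF sets_std_gauss refl])
  have "emeasure (sphere_unif d r) {\<mu>\<in>space (sphere_unif d r). sq_norm d \<mu> \<noteq> r\<^sup>2} =
      emeasure (std_gauss d) (sphere_proj d r -` {\<mu>\<in>space (borel_d d). sq_norm d \<mu> \<noteq> r\<^sup>2} \<inter> space (std_gauss d))"
    unfolding sphere_unif_eq space_distr by (rule emeasure_distr[OF mp]) measurable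
  also have "\<dots> \<le> emeasure (std_gauss d) {g\<in>space (std_gauss d). sq_norm d g < real d / 2}"
    by (rule emeasure_mono) (use that in \<open>auto simp: sq_norm_sphere_proj split: if_splits\<close>, measurable)
  also have "\<dots> \<le> ennreal (2 * exp (- sqrt (real d) / 8))" by (rule std_gauss_norm_tails)
  finally show ?thesis .
qed

section \<open>Noise vectors of a pre-training task\<close>

type_synonym task_noise = "(nat \<Rightarrow> real) \<times> (nat \<Rightarrow> vecd)"

definition task_noise_measure :: "nat \<Rightarrow> matd \<Rightarrow> nat \<Rightarrow> task_noise measure" where
  "task_noise_measure d Lam N = signs {1..N+1} \<Otimes>\<^sub>M noise d Lam {1..N+1}"

definition mean_noise :: "nat \<Rightarrow> nat \<Rightarrow> task_noise \<Rightarrow> vecd" where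
  "mean_noise d N q = (case q of (y, z) \<Rightarrow> comb d {1..N} (\<lambda>i. y i / real N) z)"

definition last_noise :: "nat \<Rightarrow> nat \<Rightarrow> task_noise \<Rightarrow> vecd" where
  "last_noise d N q = (case q of (y, z) \<Rightarrow> comb d {N+1} (\<lambda>_. y (N+1)) z)"

lemma task_measure_eq: "task_measure d Lam R N = sphere_unif d R \<Otimes>\<^sub>M task_noise_measure d Lam N"
  by (simp add: task_measure_def task_noise_measure_def)

lemma prob_space_task_noise: "prob_space (task_noise_measure d Lam N)"
  unfolding task_noise_measure_def by (intro prob_space_pair prob_space_signs prob_space_noise)

lemma prob_space_task: "prob_space (task_measure d Lam R N)"
  unfolding task_measure_eq by (intro prob_space_pair prob_space_sphere_unif prob_space_task_noise)

lemma measurable_task_noise_components: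
  "i \<in> {1..N+1} \<Longrightarrow> (\<lambda>q. fst q i) \<in> borel_measurable (task_noise_measure d Lam N)"
  "i \<in> {1..N+1} \<Longrightarrow> k < d \<Longrightarrow> (\<lambda>q. snd q i k) \<in> borel_measurable (task_noise_measure d Lam N)"
  unfolding task_noise_measure_def
  by (rule measurable_compose[OF measurable_fst measurable_signs_nth], assumption)
    (rule measurable_compose[OF measurable_snd measurable_noise_nth])

lemma measurable_mean_noise: "mean_noise d N \<in> measurable (task_noise_measure d Lam N) (borel_d d)"
  unfolding mean_noise_def case_prod_unfold comb_def
  by (intro measurable_restrict_borel_d borel_measurable_sum borel_measurable_times borel_measurable_divide
      borel_measurable_const measurable_task_noise_components) auto

lemma measurable_last_noise: "last_noise d N \<in> measurable (task_noise_measure d Lam N) (borel_d d)"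
  unfolding last_noise_def case_prod_unfold comb_def
  by (intro measurable_restrict_borel_d borel_measurable_sum borel_measurable_times
      measurable_task_noise_components) auto

lemma task_noise_integral_bound:
  assumes h: "h \<in> borel_measurable (task_noise_measure d Lam N)"
    and bnd: "\<And>y. (\<forall>i\<in>{1..N+1}. y i \<in> {-1, 1}) \<Longrightarrow> (\<integral>\<^sup>+z. h (y, z) \<partial>noise d Lam {1..N+1}) \<le> B"
  shows "(\<integral>\<^sup>+q. h q \<partial>task_noise_measure d Lam N) \<le> B"
  unfolding task_noise_measure_def
proof (rule nn_integral_pair_bound[OF prob_space_signs prob_space_noise])
  show "h \<in> borel_measurable (signs {1..N+1} \<Otimes>\<^sub>M noise d Lam {1..N+1})"
    using h by (simp only: task_noise_measure_def)
  show "AE y in signs {1..N+1}. (\<integral>\<^sup>+z. h (y, z) \<partial>noise d Lam {1..N+1}) \<le> B"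
    by (rule AE_mp[OF AE_signs], simp, intro AE_I2 impI bnd)
qed

lemma mean_coeff_sq_sum:
  assumes "\<forall>i\<in>{1..N+1}. y i \<in> {-1, 1}" "N \<ge> 1"
  shows "(\<Sum>i\<in>{1..N}. (y i / real N)\<^sup>2) \<le> 1"
proof -
  have "(\<Sum>i\<in>{1..N}. (y i / real N)\<^sup>2) = (\<Sum>i\<in>{1..N}. (1 / real N)\<^sup>2)"
  proof (intro sum.cong refl)
    fix i assume "i \<in> {1..N}"
    hence "(y i)\<^sup>2 = 1" by (intro sign_sq[OF assms(1)]) auto
    thus "(y i / real N)\<^sup>2 = (1 / real N)\<^sup>2" by (simp add: power_divide)
  qed
  also have "\<dots> = 1 / real N" using assms(2) by (simp add: power2_eq_square)
  also have "\<dots> \<le> 1" using assms(2) by simp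
  finally show ?thesis .
qed

lemma subgauss_mean_last_noise:
  assumes pd: "pos_def_d d Lam" and N: "N \<ge> 1"
  shows "subgauss d (distr (task_noise_measure d Lam N) (borel_d d) (mean_noise d N)) (mat_sqrt_d d Lam)"
    and "subgauss d (distr (task_noise_measure d Lam N) (borel_d d) (last_noise d N)) (mat_sqrt_d d Lam)"
proof -
  have me: "(\<lambda>q. ennreal (exp (inner_d d a (f q)))) \<in> borel_measurable (task_noise_measure d Lam N)"
    if f: "f \<in> measurable (task_noise_measure d Lam N) (borel_d d)" for f a
    by (intro measurable_compose[OF _ measurable_ennreal] measurable_compose[OF _ borel_measurable_exp]
        measurable_inner_d borel_measurable_const measurable_nth_borel_d[OF refl f])
  show "subgauss d (distr (task_noise_measure d Lam N) (borel_d d) (mean_noise d N)) (mat_sqrt_d d Lam)"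
  proof (rule subgauss_law[OF prob_space_task_noise measurable_mean_noise],
      rule task_noise_integral_bound[OF me[OF measurable_mean_noise]])
    fix a y assume y: "\<forall>i\<in>{1..N+1}. y i \<in> {-1, 1::real}"
    show "(\<integral>\<^sup>+z. ennreal (exp (inner_d d a (mean_noise d N (y, z)))) \<partial>noise d Lam {1..N+1}) \<le>
        ennreal (exp (sq_norm d (mat_vec d (mat_sqrt_d d Lam) a) / 2))"
      using mean_coeff_sq_sum[OF y N] unfolding mean_noise_def prod.case
      by (intro noise_comb_mgf_subset[OF pd]) auto
  qed
  show "subgauss d (distr (task_noise_measure d Lam N) (borel_d d) (last_noise d N)) (mat_sqrt_d d Lam)"
  proof (rule subgauss_law[OF prob_space_task_noise measurable_last_noise],
      rule task_noise_integral_bound[OF me[OF measurable_last_noise]])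
    fix a y assume y: "\<forall>i\<in>{1..N+1}. y i \<in> {-1, 1::real}"
    hence "(\<Sum>i\<in>{N+1}. (y (N+1))\<^sup>2) \<le> 1" using sign_sq[OF y, of "N+1"] by simp
    thus "(\<integral>\<^sup>+z. ennreal (exp (inner_d d a (last_noise d N (y, z)))) \<partial>noise d Lam {1..N+1}) \<le>
        ennreal (exp (sq_norm d (mat_vec d (mat_sqrt_d d Lam) a) / 2))"
      unfolding last_noise_def prod.case by (intro noise_comb_mgf_subset[OF pd]) auto
  qed
qed

text \<open>Both vectors belong to the same task and share its labels, so the product form of
  \<open>noise_noise_inner_tail\<close> does not apply; given the labels, they use disjoint noise
  indices.\<close>

lemma mean_last_inner_tail:
  assumes pd: "pos_def_d d Lam" and F2: "frob_sq d Lam > 0" and N: "N \<ge> 1"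
  shows "emeasure (task_noise_measure d Lam N) {q\<in>space (task_noise_measure d Lam N).
      \<bar>inner_d d (mean_noise d N q) (last_noise d N q)\<bar> > 2 * sqrt (frob_sq d Lam) * t} \<le> ennreal (4 * exp (- t))"
proof -
  let ?Q = "task_noise_measure d Lam N"
  define l where "l = 1 / (2 * sqrt (frob_sq d Lam))"
  have l: "l > 0" using F2 by (simp add: l_def)
  have l2: "l\<^sup>2 * frob_sq d Lam = 1/4" using F2 by (simp add: l_def power_divide power_mult_distrib)
  let ?A = "\<lambda>i j. l * id_mat i j"
  let ?E = "{q\<in>space ?Q. \<bar>inner_d d (mean_noise d N q) (mat_vec d ?A (last_noise d N q))\<bar> > t}"
  have [measurable]: "?E \<in> sets ?Q"
  proof -
    have [measurable]: "(\<lambda>q. \<bar>inner_d d (mean_noise d N q) (mat_vec d ?A (last_noise d N q))\<bar>) \<in> borel_measurable ?Q"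
      by (intro borel_measurable_abs measurable_inner_d measurable_mat_vec
          measurable_nth_borel_d[OF refl measurable_mean_noise] measurable_nth_borel_d[OF refl measurable_last_noise])
    show ?thesis by measurable
  qed
  have "emeasure ?Q ?E = (\<integral>\<^sup>+q. indicator ?E q \<partial>?Q)" by simp
  also have "\<dots> \<le> ennreal (4 * exp (- t))"
  proof (rule task_noise_integral_bound)
    fix y :: "nat \<Rightarrow> real"
    assume y: "\<forall>i\<in>{1..N+1}. y i \<in> {-1, 1}"
    let ?N = "noise d Lam {1..N+1}"
    let ?c = "\<lambda>i. y i / real N"
    have ins: "insert (N+1) {1..N} = {1..N+1}" by auto
    have y1: "(y (N+1))\<^sup>2 = 1" by (rule sign_sq[OF y]) auto
    let ?B = "{z\<in>space ?N. \<bar>inner_d d (comb d {1..N} ?c z) (mat_vec d ?A (comb d {N+1} (\<lambda>_. y (N+1)) z))\<bar> > t}"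
    have "(\<integral>\<^sup>+z. indicator ?E (y, z) \<partial>?N) \<le> (\<integral>\<^sup>+z. indicator ?B z \<partial>?N)"
      by (intro nn_integral_mono) (auto simp: indicator_def mean_noise_def last_noise_def)
    also have "\<dots> = emeasure ?N ?B"
    proof (rule nn_integral_indicator)
      have [measurable]: "(\<lambda>z. \<bar>inner_d d (comb d {1..N} ?c z) (mat_vec d ?A (comb d {N+1} (\<lambda>_. y (N+1)) z))\<bar>) \<in> borel_measurable ?N"
        by (intro borel_measurable_abs measurable_inner_d measurable_mat_vec)
          (auto simp: comb_def intro!: borel_measurable_sum borel_measurable_divide borel_measurable_times measurable_noise_nth)
      show "?B \<in> sets ?N" by measurable
    qed
    also have "\<dots> \<le> ennreal (4 * exp (- t))"
      unfolding ins[symmetric]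
    proof (rule noise_bilinear_tail[OF pd])
      show "(\<Sum>i\<in>{1..N}. (?c i)\<^sup>2) * (y (N+1))\<^sup>2 *
          frob_sq d (mat_mult_d d (mat_mult_d d (mat_sqrt_d d Lam) ?A) (mat_sqrt_d d Lam)) \<le> 1/4"
        unfolding y1 frob_sqrt_id_sqrt[OF pd] l2 using mean_coeff_sq_sum[OF y N] by simp
    qed auto
    finally show "(\<integral>\<^sup>+z. indicator ?E (y, z) \<partial>?N) \<le> ennreal (4 * exp (- t))" .
  qed simp
  also have "?E = {q\<in>space ?Q. \<bar>inner_d d (mean_noise d N q) (last_noise d N q)\<bar> > 2 * sqrt (frob_sq d Lam) * t}"
  proof -
    have "\<bar>l * x\<bar> > t \<longleftrightarrow> \<bar>x\<bar> > 2 * sqrt (frob_sq d Lam) * t" for x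
    proof -
      have "\<bar>l * x\<bar> > t \<longleftrightarrow> \<bar>x\<bar> / (2 * sqrt (frob_sq d Lam)) > t" using l by (simp add: abs_mult l_def)
      thus ?thesis using F2 by (simp add: pos_less_divide_eq mult.commute)
    qed
    thus ?thesis unfolding inner_scaled_id by simp
  qed
  finally show ?thesis .
qed

section \<open>Events depending on one or two tasks\<close>

lemma PiM_pair_event:
  assumes T: "prob_space T" and I: "finite I" "i \<in> I" "j \<in> I" "i \<noteq> j" and A: "A \<in> sets (T \<Otimes>\<^sub>M T)"
  shows "emeasure (PiM I (\<lambda>_. T)) {\<omega>\<in>space (PiM I (\<lambda>_. T)). (\<omega> i, \<omega> j) \<in> A} = emeasure (T \<Otimes>\<^sub>M T) A"
proof -
  interpret T: prob_space T by fact
  interpret product_sigma_finite "\<lambda>_. T" by (simp add: product_sigma_finite_def T.sigma_finite_measure_axioms)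
  interpret TT: pair_sigma_finite T T ..
  let ?M = "PiM I (\<lambda>_. T)" and ?J = "I - {i}"
  \<comment> \<open>Coordinate \<open>i\<close> is split off and integrated last; the law of
    coordinate \<open>j\<close> under the remaining product is again \<open>T\<close>.\<close>
  have Ieq: "I = insert i ?J" using I by auto
  note [measurable] = A
  have m [measurable]: "(\<lambda>\<omega>. (\<omega> i, \<omega> j)) \<in> measurable ?M (T \<Otimes>\<^sub>M T)"
    using I by (intro measurable_Pair measurable_component_singleton) auto
  have "emeasure ?M {\<omega>\<in>space ?M. (\<omega> i, \<omega> j) \<in> A} = (\<integral>\<^sup>+\<omega>. indicator A (\<omega> i, \<omega> j) \<partial>?M)"
    by (subst nn_integral_indicator[symmetric], measurable, intro nn_integral_cong) (auto simp: indicator_def)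
  also have "\<dots> = (\<integral>\<^sup>+\<omega>. indicator A (\<omega> i, \<omega> j) \<partial>PiM (insert i ?J) (\<lambda>_. T))" using Ieq by simp
  also have "\<dots> = (\<integral>\<^sup>+y. \<integral>\<^sup>+x. indicator A ((x(i := y)) i, (x(i := y)) j) \<partial>PiM ?J (\<lambda>_. T) \<partial>T)"
    by (rule product_nn_integral_insert_rev) (use I m Ieq in auto)
  also have "\<dots> = (\<integral>\<^sup>+y. \<integral>\<^sup>+x. indicator A (y, x j) \<partial>PiM ?J (\<lambda>_. T) \<partial>T)"
    using I by simp
  also have "\<dots> = (\<integral>\<^sup>+y. \<integral>\<^sup>+z. indicator A (y, z) \<partial>T \<partial>T)"
  proof (rule nn_integral_cong)
    fix y assume y: "y \<in> space T"
    have c: "(\<lambda>x. x j) \<in> measurable (PiM ?J (\<lambda>_. T)) T" using I by (intro measurable_component_singleton) auto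
    have Am: "(\<lambda>z. indicator A (y, z) :: ennreal) \<in> borel_measurable T"
      using y by measurable
    have "(\<integral>\<^sup>+z. indicator A (y, z) \<partial>T) = (\<integral>\<^sup>+z. indicator A (y, z) \<partial>distr (PiM ?J (\<lambda>_. T)) T (\<lambda>x. x j))"
      using distr_PiM_component[of ?J "\<lambda>_. T" j] I T by simp
    also have "\<dots> = (\<integral>\<^sup>+x. indicator A (y, x j) \<partial>PiM ?J (\<lambda>_. T))" by (subst nn_integral_distr[OF c]) (simp_all add: Am)
    finally show "(\<integral>\<^sup>+x. indicator A (y, x j) \<partial>PiM ?J (\<lambda>_. T)) = (\<integral>\<^sup>+z. indicator A (y, z) \<partial>T)" ..
  qed
  also have "\<dots> = (\<integral>\<^sup>+z. indicator A z \<partial>(T \<Otimes>\<^sub>M T))" by (rule T.nn_integral_fst) simp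
  also have "\<dots> = emeasure (T \<Otimes>\<^sub>M T) A" by simp
  finally show ?thesis .
qed

lemma PiM_single_event:
  assumes T: "prob_space T" and I: "finite I" "i \<in> I" and A: "A \<in> sets T"
  shows "emeasure (PiM I (\<lambda>_. T)) {\<omega>\<in>space (PiM I (\<lambda>_. T)). \<omega> i \<in> A} = emeasure T A"
proof -
  let ?M = "PiM I (\<lambda>_. T)"
  have c: "(\<lambda>x. x i) \<in> measurable ?M T" using I by (intro measurable_component_singleton) auto
  have "emeasure T A = emeasure (distr ?M T (\<lambda>x. x i)) A" using distr_PiM_component[of I "\<lambda>_. T" i] I T by simp
  also have "\<dots> = emeasure ?M ((\<lambda>x. x i) -` A \<inter> space ?M)" by (rule emeasure_distr[OF c A])
  also have "(\<lambda>x. x i) -` A \<inter> space ?M = {\<omega>\<in>space ?M. \<omega> i \<in> A}" by auto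
  finally show ?thesis ..
qed

text \<open>Vectors computed from two different tasks are independent, so the event has the
  probability it has under the product of their laws, where the decoupled tails apply.\<close>

lemma PiM_inner_event:
  assumes T: "prob_space T" and I: "finite I" "i \<in> I" "j \<in> I" "i \<noteq> j"
    and f: "f \<in> measurable T (borel_d d)" and g: "g \<in> measurable T (borel_d d)"
  shows "emeasure (PiM I (\<lambda>_. T)) {\<omega>\<in>space (PiM I (\<lambda>_. T)). \<bar>inner_d d (f (\<omega> i)) (g (\<omega> j))\<bar> > \<theta>} =
    emeasure (distr T (borel_d d) f \<Otimes>\<^sub>M distr T (borel_d d) g)
      {z\<in>space (distr T (borel_d d) f \<Otimes>\<^sub>M distr T (borel_d d) g). \<bar>inner_d d (fst z) (snd z)\<bar> > \<theta>}"
proof -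
  interpret T: prob_space T by fact
  interpret Dg: prob_space "distr T (borel_d d) g" by (rule T.prob_space_distr[OF g])
  have X [measurable]: "(\<lambda>z. \<bar>inner_d d (fst z) (snd z)\<bar>) \<in> borel_measurable (borel_d d \<Otimes>\<^sub>M borel_d d)"
    by (intro borel_measurable_abs measurable_inner_d measurable_pair_nth) auto
  let ?A = "{z\<in>space (borel_d d \<Otimes>\<^sub>M borel_d d). \<bar>inner_d d (fst z) (snd z)\<bar> > \<theta>}"
  have A: "?A \<in> sets (borel_d d \<Otimes>\<^sub>M borel_d d)" by measurable
  have fg: "(\<lambda>(x, y). (f x, g y)) \<in> measurable (T \<Otimes>\<^sub>M T) (borel_d d \<Otimes>\<^sub>M borel_d d)"
    using f g by measurable
  let ?B = "(\<lambda>(x, y). (f x, g y)) -` ?A \<inter> space (T \<Otimes>\<^sub>M T)"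
  have B: "?B \<in> sets (T \<Otimes>\<^sub>M T)" by (rule measurable_sets[OF fg A])
  have "{\<omega>\<in>space (PiM I (\<lambda>_. T)). \<bar>inner_d d (f (\<omega> i)) (g (\<omega> j))\<bar> > \<theta>} =
      {\<omega>\<in>space (PiM I (\<lambda>_. T)). (\<omega> i, \<omega> j) \<in> ?B}"
  proof -
    have "\<omega> i \<in> space T \<and> \<omega> j \<in> space T" if "\<omega> \<in> space (PiM I (\<lambda>_. T))" for \<omega>
      using that I by (auto simp: space_PiM)
    thus ?thesis using measurable_space[OF f] measurable_space[OF g] by (auto simp: space_pair_measure)
  qed
  hence "emeasure (PiM I (\<lambda>_. T)) {\<omega>\<in>space (PiM I (\<lambda>_. T)). \<bar>inner_d d (f (\<omega> i)) (g (\<omega> j))\<bar> > \<theta>} =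
      emeasure (T \<Otimes>\<^sub>M T) ?B"
    using PiM_pair_event[OF T I B] by simp
  also have "\<dots> = emeasure (distr (T \<Otimes>\<^sub>M T) (borel_d d \<Otimes>\<^sub>M borel_d d) (\<lambda>(x, y). (f x, g y))) ?A"
    by (rule emeasure_distr[OF fg A, symmetric])
  also have "distr (T \<Otimes>\<^sub>M T) (borel_d d \<Otimes>\<^sub>M borel_d d) (\<lambda>(x, y). (f x, g y)) =
      distr T (borel_d d) f \<Otimes>\<^sub>M distr T (borel_d d) g"
    by (rule pair_measure_distr[OF f g Dg.sigma_finite_measure_axioms, symmetric])
  finally show ?thesis by (simp add: space_pair_measure)
qed

lemma measurable_task_fst: "fst \<in> measurable (task_measure d Lam R N) (borel_d d)"
proof -
  have "fst \<in> measurable (task_measure d Lam R N) (sphere_unif d R)"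
    unfolding task_measure_eq by (rule measurable_fst)
  thus ?thesis by (simp only: measurable_cong_sets[OF refl sets_sphere_unif])
qed

lemma distr_task_fst: "distr (task_measure d Lam R N) (borel_d d) fst = sphere_unif d R"
proof (rule measure_eqI)
  show "sets (distr (task_measure d Lam R N) (borel_d d) fst) = sets (sphere_unif d R)"
    by (simp add: sets_sphere_unif)
  fix A assume "A \<in> sets (distr (task_measure d Lam R N) (borel_d d) fst)"
  hence A: "A \<in> sets (borel_d d)" by simp
  note m = measurable_task_fst[of d Lam R N]
  have "fst -` A \<inter> space (task_measure d Lam R N) = {s\<in>space (task_measure d Lam R N). fst s \<in> A}" by auto
  thus "emeasure (distr (task_measure d Lam R N) (borel_d d) fst) A = emeasure (sphere_unif d R) A"
    using emeasure_distr[OF m A] emeasure_pair_fst_snd(1)[OF prob_space_sphere_unif prob_space_task_noise, of A d R d Lam N] A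
    by (simp add: task_measure_eq sets_sphere_unif)
qed

lemma distr_task_snd:
  assumes f: "f \<in> measurable (task_noise_measure d Lam N) (borel_d d)"
  shows "distr (task_measure d Lam R N) (borel_d d) (\<lambda>t. f (snd t)) = distr (task_noise_measure d Lam N) (borel_d d) f"
proof (rule measure_eqI)
  fix A assume "A \<in> sets (distr (task_measure d Lam R N) (borel_d d) (\<lambda>t. f (snd t)))"
  hence A: "A \<in> sets (borel_d d)" by simp
  have m: "(\<lambda>t. f (snd t)) \<in> measurable (task_measure d Lam R N) (borel_d d)"
    unfolding task_measure_eq by (rule measurable_compose[OF measurable_snd f])
  have B: "f -` A \<inter> space (task_noise_measure d Lam N) \<in> sets (task_noise_measure d Lam N)"
    by (rule measurable_sets[OF f A])
  have "(\<lambda>t. f (snd t)) -` A \<inter> space (task_measure d Lam R N) =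
      {s\<in>space (sphere_unif d R \<Otimes>\<^sub>M task_noise_measure d Lam N). snd s \<in> f -` A \<inter> space (task_noise_measure d Lam N)}"
    unfolding task_measure_eq by (auto simp: space_pair_measure)
  thus "emeasure (distr (task_measure d Lam R N) (borel_d d) (\<lambda>t. f (snd t))) A =
      emeasure (distr (task_noise_measure d Lam N) (borel_d d) f) A"
    using emeasure_distr[OF m A] emeasure_distr[OF f A]
      emeasure_pair_fst_snd(2)[OF prob_space_sphere_unif prob_space_task_noise B, of d R]
    by (simp add: task_measure_eq)
qed simp

text \<open>The locale is used with \<open>t = 4 ln (2 B\<^sup>2 / \<delta>)\<close>, so that events of probability of order \<open>exp (- t)\<close>
  survive a union bound over all \<open>B\<^sup>2\<close> pairs of tasks.\<close>

locale pretraining =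
  fixes d N B :: nat and Lam :: matd and R t :: real
  assumes pd: "pos_def_d d Lam" and d: "d \<ge> 1" and N: "N \<ge> 1" and R: "R > 0"
    and R2: "sqrt (real d * frob_sq d Lam) \<le> R\<^sup>2" and t: "t \<ge> 1" "16 * t \<le> sqrt (real d)"
begin

abbreviation "T \<equiv> task_measure d Lam R N"
abbreviation "Pre \<equiv> pretrain_measure d Lam R N B"
abbreviation "V \<equiv> \<lambda>s::task. mean_noise d N (snd s)"
abbreviation "W \<equiv> \<lambda>s::task. last_noise d N (snd s)"

lemma Pre_eq: "Pre = PiM {1..B} (\<lambda>_. T)" by (simp add: pretrain_measure_def)

lemma prob_space_Pre: "prob_space Pre"
  unfolding Pre_eq by (intro prob_space_PiM prob_space_task)

definition "e = exp (- t)"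
text \<open>The levels of the tail bounds at parameter \<open>t\<close>: mean against mean, mean
  against noise, noise against noise.\<close>

definition "\<theta>\<^sub>1 = R * (t * (sqrt 2 * R / sqrt (real d)))"
definition "\<theta>\<^sub>2 = 2 * sqrt (trace_d d Lam) * (t * (sqrt 2 * R / sqrt (real d)))"
definition "\<theta>\<^sub>3 = 2 * sqrt (frob_sq d Lam) * t"

lemma trace_pos: "trace_d d Lam > 0" "frob_sq d Lam > 0"
proof -
  show T0: "trace_d d Lam > 0" by (rule trace_pos_def[OF pd d])
  show "frob_sq d Lam > 0" by (rule frob_sq_pos_if_trace_pos[OF T0])
qed

lemma trace_le: "trace_d d Lam \<le> R\<^sup>2"
proof -
  have "trace_d d Lam \<le> sqrt (real d * frob_sq d Lam)" by (rule real_le_rsqrt[OF trace_sq_le])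
  thus ?thesis using R2 by simp
qed

definition "r = R\<^sup>2 / sqrt (real d)"

text \<open>All three levels are reduced to \<open>t * r\<close>, with
  \<open>r = R^2 / sqrt d\<close> the scale of an inner product of different tasks. This uses that
  the trace is at most \<open>R^2\<close> and the Frobenius norm at most \<open>r\<close>, both from
  \<open>R2\<close>, together with \<open>sqrt 2 \<le> 3/2\<close>.\<close>

lemma r: "r > 0" "t * r \<le> R\<^sup>2 / 16" "\<theta>\<^sub>1 \<le> 3/2 * (t * r)" "\<theta>\<^sub>2 \<le> 3 * (t * r)" "\<theta>\<^sub>3 \<le> 2 * (t * r)"
proof -
  have sd: "sqrt (real d) > 0" using d by simp
  have s2: "sqrt 2 \<le> (3/2::real)" by (rule real_le_lsqrt) (auto simp: power2_eq_square)
  show r0: "r > 0" using R sd by (simp add: r_def)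
  have tr0: "t * r \<ge> 0" using r0 t by simp
  have "t * R\<^sup>2 \<le> (sqrt (real d) / 16) * R\<^sup>2" using t by (intro mult_right_mono) auto
  thus "t * r \<le> R\<^sup>2 / 16" using sd by (simp add: r_def field_simps)
  have "\<theta>\<^sub>1 = sqrt 2 * (t * r)" by (simp add: \<theta>\<^sub>1_def r_def power2_eq_square)
  thus "\<theta>\<^sub>1 \<le> 3/2 * (t * r)" using mult_right_mono[OF s2 tr0] by simp
  have "sqrt (trace_d d Lam) \<le> R" using trace_le R by (intro real_le_lsqrt) (auto simp: trace_pos less_imp_le)
  hence "\<theta>\<^sub>2 \<le> 2 * R * (t * (sqrt 2 * R / sqrt (real d)))"
    unfolding \<theta>\<^sub>2_def using t R by (intro mult_right_mono mult_left_mono) auto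
  also have "\<dots> = 2 * (sqrt 2 * (t * r))" by (simp add: r_def power2_eq_square)
  also have "\<dots> \<le> 2 * (3/2 * (t * r))" using mult_right_mono[OF s2 tr0] by simp
  finally show "\<theta>\<^sub>2 \<le> 3 * (t * r)" by simp
  have "sqrt (frob_sq d Lam) \<le> r" using R2 sd by (simp add: r_def real_sqrt_mult pos_le_divide_eq mult.commute)
  hence "2 * sqrt (frob_sq d Lam) * t \<le> 2 * r * t" using t by (intro mult_right_mono) auto
  thus "\<theta>\<^sub>3 \<le> 2 * (t * r)" by (simp add: \<theta>\<^sub>3_def mult_ac)
qed

lemma e_bounds: "e > 0" "exp (- sqrt (real d) / 8) \<le> e"
  using t by (auto simp: e_def)

text \<open>Mean against noise is listed in one order only, as \<open>bad\<close> ranges over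
  ordered pairs. Products of \<open>V\<close> and \<open>W\<close> from different tasks do not
  occur: signals are compared with signals and queries with queries.\<close>

definition pair_bad :: "nat \<Rightarrow> nat \<Rightarrow> (nat \<Rightarrow> task) set" where
  "pair_bad i j = {\<omega>\<in>space Pre. \<bar>inner_d d (fst (\<omega> i)) (fst (\<omega> j))\<bar> > \<theta>\<^sub>1}
     \<union> {\<omega>\<in>space Pre. \<bar>inner_d d (fst (\<omega> i)) (V (\<omega> j))\<bar> > \<theta>\<^sub>2}
     \<union> {\<omega>\<in>space Pre. \<bar>inner_d d (fst (\<omega> i)) (W (\<omega> j))\<bar> > \<theta>\<^sub>2}
     \<union> {\<omega>\<in>space Pre. \<bar>inner_d d (V (\<omega> i)) (V (\<omega> j))\<bar> > \<theta>\<^sub>3}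
     \<union> {\<omega>\<in>space Pre. \<bar>inner_d d (W (\<omega> i)) (W (\<omega> j))\<bar> > \<theta>\<^sub>3}"

definition task_bad :: "task set" where
  "task_bad = {s\<in>space T. fst s \<in> {\<mu>\<in>space (sphere_unif d R). sq_norm d \<mu> \<noteq> R\<^sup>2}}
     \<union> {s\<in>space T. sq_norm d (V s) > 8 * trace_d d Lam * t}
     \<union> {s\<in>space T. sq_norm d (W s) > 8 * trace_d d Lam * t}
     \<union> {s\<in>space T. \<bar>inner_d d (fst s) (V s)\<bar> > \<theta>\<^sub>2}
     \<union> {s\<in>space T. \<bar>inner_d d (fst s) (W s)\<bar> > \<theta>\<^sub>2}
     \<union> {s\<in>space T. \<bar>inner_d d (V s) (W s)\<bar> > \<theta>\<^sub>3}"

definition bad :: "(nat \<Rightarrow> task) set" where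
  "bad = (\<Union>i\<in>{1..B}. \<Union>j\<in>{1..B}. if i = j then {\<omega>\<in>space Pre. \<omega> i \<in> task_bad} else pair_bad i j)"

lemma meas_task: "fst \<in> measurable T (borel_d d)" "V \<in> measurable T (borel_d d)" "W \<in> measurable T (borel_d d)"
proof -
  show "fst \<in> measurable T (borel_d d)" by (rule measurable_task_fst)
  show "V \<in> measurable T (borel_d d)" "W \<in> measurable T (borel_d d)"
    unfolding task_measure_eq
    by (rule measurable_compose[OF measurable_snd measurable_mean_noise], rule measurable_compose[OF measurable_snd measurable_last_noise])
qed

lemma inner_event_sets:
  assumes "f \<in> measurable M (borel_d d)" "g \<in> measurable M (borel_d d)"
  shows "{s\<in>space M. \<bar>inner_d d (f s) (g s)\<bar> > \<theta>} \<in> sets M"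
proof -
  have [measurable]: "(\<lambda>s. \<bar>inner_d d (f s) (g s)\<bar>) \<in> borel_measurable M"
    by (intro borel_measurable_abs measurable_inner_d measurable_nth_borel_d[OF refl assms(1)] measurable_nth_borel_d[OF refl assms(2)])
  show ?thesis by measurable
qed

lemma meas_Pre:
  assumes "i \<in> {1..B}"
  shows "(\<lambda>\<omega>. \<omega> i) \<in> measurable Pre T"
  unfolding Pre_eq by (rule measurable_component_singleton[OF assms])

text \<open>Events involving the sphere cost \<open>6 * e\<close>, namely 4 plus 2 from
  \<open>exp (- sqrt d / 8) \<le> e\<close>; pure noise events cost \<open>4 * e\<close>. Together
  \<open>3 * 6 + 2 * 4 = 26\<close>. The events of a single task cost 22, rounded up to 26 for a
  uniform sum.\<close>

lemma pair_bad_bound: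
  assumes i: "i \<in> {1..B}" and j: "j \<in> {1..B}" and ij: "i \<noteq> j"
  shows "pair_bad i j \<in> sets Pre" "emeasure Pre (pair_bad i j) \<le> ennreal (26 * e)"
proof -
  note m = meas_task[THEN measurable_compose[OF meas_Pre[OF i]]] meas_task[THEN measurable_compose[OF meas_Pre[OF j]]]
  note S = inner_event_sets[OF m(1) m(4), of \<theta>\<^sub>1] inner_event_sets[OF m(1) m(5), of \<theta>\<^sub>2] inner_event_sets[OF m(1) m(6), of \<theta>\<^sub>2]
    inner_event_sets[OF m(2) m(5), of \<theta>\<^sub>3] inner_event_sets[OF m(3) m(6), of \<theta>\<^sub>3]
  show "pair_bad i j \<in> sets Pre" unfolding pair_bad_def by (intro sets.Un S)
  have six: "ennreal (4 * exp (- t) + 2 * exp (- sqrt (real d) / 8)) \<le> ennreal (6 * e)"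
    using e_bounds by (intro ennreal_leI) (simp add: e_def)
  note ev = PiM_inner_event[OF prob_space_task[of d Lam R N] finite_atLeastAtMost i j ij, folded Pre_eq]
  note sg = subgauss_mean_last_noise[OF pd N]
  have b1: "emeasure Pre {\<omega>\<in>space Pre. \<bar>inner_d d (fst (\<omega> i)) (fst (\<omega> j))\<bar> > \<theta>\<^sub>1} \<le> ennreal (6 * e)"
    unfolding ev[OF meas_task(1) meas_task(1)] distr_task_fst \<theta>\<^sub>1_def
    by (rule order_trans[OF sphere_sphere_inner_tail[OF d R] six])
  have b2: "emeasure Pre {\<omega>\<in>space Pre. \<bar>inner_d d (fst (\<omega> i)) (V (\<omega> j))\<bar> > \<theta>\<^sub>2} \<le> ennreal (6 * e)"
    unfolding ev[OF meas_task(1) meas_task(2)] distr_task_fst distr_task_snd[OF measurable_mean_noise] \<theta>\<^sub>2_def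
    by (rule order_trans[OF sphere_noise_inner_tail[OF pd d R sg(1) trace_pos(1)] six])
  have b3: "emeasure Pre {\<omega>\<in>space Pre. \<bar>inner_d d (fst (\<omega> i)) (W (\<omega> j))\<bar> > \<theta>\<^sub>2} \<le> ennreal (6 * e)"
    unfolding ev[OF meas_task(1) meas_task(3)] distr_task_fst distr_task_snd[OF measurable_last_noise] \<theta>\<^sub>2_def
    by (rule order_trans[OF sphere_noise_inner_tail[OF pd d R sg(2) trace_pos(1)] six])
  have b4: "emeasure Pre {\<omega>\<in>space Pre. \<bar>inner_d d (V (\<omega> i)) (V (\<omega> j))\<bar> > \<theta>\<^sub>3} \<le> ennreal (4 * e)"
    unfolding ev[OF meas_task(2) meas_task(2)] distr_task_snd[OF measurable_mean_noise] \<theta>\<^sub>3_def e_def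
    by (rule noise_noise_inner_tail[OF pd trace_pos(2) sg(1) sg(1)])
  have b5: "emeasure Pre {\<omega>\<in>space Pre. \<bar>inner_d d (W (\<omega> i)) (W (\<omega> j))\<bar> > \<theta>\<^sub>3} \<le> ennreal (4 * e)"
    unfolding ev[OF meas_task(3) meas_task(3)] distr_task_snd[OF measurable_last_noise] \<theta>\<^sub>3_def e_def
    by (rule noise_noise_inner_tail[OF pd trace_pos(2) sg(2) sg(2)])
  have "emeasure Pre (pair_bad i j) \<le> ennreal ((((6 * e + 6 * e) + 6 * e) + 4 * e) + 4 * e)"
    unfolding pair_bad_def using e_bounds(1)
    by (intro emeasure_Un_le sets.Un S b1 b2 b3 b4 b5) auto
  thus "emeasure Pre (pair_bad i j) \<le> ennreal (26 * e)" by simp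
qed

lemma task_bad_bound: "task_bad \<in> sets T" "emeasure T task_bad \<le> ennreal (26 * e)"
proof -
  note prP = prob_space_sphere_unif[of d R] and prQ = prob_space_task_noise[of d Lam N]
  note sg = subgauss_mean_last_noise[OF pd N]
  have six: "ennreal (4 * exp (- t) + 2 * exp (- sqrt (real d) / 8)) \<le> ennreal (6 * e)"
    using e_bounds by (intro ennreal_leI) (simp add: e_def)
  have sqm [measurable]: "sq_norm d \<in> borel_measurable (borel_d d)"
    by (intro measurable_sq_norm measurable_component_singleton) auto
  have A1: "{\<mu>\<in>space (sphere_unif d R). sq_norm d \<mu> \<noteq> R\<^sup>2} \<in> sets (sphere_unif d R)"
  proof -
    have [measurable]: "sq_norm d \<in> borel_measurable (sphere_unif d R)"
      using sqm by (simp only: measurable_cong_sets[OF sets_sphere_unif refl])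
    show ?thesis by measurable
  qed
  note [measurable] = A1
  have S1: "{s\<in>space T. fst s \<in> {\<mu>\<in>space (sphere_unif d R). sq_norm d \<mu> \<noteq> R\<^sup>2}} \<in> sets T"
    unfolding task_measure_eq by measurable
  have Snorm: "{s\<in>space T. sq_norm d (f s) > \<theta>} \<in> sets T" if "f \<in> measurable T (borel_d d)" for f \<theta>
    using that by measurable
  note S = S1 Snorm[OF meas_task(2)] Snorm[OF meas_task(3)] inner_event_sets[OF meas_task(1) meas_task(2), of \<theta>\<^sub>2]
    inner_event_sets[OF meas_task(1) meas_task(3), of \<theta>\<^sub>2] inner_event_sets[OF meas_task(2) meas_task(3), of \<theta>\<^sub>3]
  show "task_bad \<in> sets T" unfolding task_bad_def by (intro sets.Un S)
  have b1: "emeasure T {s\<in>space T. fst s \<in> {\<mu>\<in>space (sphere_unif d R). sq_norm d \<mu> \<noteq> R\<^sup>2}} \<le> ennreal (2 * e)"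
    unfolding task_measure_eq emeasure_pair_fst_snd(1)[OF prP prQ A1]
    by (rule order_trans[OF sphere_norm_tail[OF d]]) (use e_bounds in \<open>auto intro!: ennreal_leI\<close>)
  have bn: "emeasure T {s\<in>space T. sq_norm d (f (snd s)) > 8 * trace_d d Lam * t} \<le> ennreal (2 * e)"
    if f: "f \<in> measurable (task_noise_measure d Lam N) (borel_d d)"
      and sgf: "subgauss d (distr (task_noise_measure d Lam N) (borel_d d) f) (mat_sqrt_d d Lam)" for f
  proof -
    let ?A = "{v\<in>space (borel_d d). sq_norm d v > 8 * trace_d d Lam * t}"
    have A: "?A \<in> sets (borel_d d)" by measurable
    have m: "(\<lambda>s. f (snd s)) \<in> measurable T (borel_d d)"
      unfolding task_measure_eq by (rule measurable_compose[OF measurable_snd f])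
    have "{s\<in>space T. sq_norm d (f (snd s)) > 8 * trace_d d Lam * t} = (\<lambda>s. f (snd s)) -` ?A \<inter> space T"
      using measurable_space[OF m] by auto
    hence "emeasure T {s\<in>space T. sq_norm d (f (snd s)) > 8 * trace_d d Lam * t} = emeasure (distr T (borel_d d) (\<lambda>s. f (snd s))) ?A"
      using emeasure_distr[OF m A] by simp
    also have "\<dots> \<le> ennreal (2 * e)"
      unfolding distr_task_snd[OF f] e_def using noise_norm_tail[OF pd trace_pos(1) sgf, of t] by simp
    finally show ?thesis .
  qed
  have bi: "emeasure T {s\<in>space T. \<bar>inner_d d (fst s) (f (snd s))\<bar> > \<theta>\<^sub>2} \<le> ennreal (6 * e)"
    if f: "f \<in> measurable (task_noise_measure d Lam N) (borel_d d)"
      and sgf: "subgauss d (distr (task_noise_measure d Lam N) (borel_d d) f) (mat_sqrt_d d Lam)" for f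
  proof -
    have X: "(\<lambda>z. \<bar>inner_d d (fst z) (snd z)\<bar>) \<in> borel_measurable (sphere_unif d R \<Otimes>\<^sub>M borel_d d)"
      by (intro borel_measurable_abs measurable_inner_d measurable_pair_nth[OF sets_sphere_unif refl])
    show ?thesis
      using emeasure_pair_law[OF prP prQ f X, of \<theta>\<^sub>2] order_trans[OF sphere_noise_inner_tail[OF pd d R sgf trace_pos(1), of t] six]
      by (simp add: task_measure_eq \<theta>\<^sub>2_def)
  qed
  have b6: "emeasure T {s\<in>space T. \<bar>inner_d d (V s) (W s)\<bar> > \<theta>\<^sub>3} \<le> ennreal (4 * e)"
  proof -
    let ?A = "{q\<in>space (task_noise_measure d Lam N). \<bar>inner_d d (mean_noise d N q) (last_noise d N q)\<bar> > \<theta>\<^sub>3}"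
    have A: "?A \<in> sets (task_noise_measure d Lam N)" by (rule inner_event_sets[OF measurable_mean_noise measurable_last_noise])
    have "{s\<in>space T. \<bar>inner_d d (V s) (W s)\<bar> > \<theta>\<^sub>3} = {s\<in>space (sphere_unif d R \<Otimes>\<^sub>M task_noise_measure d Lam N). snd s \<in> ?A}"
      unfolding task_measure_eq by (auto simp: space_pair_measure)
    hence "emeasure T {s\<in>space T. \<bar>inner_d d (V s) (W s)\<bar> > \<theta>\<^sub>3} = emeasure (task_noise_measure d Lam N) ?A"
      using emeasure_pair_fst_snd(2)[OF prP prQ A] by (simp add: task_measure_eq)
    also have "\<dots> \<le> ennreal (4 * e)" unfolding \<theta>\<^sub>3_def e_def by (rule mean_last_inner_tail[OF pd trace_pos(2) N])
    finally show ?thesis .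
  qed
  have "emeasure T task_bad \<le> ennreal (((((2 * e + 2 * e) + 2 * e) + 6 * e) + 6 * e) + 4 * e)"
    unfolding task_bad_def using e_bounds(1)
    by (intro emeasure_Un_le sets.Un S b1 b6 bn[OF measurable_mean_noise sg(1)] bn[OF measurable_last_noise sg(2)]
        bi[OF measurable_mean_noise sg(1)] bi[OF measurable_last_noise sg(2)]) auto
  also have "\<dots> \<le> ennreal (26 * e)" using e_bounds(1) by (intro ennreal_leI) simp
  finally show "emeasure T task_bad \<le> ennreal (26 * e)" .
qed

lemma bad_bound: "bad \<in> sets Pre" "emeasure Pre bad \<le> ennreal ((real B)\<^sup>2 * (26 * e))"
proof -
  let ?F = "\<lambda>i j. if i = j then {\<omega>\<in>space Pre. \<omega> i \<in> task_bad} else pair_bad i j"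
  note [measurable] = task_bad_bound(1)
  have S: "?F i j \<in> sets Pre" if "i \<in> {1..B}" "j \<in> {1..B}" for i j
    using measurable_sets[OF meas_Pre[OF that(1)] task_bad_bound(1)] pair_bad_bound(1)[OF that]
    by (auto simp: vimage_def Int_def conj_commute)
  have b: "emeasure Pre (?F i j) \<le> ennreal (26 * e)" if "i \<in> {1..B}" "j \<in> {1..B}" for i j
    using pair_bad_bound(2)[OF that] task_bad_bound(2)
      PiM_single_event[OF prob_space_task _ that(1) task_bad_bound(1), folded Pre_eq]
    by auto
  have SU: "(\<Union>j\<in>{1..B}. ?F i j) \<in> sets Pre" if "i \<in> {1..B}" for i
    by (rule sets.finite_UN[OF finite_atLeastAtMost S[OF that]])
  show "bad \<in> sets Pre" unfolding bad_def by (rule sets.finite_UN[OF finite_atLeastAtMost SU])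
  have "emeasure Pre bad \<le> (\<Sum>i\<in>{1..B}. emeasure Pre (\<Union>j\<in>{1..B}. ?F i j))"
    unfolding bad_def by (rule emeasure_subadditive_finite[OF finite_atLeastAtMost image_subsetI[OF SU]])
  also have "\<dots> \<le> (\<Sum>i\<in>{1..B}. \<Sum>j\<in>{1..B}. emeasure Pre (?F i j))"
    by (intro sum_mono emeasure_subadditive_finite[OF finite_atLeastAtMost image_subsetI] S)
  also have "\<dots> \<le> (\<Sum>i\<in>{1..B}. \<Sum>j\<in>{1..B}. ennreal (26 * e))" by (intro sum_mono b)
  also have "\<dots> = ennreal ((real B)\<^sup>2 * (26 * e))"
    using e_bounds(1) by (simp add: ennreal_mult'' ennreal_of_nat_eq_real_of_nat power2_eq_square mult.assoc)
  finally show "emeasure Pre bad \<le> ennreal ((real B)\<^sup>2 * (26 * e))" .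
qed

text \<open>Multiplication by the label turns each example into the class mean plus signed noise,
  which puts both sides of a margin constraint in the same form.\<close>

lemma task_vectors:
  assumes y: "\<forall>i\<in>{1..N+1}. task_y s i \<in> {-1, 1}" and k: "k < d"
  shows "task_muhat d N s k = fst s k + V s k"
    and "task_y s (N+1) * task_x d s (N+1) k = fst s k + W s k"
proof -
  obtain \<mu> ys zs where s: "s = (\<mu>, ys, zs)" by (cases s)
  have yy: "ys i * ys i = 1" if "i \<in> {1..N+1}" for i
    using sign_sq[of "{1..N+1}" ys i] y that by (simp add: s task_y_def power2_eq_square)
  have x: "task_y s i * task_x d s i k = \<mu> k + ys i * zs i k" if "i \<in> {1..N+1}" for i
  proof -
    have "task_y s i * task_x d s i k = (ys i * ys i) * \<mu> k + ys i * zs i k"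
      using k by (simp add: s task_y_def task_x_def algebra_simps)
    thus ?thesis by (simp add: yy[OF that])
  qed
  have "(\<Sum>i=1..N. task_y s i * task_x d s i k) = (\<Sum>i=1..N. \<mu> k + ys i * zs i k)"
    by (intro sum.cong refl x) auto
  hence "task_muhat d N s k = (1 / real N) * (real N * \<mu> k + (\<Sum>i=1..N. ys i * zs i k))"
    using k by (simp add: task_muhat_def sum.distrib)
  thus "task_muhat d N s k = fst s k + V s k"
    using N k by (simp add: s mean_noise_def comb_def distrib_left sum_divide_distrib)
  show "task_y s (N+1) * task_x d s (N+1) k = fst s k + W s k"
    using x[of "N+1"] k by (simp add: s last_noise_def comb_def)
qed

definition signal :: "(nat \<Rightarrow> task) \<Rightarrow> nat \<Rightarrow> vecd" where
  "signal \<omega> i = task_muhat d N (\<omega> i)"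

definition query :: "(nat \<Rightarrow> task) \<Rightarrow> nat \<Rightarrow> vecd" where
  "query \<omega> i = (\<lambda>k. task_y (\<omega> i) (N+1) * task_x d (\<omega> i) (N+1) k)"

lemma mm_feasible_eq: "mm_feasible d N B \<omega> = margin_ok d {1..B} (signal \<omega>) (query \<omega>)"
  by (rule ext) (simp add: mm_feasible_def margin_ok_def signal_def query_def)

lemma is_max_margin_eq: "is_max_margin d N B \<omega> = min_norm d (mm_feasible d N B \<omega>)"
  by (rule ext) (auto simp: is_max_margin_def min_norm_def)

text \<open>Different tasks: one mean term, two mixed terms and one noise term sum to at most
  \<open>(3/2 + 6 + 2) * (t * r)\<close>. Equal tasks: the means give \<open>R^2\<close>, the noise
  \<open>8 * t * R^2\<close>, and the mixed terms are small. The factor 15 covers both. For the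
  margin, \<open>R^2 - 8 * (t * r) \<ge> R^2 / 2\<close> is exactly what
  \<open>16 * t \<le> sqrt d\<close> provides.\<close>

lemma good_inner_products:
  assumes \<omega>: "\<omega> \<in> space Pre" "\<omega> \<notin> bad" and y: "\<forall>i\<in>{1..B}. \<forall>k\<in>{1..N+1}. task_y (\<omega> i) k \<in> {-1, 1}"
    and i: "i \<in> {1..B}" and j: "j \<in> {1..B}"
  shows "\<bar>inner_d d (signal \<omega> i) (signal \<omega> j)\<bar> \<le> (if i = j then 15 * t * R\<^sup>2 else 15 * t * r)"
    and "\<bar>inner_d d (query \<omega> i) (query \<omega> j)\<bar> \<le> (if i = j then 15 * t * R\<^sup>2 else 15 * t * r)"
    and "i = j \<Longrightarrow> inner_d d (signal \<omega> i) (query \<omega> j) \<ge> R\<^sup>2 / 2"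
proof -
  have sv: "signal \<omega> i' k = fst (\<omega> i') k + V (\<omega> i') k" "query \<omega> i' k = fst (\<omega> i') k + W (\<omega> i') k"
    if "k < d" "i' \<in> {1..B}" for i' k
    using task_vectors[of "\<omega> i'" k] y that unfolding signal_def query_def by blast+
  have exp1: "inner_d d (signal \<omega> i) (signal \<omega> j) = inner_d d (fst (\<omega> i)) (fst (\<omega> j)) + inner_d d (fst (\<omega> i)) (V (\<omega> j))
      + inner_d d (fst (\<omega> j)) (V (\<omega> i)) + inner_d d (V (\<omega> i)) (V (\<omega> j))"
    using inner_d_cong[of d "signal \<omega> i" "\<lambda>k. fst (\<omega> i) k + V (\<omega> i) k" "signal \<omega> j" "\<lambda>k. fst (\<omega> j) k + V (\<omega> j) k", OF sv(1)[OF _ i] sv(1)[OF _ j]]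
    by (simp add: inner_d_add_left inner_d_add_right inner_d_commute[of d "V (\<omega> i)" "fst (\<omega> j)"])
  have exp2: "inner_d d (query \<omega> i) (query \<omega> j) = inner_d d (fst (\<omega> i)) (fst (\<omega> j)) + inner_d d (fst (\<omega> i)) (W (\<omega> j))
      + inner_d d (fst (\<omega> j)) (W (\<omega> i)) + inner_d d (W (\<omega> i)) (W (\<omega> j))"
    using inner_d_cong[of d "query \<omega> i" "\<lambda>k. fst (\<omega> i) k + W (\<omega> i) k" "query \<omega> j" "\<lambda>k. fst (\<omega> j) k + W (\<omega> j) k", OF sv(2)[OF _ i] sv(2)[OF _ j]]
    by (simp add: inner_d_add_left inner_d_add_right inner_d_commute[of d "W (\<omega> i)" "fst (\<omega> j)"])
  have exp3: "inner_d d (signal \<omega> i) (query \<omega> j) = inner_d d (fst (\<omega> i)) (fst (\<omega> j)) + inner_d d (fst (\<omega> i)) (W (\<omega> j))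
      + inner_d d (fst (\<omega> j)) (V (\<omega> i)) + inner_d d (V (\<omega> i)) (W (\<omega> j))"
    using inner_d_cong[of d "signal \<omega> i" "\<lambda>k. fst (\<omega> i) k + V (\<omega> i) k" "query \<omega> j" "\<lambda>k. fst (\<omega> j) k + W (\<omega> j) k", OF sv(1)[OF _ i] sv(2)[OF _ j]]
    by (simp add: inner_d_add_left inner_d_add_right inner_d_commute[of d "V (\<omega> i)" "fst (\<omega> j)"])
  have tr0: "t * r \<ge> 0" using r(1) t by simp
  have tR: "t * R\<^sup>2 \<ge> R\<^sup>2" using t mult_right_mono[OF t(1), of "R\<^sup>2"] by simp
  show "\<bar>inner_d d (signal \<omega> i) (signal \<omega> j)\<bar> \<le> (if i = j then 15 * t * R\<^sup>2 else 15 * t * r)"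
    and "\<bar>inner_d d (query \<omega> i) (query \<omega> j)\<bar> \<le> (if i = j then 15 * t * R\<^sup>2 else 15 * t * r)"
    and "i = j \<Longrightarrow> inner_d d (signal \<omega> i) (query \<omega> j) \<ge> R\<^sup>2 / 2"
  proof (goal_cases)
    have ng: "\<omega> \<notin> pair_bad i j \<and> \<omega> \<notin> pair_bad j i" if "i \<noteq> j"
      using \<omega>(2) i j that unfolding bad_def by (auto split: if_splits)
    have ns: "\<omega> i \<notin> task_bad" using \<omega> i unfolding bad_def by auto
    have sT: "\<omega> i \<in> space T" using measurable_space[OF meas_Pre[OF i] \<omega>(1)] .
    have sP: "fst (\<omega> i) \<in> space (sphere_unif d R)" using sT unfolding task_measure_eq by (auto simp: space_pair_measure)
    have n1: "inner_d d (fst (\<omega> i)) (fst (\<omega> i)) = R\<^sup>2"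
      using ns sT sP unfolding task_bad_def inner_d_self by auto
    have n2: "inner_d d (V (\<omega> i)) (V (\<omega> i)) \<le> 8 * (t * R\<^sup>2)" "inner_d d (W (\<omega> i)) (W (\<omega> i)) \<le> 8 * (t * R\<^sup>2)"
    proof -
      have "8 * trace_d d Lam * t \<le> 8 * (t * R\<^sup>2)" using trace_le t by (simp add: mult_right_mono mult.commute)
      thus "inner_d d (V (\<omega> i)) (V (\<omega> i)) \<le> 8 * (t * R\<^sup>2)" "inner_d d (W (\<omega> i)) (W (\<omega> i)) \<le> 8 * (t * R\<^sup>2)"
        using ns sT unfolding task_bad_def inner_d_self by auto
    qed
    have n2': "inner_d d (V (\<omega> i)) (V (\<omega> i)) \<ge> 0" "inner_d d (W (\<omega> i)) (W (\<omega> i)) \<ge> 0" by (simp_all add: inner_d_self)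
    have n3: "\<bar>inner_d d (fst (\<omega> i)) (V (\<omega> i))\<bar> \<le> \<theta>\<^sub>2" "\<bar>inner_d d (fst (\<omega> i)) (W (\<omega> i))\<bar> \<le> \<theta>\<^sub>2" "\<bar>inner_d d (V (\<omega> i)) (W (\<omega> i))\<bar> \<le> \<theta>\<^sub>3"
      using ns sT unfolding task_bad_def by auto
    have p: "\<bar>inner_d d (fst (\<omega> i)) (fst (\<omega> j))\<bar> \<le> \<theta>\<^sub>1" "\<bar>inner_d d (fst (\<omega> i)) (V (\<omega> j))\<bar> \<le> \<theta>\<^sub>2"
      "\<bar>inner_d d (fst (\<omega> j)) (V (\<omega> i))\<bar> \<le> \<theta>\<^sub>2" "\<bar>inner_d d (fst (\<omega> i)) (W (\<omega> j))\<bar> \<le> \<theta>\<^sub>2"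
      "\<bar>inner_d d (fst (\<omega> j)) (W (\<omega> i))\<bar> \<le> \<theta>\<^sub>2" "\<bar>inner_d d (V (\<omega> i)) (V (\<omega> j))\<bar> \<le> \<theta>\<^sub>3"
      "\<bar>inner_d d (W (\<omega> i)) (W (\<omega> j))\<bar> \<le> \<theta>\<^sub>3" if "i \<noteq> j"
      using ng[OF that] \<omega>(1) unfolding pair_bad_def by auto
    have c15: "15 * t * R\<^sup>2 = 15 * (t * R\<^sup>2)" "15 * t * r = 15 * (t * r)" by simp_all
    case 1
    show ?case
    proof (cases "i = j")
      case True
      have "\<bar>inner_d d (signal \<omega> i) (signal \<omega> j)\<bar> \<le> 15 * (t * R\<^sup>2)"
        unfolding True[symmetric] using exp1[folded True] n1 n2(1) n2'(1) n3(1) r(2,4) tR tr0 zero_le_power2[of R] by linarith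
      thus ?thesis using True by simp
    next
      case False
      have "\<bar>inner_d d (signal \<omega> i) (signal \<omega> j)\<bar> \<le> 15 * (t * r)"
        unfolding exp1 using p(1,2,3,6)[OF False] r(3,4,5) tr0 by linarith
      thus ?thesis using False by simp
    qed
    case 2
    show ?case
    proof (cases "i = j")
      case True
      have "\<bar>inner_d d (query \<omega> i) (query \<omega> j)\<bar> \<le> 15 * (t * R\<^sup>2)"
        unfolding True[symmetric] using exp2[folded True] n1 n2(2) n2'(2) n3(2) r(2,4) tR tr0 zero_le_power2[of R] by linarith
      thus ?thesis using True by simp
    next
      case False
      have "\<bar>inner_d d (query \<omega> i) (query \<omega> j)\<bar> \<le> 15 * (t * r)"
        unfolding exp2 using p(1,4,5,7)[OF False] r(3,4,5) tr0 by linarith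
      thus ?thesis using False by simp
    qed
    case 3
    show ?case
      unfolding 3[symmetric] using exp3[folded 3] n1 n3 r(2,4,5) tr0 by linarith
  qed
qed

lemma good_feasible:
  assumes "\<omega> \<in> space Pre" "\<omega> \<notin> bad" "\<forall>i\<in>{1..B}. \<forall>k\<in>{1..N+1}. task_y (\<omega> i) k \<in> {-1, 1}"
  shows "margin_ok d {1..B} (signal \<omega>) (query \<omega>) (\<lambda>i j. (2 / R\<^sup>2) * id_mat i j)"
  unfolding margin_ok_def inner_scaled_id
proof
  fix i assume i: "i \<in> {1..B}"
  have "R\<^sup>2 / 2 \<le> inner_d d (signal \<omega> i) (query \<omega> i)" by (rule good_inner_products(3)[OF assms i i refl])
  hence "(2 / R\<^sup>2) * (R\<^sup>2 / 2) \<le> (2 / R\<^sup>2) * inner_d d (signal \<omega> i) (query \<omega> i)" by (intro mult_left_mono) auto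
  thus "1 \<le> (2 / R\<^sup>2) * inner_d d (signal \<omega> i) (query \<omega> i)" using R by simp
qed

lemma good_trace:
  assumes \<omega>: "\<omega> \<in> space Pre" "\<omega> \<notin> bad" "\<forall>i\<in>{1..B}. \<forall>k\<in>{1..N+1}. task_y (\<omega> i) k \<in> {-1, 1}"
    and B: "B \<ge> 1" and U: "min_norm d (margin_ok d {1..B} (signal \<omega>) (query \<omega>)) U"
    and m: "0 < m" "m \<le> 1" "m * real d \<le> real B"
  shows "frob_sq d U > 0" "m * sqrt (real d) / (45 * t) * sqrt (frob_sq d U) \<le> trace_d d U"
proof -
  define F where "F = sqrt (frob_sq d U)"
  have F2: "F\<^sup>2 = frob_sq d U" and F0: "F \<ge> 0" by (simp_all add: F_def)
  define h where "h = 15 * t * R\<^sup>2"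
  have h0: "h > 0" using t R by (simp add: h_def)
  have rh: "15 * t * r = h / sqrt (real d)" by (simp add: r_def h_def)
  have dpos: "real d > 0" using d by simp
  have Bpos: "real B > 0" using B by simp
  have md: "m * real d > 0" using m dpos by simp
  \<comment> \<open>A diagonal term is at most \<open>h^2\<close>, any other at most
    \<open>h^2 / d\<close>; allowing \<open>h^2 / d\<close> on the diagonal as well makes the sum
    explicit.\<close>
  have "(\<Sum>i\<in>{1..B}. \<Sum>j\<in>{1..B}. inner_d d (signal \<omega> i) (signal \<omega> j) * inner_d d (query \<omega> i) (query \<omega> j)) \<le>
      (\<Sum>i\<in>{1..B}. \<Sum>j\<in>{1..B}. (if i = j then h\<^sup>2 else 0) + h\<^sup>2 / real d)"
  proof (intro sum_mono)
    fix i j assume ij: "i \<in> {1..B}" "j \<in> {1..B}"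
    let ?x = "inner_d d (signal \<omega> i) (signal \<omega> j)" and ?y = "inner_d d (query \<omega> i) (query \<omega> j)"
    let ?c = "if i = j then h else 15 * t * r"
    have "?x * ?y \<le> \<bar>?x\<bar> * \<bar>?y\<bar>" by (simp add: abs_mult[symmetric])
    also have "\<dots> \<le> ?c * ?c"
      using good_inner_products(1,2)[OF \<omega> ij, folded h_def] by (intro mult_mono) auto
    also have "\<dots> \<le> (if i = j then h\<^sup>2 else 0) + h\<^sup>2 / real d"
    proof (cases "i = j")
      case True
      have "0 \<le> h\<^sup>2 / real d" by simp
      thus ?thesis using True by (simp only: if_True power2_eq_square[of h]) simp
    next
      case False
      have "(h / sqrt (real d)) * (h / sqrt (real d)) = h\<^sup>2 / real d"
        using dpos by (simp add: power2_eq_square[of h])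
      thus ?thesis using False unfolding rh by (simp only: if_False)
    qed
    finally show "?x * ?y \<le> (if i = j then h\<^sup>2 else 0) + h\<^sup>2 / real d" .
  qed
  also have "\<dots> = real B * h\<^sup>2 + (real B)\<^sup>2 * (h\<^sup>2 / real d)"
    by (simp add: sum.distrib power2_eq_square[of "real B"] algebra_simps)
  also have "\<dots> = (real B)\<^sup>2 * h\<^sup>2 * (1 / real B + 1 / real d)"
    using Bpos by (simp add: field_simps power2_eq_square)
  also have "\<dots> \<le> (real B)\<^sup>2 * h\<^sup>2 * (1 / (m * real d) + 1 / (m * real d))"
  proof (intro mult_left_mono add_mono)
    show "1 / real B \<le> 1 / (m * real d)" using m(3) md Bpos by (intro divide_left_mono) auto
    have "m * real d \<le> real d" using m(2) dpos by simp
    thus "1 / real d \<le> 1 / (m * real d)" using md dpos by (intro divide_left_mono) auto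
  qed auto
  finally have S: "(\<Sum>i\<in>{1..B}. \<Sum>j\<in>{1..B}. inner_d d (signal \<omega> i) (signal \<omega> j) * inner_d d (query \<omega> i) (query \<omega> j))
      \<le> (real B)\<^sup>2 * (h\<^sup>2 * (2 / (m * real d)))" by (simp add: mult.assoc)
  have "(real B)\<^sup>2 \<le> F\<^sup>2 * (\<Sum>i\<in>{1..B}. \<Sum>j\<in>{1..B}. inner_d d (signal \<omega> i) (signal \<omega> j) * inner_d d (query \<omega> i) (query \<omega> j))"
    using margin_sum_bound[of "{1..B}" d "signal \<omega>" "query \<omega>" U] U unfolding F2 min_norm_def by simp
  also have "\<dots> \<le> F\<^sup>2 * ((real B)\<^sup>2 * (h\<^sup>2 * (2 / (m * real d))))" by (intro mult_left_mono S) simp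
  finally have "(real B)\<^sup>2 * 1 \<le> (real B)\<^sup>2 * (F\<^sup>2 * h\<^sup>2 * (2 / (m * real d)))" by (simp add: mult_ac)
  hence "1 \<le> F\<^sup>2 * h\<^sup>2 * (2 / (m * real d))" using Bpos by (subst (asm) mult_le_cancel_left_pos) auto
  hence md2: "m * real d \<le> 2 * (F * h)\<^sup>2" using md by (simp add: pos_le_divide_eq power_mult_distrib mult_ac)
  have "F \<noteq> 0" using md2 md by auto
  hence Fp: "F > 0" using F0 by simp
  show "frob_sq d U > 0" using Fp by (simp add: F_def)
  have "(m * sqrt (real d))\<^sup>2 \<le> m * real d"
  proof -
    have "m * (m * real d) \<le> 1 * (m * real d)" using m md by (intro mult_right_mono) auto
    thus ?thesis by (simp add: power_mult_distrib power2_eq_square[of m] mult.assoc)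
  qed
  \<comment> \<open>3/2 serves as a rational upper bound for \<open>sqrt 2\<close>.\<close>
  also have "\<dots> \<le> (3/2 * (F * h))\<^sup>2"
  proof -
    have "(3/2 * (F * h))\<^sup>2 = 9/4 * (F * h)\<^sup>2" by (simp only: power_mult_distrib[of "3/2"]) (simp add: power_divide)
    thus ?thesis using md2 zero_le_power2[of "F * h"] by linarith
  qed
  finally have q: "m * sqrt (real d) \<le> 3/2 * (F * h)" by (rule power2_le_imp_le) (use Fp h0 in simp)
  have "F\<^sup>2 \<le> (2 / R\<^sup>2) * trace_d d U"
    unfolding F2 by (rule min_norm_trace_ge[OF U _ good_feasible[OF \<omega>]]) (use R in simp)
  hence trF: "F\<^sup>2 * R\<^sup>2 / 2 \<le> trace_d d U" using R by (simp add: field_simps)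
  \<comment> \<open>45 is 3 times the factor 15 in \<open>h\<close>: it turns
    \<open>3/2 * F * h\<close> into \<open>F * R^2 / 2\<close>, the quantity supplied by feasibility
    of the scaled identity.\<close>
  have "m * sqrt (real d) / (45 * t) * F \<le> (3/2 * (F * h)) / (45 * t) * F"
    using q t Fp by (intro mult_right_mono divide_right_mono) auto
  also have "\<dots> = F\<^sup>2 * R\<^sup>2 / 2" using t by (simp add: h_def power2_eq_square)
  finally show "m * sqrt (real d) / (45 * t) * sqrt (frob_sq d U) \<le> trace_d d U" using trF by (simp add: F_def)
qed

lemma AE_task_signs: "AE \<omega> in Pre. \<forall>i\<in>{1..B}. \<forall>k\<in>{1..N+1}. task_y (\<omega> i) k \<in> {-1, 1}"
  unfolding Pre_eq
proof (rule AE_finite_allI)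
  fix i assume i: "i \<in> {1..B}"
  have "AE s in T. \<forall>k\<in>{1..N+1}. fst (snd s) k \<in> {-1, 1}"
    unfolding task_measure_eq
    by (rule AE_pair_fst_snd(2)[OF prob_space_sphere_unif prob_space_task_noise], unfold task_noise_measure_def,
        rule AE_pair_fst_snd(1)[OF prob_space_signs prob_space_noise], rule AE_signs) simp
  hence "AE s in T. \<forall>k\<in>{1..N+1}. task_y s k \<in> {-1, 1}" by (simp add: task_y_def)
  thus "AE \<omega> in PiM {1..B} (\<lambda>_. T). \<forall>k\<in>{1..N+1}. task_y (\<omega> i) k \<in> {-1, 1}"
    using i by (intro AE_PiM_component[of _ "\<lambda>_. T"] prob_space_task) auto
qed simp

lemma measurable_mm_feasible: "Measurable.pred Pre (\<lambda>\<omega>. mm_feasible d N B \<omega> U)"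
proof -
  have mu: "k < d \<Longrightarrow> (\<lambda>s. fst s k) \<in> borel_measurable T" for k
    by (rule measurable_nth_borel_d[OF refl meas_task(1)])
  have sndm: "snd \<in> measurable T (task_noise_measure d Lam N)" unfolding task_measure_eq by (rule measurable_snd)
  have y: "(\<lambda>s. task_y s i) \<in> borel_measurable T" if "i \<in> {1..N+1}" for i
    unfolding task_y_def using measurable_compose[OF sndm measurable_task_noise_components(1)[OF that]] by simp
  have x: "(\<lambda>s. task_x d s i k) \<in> borel_measurable T" if i: "i \<in> {1..N+1}" and k: "k < d" for i k
  proof -
    have "(\<lambda>s. task_x d s i k) = (\<lambda>s. fst (snd s) i * fst s k + snd (snd s) i k)"
      using k by (auto simp: task_x_def fun_eq_iff)
    thus ?thesis
      using measurable_compose[OF sndm measurable_task_noise_components(1)[OF i]] mu[OF k]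
        measurable_compose[OF sndm measurable_task_noise_components(2)[OF i k]] by simp
  qed
  have a: "(\<lambda>s. task_muhat d N s k) \<in> borel_measurable T" if k: "k < d" for k
  proof -
    have "(\<lambda>s. task_muhat d N s k) = (\<lambda>s. (1 / real N) * (\<Sum>i=1..N. task_y s i * task_x d s i k))"
      using k by (simp add: task_muhat_def fun_eq_iff)
    moreover have "(\<lambda>s. (1 / real N) * (\<Sum>i=1..N. task_y s i * task_x d s i k)) \<in> borel_measurable T"
      using k by (intro borel_measurable_times borel_measurable_const borel_measurable_sum x y) auto
    ultimately show ?thesis by simp
  qed
  have [measurable]: "(\<lambda>\<omega>. inner_d d (signal \<omega> i) (mat_vec d U (query \<omega> i))) \<in> borel_measurable Pre" if i: "i \<in> {1..B}" for i
    unfolding signal_def query_def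
    by (intro measurable_inner_d measurable_mat_vec borel_measurable_times
        measurable_compose[OF meas_Pre[OF i] a] measurable_compose[OF meas_Pre[OF i] x] measurable_compose[OF meas_Pre[OF i] y]) auto
  show ?thesis
    unfolding mm_feasible_eq margin_ok_def by (intro pred_intros_finite(3)) (simp, measurable)
qed

text \<open>The event of the theorem is expressed through the measurable selection \<open>opt_limit\<close>, which
  makes it an element of the product sigma-algebra.\<close>

lemma max_margin_event:
  assumes B: "B \<ge> 1" and m: "0 < m" "m \<le> 1" "m * real d \<le> real B"
    and err: "\<And>U. frob_sq d U > 0 \<Longrightarrow> m * sqrt (real d) / (45 * t) * sqrt (frob_sq d U) \<le> trace_d d U \<Longrightarrow>
      test_error d Lam Rt p M U \<le> b"
  shows "measure Pre {\<omega>\<in>space Pre. \<exists>U. is_max_margin d N B \<omega> U \<and> test_error d Lam Rt p M U \<le> b}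
    \<ge> 1 - (real B)\<^sup>2 * (26 * e)"
proof -
  interpret Pre: prob_space Pre by (rule prob_space_Pre)
  let ?G = "{\<omega>\<in>space Pre. \<exists>U. is_max_margin d N B \<omega> U \<and> test_error d Lam Rt p M U \<le> b}"
  define Wopt where "Wopt = (\<lambda>\<omega>. opt_limit d (mm_feasible d N B \<omega>))"
  have opt: "is_max_margin d N B \<omega> (Wopt \<omega>)" if "mm_feasible d N B \<omega> U" for \<omega> U
    using opt_limit_min_norm[of "{1..B}" d "signal \<omega>" "query \<omega>" U] that
    unfolding is_max_margin_eq Wopt_def mm_feasible_eq by simp
  have uniq: "U = Wopt \<omega>" if "is_max_margin d N B \<omega> U" for \<omega> U
  proof -
    have "mm_feasible d N B \<omega> U" using that by (simp add: is_max_margin_def)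
    from opt[OF this] that show ?thesis unfolding is_max_margin_eq mm_feasible_eq by (intro min_norm_unique)
  qed
  note [measurable] = measurable_mm_feasible
  have Om: "(\<lambda>\<omega>. Wopt \<omega> i j) \<in> borel_measurable Pre" for i j
    unfolding Wopt_def by (rule measurable_opt_limit) measurable
  have [measurable]: "(\<lambda>\<omega>. test_error d Lam Rt p M (Wopt \<omega>)) \<in> borel_measurable Pre"
    by (rule measurable_test_error) (rule Om)
  \<comment> \<open>By uniqueness the existential over solutions becomes a statement about
    \<open>Wopt\<close>, guarded by feasibility; feasibility is equivalent to that of some rational
    matrix, a countable union.\<close>
  have "?G = {\<omega>\<in>space Pre. (\<exists>k. mm_feasible d N B \<omega> (rat_mat d k)) \<and> test_error d Lam Rt p M (Wopt \<omega>) \<le> b}"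
  proof (intro Collect_cong conj_cong refl iffI)
    fix \<omega> assume "\<exists>U. is_max_margin d N B \<omega> U \<and> test_error d Lam Rt p M U \<le> b"
    then obtain U where U: "is_max_margin d N B \<omega> U" "test_error d Lam Rt p M U \<le> b" by blast
    hence "margin_ok d {1..B} (signal \<omega>) (query \<omega>) U" by (simp add: is_max_margin_def mm_feasible_eq)
    from rational_feasible_approx[OF _ this, of 1]
    have "\<exists>k. mm_feasible d N B \<omega> (rat_mat d k)" unfolding mm_feasible_eq by auto
    thus "(\<exists>k. mm_feasible d N B \<omega> (rat_mat d k)) \<and> test_error d Lam Rt p M (Wopt \<omega>) \<le> b"
      using U uniq[OF U(1)] by simp
  next
    fix \<omega> assume "(\<exists>k. mm_feasible d N B \<omega> (rat_mat d k)) \<and> test_error d Lam Rt p M (Wopt \<omega>) \<le> b"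
    thus "\<exists>U. is_max_margin d N B \<omega> U \<and> test_error d Lam Rt p M U \<le> b" using opt by blast
  qed
  hence G: "?G \<in> sets Pre" by simp
  have "AE \<omega> in Pre. \<omega> \<in> space Pre - bad \<longrightarrow> \<omega> \<in> ?G"
    using AE_task_signs
  proof (rule AE_mp, intro AE_I2 impI)
    fix \<omega> assume y: "\<forall>i\<in>{1..B}. \<forall>k\<in>{1..N+1}. task_y (\<omega> i) k \<in> {-1, 1}" and "\<omega> \<in> space Pre - bad"
    hence \<omega>: "\<omega> \<in> space Pre" "\<omega> \<notin> bad" by auto
    from good_feasible[OF \<omega> y] have mm: "is_max_margin d N B \<omega> (Wopt \<omega>)" by (intro opt) (simp add: mm_feasible_eq)
    hence "min_norm d (margin_ok d {1..B} (signal \<omega>) (query \<omega>)) (Wopt \<omega>)" unfolding is_max_margin_eq mm_feasible_eq .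
    from err[OF good_trace[OF \<omega> y B this m]] mm \<omega> show "\<omega> \<in> ?G" by blast
  qed
  hence "emeasure Pre (space Pre - bad) \<le> emeasure Pre ?G" by (intro emeasure_mono_AE G)
  hence "measure Pre (space Pre - bad) \<le> measure Pre ?G" by (simp add: Pre.emeasure_eq_measure)
  moreover have "measure Pre (space Pre - bad) = 1 - measure Pre bad" by (rule Pre.prob_compl[OF bad_bound(1)])
  moreover have "measure Pre bad \<le> (real B)\<^sup>2 * (26 * e)"
    using bad_bound(2) e_bounds(1) by (simp add: Pre.emeasure_eq_measure)
  ultimately show ?thesis by linarith
qed

end

text \<open>If one of the exponentials on the right is at least 1/2, the bound exceeds 1; otherwise
  \<open>8 y\<^sup>3 \<le> 2 y\<close> for each of them.\<close>

lemma error_bound_simplify: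
  fixes x f a b c :: real
  assumes "x \<le> 1" "0 \<le> f" "x \<le> f + 8 * exp (- 3 * a) + 8 * exp (- 3 * b) + 8 * exp (- 3 * c)"
  shows "x \<le> f + 2 * exp (- a) + 4 * exp (- b) + 2 * exp (- c)"
proof -
  have cube: "8 * exp (- 3 * y) \<le> 2 * exp (- y)" if "exp (- y) < 1/2" for y :: real
  proof -
    have "exp (- 3 * y) = exp (- y) * (exp (- y) * exp (- y))" by (simp add: exp_add[symmetric])
    also have "\<dots> \<le> exp (- y) * ((1/2) * (1/2))" using that by (intro mult_left_mono mult_mono) auto
    finally show ?thesis by simp
  qed
  have pos: "exp (- a) > 0" "exp (- b) > 0" "exp (- c) > 0" by (rule exp_gt_zero)+
  consider "exp (- a) \<ge> 1/2" | "exp (- b) \<ge> 1/2" | "exp (- c) \<ge> 1/2"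
    | "exp (- a) < 1/2" "exp (- b) < 1/2" "exp (- c) < 1/2" by linarith
  thus ?thesis
  proof cases
    case 4
    from cube[OF 4(1)] cube[OF 4(2)] cube[OF 4(3)] assms(3) pos show ?thesis by linarith
  qed (use assms(1,2) pos in linarith)+
qed

section \<open>Choice of the constants and assembly\<close>

theorem mainTheorem1:
  fixes c_p :: real
  assumes "0 < c_p" and "c_p \<le> 1/2"
  shows "\<exists>C c :: real. C > 1 \<and> c > 0 \<and>
    (\<forall>(d::nat) (Lam::matd) (B::nat) (N::nat) (R::real) (\<delta>::real) (c_B::real) (M::nat) (Rt::real).
      pos_def_d d Lam \<longrightarrow> B \<ge> 1 \<longrightarrow> N \<ge> 1 \<longrightarrow> R > 0 \<longrightarrow> 0 < \<delta> \<longrightarrow> \<delta> < 1 \<longrightarrow>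
      M \<ge> 1 \<longrightarrow> Rt > 0 \<longrightarrow> c_B > 0 \<longrightarrow>
      \<comment> \<open>(A1)\<close>
      R\<^sup>2 \<ge> max (C\<^sup>2 * sqrt (real d * trace_d d (mat_mult_d d Lam Lam)))
                 (C\<^sup>2 * max (max (trace_d d Lam / real d)
                                 (sqrt (trace_d d (mat_mult_d d Lam Lam) / real N)))
                            (op_norm_d d Lam)
                      * ln (2 * real B / \<delta>)) \<longrightarrow>
      \<comment> \<open>(A2)\<close>
      real B \<ge> c_B * real d \<longrightarrow>
      \<comment> \<open>(A3)\<close>
      real d \<ge> C * (ln (2 * (real B)\<^sup>2 / \<delta>)) ^ 4 \<longrightarrow>
      (let p = 1/2 - c_p;
           \<rho> = min c_B 1 / (ln (2 * (real B)\<^sup>2 / \<delta>))\<^sup>2;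
           bound = (p + 2 * exp (- c * real M)) * (if p > 0 then 1 else 0)
                   + 2 * exp (- c * \<rho> * sqrt (real d))
                   + 4 * exp (- c * \<rho> * Rt / op_norm_d d (mat_sqrt_d d Lam))
                   + 2 * exp (- c * \<rho> * sqrt (real M) * Rt\<^sup>2 / (op_norm_d d Lam * sqrt (real d)))
       in measure (pretrain_measure d Lam R N B)
            {\<omega> \<in> space (pretrain_measure d Lam R N B).
               \<exists>W. is_max_margin d N B \<omega> W \<and> test_error d Lam Rt p M W \<le> bound}
          \<ge> 1 - 10 * \<delta>))"
proof -
  \<comment> \<open>With \<open>L = ln (2 B^2 / \<delta>)\<close>, (A3) gives
    \<open>sqrt d \<ge> 100 L^2\<close>, and \<open>16 * t = 64 * L \<le> 100 * L^2\<close> since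
    \<open>L \<ge> 2/3\<close>; this is the locale condition on \<open>t\<close>.\<close>
  define C where "C = (10000::real)"
  \<comment> \<open>\<open>57600 = 3 * 64 * 300\<close>: 300 comes from \<open>qr\<close>, 64 from
    the cross terms in \<open>test_error_bound\<close>, and 3 is the reserve in the exponents for
    \<open>error_bound_simplify\<close>. The square of \<open>c_p\<close> matches the flip exponent
    \<open>c_p^2 / 4\<close> and is at most \<open>c_p\<close>, as the other terms need.\<close>
  define c where "c = c_p\<^sup>2 / 57600"
  have c: "c > 0" using assms by (simp add: c_def)
  have cp2: "c_p\<^sup>2 \<le> 1/4" "c_p\<^sup>2 \<le> c_p"
    using assms power_mono[of c_p "1/2" 2] mult_left_mono[of c_p 1 c_p] by (auto simp: power2_eq_square)
  show ?thesis
  proof (rule exI[of _ C], rule exI[of _ c], intro conjI allI impI)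
    show "C > 1" by (simp add: C_def)
    show "c > 0" by (rule c)
    fix d :: nat and Lam :: matd and B N :: nat and R \<delta> c_B :: real and M :: nat and Rt :: real
    assume pd: "pos_def_d d Lam" and B: "B \<ge> 1" and N: "N \<ge> 1" and R: "R > 0" and \<delta>: "0 < \<delta>" "\<delta> < 1"
      and M: "M \<ge> 1" and Rt: "Rt > 0" and cB: "c_B > 0"
      and A1: "R\<^sup>2 \<ge> max (C\<^sup>2 * sqrt (real d * trace_d d (mat_mult_d d Lam Lam)))
                 (C\<^sup>2 * max (max (trace_d d Lam / real d)
                                 (sqrt (trace_d d (mat_mult_d d Lam Lam) / real N)))
                            (op_norm_d d Lam)
                      * ln (2 * real B / \<delta>))"
      and A2: "real B \<ge> c_B * real d" and A3: "real d \<ge> C * (ln (2 * (real B)\<^sup>2 / \<delta>)) ^ 4"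
    define L where "L = ln (2 * (real B)\<^sup>2 / \<delta>)"
    define t where "t = 4 * L"
    define m where "m = min c_B 1"
    define \<rho> where "\<rho> = m / L\<^sup>2"
    define p where "p = 1/2 - c_p"
    have B2: "(real B)\<^sup>2 \<ge> 1" using B by simp
    have "2 * (real B)\<^sup>2 / \<delta> \<ge> 2"
      using B2 \<delta> by (simp add: pos_le_divide_eq)
    hence Lln: "ln 2 \<le> L" unfolding L_def by (intro ln_mono) auto
    hence L: "L \<ge> 2/3" using ln2_ge_two_thirds by linarith
    have L0: "L > 0" using L by linarith
    have dC: "real d \<ge> 10000 * L ^ 4" using A3 by (simp add: C_def L_def)
    have "0 < 10000 * L ^ 4" using L0 by simp
    hence d: "d \<ge> 1" using dC by (cases d) auto
    have sd0: "sqrt (real d) > 0" using d by simp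
    have "100 * L\<^sup>2 \<le> sqrt (real d)"
    proof (rule real_le_rsqrt)
      have "(100 * L\<^sup>2)\<^sup>2 = 10000 * L ^ 4" by (simp add: power_mult_distrib)
      thus "(100 * L\<^sup>2)\<^sup>2 \<le> real d" using dC by simp
    qed
    moreover have "16 * t \<le> 100 * L\<^sup>2"
    proof -
      have "(2/3) * L \<le> L * L" using L L0 by (intro mult_right_mono) auto
      thus ?thesis using L0 by (simp add: t_def power2_eq_square)
    qed
    ultimately have td: "16 * t \<le> sqrt (real d)" by linarith
    have sym: "symmetric_d d Lam" using pd by (simp add: pos_def_d_def)
    have R2: "sqrt (real d * frob_sq d Lam) \<le> R\<^sup>2"
    proof -
      have "1 * sqrt (real d * frob_sq d Lam) \<le> C\<^sup>2 * sqrt (real d * frob_sq d Lam)"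
        by (intro mult_right_mono) (auto simp: C_def)
      thus ?thesis using A1 by (simp add: frob_sq_symmetric[OF sym])
    qed
    interpret pretraining d N B Lam R t
      by unfold_locales (use pd d N R R2 td L in \<open>auto simp: t_def\<close>)
    have m: "0 < m" "m \<le> 1" "m * real d \<le> real B"
    proof -
      show "0 < m" "m \<le> 1" using cB by (auto simp: m_def)
      have "m * real d \<le> c_B * real d" by (intro mult_right_mono) (auto simp: m_def)
      thus "m * real d \<le> real B" using A2 by linarith
    qed
    have \<rho>: "\<rho> > 0" using m L0 by (simp add: \<rho>_def)
    \<comment> \<open>\<open>e = exp (- 4 L)\<close>. One factor \<open>exp (- L)\<close> equals
      \<open>\<delta> / (2 B^2)\<close> and pays for the union bound; the other three are at most
      1/8, so the total is \<open>26/16 * \<delta>\<close>.\<close>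
    have e10: "(real B)\<^sup>2 * (26 * e) \<le> 10 * \<delta>"
    proof -
      have eL: "exp (- L) = \<delta> / (2 * (real B)\<^sup>2)"
        unfolding L_def using \<delta> B by (simp add: exp_minus inverse_eq_divide)
      have "exp (- L) \<le> exp (- ln 2)" using Lln by simp
      hence half: "exp (- L) \<le> 1/2" by (simp add: exp_minus)
      have "e = exp (- t)" by (rule e_def)
      also have "\<dots> = exp (- L) * exp (- L) ^ 3"
        unfolding t_def by (simp add: exp_of_nat_mult[symmetric] exp_add[symmetric])
      also have "\<dots> \<le> exp (- L) * (1/2) ^ 3" using half by (intro mult_left_mono power_mono) auto
      finally have "(real B)\<^sup>2 * (26 * e) \<le> (real B)\<^sup>2 * (26 * (exp (- L) * (1/2) ^ 3))"
        by (intro mult_left_mono) auto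
      also have "\<dots> = 26 / 16 * \<delta>" unfolding eL using B by (simp add: field_simps)
      finally show ?thesis using \<delta> by linarith
    qed
    define q where "q = m * sqrt (real d) / (45 * t)"
    have q0: "q > 0" using m sd0 L0 by (simp add: q_def t_def)
    \<comment> \<open>Since \<open>m = \<rho> L^2\<close> and \<open>t = 4 L\<close>,
      \<open>q\<close> is \<open>\<rho> sqrt d\<close> times \<open>L / 180\<close>, and
      \<open>L \<ge> 2/3\<close> makes that factor at least 1/300.\<close>
    have qr: "\<rho> * sqrt (real d) / 300 \<le> q"
    proof -
      have "q = (\<rho> * sqrt (real d)) * (L / 180)"
        using L0 by (simp add: q_def t_def \<rho>_def power2_eq_square)
      moreover have "(\<rho> * sqrt (real d)) * (1 / 300) \<le> (\<rho> * sqrt (real d)) * (L / 180)"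
        using L \<rho> sd0 by (intro mult_left_mono) auto
      ultimately show ?thesis by simp
    qed
    define \<sigma> where "\<sigma> = op_norm_d d (mat_sqrt_d d Lam)"
    define \<Lambda> where "\<Lambda> = op_norm_d d Lam"
    have \<sigma>: "\<sigma> > 0" and \<Lambda>: "\<Lambda> > 0" unfolding \<sigma>_def \<Lambda>_def by (intro op_norm_pos[OF pd d])+
    define bound where "bound = (p + 2 * exp (- c * real M)) * (if p > 0 then 1 else 0)
                   + 2 * exp (- c * \<rho> * sqrt (real d))
                   + 4 * exp (- c * \<rho> * Rt / \<sigma>)
                   + 2 * exp (- c * \<rho> * sqrt (real M) * Rt\<^sup>2 / (\<Lambda> * sqrt (real d)))"
    have err: "test_error d Lam Rt p M U \<le> bound"
      if U: "frob_sq d U > 0" "q * sqrt (frob_sq d U) \<le> trace_d d U" for U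
    proof -
      let ?a = "c * \<rho> * sqrt (real d)" and ?b = "c * \<rho> * Rt / \<sigma>"
        and ?c = "c * \<rho> * sqrt (real M) * Rt\<^sup>2 / (\<Lambda> * sqrt (real d))"
      let ?f = "(p + 2 * exp (- c * real M)) * (if p > 0 then 1 else 0)"
      have le1: "test_error d Lam Rt p M U \<le> 1"
        unfolding test_error_def by (rule prob_space.prob_le_1[OF prob_space_test])
      have f0: "?f \<ge> 0" by simp
      have flip: "(p + exp (- (c_p\<^sup>2 / 4) * real M)) * (if p > 0 then 1 else 0) \<le> ?f"
      proof -
        have "c * real M \<le> c_p\<^sup>2 / 4 * real M" by (intro mult_right_mono) (auto simp: c_def)
        hence "exp (- (c_p\<^sup>2 / 4) * real M) \<le> exp (- c * real M)" by simp
        moreover have "exp (- c * real M) > 0" by (rule exp_gt_zero)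
        ultimately have "p + exp (- (c_p\<^sup>2 / 4) * real M) \<le> p + 2 * exp (- c * real M)" by linarith
        thus ?thesis by (rule mult_right_mono) simp
      qed
      have a1: "3 * ?a \<le> q / 8"
      proof -
        have "3 * c \<le> 1 / 2400" using cp2 by (simp add: c_def)
        hence "(3 * c) * (\<rho> * sqrt (real d)) \<le> (1 / 2400) * (\<rho> * sqrt (real d))"
          using \<rho> sd0 by (intro mult_right_mono) auto
        thus ?thesis using qr by simp
      qed
      \<comment> \<open>The norm tail \<open>exp (- sqrt d / 8)\<close> is absorbed into the term
        with \<rho>, which is possible because \<open>m \<le> 1\<close> and
        \<open>L \<ge> 2/3\<close> bound \<rho> by 9/4.\<close>
      have a2: "3 * ?a \<le> sqrt (real d) / 8"
      proof -
        have "(2/3) * (2/3) \<le> L * L" using L by (intro mult_mono) auto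
        hence "\<rho> \<le> 9/4" using m L0 by (simp add: \<rho>_def power2_eq_square pos_divide_le_eq)
        hence "3 * c * \<rho> \<le> 3 * c * (9/4)" using c by (intro mult_left_mono) auto
        also have "\<dots> \<le> 1/8" using cp2 by (simp add: c_def)
        finally have "(3 * c * \<rho>) * sqrt (real d) \<le> (1/8) * sqrt (real d)" by (intro mult_right_mono) auto
        thus ?thesis by (simp add: mult.assoc)
      qed
      have b1: "3 * ?b \<le> c_p * Rt * q / (64 * \<sigma> * sqrt (real d))"
      proof -
        have "3 * ?b = c_p\<^sup>2 * (\<rho> * Rt / (19200 * \<sigma>))" by (simp add: c_def)
        also have "\<dots> \<le> c_p * (\<rho> * Rt / (19200 * \<sigma>))"
          using cp2 \<rho> Rt \<sigma> by (intro mult_right_mono) auto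
        also have "\<dots> = c_p * Rt * (\<rho> * sqrt (real d) / 300) / (64 * \<sigma> * sqrt (real d))"
          using sd0 \<sigma> by simp
        also have "\<dots> \<le> c_p * Rt * q / (64 * \<sigma> * sqrt (real d))"
          using qr assms Rt \<sigma> sd0 by (intro divide_right_mono mult_left_mono) auto
        finally show ?thesis .
      qed
      have c1: "3 * ?c \<le> c_p * sqrt (real M) * Rt\<^sup>2 * q / (32 * \<Lambda> * real d)"
      proof -
        have sdd: "real d = sqrt (real d) * sqrt (real d)" by simp
        have "3 * ?c = c_p\<^sup>2 * (\<rho> * sqrt (real M) * Rt\<^sup>2 / (19200 * (\<Lambda> * sqrt (real d))))" by (simp add: c_def)
        also have "\<dots> \<le> c_p * (\<rho> * sqrt (real M) * Rt\<^sup>2 / (9600 * (\<Lambda> * sqrt (real d))))"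
          using assms cp2 \<rho> \<Lambda> sd0 by (intro mult_mono divide_left_mono) auto
        also have "\<dots> = c_p * sqrt (real M) * Rt\<^sup>2 * (\<rho> * sqrt (real d) / 300) / (32 * \<Lambda> * (sqrt (real d) * sqrt (real d)))"
          using sd0 \<Lambda> by (simp del: real_sqrt_mult_self)
        also have "\<dots> \<le> c_p * sqrt (real M) * Rt\<^sup>2 * q / (32 * \<Lambda> * (sqrt (real d) * sqrt (real d)))"
          using qr assms \<Lambda> by (intro divide_right_mono mult_left_mono) auto
        finally show ?thesis by simp
      qed
      have "test_error d Lam Rt p M U \<le> (p + exp (- (c_p\<^sup>2 / 4) * real M)) * (if p > 0 then 1 else 0)
          + (2 * exp (- q / 8) + 6 * exp (- sqrt (real d) / 8))
          + 8 * exp (- (c_p * Rt * q / (64 * \<sigma> * sqrt (real d))))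
          + 4 * exp (- (c_p * sqrt (real M) * Rt\<^sup>2 * q / (32 * \<Lambda> * real d)))"
        unfolding p_def \<sigma>_def \<Lambda>_def by (rule test_error_bound[OF pd d M Rt assms q0 U])
      \<comment> \<open>All exponents are kept at three times their final value, so that the
        coefficients 8 can be reduced to those of the claim.\<close>
      also have "\<dots> \<le> ?f + (2 * exp (- 3 * ?a) + 6 * exp (- 3 * ?a)) + 8 * exp (- 3 * ?b) + 8 * exp (- 3 * ?c)"
      proof (intro add_mono flip)
        show "2 * exp (- q / 8) \<le> 2 * exp (- 3 * ?a)" using a1 by simp
        show "6 * exp (- sqrt (real d) / 8) \<le> 6 * exp (- 3 * ?a)" using a2 by simp
        show "8 * exp (- (c_p * Rt * q / (64 * \<sigma> * sqrt (real d)))) \<le> 8 * exp (- 3 * ?b)" using b1 by simp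
        have "exp (- (c_p * sqrt (real M) * Rt\<^sup>2 * q / (32 * \<Lambda> * real d))) \<le> exp (- 3 * ?c)" using c1 by simp
        thus "4 * exp (- (c_p * sqrt (real M) * Rt\<^sup>2 * q / (32 * \<Lambda> * real d))) \<le> 8 * exp (- 3 * ?c)"
          using exp_gt_zero[of "- 3 * ?c"] by linarith
      qed
      finally have "test_error d Lam Rt p M U \<le> ?f + 8 * exp (- 3 * ?a) + 8 * exp (- 3 * ?b) + 8 * exp (- 3 * ?c)" by linarith
      from error_bound_simplify[OF le1 f0 this] show ?thesis unfolding bound_def by simp
    qed
    have "measure Pre {\<omega>\<in>space Pre. \<exists>U. is_max_margin d N B \<omega> U \<and> test_error d Lam Rt p M U \<le> bound}
        \<ge> 1 - (real B)\<^sup>2 * (26 * e)"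
      by (rule max_margin_event[OF B m err]) (simp_all add: q_def)
    hence "measure Pre {\<omega>\<in>space Pre. \<exists>U. is_max_margin d N B \<omega> U \<and> test_error d Lam Rt p M U \<le> bound} \<ge> 1 - 10 * \<delta>"
      using e10 by linarith
    thus "let p = 1/2 - c_p;
           \<rho> = min c_B 1 / (ln (2 * (real B)\<^sup>2 / \<delta>))\<^sup>2;
           bound = (p + 2 * exp (- c * real M)) * (if p > 0 then 1 else 0)
                   + 2 * exp (- c * \<rho> * sqrt (real d))
                   + 4 * exp (- c * \<rho> * Rt / op_norm_d d (mat_sqrt_d d Lam))
                   + 2 * exp (- c * \<rho> * sqrt (real M) * Rt\<^sup>2 / (op_norm_d d Lam * sqrt (real d)))
       in measure (pretrain_measure d Lam R N B)
            {\<omega> \<in> space (pretrain_measure d Lam R N B).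
               \<exists>W. is_max_margin d N B \<omega> W \<and> test_error d Lam Rt p M W \<le> bound}
          \<ge> 1 - 10 * \<delta>"
      unfolding Let_def bound_def p_def \<rho>_def m_def L_def \<sigma>_def \<Lambda>_def .
  qed
qed

end
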